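(* For any Kneser graph $K=K(t,2)$ with $t\ge 5$, there exists a constant $\delta>0$ such that for any sufficiently large integer $n$ and any integer $1\le q\le \delta n$, we have $h_K(n,q)=t_K(n,q)$.
   Context: All graphs are finite and simple. The Kneser graph $K(t,2)$ has as vertices the $2$-element subsets of $[t]=\{1,\dots,t\}$, two of them being adjacent if and only if they are disjoint. For a graph $F$: $\mathrm{ex}(n,F)$ is the maximum number of edges in an $n$-vertex graph not containing $F$ as a (not necessarily induced) subgraph; an $n$-vertex $F$-free graph with $\mathrm{ex}(n,F)$ edges is an extremal graph for $F$. The number of copies of $F$ in $G$ is the number of edge-preserving injections $V(F)\to V(G)$ divided by the number of automorphisms of $F$ (for $F$ without isolated vertices, this is the number of edge subsets of $G$ that induce a copy of $F$). $h_F(n,q)$ is the minimum number of copies of $F$ in an $n$-vertex graph with $\mathrm{ex}(n,F)+q$ edges. $t_F(n,q)$ is the minimum number of copies of $F$ in graphs obtained from an $n$-vertex extremal graph for $F$ by adding $q$ new edges. *)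

theory Defs
  imports Complex_Main "HOL-Library.FuncSet"
begin

text \<open>A graph is a pair of a vertex set and a set of edges, each edge being a two-element
  set of vertices.\<close>

type_synonym 'a graph = "'a set \<times> 'a set set"

abbreviation verts :: "'a graph \<Rightarrow> 'a set" where "verts \<equiv> fst"
abbreviation edges :: "'a graph \<Rightarrow> 'a set set" where "edges \<equiv> snd"

definition simple_graph :: "'a graph \<Rightarrow> bool" where
  "simple_graph G \<longleftrightarrow> finite (verts G) \<and> (\<forall>e\<in>edges G. e \<subseteq> verts G \<and> card e = 2)"

definition kneser2 :: "nat \<Rightarrow> nat set graph" where
  "kneser2 t =
     (let V = {a. a \<subseteq> {1..t} \<and> card a = 2}
      in (V, {{a, b} | a b. a \<in> V \<and> b \<in> V \<and> a \<inter> b = {}}))"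

text \<open>Maps are taken extensional (undefined outside the vertex set), so that the sets of
  embeddings and automorphisms have the right cardinality.\<close>

definition embeddings :: "'a graph \<Rightarrow> 'b graph \<Rightarrow> ('a \<Rightarrow> 'b) set" where
  "embeddings F G =
     {f \<in> verts F \<rightarrow>\<^sub>E verts G. inj_on f (verts F) \<and> (\<forall>e\<in>edges F. f ` e \<in> edges G)}"

definition automorphisms :: "'a graph \<Rightarrow> ('a \<Rightarrow> 'a) set" where
  "automorphisms F =
     {f \<in> verts F \<rightarrow>\<^sub>E verts F. bij_betw f (verts F) (verts F) \<and>
        (\<forall>u\<in>verts F. \<forall>v\<in>verts F. {u, v} \<in> edges F \<longleftrightarrow> {f u, f v} \<in> edges F)}"

text \<open>The division is exact, see \<open>card_automorphisms_dvd\<close> below.\<close>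

definition num_copies :: "'a graph \<Rightarrow> 'b graph \<Rightarrow> nat" where
  "num_copies F G = card (embeddings F G) div card (automorphisms F)"

definition F_free :: "'a graph \<Rightarrow> 'b graph \<Rightarrow> bool" where
  "F_free F G \<longleftrightarrow> embeddings F G = {}"

text \<open>Every finite graph is isomorphic to one whose vertices are natural numbers, so host graphs
  are taken with vertices in \<open>nat\<close>.\<close>

definition nvertex_graph :: "nat \<Rightarrow> nat graph \<Rightarrow> bool" where
  "nvertex_graph n G \<longleftrightarrow> simple_graph G \<and> card (verts G) = n"

definition ex_number :: "nat \<Rightarrow> 'a graph \<Rightarrow> nat" where
  "ex_number n F =
     (GREATEST m. \<exists>G. nvertex_graph n G \<and> F_free F G \<and> card (edges G) = m)"

definition extremal_graph :: "'a graph \<Rightarrow> nat \<Rightarrow> nat graph \<Rightarrow> bool" where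
  "extremal_graph F n G \<longleftrightarrow>
     nvertex_graph n G \<and> F_free F G \<and> card (edges G) = ex_number n F"

definition h_min :: "'a graph \<Rightarrow> nat \<Rightarrow> nat \<Rightarrow> nat" where
  "h_min F n q =
     (LEAST c. \<exists>G. nvertex_graph n G \<and> card (edges G) = ex_number n F + q \<and>
        num_copies F G = c)"

definition t_min :: "'a graph \<Rightarrow> nat \<Rightarrow> nat \<Rightarrow> nat" where
  "t_min F n q =
     (LEAST c. \<exists>G A. extremal_graph F n G \<and>
        A \<inter> edges G = {} \<and> card A = q \<and> simple_graph (verts G, edges G \<union> A) \<and>
        num_copies F (verts G, edges G \<union> A) = c)"

text \<open>Two embeddings differ by an automorphism iff they have the same image subgraph, so the
  automorphism group acts freely on embeddings with orbits the subgraphs isomorphic to \<open>F\<close>.\<close>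

lemma card_embeddings_fibre:
  assumes F: "simple_graph F" and f: "f \<in> embeddings F G"
  shows "card {g \<in> embeddings F G. g ` verts F = f ` verts F \<and>
            (`) g ` edges F = (`) f ` edges F} = card (automorphisms F)"
    (is "card ?A = _")
proof -
  let ?V = "verts F" and ?E = "edges F"
  let ?h = "\<lambda>a. restrict (f \<circ> a) ?V"
  have fI: "inj_on f ?V" "f \<in> ?V \<rightarrow>\<^sub>E verts G" "\<forall>e\<in>?E. f ` e \<in> edges G"
    using f by (auto simp: embeddings_def)
  have EV: "e \<subseteq> ?V" "card e = 2" if "e \<in> ?E" for e
    using F that by (auto simp: simple_graph_def)
  have Epair: "\<exists>u v. e = {u, v} \<and> u \<in> ?V \<and> v \<in> ?V" if "e \<in> ?E" for e
    using EV[OF that] by (auto simp: card_2_iff)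
  have "bij_betw ?h (automorphisms F) ?A"
    unfolding bij_betw_def
  proof
    show "inj_on ?h (automorphisms F)"
    proof (rule inj_onI)
      fix a b assume ab: "a \<in> automorphisms F" "b \<in> automorphisms F" and eq: "?h a = ?h b"
      show "a = b"
      proof (rule PiE_ext[of _ ?V "\<lambda>_. ?V"])
        show "a \<in> ?V \<rightarrow>\<^sub>E ?V" "b \<in> ?V \<rightarrow>\<^sub>E ?V"
          using ab by (auto simp: automorphisms_def)
        fix x assume x: "x \<in> ?V"
        have "f (a x) = f (b x)" using fun_cong[OF eq, of x] x by simp
        moreover have "a x \<in> ?V" "b x \<in> ?V" using ab x by (auto simp: automorphisms_def)
        ultimately show "a x = b x" using fI(1) by (auto dest: inj_onD)
      qed
    qed
    show "?h ` automorphisms F = ?A"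
    proof (intro equalityI subsetI)
      fix g assume "g \<in> ?h ` automorphisms F"
      then obtain a where a: "a \<in> automorphisms F" and g: "g = ?h a" by auto
      have aV: "a ` ?V = ?V" "inj_on a ?V"
        using a by (auto simp: automorphisms_def bij_betw_def)
      have aE: "{u, v} \<in> ?E \<longleftrightarrow> {a u, a v} \<in> ?E" if "u \<in> ?V" "v \<in> ?V" for u v
        using a that by (auto simp: automorphisms_def)
      have ge: "g ` e = f ` a ` e" if "e \<subseteq> ?V" for e
        unfolding g using that by (auto simp: image_image intro!: image_cong)
      have E1: "a ` e \<in> ?E" if "e \<in> ?E" for e
        using Epair[OF that] aE that by auto
      have E2: "\<exists>d\<in>?E. e = a ` d" if e: "e \<in> ?E" for e
      proof -
        from Epair[OF e] obtain u v where uv: "e = {u, v}" "u \<in> ?V" "v \<in> ?V" by blast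
        have "u \<in> a ` ?V" "v \<in> a ` ?V" using uv aV(1) by simp_all
        then obtain x y where xy: "x \<in> ?V" "y \<in> ?V" "u = a x" "v = a y" by (elim imageE)
        with aE[of x y] e uv have "{x, y} \<in> ?E" by simp
        with uv xy show ?thesis by (intro bexI[of _ "{x, y}"]) auto
      qed
      have "(`) a ` ?E = ?E" using E1 E2 by blast
      then have "(`) f ` ?E = (`) f ` (`) a ` ?E" by simp
      also have "\<dots> = (`) g ` ?E"
        using ge EV(1) by (subst image_image) (rule image_cong, simp_all only:)
      finally have gE: "(`) g ` ?E = (`) f ` ?E" ..
      have gV: "g ` ?V = f ` ?V" using ge[of ?V] aV by simp
      have "g \<in> embeddings F G"
        unfolding embeddings_def
      proof (intro CollectI conjI)
        have "a x \<in> ?V" if "x \<in> ?V" for x using aV(1) that by blast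
        then show "g \<in> ?V \<rightarrow>\<^sub>E verts G"
          unfolding g using fI(2) by (auto simp: PiE_iff)
        have "inj_on (f \<circ> a) ?V" using aV fI(1) by (intro comp_inj_on) auto
        then show "inj_on g ?V" unfolding g by (simp add: inj_on_def)
        show "\<forall>e\<in>?E. g ` e \<in> edges G" using ge EV(1) E1 fI(3) by simp
      qed
      with gV gE show "g \<in> ?A" by simp
    next
      fix g assume "g \<in> ?A"
      then have g: "inj_on g ?V" "g \<in> ?V \<rightarrow>\<^sub>E verts G" "g ` ?V = f ` ?V"
        "(`) g ` ?E = (`) f ` ?E"
        by (auto simp: embeddings_def)
      define a where "a = restrict (\<lambda>x. inv_into ?V f (g x)) ?V"
      have gx: "g x \<in> f ` ?V" if "x \<in> ?V" for x using g(3) that by blast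
      have aV: "a x \<in> ?V" if "x \<in> ?V" for x
        using gx[OF that] that by (simp add: a_def inv_into_into)
      have fa: "f (a x) = g x" if "x \<in> ?V" for x
        using gx[OF that] that by (simp add: a_def f_inv_into_f)
      have inj: "inj_on a ?V" using g(1) fa by (metis (no_types, lifting) inj_onD inj_onI)
      have "a ` ?V = ?V"
        using F inj aV by (intro endo_inj_surj) (auto simp: simple_graph_def)
      then have bij: "bij_betw a ?V ?V" using inj by (simp add: bij_betw_def)
      have img: "e \<in> ?E \<longleftrightarrow> k ` e \<in> (`) k ` ?E" if "e \<subseteq> ?V" "inj_on k ?V" for e and k :: "_ \<Rightarrow> 'b"
      proof
        assume "k ` e \<in> (`) k ` ?E"
        then obtain d where "d \<in> ?E" "k ` e = k ` d" by blast
        then show "e \<in> ?E" using that EV(1)[of d] inj_on_image_eq_iff[of k ?V e d] by simp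
      qed blast
      have "{u, v} \<in> ?E \<longleftrightarrow> {a u, a v} \<in> ?E" if uv: "u \<in> ?V" "v \<in> ?V" for u v
      proof -
        have "{u, v} \<in> ?E \<longleftrightarrow> g ` {u, v} \<in> (`) g ` ?E" using uv g(1) by (intro img) auto
        also have "g ` {u, v} = f ` {a u, a v}" using uv fa by simp
        also have "f ` {a u, a v} \<in> (`) g ` ?E \<longleftrightarrow> {a u, a v} \<in> ?E"
          unfolding g(4) using uv aV fI(1) by (intro img[symmetric]) auto
        finally show ?thesis .
      qed
      with bij aV have "a \<in> automorphisms F"
        by (auto simp: automorphisms_def a_def)
      moreover have "g = ?h a"
      proof
        fix x show "g x = ?h a x" using fa[of x] g(2) by (auto simp: PiE_def extensional_def)
      qed
      ultimately show "g \<in> ?h ` automorphisms F" by blast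
    qed
  qed
  then show ?thesis by (simp add: bij_betw_same_card)
qed

lemma card_automorphisms_dvd:
  assumes F: "simple_graph F" and G: "simple_graph G"
  shows "card (automorphisms F) dvd card (embeddings F G)"
proof -
  let ?s = "\<lambda>g. (g ` verts F, (`) g ` edges F)"
  let ?M = "embeddings F G"
  have "finite (verts F \<rightarrow>\<^sub>E verts G)"
    using F G by (intro finite_PiE) (auto simp: simple_graph_def)
  then have fin: "finite ?M" by (rule rev_finite_subset) (auto simp: embeddings_def)
  have "card ?M = (\<Sum>s\<in>?s ` ?M. card {g \<in> ?M. ?s g = s})"
    using sum.image_gen[OF fin, of "\<lambda>_. 1::nat" ?s] by simp
  also have "\<dots> = (\<Sum>s\<in>?s ` ?M. card (automorphisms F))"
  proof (rule sum.cong[OF refl])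
    fix s assume "s \<in> ?s ` ?M"
    then obtain f where "f \<in> ?M" "s = ?s f" by auto
    then show "card {g \<in> ?M. ?s g = s} = card (automorphisms F)"
      using card_embeddings_fibre[OF F, of f G] by simp
  qed
  finally show ?thesis by simp
qed

end

theory Submission
  imports Defs "HOL-Analysis.Convex"
begin

text \<open>Put \<open>r = t - 3\<close> and let \<open>v\<close> be the number of vertices of \<open>K = K(t,2)\<close>. The extremal graph
  consists of two vertices joined to everything and a balanced complete \<open>r\<close>-partite graph on the
  rest: two vertices of \<open>K\<close> can be deleted, but every colouring of the others by \<open>r\<close> colours still has
  a monochromatic edge. Only embeddings have to be counted, since the number of copies is a monotone
  function of their number.

  Let \<open>G\<close> have \<open>q\<close> edges too many. A star with \<open>q\<close> edges inside a class of the extremal graph creates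
  only \<open>O(q n\<^bsup>v-4\<^esup>)\<close> copies, so \<open>G\<close> may be assumed to have so few. Then \<open>G\<close> has few complete subgraphs on
  \<open>r + 1\<close> vertices, and by stability a maximum cut of \<open>G\<close> into \<open>r\<close> classes is almost balanced and almost
  complete. Call a vertex high if it has linearly many neighbours in its own class. The colouring of
  \<open>K\<close> by \<open>max 4 (Max x)\<close> has only three monochromatic edges, which are disjoint and in one class; hence
  three high vertices, or three disjoint edges inside a class, would give order \<open>n\<^bsup>v-3\<^esup>\<close> copies.
  Comparing edge numbers leaves exactly two high vertices, and these are almost complete to the rest.

  So \<open>G\<close> arises from an apex graph by deleting some cross edges and adding edges inside classes. An
  inner edge lies in order \<open>n\<^bsup>v-4\<^esup>\<close> copies, while restoring a cross edge creates only \<open>O(q n\<^bsup>v-5\<^esup>)\<close> and moving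
  a vertex to a smaller class multiplies the number of copies by \<open>1 + O(1/n)\<close>. Trading surplus inner
  edges for restored cross edges and for balance therefore never increases the number of copies, and
  ends at an extremal graph with \<open>q\<close> added edges.\<close>

section \<open>Colourings of the Kneser graph\<close>

text \<open>What makes the counts sharp is a colouring fact with a stability part: a set of vertices
  whose deletion leaves \<open>K\<close> properly \<open>r\<close>-colourable has at least three
  elements, and if it has exactly three, they pairwise meet. Since two apex vertices amount to two
  deletions, every copy in an apex graph uses an inner edge. Since an edge \<open>pq\<close> of
  \<open>K\<close> is a disjoint pair, any third vertex may be deleted along with \<open>p\<close>
  and \<open>q\<close>, and this leads to two disjoint monochromatic edges off \<open>p\<close> and
  \<open>q\<close>. So a copy through a given cross edge has two vertices fixed and must pay twice
  more, by an inner edge (two vertices, \<open>q\<close> choices) or by an apex vertex (one vertex),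
  with at least one inner edge among its edges. The resulting bound falls below the number of copies
  owned by one inner edge as soon as \<open>q\<close> is a small multiple of \<open>n\<close>, which
  is the main demand on \<delta>. Stability is obtained by counting alone, without a regularity or
  removal lemma: \<open>K\<close> is \<open>(r+1)\<close>-colourable, so a positive density of
  cliques on \<open>r + 1\<close> vertices blows up to \<open>n^v\<close> copies, and a clique on
  \<open>r\<close> vertices with few extensions sorts the other vertices by the one clique vertex
  that they miss.\<close>

definition pairs :: "'a set \<Rightarrow> 'a set set" where
  "pairs P = {x. x \<subseteq> P \<and> card x = 2}"

lemma finite_pairs: "finite P \<Longrightarrow> finite (pairs P)"
  by (simp add: pairs_def)

lemma card_pairs: "finite P \<Longrightarrow> card (pairs P) = card P choose 2"
  by (simp add: pairs_def n_subsets)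

lemma card_pairs2: "finite P \<Longrightarrow> 2 * card (pairs P) = card P * (card P - 1)"
  by (cases "card P") (simp_all add: card_pairs choose_two)

text \<open>Pick one member \<open>{a,b}\<close>, one that avoids \<open>a\<close> (so it is
  \<open>{b,c}\<close>) and one that avoids \<open>b\<close> (so it is \<open>{a,c}\<close>). Any
  further member meets all three and so contains two of \<open>a\<close>, \<open>b\<close>,
  \<open>c\<close>: an intersecting family of pairs without a common point is a triangle.\<close>

lemma intersecting_not_star:
  assumes P: "S \<subseteq> pairs P" and int: "\<And>x y. x \<in> S \<Longrightarrow> y \<in> S \<Longrightarrow> x \<inter> y \<noteq> {}"
    and ns: "\<And>a. a \<in> P \<Longrightarrow> \<exists>x\<in>S. a \<notin> x" and ne: "P \<noteq> {}"
  obtains a b c where "a \<noteq> b" "b \<noteq> c" "a \<noteq> c" "{a,b,c} \<subseteq> P" "S = {{a,b},{b,c},{a,c}}"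
proof -
  have c2: "\<exists>u v. x = {u,v} \<and> u \<noteq> v \<and> u \<in> P \<and> v \<in> P" if "x \<in> S" for x
  proof -
    have "card x = 2" "x \<subseteq> P" using that P by (auto simp: pairs_def)
    then show ?thesis by (auto simp: card_2_iff)
  qed
  from ne ns obtain x where x: "x \<in> S" by blast
  then obtain a b where ab: "x = {a,b}" "a \<noteq> b" "a \<in> P" "b \<in> P" using c2 by blast
  obtain y where y: "y \<in> S" "a \<notin> y" using ns ab by blast
  have "b \<in> y" using int[OF x y(1)] ab y by auto
  then obtain c where c: "y = {b,c}" "b \<noteq> c" "c \<in> P" using c2[OF y(1)] by blast
  obtain z where z: "z \<in> S" "b \<notin> z" using ns ab by blast
  have "a \<in> z" using int[OF x z(1)] ab z by auto
  moreover have "c \<in> z" using int[OF y(1) z(1)] c z by auto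
  moreover have "a \<noteq> c" using y c by auto
  moreover obtain u v where "z = {u,v}" using c2[OF z(1)] by blast
  ultimately have zz: "z = {a,c}" by auto
  have "w \<in> {{a,b},{b,c},{a,c}}" if w: "w \<in> S" for w
  proof -
    have "card w = 2" using w P by (auto simp: pairs_def)
    then have two: "w = {p,q}" if "p \<in> w" "q \<in> w" "p \<noteq> q" for p q
      using that card_subset_eq[of w "{p,q}"] card_ge_0_finite[of w] by simp
    have "a \<in> w \<or> b \<in> w" "b \<in> w \<or> c \<in> w" "a \<in> w \<or> c \<in> w"
      using int[OF w x] int[OF w y(1)] int[OF w z(1)] ab(1) c(1) zz by blast+
    then consider "a \<in> w" "b \<in> w" | "b \<in> w" "c \<in> w" | "a \<in> w" "c \<in> w" by blast
    then show ?thesis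
      using two[OF _ _ \<open>a \<noteq> b\<close>] two[OF _ _ \<open>b \<noteq> c\<close>] two[OF _ _ \<open>a \<noteq> c\<close>] by cases simp_all
  qed
  moreover have "{{a,b},{b,c},{a,c}} \<subseteq> S" using x y z ab(1) c(1) zz by simp
  ultimately have "S = {{a,b},{b,c},{a,c}}" by blast
  then show ?thesis using that[of a b c] ab c \<open>a \<noteq> c\<close> by simp
qed

text \<open>The counting half of both defect lemmas: once no colour class is a star, every class has
  at most three pairs, so few colours leave many pairs uncoloured.\<close>

lemma class_count:
  assumes P: "finite P" and C: "finite C" and D: "D \<subseteq> pairs P"
    and col: "\<And>x. x \<in> pairs P - D \<Longrightarrow> col x \<in> C"
    and ns: "\<And>i. i \<in> C \<Longrightarrow> card {x \<in> pairs P - D. col x = i} \<le> 3"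
  shows "card (pairs P) \<le> 3 * card C + card D"
proof -
  have eq: "pairs P - D = (\<Union>i\<in>C. {x \<in> pairs P - D. col x = i})" using col by auto
  have "card (pairs P - D) \<le> (\<Sum>i\<in>C. card {x \<in> pairs P - D. col x = i})"
    by (subst eq, rule card_UN_le[OF C])
  also have "\<dots> \<le> (\<Sum>i\<in>C. 3)" by (intro sum_mono ns)
  finally have "card (pairs P - D) \<le> 3 * card C" by simp
  moreover have "card (pairs P - D) = card (pairs P) - card D"
    using D finite_subset[OF D finite_pairs[OF P]] by (intro card_Diff_subset)
  ultimately show ?thesis by linarith
qed

lemma not_star_card:
  assumes "S \<subseteq> pairs P" "\<And>x y. x \<in> S \<Longrightarrow> y \<in> S \<Longrightarrow> x \<inter> y \<noteq> {}"
    and "\<And>a. a \<in> P \<Longrightarrow> \<exists>x\<in>S. a \<notin> x" and "P \<noteq> {}"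
  shows "card S \<le> 3"
proof -
  obtain a b c where "S = {{a,b},{b,c},{a,c}}" 
    by (rule intersecting_not_star[OF assms])
  then have "S = set [{a,b},{b,c},{a,c}]" by simp
  then show ?thesis using card_length[of "[{a,b},{b,c},{a,c}]"] by simp
qed

text \<open>\<open>D\<close> is a set of deleted vertices of the Kneser graph; the rest is properly
  coloured with three colours fewer than there are points. A class with a common point (the empty
  class included) is removed together with that point, which keeps the difference of three. If no
  class is a star, each is a triangle, and comparing \<open>(c+3)(c+2)/2\<close> pairs with
  \<open>3c + card D\<close> leaves only \<open>c = 1\<close> when \<open>card D \<le> 3\<close>:
  four points, one triangle, and \<open>D\<close> the three pairs through the fourth point.\<close>

lemma colouring_defects3:
  assumes "finite P" "card P = card C + 3" "finite C" "D \<subseteq> pairs P"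
    and "\<And>x. x \<in> pairs P - D \<Longrightarrow> col x \<in> C"
    and "\<And>x y. x \<in> pairs P - D \<Longrightarrow> y \<in> pairs P - D \<Longrightarrow> col x = col y \<Longrightarrow> x \<inter> y \<noteq> {}"
  shows "card D \<ge> 3 \<and> (card D = 3 \<longrightarrow> (\<forall>x\<in>D. \<forall>y\<in>D. x \<inter> y \<noteq> {}))"
  using assms
proof (induction "card C" arbitrary: P C D)
  case 0
  then have C: "C = {}" and P: "card P = 3" by auto
  then have D: "D = pairs P" using 0 by blast
  have "card D = 3" using 0 P D card_pairs2[of P] by simp
  moreover have "x \<inter> y \<noteq> {}" if "x \<in> D" "y \<in> D" for x y
  proof
    assume "x \<inter> y = {}"
    moreover have "finite x" "finite y" "card x = 2" "card y = 2"
      using that D by (auto simp: pairs_def intro: card_ge_0_finite)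
    ultimately have "card (x \<union> y) = 4" by (simp add: card_Un_disjoint)
    moreover have "x \<union> y \<subseteq> P" using that D by (auto simp: pairs_def)
    then have "card (x \<union> y) \<le> 3" using card_mono[of P "x \<union> y"] 0(2) P by simp
    ultimately show False by simp
  qed
  ultimately show ?case by simp
next
  case (Suc k)
  note fin = \<open>finite P\<close> and finC = \<open>finite C\<close>
  have finD: "finite D" using Suc.prems finite_pairs finite_subset by blast
  show ?case
  proof (cases "\<exists>i\<in>C. \<exists>a\<in>P. \<forall>x\<in>pairs P - D. col x = i \<longrightarrow> a \<in> x")
    case True
    then obtain i a where ia: "i \<in> C" "a \<in> P" "\<And>x. x \<in> pairs P - D \<Longrightarrow> col x = i \<Longrightarrow> a \<in> x" by blast
    let ?P = "P - {a}" and ?C = "C - {i}"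
    let ?D = "D \<inter> pairs ?P"
    have sub: "pairs ?P \<subseteq> pairs P" by (auto simp: pairs_def)
    have "card ?D \<ge> 3 \<and> (card ?D = 3 \<longrightarrow> (\<forall>x\<in>?D. \<forall>y\<in>?D. x \<inter> y \<noteq> {}))"
    proof (rule Suc.hyps(1)[of ?C])
      show "k = card ?C" using Suc ia by simp
      show "card ?P = card ?C + 3" using Suc ia by simp
      show "col x \<in> ?C" if "x \<in> pairs ?P - ?D" for x
        using that ia(3)[of x] Suc.prems(5)[of x] sub by (auto simp: pairs_def)
      show "x \<inter> y \<noteq> {}" if "x \<in> pairs ?P - ?D" "y \<in> pairs ?P - ?D" "col x = col y" for x y
        using that Suc.prems(6)[of x y] sub by auto
    qed (use fin finC in auto)
    moreover have "card ?D \<le> card D" using finD by (intro card_mono) auto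
    moreover have "card ?D = card D \<Longrightarrow> ?D = D" using finD by (intro card_subset_eq) auto
    ultimately show ?thesis by (cases "card ?D = card D") auto
  next
    case False
    let ?S = "\<lambda>i. {x \<in> pairs P - D. col x = i}"
    have Pne: "P \<noteq> {}" using Suc by auto
    have S: "?S i \<subseteq> pairs P" for i by auto
    have int: "x \<inter> y \<noteq> {}" if "x \<in> ?S i" "y \<in> ?S i" for i x y
      using that Suc.prems(6)[of x y] by simp
    have ns: "\<exists>x\<in>?S i. a \<notin> x" if "i \<in> C" "a \<in> P" for i a using False that by blast
    have "card (pairs P) \<le> 3 * card C + card D"
      by (rule class_count[OF fin finC Suc.prems(4) Suc.prems(5) not_star_card[OF S int ns Pne]])
    then have ineq: "(card C + 3) * (card C + 2) \<le> 6 * card C + 2 * card D"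
      using card_pairs2[OF fin] Suc.prems(2) by simp
    show ?thesis
    proof (cases "card D \<le> 3")
      case le: True
      have "(card C + 3) * (card C + 2) \<le> 6 * card C + 6" using ineq le by linarith
      then have "card C * card C \<le> card C" by (simp add: algebra_simps)
      then have c1: "card C = 1" using Suc.hyps(2) by (cases "card C") auto
      with ineq le have d3: "card D = 3" by simp
      from c1 obtain i where i: "C = {i}" by (auto simp: card_1_singleton_iff)
      then have "i \<in> C" by simp
      obtain a b c where abc: "a \<noteq> b" "b \<noteq> c" "a \<noteq> c" "{a,b,c} \<subseteq> P" "?S i = {{a,b},{b,c},{a,c}}"
        by (rule intersecting_not_star[OF S int ns[OF \<open>i \<in> C\<close>] Pne])
      have "card (P - {a,b,c}) = 1" using abc fin Suc.prems(2) c1 by (subst card_Diff_subset) auto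
      then obtain d where d: "P - {a,b,c} = {d}" by (auto simp: card_1_singleton_iff)
      then have P4: "P = {a,b,c,d}" using abc by auto
      have all: "pairs P - D = {{a,b},{b,c},{a,c}}" using abc(5) Suc.prems(5) i by auto
      have "d \<in> x" if "x \<in> D" for x
      proof (rule ccontr)
        assume "d \<notin> x"
        then have "x \<subseteq> {a,b,c}" "card x = 2" using that Suc.prems(4) P4 by (auto simp: pairs_def)
        then obtain u v where uv: "x = {u,v}" "u \<noteq> v" by (auto simp: card_2_iff)
        then have "u \<in> {a,b,c}" "v \<in> {a,b,c}" using \<open>x \<subseteq> {a,b,c}\<close> by auto
        then have "x \<in> {{a,b},{b,c},{a,c}}" using uv by auto
        then show False using all that by blast
      qed
      then show ?thesis using d3 by auto
    qed auto
  qed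
qed

text \<open>The same removal of star classes, now with four points more than colours. In the base
  case all six pairs of a 4-set are defects; without stars the count reads
  \<open>c^2 + c + 12 \<le> 2 * card D\<close>.\<close>

lemma colouring_defects6:
  assumes "finite P" "card P = card C + 4" "finite C" "D \<subseteq> pairs P"
    and "\<And>x. x \<in> pairs P - D \<Longrightarrow> col x \<in> C"
    and "\<And>x y. x \<in> pairs P - D \<Longrightarrow> y \<in> pairs P - D \<Longrightarrow> col x = col y \<Longrightarrow> x \<inter> y \<noteq> {}"
  shows "card D \<ge> 6"
  using assms
proof (induction "card C" arbitrary: P C D)
  case 0
  then have C: "C = {}" and P: "card P = 4" by auto
  then have "D = pairs P" using 0 by blast
  then show ?case using 0(2) P card_pairs2[of P] by simp
next
  case (Suc k)
  note fin = \<open>finite P\<close> and finC = \<open>finite C\<close>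
  have finD: "finite D" using Suc.prems finite_pairs finite_subset by blast
  show ?case
  proof (cases "\<exists>i\<in>C. \<exists>a\<in>P. \<forall>x\<in>pairs P - D. col x = i \<longrightarrow> a \<in> x")
    case True
    then obtain i a where ia: "i \<in> C" "a \<in> P" "\<And>x. x \<in> pairs P - D \<Longrightarrow> col x = i \<Longrightarrow> a \<in> x" by blast
    let ?P = "P - {a}" and ?C = "C - {i}"
    let ?D = "D \<inter> pairs ?P"
    have sub: "pairs ?P \<subseteq> pairs P" by (auto simp: pairs_def)
    have "card ?D \<ge> 6"
    proof (rule Suc.hyps(1)[of ?C])
      show "k = card ?C" using Suc ia by simp
      show "card ?P = card ?C + 4" using Suc ia by simp
      show "col x \<in> ?C" if "x \<in> pairs ?P - ?D" for x
        using that ia(3)[of x] Suc.prems(5)[of x] sub by (auto simp: pairs_def)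
      show "x \<inter> y \<noteq> {}" if "x \<in> pairs ?P - ?D" "y \<in> pairs ?P - ?D" "col x = col y" for x y
        using that Suc.prems(6)[of x y] sub by auto
    qed (use fin finC in auto)
    moreover have "card ?D \<le> card D" using finD by (intro card_mono) auto
    ultimately show ?thesis by linarith
  next
    case False
    let ?S = "\<lambda>i. {x \<in> pairs P - D. col x = i}"
    have Pne: "P \<noteq> {}" using Suc by auto
    have "card (pairs P) \<le> 3 * card C + card D"
    proof (rule class_count[OF fin finC Suc.prems(4) Suc.prems(5) not_star_card[OF _ _ _ Pne]])
      show "\<exists>x\<in>?S i. a \<notin> x" if "i \<in> C" "a \<in> P" for i a using False that by blast
      show "x \<inter> y \<noteq> {}" if "x \<in> ?S i" "y \<in> ?S i" for i x y
        using that Suc.prems(6)[of x y] by simp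
    qed auto
    then have "(card C + 4) * (card C + 3) \<le> 6 * card C + 2 * card D"
      using card_pairs2[OF fin] Suc.prems(2) by (simp add: add.commute)
    then have "card C * card C + card C + 12 \<le> 2 * card D" by (simp add: algebra_simps)
    then show ?thesis by linarith
  qed
qed

text \<open>The contrapositive of \<open>colouring_defects3\<close>, in the form in which copies are
  analysed: \<open>D\<close> collects the vertices of \<open>K\<close> that are to be avoided, and a
  monochromatic edge survives. Three deletions are still harmless when two of them are disjoint
  pairs, since an exceptional \<open>D\<close> is intersecting.\<close>

lemma kneser_cover:
  fixes t :: nat
  assumes t: "t \<ge> 3" and D: "D \<subseteq> pairs {1..t}" and col: "\<And>x. x \<in> pairs {1..t} \<Longrightarrow> col x < t - 3"
    and d: "card D < 3 \<or> card D = 3 \<and> p \<in> D \<and> q \<in> D \<and> p \<inter> q = {}"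
  shows "\<exists>x\<in>pairs {1..t} - D. \<exists>y\<in>pairs {1..t} - D. x \<inter> y = {} \<and> col x = col y"
proof (rule ccontr)
  assume "\<not> ?thesis"
  then have "card D \<ge> 3 \<and> (card D = 3 \<longrightarrow> (\<forall>x\<in>D. \<forall>y\<in>D. x \<inter> y \<noteq> {}))"
    using t D col by (intro colouring_defects3[where P = "{1..t}" and C = "{..<t-3}"]) auto
  then show False using d by (metis less_le_not_le)
qed

text \<open>A triangle of monochromatic edges is a whole colour class, because no pair meets three
  disjoint pairs; this is the case that needs \<open>colouring_defects6\<close>.\<close>

lemma kneser_two_disjoint_mono_edges:
  fixes t :: nat
  assumes t: "t \<ge> 4" and p: "p \<in> pairs {1..t}" "q \<in> pairs {1..t}" "p \<inter> q = {}"
    and col: "\<And>x. x \<in> pairs {1..t} \<Longrightarrow> col x < t - 3"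
  shows "\<exists>x1 y1 x2 y2. {x1,y1,x2,y2} \<subseteq> pairs {1..t} - {p,q} \<and> distinct [x1,y1,x2,y2] \<and>
    x1 \<inter> y1 = {} \<and> x2 \<inter> y2 = {} \<and> col x1 = col y1 \<and> col x2 = col y2"
proof (rule ccontr)
  assume neg: "\<not> ?thesis"
  define W where "W = pairs {1..t} - {p,q}"
  define Q where "Q x y \<longleftrightarrow> x \<in> W \<and> y \<in> W \<and> x \<inter> y = {} \<and> col x = col y" for x y
  have WV: "x \<in> pairs {1..t}" if "x \<in> W" for x using that by (simp add: W_def)
  have card2: "card x = 2" if "x \<in> W" for x using WV[OF that] by (simp add: pairs_def)
  have Qsym: "Q y x" if "Q x y" for x y using that unfolding Q_def by (metis Int_commute)
  have ne: "x \<noteq> y" if "Q x y" for x y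
  proof
    assume "x = y"
    moreover have "y \<in> W" "x \<inter> y = {}" using that by (simp_all add: Q_def)
    ultimately show False using card2[of y] by auto
  qed
  have share: "x1 = x2 \<or> x1 = y2 \<or> y1 = x2 \<or> y1 = y2" if "Q x1 y1" "Q x2 y2" for x1 y1 x2 y2
  proof (rule ccontr)
    assume "\<not> ?thesis"
    then have "{x1,y1,x2,y2} \<subseteq> pairs {1..t} - {p,q} \<and> distinct [x1,y1,x2,y2] \<and>
      x1 \<inter> y1 = {} \<and> x2 \<inter> y2 = {} \<and> col x1 = col y1 \<and> col x2 = col y2"
      using that ne[OF that(1)] ne[OF that(2)] unfolding Q_def W_def by simp
    with neg show False by (elim notE) (intro exI)
  qed
  have t3: "t \<ge> 3" using t by simp
  \<comment> \<open>\<open>p\<close> and \<open>q\<close> are disjoint, so deleting one more vertex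
    \<open>a\<close> stays within reach of \<open>kneser_cover\<close>: every vertex is avoided by
    some monochromatic edge off \<open>p\<close> and \<open>q\<close>. By \<open>share\<close> these
    edges pairwise meet; having no common end, they form a triangle.\<close>
  have off: "\<exists>x y. Q x y \<and> x \<noteq> a \<and> y \<noteq> a" for a
  proof -
    have "card ({p,q,a} \<inter> pairs {1..t}) \<le> card {p,q,a}" by (intro card_mono) auto
    also have "\<dots> \<le> 3" by (simp add: card_insert_if)
    finally have "card ({p,q,a} \<inter> pairs {1..t}) < 3 \<or> card ({p,q,a} \<inter> pairs {1..t}) = 3" by linarith
    then have d: "card ({p,q,a} \<inter> pairs {1..t}) < 3 \<or> card ({p,q,a} \<inter> pairs {1..t}) = 3 \<and>
       p \<in> {p,q,a} \<inter> pairs {1..t} \<and> q \<in> {p,q,a} \<inter> pairs {1..t} \<and> p \<inter> q = {}"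
      using p by simp
    have "\<exists>x\<in>pairs {1..t} - {p,q,a} \<inter> pairs {1..t}. \<exists>y\<in>pairs {1..t} - {p,q,a} \<inter> pairs {1..t}.
        x \<inter> y = {} \<and> col x = col y"
    proof (rule kneser_cover[OF t3 Int_lower2 _ d])
      show "col x < t - 3" if "x \<in> pairs {1..t}" for x by (rule col[OF that])
    qed
    then obtain x y where "x \<in> pairs {1..t} - {p,q,a} \<inter> pairs {1..t}" 
        "y \<in> pairs {1..t} - {p,q,a} \<inter> pairs {1..t}" "x \<inter> y = {}" "col x = col y" by (elim bexE conjE)
    then have "Q x y \<and> x \<noteq> a \<and> y \<noteq> a" unfolding Q_def W_def by blast
    then show ?thesis by blast
  qed
  obtain x y where xy: "Q x y" using off by blast
  have third: "\<exists>z. Q z b \<and> z \<noteq> a" if "Q a b" for a b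
  proof -
    obtain u v where uv: "Q u v" "u \<noteq> a" "v \<noteq> a" using off by blast
    with share[OF uv(1) that] have "u = b \<or> v = b" by blast
    then show ?thesis using uv Qsym by blast
  qed
  obtain z where z: "Q z y" "z \<noteq> x" using third[OF xy] by blast
  obtain w where w: "Q w x" "w \<noteq> y" using third[OF Qsym[OF xy]] by blast
  have "w = z" using share[OF z(1) w(1)] z(2) w(2) ne[OF xy] by blast
  then have zx: "Q z x" using w by simp
  have cls: "u \<in> {x,y,z}" if u: "u \<in> W" "col u = col x" for u
  proof (rule ccontr)
    assume no: "u \<notin> {x,y,z}"
    obtain a b where ab: "u = {a,b}" using card2[OF u(1)] by (auto simp: card_2_iff)
    have "x \<inter> y = {}" "z \<inter> y = {}" "z \<inter> x = {}" using xy z zx by (simp_all add: Q_def)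
    then have "u \<inter> x = {} \<or> u \<inter> y = {} \<or> u \<inter> z = {}" unfolding ab by blast
    moreover have "x \<in> W" "y \<in> W" "z \<in> W" "col y = col x" "col z = col x" using xy z zx by (simp_all add: Q_def)
    ultimately have "Q u x \<or> Q u y \<or> Q u z" using u by (simp add: Q_def)
    then show False
      using share[OF _ z(1), of u x] share[OF _ zx, of u y] share[OF _ xy, of u z] no
        ne[OF xy] ne[OF z(1)] ne[OF zx] by blast
  qed
  \<comment> \<open>The triangle exhausts its colour class, so removing it frees a colour:
    \<open>t - 4\<close> colours on \<open>t\<close> points need six defects, one more than
    \<open>?D\<close> can have.\<close>
  let ?D = "{p,q,x,y,z}"
  have "\<exists>a\<in>pairs {1..t} - ?D. \<exists>b\<in>pairs {1..t} - ?D. a \<inter> b = {} \<and> col a = col b"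
  proof (rule ccontr)
    assume neg2: "\<not> ?thesis"
    have x: "x \<in> pairs {1..t}" "y \<in> pairs {1..t}" "z \<in> pairs {1..t}"
      using xy z WV by (simp_all add: Q_def)
    have "card ?D \<ge> 6"
    proof (rule colouring_defects6[where P = "{1..t}" and C = "{..<t-3} - {col x}" and col = col])
      show "card {1..t} = card ({..<t-3} - {col x}) + 4" using t col[OF x(1)] by simp
      show "col u \<in> {..<t-3} - {col x}" if "u \<in> pairs {1..t} - ?D" for u
      proof -
        have "u \<in> W" using that by (simp add: W_def)
        then have "col u \<noteq> col x" using cls[of u] that by blast
        then show ?thesis using col[of u] that by simp
      qed
      show "?D \<subseteq> pairs {1..t}" using p x by blast
      show "u \<inter> v \<noteq> {}" if "u \<in> pairs {1..t} - ?D" "v \<in> pairs {1..t} - ?D" "col u = col v" for u v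
      proof
        assume "u \<inter> v = {}"
        with that(3) have "u \<inter> v = {} \<and> col u = col v" by simp
        with that(1,2) neg2 show False by (elim notE) (intro bexI)
      qed
    qed simp_all
    moreover have "card ?D \<le> 5" using card_length[of "[p,q,x,y,z]"] by simp
    ultimately show False by simp
  qed
  then obtain a b where ab: "a \<in> pairs {1..t} - ?D" "b \<in> pairs {1..t} - ?D" "a \<inter> b = {}" "col a = col b"
    by (elim bexE conjE)
  then have "a \<in> W" "b \<in> W" by (simp_all only: W_def Diff_iff insert_iff empty_iff) blast+
  then have "Q a b" using ab(3,4) by (simp only: Q_def simp_thms)
  from share[OF this xy] ab(1,2) show False by (elim disjE) simp_all
qed

section \<open>Counting maps and embeddings\<close>

text \<open>The values are chosen one index at a time: each of the at most \<open>m\<close> earlier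
  values rules out at most \<open>e\<close> candidates, so \<open>a - m * e\<close> remain. The
  lower bounds for cliques and for extensions of partial embeddings come from this count.\<close>

lemma greedy_count:
  fixes C :: "'i \<Rightarrow> 'b set" and R :: "'i \<Rightarrow> 'i \<Rightarrow> 'b \<Rightarrow> 'b \<Rightarrow> bool" and a e :: real
  assumes "finite I" and "card I \<le> Suc m"
    and C: "\<And>x. x \<in> I \<Longrightarrow> finite (C x)" "\<And>x. x \<in> I \<Longrightarrow> a \<le> card (C x)"
    and R: "\<And>x y w. x \<in> I \<Longrightarrow> y \<in> I \<Longrightarrow> x \<noteq> y \<Longrightarrow> w \<in> C x \<Longrightarrow> real (card {z \<in> C y. \<not> R x y w z}) \<le> e"
    and sym: "\<And>x y w z. R x y w z \<Longrightarrow> R y x z w"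
    and e: "0 \<le> e" and a: "m * e \<le> a"
  shows "(a - m * e) ^ card I \<le> card {\<phi> \<in> PiE I C. \<forall>x\<in>I. \<forall>y\<in>I. x \<noteq> y \<longrightarrow> R x y (\<phi> x) (\<phi> y)}"
  using assms(1-2) C R
proof (induction I rule: finite_induct)
  case empty
  then show ?case by simp
next
  case (insert x I)
  let ?S = "\<lambda>I. {\<phi> \<in> PiE I C. \<forall>x\<in>I. \<forall>y\<in>I. x \<noteq> y \<longrightarrow> R x y (\<phi> x) (\<phi> y)}"
  let ?W = "\<lambda>\<phi>. {w \<in> C x. \<forall>y\<in>I. R y x (\<phi> y) w}"
  have IH: "(a - m * e) ^ card I \<le> card (?S I)"
    using insert.hyps insert.prems(1) by (intro insert.IH insert.prems(2-4)) (auto simp: card_insert_if)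
  have finS: "finite (?S K)" if "K \<subseteq> insert x I" for K
  proof (rule finite_subset[of _ "PiE K C"])
    have "finite K" using that insert.hyps finite_subset by blast
    then show "finite (PiE K C)" using that insert.prems(2) by (intro finite_PiE) auto
  qed auto
  have finCx: "finite (C x)" using insert.prems(2) by simp
  have W: "a - m * e \<le> card (?W \<phi>)" if "\<phi> \<in> ?S I" for \<phi>
  proof -
    have "C x - ?W \<phi> \<subseteq> (\<Union>y\<in>I. {w \<in> C x. \<not> R y x (\<phi> y) w})" by auto
    then have "card (C x - ?W \<phi>) \<le> card (\<Union>y\<in>I. {w \<in> C x. \<not> R y x (\<phi> y) w})"
      using finCx insert.hyps by (intro card_mono) auto
    also have "\<dots> \<le> (\<Sum>y\<in>I. card {w \<in> C x. \<not> R y x (\<phi> y) w})"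
      by (rule card_UN_le[OF insert.hyps(1)])
    finally have "real (card (C x - ?W \<phi>)) \<le> (\<Sum>y\<in>I. real (card {w \<in> C x. \<not> R y x (\<phi> y) w}))"
      by (simp flip: of_nat_sum)
    also have "\<dots> \<le> (\<Sum>y\<in>I. e)"
    proof (rule sum_mono)
      fix y assume y: "y \<in> I"
      have "\<phi> y \<in> C y" using that y by auto
      then show "real (card {w \<in> C x. \<not> R y x (\<phi> y) w}) \<le> e"
        using insert.hyps y by (intro insert.prems(4)) auto
    qed
    also have "\<dots> \<le> m * e" using insert.prems(1) insert.hyps e by (simp add: mult_right_mono)
    finally have "real (card (C x - ?W \<phi>)) \<le> m * e" .
    moreover have "card (C x - ?W \<phi>) = card (C x) - card (?W \<phi>)"
      using finCx by (intro card_Diff_subset) auto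
    moreover have "card (?W \<phi>) \<le> card (C x)" using finCx by (intro card_mono) auto
    moreover have "a \<le> card (C x)" using insert.prems(3) by simp
    ultimately show ?thesis by linarith
  qed
  let ?f = "\<lambda>p. (fst p)(x := snd p)"
  have inj: "inj_on ?f (Sigma (?S I) ?W)"
  proof (rule inj_onI)
    fix p q assume p: "p \<in> Sigma (?S I) ?W" and q: "q \<in> Sigma (?S I) ?W" and eq: "?f p = ?f q"
    have "snd p = snd q" using fun_cong[OF eq, of x] by simp
    moreover have "fst p = fst q"
    proof
      fix z show "fst p z = fst q z"
      proof (cases "z = x")
        case True
        have "fst p \<in> extensional I" "fst q \<in> extensional I" using p q by (auto simp: PiE_def)
        then show ?thesis using True insert.hyps by (simp add: extensional_def)
      next
        case False
        then show ?thesis using fun_cong[OF eq, of z] by simp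
      qed
    qed
    ultimately show "p = q" by (simp add: prod_eq_iff)
  qed
  have sub: "?f ` Sigma (?S I) ?W \<subseteq> ?S (insert x I)"
  proof
    fix g assume "g \<in> ?f ` Sigma (?S I) ?W"
    then obtain \<phi> w where g: "g = \<phi>(x := w)" and \<phi>: "\<phi> \<in> ?S I" and w: "w \<in> ?W \<phi>" by auto
    have "g \<in> PiE (insert x I) C" using \<phi> w unfolding g by (auto simp: PiE_def extensional_def)
    moreover have "R u v (g u) (g v)" if "u \<in> insert x I" "v \<in> insert x I" "u \<noteq> v" for u v
      using that \<phi> w insert.hyps sym unfolding g by auto
    ultimately show "g \<in> ?S (insert x I)" by blast
  qed
  have "(a - m * e) ^ card (insert x I) = (a - m * e) ^ card I * (a - m * e)"
    using insert.hyps by simp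
  also have "\<dots> \<le> card (?S I) * (a - m * e)" using IH a by (intro mult_right_mono) auto
  also have "\<dots> = (\<Sum>\<phi>\<in>?S I. a - m * e)" by simp
  also have "\<dots> \<le> (\<Sum>\<phi>\<in>?S I. real (card (?W \<phi>)))" by (intro sum_mono W)
  also have "\<dots> = real (card (Sigma (?S I) ?W))"
    using finS[of I] finCx by (subst card_SigmaI) auto
  also have "\<dots> = real (card (?f ` Sigma (?S I) ?W))" by (simp add: card_image[OF inj])
  also have "\<dots> \<le> real (card (?S (insert x I)))"
    using card_mono[OF finS[OF subset_refl] sub] by simp
  finally show ?case .
qed

text \<open>Upper bounds on copies rest on this: values are pinned on the tuple \<open>js\<close>,
  and all other arguments are free.\<close>

lemma card_maps_fixed:
  assumes I: "finite I" and V: "finite V" and js: "distinct js" "set js \<subseteq> I" and R: "finite R"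
  shows "card {\<phi> \<in> I \<rightarrow>\<^sub>E V. map \<phi> js \<in> R} \<le> card R * card V ^ (card I - length js)"
proof -
  let ?A = "{\<phi> \<in> I \<rightarrow>\<^sub>E V. map \<phi> js \<in> R}"
  let ?f = "\<lambda>\<phi>. (map \<phi> js, restrict \<phi> (I - set js))"
  have inj: "inj_on ?f ?A"
  proof (rule inj_onI)
    fix f g assume f: "f \<in> ?A" and g: "g \<in> ?A" and eq: "?f f = ?f g"
    show "f = g"
    proof (rule PiE_ext[of _ I "\<lambda>_. V"])
      show "f \<in> I \<rightarrow>\<^sub>E V" "g \<in> I \<rightarrow>\<^sub>E V" using f g by auto
      fix x assume x: "x \<in> I"
      show "f x = g x"
      proof (cases "x \<in> set js")
        case True
        then show ?thesis using eq by (auto simp: map_eq_conv)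
      next
        case False
        have "restrict f (I - set js) x = restrict g (I - set js) x" using eq by simp
        then show ?thesis using False x by simp
      qed
    qed
  qed
  have "?f ` ?A \<subseteq> R \<times> ((I - set js) \<rightarrow>\<^sub>E V)" by (auto simp: PiE_iff split: if_splits)
  moreover have fin: "finite ((I - set js) \<rightarrow>\<^sub>E V)" using I V by (intro finite_PiE) auto
  ultimately have "card (?f ` ?A) \<le> card (R \<times> ((I - set js) \<rightarrow>\<^sub>E V))"
    using R by (intro card_mono) auto
  also have "\<dots> = card R * card V ^ card (I - set js)"
    using I by (simp add: card_cartesian_product card_PiE)
  also have "card (I - set js) = card I - length js"
    using js I by (simp add: card_Diff_subset distinct_card)
  finally show ?thesis unfolding card_image[OF inj] .
qed

lemma card_noninjective_maps:
  assumes I: "finite I" and V: "finite V"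
  shows "card {\<phi> \<in> I \<rightarrow>\<^sub>E V. \<not> inj_on \<phi> I} \<le> (card I)^2 * card V ^ (card I - 1)"
proof -
  let ?P = "{p \<in> I \<times> I. fst p \<noteq> snd p}"
  let ?R = "(\<lambda>u. [u,u]) ` V"
  let ?B = "\<lambda>p. {\<phi> \<in> I \<rightarrow>\<^sub>E V. map \<phi> [fst p, snd p] \<in> ?R}"
  have finP: "finite ?P" using I by simp
  have "{\<phi> \<in> I \<rightarrow>\<^sub>E V. \<not> inj_on \<phi> I} \<subseteq> (\<Union>p\<in>?P. ?B p)"
  proof
    fix \<phi> assume \<phi>: "\<phi> \<in> {\<phi> \<in> I \<rightarrow>\<^sub>E V. \<not> inj_on \<phi> I}"
    then obtain x y where xy: "x \<in> I" "y \<in> I" "\<phi> x = \<phi> y" "x \<noteq> y" by (auto simp: inj_on_def)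
    have "\<phi> y \<in> V" using \<phi> xy by auto
    then have "\<phi> \<in> ?B (x,y)" using \<phi> xy by auto
    then show "\<phi> \<in> (\<Union>p\<in>?P. ?B p)" using xy by (intro UN_I[of "(x,y)"]) auto
  qed
  moreover have "finite (I \<rightarrow>\<^sub>E V)" using I V by (intro finite_PiE) auto
  then have "finite (\<Union>p\<in>?P. ?B p)" using finP by auto
  ultimately have "card {\<phi> \<in> I \<rightarrow>\<^sub>E V. \<not> inj_on \<phi> I} \<le> card (\<Union>p\<in>?P. ?B p)" by (intro card_mono)
  also have "\<dots> \<le> (\<Sum>p\<in>?P. card (?B p))" by (rule card_UN_le[OF finP])
  also have "\<dots> \<le> (\<Sum>p\<in>?P. card V ^ (card I - 1))"
  proof (rule sum_mono)
    fix p assume p: "p \<in> ?P"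
    then have "card {fst p, snd p} \<le> card I" using I by (intro card_mono) auto
    then have I2: "card I \<ge> 2" using p by simp
    have "card (?B p) \<le> card ?R * card V ^ (card I - length [fst p, snd p])"
      using I V p by (intro card_maps_fixed) auto
    also have "card ?R = card V" by (intro card_image) (auto simp: inj_on_def)
    also have "card V * card V ^ (card I - length [fst p, snd p]) = card V ^ (Suc (card I - 2))" by (simp add: numeral_2_eq_2)
    also have "Suc (card I - 2) = card I - 1" using I2 by simp
    finally show "card (?B p) \<le> card V ^ (card I - 1)" .
  qed
  also have "\<dots> = card ?P * card V ^ (card I - 1)" by simp
  also have "card ?P \<le> (card I)^2"
    using card_mono[of "I \<times> I" ?P] I by (simp add: card_cartesian_product power2_eq_square)
  finally show ?thesis by simp
qed

section \<open>Homomorphisms of complete multipartite graphs and blow-ups\<close>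

text \<open>Homomorphisms of the complete multipartite graph on \<open>I\<close> whose parts are the
  fibres of \<open>c\<close>. With \<open>c = id\<close> and a loopless host these are ordered
  cliques; with \<open>c\<close> a proper colouring of \<open>K\<close> they preserve the edges of
  \<open>K\<close>. Maps may repeat vertices, so that a vertex can be duplicated freely.\<close>

definition multipartite_homs :: "'a set \<Rightarrow> 'a set set \<Rightarrow> ('i \<Rightarrow> 'c) \<Rightarrow> 'i set \<Rightarrow> ('i \<Rightarrow> 'a) set" where
  "multipartite_homs V E c I = {\<phi> \<in> I \<rightarrow>\<^sub>E V. \<forall>x\<in>I. \<forall>y\<in>I. c x \<noteq> c y \<longrightarrow> {\<phi> x, \<phi> y} \<in> E}"

lemma finite_multipartite_homs: "finite V \<Longrightarrow> finite I \<Longrightarrow> finite (multipartite_homs V E c I)"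
  by (rule finite_subset[of _ "I \<rightarrow>\<^sub>E V"]) (auto simp: multipartite_homs_def intro: finite_PiE)

text \<open>Cauchy-Schwarz. The maps are grouped by their restriction to \<open>I\<close> minus
  \<open>x\<close>; a pair of maps in one group gives a map on \<open>insert x' I\<close> with
  \<open>x'\<close> as a twin of \<open>x\<close>, and the groups number at most
  \<open>card V ^ (card I - 1)\<close>.\<close>

lemma multipartite_homs_duplicate:
  fixes V :: "'a set" and I :: "'i set"
  assumes V: "finite V" and I: "finite I" and x: "x \<in> I" "x' \<notin> I" "c x' = c x"
  shows "(card (multipartite_homs V E c I))^2 \<le> card V ^ (card I - 1) * card (multipartite_homs V E c (insert x' I))"
proof -
  let ?H = "multipartite_homs V E c"
  let ?J = "I - {x}"
  let ?P = "?J \<rightarrow>\<^sub>E V"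
  let ?d = "\<lambda>\<psi>. {w \<in> V. \<psi>(x := w) \<in> ?H I}"
  have finP: "finite ?P" using I V by (intro finite_PiE) auto
  have find: "finite (?d \<psi>)" for \<psi> using V by simp
  have finH: "finite (?H (insert x' I))" using V I by (intro finite_multipartite_homs) auto
  have "?H I \<subseteq> (\<lambda>p. (fst p)(x := snd p)) ` Sigma ?P ?d"
  proof
    fix \<phi> assume \<phi>: "\<phi> \<in> ?H I"
    let ?\<psi> = "restrict \<phi> ?J"
    have eq: "?\<psi>(x := \<phi> x) = \<phi>"
      using \<phi> x by (auto simp: multipartite_homs_def PiE_def extensional_def fun_eq_iff)
    moreover have "?\<psi> \<in> ?P" "\<phi> x \<in> V" using \<phi> x by (auto simp: multipartite_homs_def PiE_iff)
    ultimately have "(?\<psi>, \<phi> x) \<in> Sigma ?P ?d" using \<phi> by simp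
    then show "\<phi> \<in> (\<lambda>p. (fst p)(x := snd p)) ` Sigma ?P ?d"
      by (rule rev_image_eqI) (simp only: fst_conv snd_conv eq)
  qed
  then have "card (?H I) \<le> card (Sigma ?P ?d)"
    using finP find by (meson card_image_le card_mono finite_SigmaI finite_imageI order_trans)
  then have "card (?H I) \<le> (\<Sum>\<psi>\<in>?P. card (?d \<psi>))" using finP find by (simp add: card_SigmaI)
  then have "real (card (?H I))^2 \<le> (\<Sum>\<psi>\<in>?P. real (card (?d \<psi>)))^2"
    by (intro power_mono) (simp_all flip: of_nat_sum)
  also have "\<dots> \<le> real (card ?P) * (\<Sum>\<psi>\<in>?P. (real (card (?d \<psi>)))^2)"
    using sum_squared_le_sum_of_squares[of "\<lambda>\<psi>. real (card (?d \<psi>))" ?P]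
    by (simp add: mult.commute)
  also have "(\<Sum>\<psi>\<in>?P. (real (card (?d \<psi>)))^2) = real (card (Sigma ?P (\<lambda>\<psi>. ?d \<psi> \<times> ?d \<psi>)))"
    using finP find by (subst card_SigmaI) (auto simp: card_cartesian_product power2_eq_square)
  also have "card (Sigma ?P (\<lambda>\<psi>. ?d \<psi> \<times> ?d \<psi>)) \<le> card (?H (insert x' I))"
  proof (rule card_inj_on_le[of "\<lambda>p. (fst p)(x := fst (snd p), x' := snd (snd p))", OF _ _ finH])
    have xx': "x \<noteq> x'" using x by auto
    show "inj_on (\<lambda>p. (fst p)(x := fst (snd p), x' := snd (snd p))) (Sigma ?P (\<lambda>\<psi>. ?d \<psi> \<times> ?d \<psi>))"
    proof (rule inj_onI)
      fix p q assume p: "p \<in> Sigma ?P (\<lambda>\<psi>. ?d \<psi> \<times> ?d \<psi>)" and q: "q \<in> Sigma ?P (\<lambda>\<psi>. ?d \<psi> \<times> ?d \<psi>)"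
        and eq: "(fst p)(x := fst (snd p), x' := snd (snd p)) = (fst q)(x := fst (snd q), x' := snd (snd q))"
      have "fst p z = fst q z" if "z \<in> ?J" for z using fun_cong[OF eq, of z] that x by (auto split: if_splits)
      then have "fst p = fst q" using p q by (intro PiE_ext[of _ ?J "\<lambda>_. V"]) auto
      moreover have "snd (snd p) = snd (snd q)" using fun_cong[OF eq, of x'] by simp
      moreover have "fst (snd p) = fst (snd q)" using fun_cong[OF eq, of x] xx' by simp
      ultimately show "p = q" by (simp add: prod_eq_iff)
    qed
    show "(\<lambda>p. (fst p)(x := fst (snd p), x' := snd (snd p))) ` Sigma ?P (\<lambda>\<psi>. ?d \<psi> \<times> ?d \<psi>) \<subseteq> ?H (insert x' I)"
    proof
      fix g assume "g \<in> (\<lambda>p. (fst p)(x := fst (snd p), x' := snd (snd p))) ` Sigma ?P (\<lambda>\<psi>. ?d \<psi> \<times> ?d \<psi>)"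
      then obtain \<psi> w w' where g: "g = \<psi>(x := w, x' := w')" and \<psi>: "\<psi> \<in> ?P" and w: "w \<in> ?d \<psi>" "w' \<in> ?d \<psi>"
        by auto
      have g1: "g z = (\<psi>(x := w)) z" if "z \<in> I" for z using that x g by auto
      have g2: "g z = (\<psi>(x := w')) z" if "z \<in> I" "z \<noteq> x" for z using that x g by auto
      have gx': "g x' = (\<psi>(x := w')) x" using g by simp
      have H1: "{(\<psi>(x := u)) a, (\<psi>(x := u)) b} \<in> E" if "u \<in> ?d \<psi>" "a \<in> I" "b \<in> I" "c a \<noteq> c b" for u a b
        using that unfolding multipartite_homs_def by blast
      have "g \<in> insert x' I \<rightarrow>\<^sub>E V" unfolding g using \<psi> w x by (auto simp: PiE_def extensional_def)
      moreover have "{g a, g b} \<in> E" if ab: "a \<in> insert x' I" "b \<in> insert x' I" "c a \<noteq> c b" for a b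
      proof -
        consider "a \<in> I" "b \<in> I" | "a = x'" "b \<in> I" | "a \<in> I" "b = x'" using ab by blast
        then show ?thesis
        proof cases
          case 1
          then show ?thesis using H1[OF w(1) 1 ab(3)] g1 by simp
        next
          case 2
          then have "b \<noteq> x" "c x \<noteq> c b" using ab x by auto
          then show ?thesis using H1[OF w(2) x(1) 2(2)] 2 gx' g2[OF 2(2)] by simp
        next
          case 3
          then have "a \<noteq> x" "c a \<noteq> c x" using ab x by auto
          then show ?thesis using H1[OF w(2) 3(1) x(1)] 3 gx' g2[OF 3(1)] by simp
        qed
      qed
      ultimately show "g \<in> ?H (insert x' I)" by (simp add: multipartite_homs_def)
    qed
  qed
  also have "card ?P = card V ^ (card I - 1)" using I x by (simp add: card_PiE)
  finally have "real (card (?H I))^2 \<le> real (card V ^ (card I - 1)) * real (card (?H (insert x' I)))"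
    by (simp add: mult_left_mono)
  then show ?thesis by (simp flip: of_nat_mult of_nat_power add: of_nat_le_iff)
qed

text \<open>Each added twin squares the density, whence the exponent \<open>2 ^ card K\<close>. A
  vertex of \<open>K\<close> has a twin in \<open>J\<close> because its colour occurs there.\<close>

lemma multipartite_homs_blowup:
  fixes V :: "'a set" and J :: "'i set" and d :: real
  assumes V: "finite V" "V \<noteq> {}" and J: "finite J" and d: "d > 0" "d * real (card V) ^ card J \<le> card (multipartite_homs V E c J)"
    and K: "finite K" "K \<inter> J = {}" "c ` K \<subseteq> c ` J"
  shows "d ^ (2 ^ card K) * real (card V) ^ card (J \<union> K) \<le> card (multipartite_homs V E c (J \<union> K))"
  using K
proof (induction K rule: finite_induct)
  case empty
  then show ?case using d by simp
next
  case (insert x' K)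
  let ?n = "real (card V)" and ?I = "J \<union> K" and ?H = "multipartite_homs V E c"
  let ?D = "d ^ (2 ^ card K)"
  have n: "?n > 0" using V by (simp add: card_gt_0_iff)
  obtain x where x: "x \<in> J" "c x' = c x" using insert.prems by auto
  have IH: "?D * ?n ^ card ?I \<le> card (?H ?I)" using insert by auto
  have fin: "finite ?I" using J insert.hyps by simp
  have "card ?I \<noteq> 0" using x fin by auto
  then obtain m where m: "card ?I = Suc m" by (cases "card ?I") auto
  have "?n ^ m * (?D ^ 2 * ?n ^ (Suc (Suc m))) = (?D * ?n ^ card ?I)^2"
    using m by (simp add: power2_eq_square algebra_simps)
  also have "\<dots> \<le> (real (card (?H ?I)))^2" using IH d n by (intro power_mono) auto
  also have "\<dots> \<le> real (card V ^ (card ?I - 1) * card (?H (insert x' ?I)))"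
    using multipartite_homs_duplicate[OF V(1) fin, of x x' c E] x insert.hyps insert.prems
    by (simp only: of_nat_power[symmetric] of_nat_le_iff) auto
  also have "\<dots> = ?n ^ m * real (card (?H (insert x' ?I)))" using m by simp
  finally have "?D ^ 2 * ?n ^ (Suc (Suc m)) \<le> real (card (?H (insert x' ?I)))"
    using n by (simp add: mult_le_cancel_left)
  moreover have "card (J \<union> insert x' K) = Suc (Suc m)" using m fin insert by auto
  moreover have "d ^ (2 ^ card (insert x' K)) = ?D ^ 2"
    using insert.hyps by (simp add: power_mult[symmetric] mult.commute)
  ultimately show ?case by simp
qed

section \<open>Embeddings of the Kneser graph\<close>

abbreviation kn :: "nat \<Rightarrow> nat set set" where "kn t \<equiv> pairs {1..t}"

lemma card_kn_ge: "t \<ge> 5 \<Longrightarrow> 10 \<le> card (kn t)"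
proof -
  assume t: "t \<ge> 5"
  have "2 * card (kn t) = t * (t - 1)" using card_pairs2[of "{1..t}"] by simp
  moreover have "5 * 4 \<le> t * (t - 1)" using t by (intro mult_le_mono) auto
  ultimately show ?thesis by linarith
qed

lemma kneser_embeddings_iff:
  "\<phi> \<in> embeddings (kneser2 t) (V, E) \<longleftrightarrow> \<phi> \<in> kn t \<rightarrow>\<^sub>E V \<and> inj_on \<phi> (kn t) \<and>
     (\<forall>a\<in>kn t. \<forall>b\<in>kn t. a \<inter> b = {} \<longrightarrow> {\<phi> a, \<phi> b} \<in> E)"
proof -
  have V: "verts (kneser2 t) = kn t" by (simp add: kneser2_def pairs_def Let_def)
  have E: "edges (kneser2 t) = {{a, b} | a b. a \<in> kn t \<and> b \<in> kn t \<and> a \<inter> b = {}}"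
    by (simp add: kneser2_def pairs_def Let_def)
  have "(\<forall>e\<in>edges (kneser2 t). \<phi> ` e \<in> E) \<longleftrightarrow>
     (\<forall>a\<in>kn t. \<forall>b\<in>kn t. a \<inter> b = {} \<longrightarrow> {\<phi> a, \<phi> b} \<in> E)"
  proof (intro iffI ballI impI)
    fix a b assume h: "\<forall>e\<in>edges (kneser2 t). \<phi> ` e \<in> E" and ab: "a \<in> kn t" "b \<in> kn t" "a \<inter> b = {}"
    from ab have "{a,b} \<in> edges (kneser2 t)" unfolding E by blast
    with h have "\<phi> ` {a,b} \<in> E" by (rule bspec)
    then show "{\<phi> a, \<phi> b} \<in> E" by simp
  next
    fix e assume h: "\<forall>a\<in>kn t. \<forall>b\<in>kn t. a \<inter> b = {} \<longrightarrow> {\<phi> a, \<phi> b} \<in> E" and "e \<in> edges (kneser2 t)"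
    then obtain a b where "e = {a,b}" "a \<in> kn t" "b \<in> kn t" "a \<inter> b = {}" unfolding E by blast
    then show "\<phi> ` e \<in> E" using h by simp
  qed
  then show ?thesis unfolding embeddings_def V by simp
qed

lemma finite_kneser_embeddings: "finite V \<Longrightarrow> finite (embeddings (kneser2 t) (V, E))"
  by (rule finite_subset[of _ "kn t \<rightarrow>\<^sub>E V"])
    (auto simp: kneser_embeddings_iff finite_pairs intro: finite_PiE)

text \<open>\<open>max 3 (Max x)\<close> is a proper colouring with the \<open>t - 2\<close> colours
  in \<open>{3..t}\<close>: pairs with a common maximum above 3 meet, and so do pairs inside
  \<open>{1,2,3}\<close>. The pairs \<open>{1,k}\<close> represent each colour once, so their
  homomorphisms are cliques, and blowing them up to all of \<open>kn t\<close> gives maps that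
  preserve the edges of the Kneser graph.\<close>

lemma many_cliques_many_kneser:
  fixes c :: real
  assumes t: "t \<ge> 3" and c: "c > 0"
  shows "\<exists>k>0. \<exists>n0. \<forall>(V :: 'a set) E. finite V \<longrightarrow> card V \<ge> n0 \<longrightarrow>
    c * real (card V) ^ (t - 2) \<le> card (multipartite_homs V E id ((\<lambda>k. {1,k}) ` {3..t})) \<longrightarrow>
    k * real (card V) ^ card (kn t) \<le> card (embeddings (kneser2 t) (V, E))"
proof -
  define J :: "nat set set" where "J = (\<lambda>k. {1,k}) ` {3..t}"
  define col where "col x = max 3 (Max x)" for x :: "nat set"
  let ?K = "kn t - J"
  have injJ: "inj_on (\<lambda>k::nat. {1,k}) {3..t}" by (auto simp: inj_on_def doubleton_eq_iff)
  have cardJ: "card J = t - 2" unfolding J_def using card_image[OF injJ] by simp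
  have finJ: "finite J" by (simp add: J_def)
  have colJ: "col {1,k} = k" if "k \<ge> 3" for k using that by (simp add: col_def)
  have JV: "J \<subseteq> kn t" using t by (auto simp: J_def pairs_def)
  have injc: "inj_on col J"
  proof (rule inj_onI)
    fix x y assume "x \<in> J" "y \<in> J" "col x = col y"
    moreover from this obtain j k where "x = {1,j}" "y = {1,k}" "j \<ge> 3" "k \<ge> 3" by (auto simp: J_def)
    ultimately show "x = y" using colJ[of j] colJ[of k] by simp
  qed
  have colr: "col x \<in> {3..t}" if "x \<in> kn t" for x
  proof -
    have x: "finite x" "x \<noteq> {}" "x \<subseteq> {1..t}" using that by (auto simp: pairs_def intro: finite_subset)
    then have "Max x \<in> {1..t}" using Max_in by blast
    then show ?thesis using t by (auto simp: col_def)
  qed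
  have colK: "col ` ?K \<subseteq> col ` J"
  proof
    fix k assume "k \<in> col ` ?K"
    then have k: "k \<in> {3..t}" using colr by auto
    then have "{1,k} \<in> J" by (auto simp: J_def)
    moreover have "col {1,k} = k" using colJ k by simp
    ultimately show "k \<in> col ` J" by force
  qed
  have proper: "col a \<noteq> col b" if ab: "a \<in> kn t" "b \<in> kn t" "a \<inter> b = {}" for a b
  proof
    assume eq: "col a = col b"
    have fin: "finite a" "a \<noteq> {}" "finite b" "b \<noteq> {}" "card a = 2" "card b = 2" "a \<subseteq> {1..t}" "b \<subseteq> {1..t}"
      using ab by (auto simp: pairs_def intro: finite_subset)
    show False
    proof (cases "col a > 3")
      case True
      then have "Max a = Max b" using eq by (auto simp: col_def max_def split: if_splits)
      then show False using Max_in[OF fin(1,2)] Max_in[OF fin(3,4)] ab by auto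
    next
      case False
      then have "Max a \<le> 3" "Max b \<le> 3" using eq by (auto simp: col_def)
      then have "\<forall>z\<in>a. z \<le> 3" "\<forall>z\<in>b. z \<le> 3" using fin by auto
      then have "a \<union> b \<subseteq> {1..3}" using fin(7,8) by auto
      then have "card (a \<union> b) \<le> card {1..3::nat}" by (intro card_mono) auto
      then show False using fin ab by (simp add: card_Un_disjoint)
    qed
  qed
  let ?v = "card (kn t)"
  define D where "D = c ^ (2 ^ card ?K)"
  have D: "D > 0" using c by (simp add: D_def)
  have v: "?v > 0"
  proof -
    have "{1,2} \<in> kn t" using t by (auto simp: pairs_def)
    then show ?thesis by (auto simp: card_gt_0_iff finite_pairs)
  qed
  show ?thesis
  \<comment> \<open>The threshold on \<open>card V\<close> makes the non-injective maps, of order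
    one power of \<open>card V\<close> lower, cost at most half of the maps found.\<close>
  proof (intro exI[of _ "D / 2"] conjI exI[of _ "nat \<lceil>2 * ?v^2 / D\<rceil> + 1"] allI impI)
    show "D / 2 > 0" using D by simp
    fix V :: "'a set" and E
    assume V: "finite V" and n: "nat \<lceil>2 * ?v^2 / D\<rceil> + 1 \<le> card V"
      and cl: "c * real (card V) ^ (t - 2) \<le> card (multipartite_homs V E id ((\<lambda>k. {1,k}) ` {3..t}))"
    let ?n = "real (card V)"
    have ne: "V \<noteq> {}" using n by auto
    have homeq: "multipartite_homs V E id J = multipartite_homs V E col J"
      using injc by (simp add: multipartite_homs_def inj_on_eq_iff cong: conj_cong)
    have cl': "c * real (card V) ^ card J \<le> card (multipartite_homs V E col J)"
      using cl by (simp only: J_def[symmetric] cardJ homeq)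
    have "D * real (card V) ^ card (J \<union> ?K) \<le> card (multipartite_homs V E col (J \<union> ?K))"
      unfolding D_def using colK
      by (intro multipartite_homs_blowup[OF V ne finJ c cl']) (auto simp: finite_pairs)
    also have "J \<union> ?K = kn t" using JV by auto
    finally have H: "D * ?n ^ ?v \<le> card (multipartite_homs V E col (kn t))" by simp
    have "multipartite_homs V E col (kn t) \<subseteq> embeddings (kneser2 t) (V,E) \<union> {\<phi> \<in> kn t \<rightarrow>\<^sub>E V. \<not> inj_on \<phi> (kn t)}"
      using proper by (auto simp: multipartite_homs_def kneser_embeddings_iff)
    then have "card (multipartite_homs V E col (kn t)) \<le> card (embeddings (kneser2 t) (V,E) \<union> {\<phi> \<in> kn t \<rightarrow>\<^sub>E V. \<not> inj_on \<phi> (kn t)})"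
    proof (rule card_mono[rotated])
      have "finite (kn t \<rightarrow>\<^sub>E V)" using V by (intro finite_PiE finite_pairs) auto
      then have "finite {\<phi> \<in> kn t \<rightarrow>\<^sub>E V. \<not> inj_on \<phi> (kn t)}" by simp
      then show "finite (embeddings (kneser2 t) (V,E) \<union> {\<phi> \<in> kn t \<rightarrow>\<^sub>E V. \<not> inj_on \<phi> (kn t)})"
        using finite_kneser_embeddings[OF V] by blast
    qed
    also have "\<dots> \<le> card (embeddings (kneser2 t) (V,E)) + card {\<phi> \<in> kn t \<rightarrow>\<^sub>E V. \<not> inj_on \<phi> (kn t)}"
      by (rule card_Un_le)
    also have "\<dots> \<le> card (embeddings (kneser2 t) (V,E)) + ?v^2 * card V ^ (?v - 1)"
      using card_noninjective_maps[of "kn t" V] V by (simp add: finite_pairs)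
    finally have le: "D * ?n ^ ?v \<le> card (embeddings (kneser2 t) (V,E)) + real (?v^2) * ?n ^ (?v - 1)"
      using H by (simp flip: of_nat_power of_nat_mult of_nat_add)
    have "2 * ?v^2 / D \<le> ?n" using n by linarith
    then have "real (?v^2) \<le> D / 2 * ?n" using D by (simp add: field_simps)
    then have "real (?v^2) * ?n ^ (?v - 1) \<le> D / 2 * ?n * ?n ^ (?v - 1)" by (intro mult_right_mono) auto
    also have "\<dots> = D / 2 * ?n ^ ?v" using v by (cases ?v) (auto simp: algebra_simps)
    finally show "D / 2 * ?n ^ ?v \<le> card (embeddings (kneser2 t) (V,E))" using le by linarith
  qed
qed

section \<open>Stability\<close>

text \<open>Ordered pairs, so that every edge counts twice and degree sums need no halves.\<close>

definition opairs :: "'a set \<Rightarrow> 'a set set \<Rightarrow> ('a \<times> 'a) set" where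
  "opairs V E = {p \<in> V \<times> V. {fst p, snd p} \<in> E}"

definition nbs :: "'a set \<Rightarrow> 'a set set \<Rightarrow> 'a \<Rightarrow> 'a set" where
  "nbs V E x = {y \<in> V. {x, y} \<in> E}"

lemma finite_opairs [simp]: "finite V \<Longrightarrow> finite (opairs V E)"
  by (simp add: opairs_def)

lemma finite_nbs [simp]: "finite V \<Longrightarrow> finite (nbs V E x)"
  by (simp add: nbs_def)

lemma card_opairs_le: "finite V \<Longrightarrow> card (opairs V E) \<le> (card V)^2"
  using card_mono[of "V \<times> V" "opairs V E"] by (auto simp: opairs_def card_cartesian_product power2_eq_square)

lemma card_opairs_remove:
  assumes "finite W"
  shows "card (opairs W E) \<le> card (opairs (W - {x}) E) + 2 * card (nbs W E x)"
proof -
  let ?A = "Pair x ` nbs W E x" and ?B = "(\<lambda>y. (y,x)) ` nbs W E x"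
  have "opairs W E \<subseteq> opairs (W - {x}) E \<union> (?A \<union> ?B)"
  proof
    fix p assume p: "p \<in> opairs W E"
    obtain u v where uv: "p = (u,v)" by (cases p)
    show "p \<in> opairs (W - {x}) E \<union> (?A \<union> ?B)"
      using p unfolding uv opairs_def nbs_def by (cases "u = x"; cases "v = x") (auto simp: insert_commute)
  qed
  then have "card (opairs W E) \<le> card (opairs (W - {x}) E \<union> (?A \<union> ?B))"
    using assms by (intro card_mono) auto
  also have "\<dots> \<le> card (opairs (W - {x}) E) + card (?A \<union> ?B)" by (rule card_Un_le)
  also have "card (?A \<union> ?B) \<le> card ?A + card ?B" by (rule card_Un_le)
  also have "card ?A + card ?B \<le> card (nbs W E x) + card (nbs W E x)"
    using assms by (intro add_mono card_image_le) auto
  finally show ?thesis by simp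
qed

text \<open>\<open>W\<close> maximises the ordered edges minus \<open>a * card W ^ 2\<close>.
  Removing a vertex loses at most twice its degree and changes the square by
  \<open>2 * card W - 1\<close>, so maximality bounds the degree from below; comparison with
  \<open>V\<close> itself is the second claim.\<close>

lemma min_degree_subset:
  fixes a :: real
  assumes V: "finite V"
  shows "\<exists>W\<subseteq>V. (\<forall>x\<in>W. a * (card W - 1/2) \<le> card (nbs W E x)) \<and>
    card (opairs V E) - a * real (card V)^2 \<le> card (opairs W E) - a * real (card W)^2"
proof -
  let ?f = "\<lambda>W. real (card (opairs W E)) - a * real (card W)^2"
  have fin: "finite (?f ` Pow V)" "?f ` Pow V \<noteq> {}" using V by auto
  obtain W where W: "W \<subseteq> V" "?f W = Max (?f ` Pow V)" using Max_in[OF fin] by auto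
  have max: "?f U \<le> ?f W" if "U \<subseteq> V" for U using that fin by (simp add: W(2))
  have finW: "finite W" using W V finite_subset by blast
  have "a * (card W - 1/2) \<le> card (nbs W E x)" if x: "x \<in> W" for x
  proof -
    have c: "real (card (W - {x})) = real (card W) - 1"
    proof -
      have "card W > 0" using x finW by (auto simp: card_gt_0_iff)
      then show ?thesis using x finW by (simp add: of_nat_diff)
    qed
    have "?f (W - {x}) \<le> ?f W" using W by (intro max) auto
    moreover have "real (card (opairs W E)) \<le> card (opairs (W - {x}) E) + 2 * card (nbs W E x)"
      using card_opairs_remove[OF finW, of E x] by (simp flip: of_nat_add of_nat_mult)
    ultimately have "a * real (card W)^2 - a * (real (card W) - 1)^2 \<le> 2 * card (nbs W E x)"
      unfolding c by linarith
    then show ?thesis by (simp add: power2_eq_square algebra_simps)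
  qed
  moreover have "?f V \<le> ?f W" by (rule max) simp
  ultimately show ?thesis using W(1) by blast
qed

lemma many_cliques:
  fixes e :: real and I :: "'i set"
  assumes W: "finite W" and I: "finite I" "card I \<le> Suc m"
    and deg: "\<And>x. x \<in> W \<Longrightarrow> card W - e \<le> card (nbs W E x)" and e: "0 \<le> e" "m * e \<le> card W"
  shows "(card W - m * e) ^ card I \<le> card (multipartite_homs W E id I)"
proof -
  have "(card W - m * e) ^ card I \<le>
    card {\<phi> \<in> I \<rightarrow>\<^sub>E W. \<forall>x\<in>I. \<forall>y\<in>I. x \<noteq> y \<longrightarrow> {\<phi> x, \<phi> y} \<in> E}"
  proof (rule greedy_count[where R = "\<lambda>_ _ w z. {w, z} \<in> E"])
    show "real (card {z \<in> W. {w,z} \<notin> E}) \<le> e" if w: "w \<in> W" for w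
    proof -
      have "{z \<in> W. {w,z} \<notin> E} = W - nbs W E w" by (auto simp: nbs_def)
      then have "card {z \<in> W. {w,z} \<notin> E} = card W - card (nbs W E w)"
        using W by (simp add: card_Diff_subset nbs_def)
      moreover have "card (nbs W E w) \<le> card W" using W by (intro card_mono) (auto simp: nbs_def)
      ultimately show ?thesis using deg[OF w] by linarith
    qed
    show "{z, w} \<in> E" if "{w, z} \<in> E" for w z using that by (simp add: insert_commute)
  qed (use W I e in auto)
  then show ?thesis by (simp add: multipartite_homs_def)
qed

lemma multipartite_homs_mono: "W \<subseteq> V \<Longrightarrow> multipartite_homs W E c I \<subseteq> multipartite_homs V E c I"
  by (auto simp: multipartite_homs_def PiE_iff)

text \<open>Half of the surplus \<open>g\<close> is spent on minimum degree: with
  \<open>a = 1 - 1/r + g/2\<close> there is a \<open>W\<close> of at least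
  \<open>g/2 * card V\<close> vertices in which any \<open>r\<close> vertices still have at least
  \<open>r * (g * card W / 2 - 1)\<close> common neighbours, so cliques on \<open>r + 1\<close>
  vertices can be built greedily.\<close>

lemma turan_supersaturation:
  fixes g :: real
  assumes g: "0 < g" "g \<le> 1" and r: "r \<ge> 1"
  shows "\<exists>c>0. \<exists>n0. \<forall>(V :: 'a set) E (J :: 'i set). finite V \<longrightarrow> card V \<ge> n0 \<longrightarrow> finite J \<longrightarrow> card J = Suc r \<longrightarrow>
    (1 - 1 / r + g) * real (card V)^2 \<le> card (opairs V E) \<longrightarrow>
    c * real (card V) ^ Suc r \<le> card (multipartite_homs V E id J)"
proof (intro exI[of _ "(g^2/8) ^ Suc r"] conjI exI[of _ "nat \<lceil>8 / g^2\<rceil> + 1"] allI impI)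
  show "0 < (g^2/8) ^ Suc r" using g by simp
  fix V :: "'a set" and E and J :: "'i set"
  assume V: "finite V" and n: "nat \<lceil>8 / g^2\<rceil> + 1 \<le> card V" and J: "finite J" "card J = Suc r"
    and ed: "(1 - 1 / r + g) * real (card V)^2 \<le> card (opairs V E)"
  define a where "a = 1 - 1 / real r + g / 2"
  have "0 \<le> 1 / real r" "1 / real r \<le> 1" using r by simp_all
  then have a: "0 \<le> a" "a \<le> 2" unfolding a_def using g by linarith+
  obtain W where W: "W \<subseteq> V" "\<forall>x\<in>W. a * (card W - 1/2) \<le> card (nbs W E x)"
    "card (opairs V E) - a * real (card V)^2 \<le> card (opairs W E) - a * real (card W)^2"
    using min_degree_subset[OF V, of a E] by (elim exE conjE)
  let ?n = "real (card V)" and ?N = "real (card W)"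
  have finW: "finite W" using W(1) V finite_subset by blast
  have "g / 2 * ?n^2 = (1 - 1 / r + g) * ?n^2 - a * ?n^2" by (simp add: a_def algebra_simps)
  also have "\<dots> \<le> card (opairs W E) - a * ?N^2" using ed W(3) by linarith
  also have "\<dots> \<le> ?N^2"
  proof -
    have "real (card (opairs W E)) \<le> ?N^2" using card_opairs_le[OF finW, of E] by (simp flip: of_nat_power)
    moreover have "0 \<le> a * ?N^2" using a by simp
    ultimately show ?thesis by linarith
  qed
  finally have "g / 2 * ?n^2 \<le> ?N^2" .
  moreover have "(g / 2 * ?n)^2 \<le> g / 2 * ?n^2"
  proof -
    have "(g/2)^2 \<le> g/2" using g by (simp add: power2_eq_square field_simps)
    then have "(g/2)^2 * ?n^2 \<le> g / 2 * ?n^2" by (rule mult_right_mono) simp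
    then show ?thesis unfolding power_mult_distrib .
  qed
  ultimately have "(g / 2 * ?n)^2 \<le> ?N^2" by linarith
  then have N: "g / 2 * ?n \<le> ?N" by (rule power2_le_imp_le) simp
  have n8: "8 / g^2 \<le> ?n" using n by linarith
  then have "4 \<le> g * (g / 2 * ?n)" using g by (simp add: field_simps power2_eq_square)
  also have "\<dots> \<le> g * ?N" using N g by (intro mult_left_mono) auto
  finally have gN: "4 \<le> g * ?N" .
  define e where "e = ?N - a * (?N - 1/2)"
  have Npos: "?N > 0" using gN g by (cases "card W = 0") auto
  then obtain x where x: "x \<in> W" by (metis card_gt_0_iff ex_in_conv of_nat_0_less_iff)
  have "a * (?N - 1/2) \<le> ?N"
    using W(2)[rule_format, OF x] card_mono[OF finW, of "nbs W E x"] by (auto simp: nbs_def)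
  then have e0: "0 \<le> e" by (simp add: e_def)
  have ra: "real r * a = real r - 1 + r * g / 2" unfolding a_def using r by (simp add: field_simps)
  have "real r * e = r * ?N - (real r * a) * ?N + (real r * a) / 2" by (simp add: e_def algebra_simps)
  moreover have "(real r * a) * ?N = r * ?N - ?N + r * g / 2 * ?N" unfolding ra by (simp add: algebra_simps)
  ultimately have "?N - r * e = r * g / 2 * ?N - r * a / 2" by linarith
  also have "\<dots> \<ge> r * (g * ?N / 2 - 1)"
  proof -
    have "r * a / 2 \<le> real r" using mult_right_mono[OF a(2), of "real r"] by (simp add: mult.commute)
    then show ?thesis by (simp add: algebra_simps)
  qed
  finally have "r * (g * ?N / 2 - 1) \<le> ?N - r * e" .
  moreover have "g * ?N / 4 \<le> r * (g * ?N / 2 - 1)"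
  proof -
    have "1 * (g * ?N / 4) \<le> r * (g * ?N / 2 - 1)" using gN r by (intro mult_mono) auto
    then show ?thesis by simp
  qed
  moreover have "g^2/8 * ?n \<le> g * ?N / 4"
    using mult_left_mono[OF N, of "g/4"] g by (simp add: power2_eq_square algebra_simps)
  ultimately have lb: "g^2/8 * ?n \<le> ?N - r * e" by linarith
  have lb0: "0 \<le> g^2/8 * ?n" by simp
  have "(g^2/8) ^ Suc r * ?n ^ Suc r = (g^2/8 * ?n) ^ card J" using J by (simp only: power_mult_distrib)
  also have "\<dots> \<le> (?N - r * e) ^ card J" by (intro power_mono lb lb0)
  also have "\<dots> \<le> card (multipartite_homs W E id J)"
  proof (rule many_cliques[OF finW J(1)])
    show "?N - e \<le> card (nbs W E x)" if "x \<in> W" for x using W(2)[rule_format, OF that] by (simp add: e_def)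
    show "real r * e \<le> ?N" using lb lb0 by linarith
  qed (use J e0 in auto)
  also have "\<dots> \<le> card (multipartite_homs V E id J)"
    using card_mono[OF finite_multipartite_homs[OF V J(1)] multipartite_homs_mono[OF W(1)]] by simp
  finally show "(g^2/8) ^ Suc r * ?n ^ Suc r \<le> card (multipartite_homs V E id J)" by simp
qed

section \<open>A partition from a clique with few extensions\<close>

text \<open>Averaging over the cliques on \<open>J0\<close>. A clique on \<open>insert j0 J0\<close>
  determines the pair of \<phi> and \<open>y\<close>, and for each \<open>i\<close> it determines
  \<phi> up to the forgotten value at \<open>i\<close>, that is up to \<open>card W\<close> choices.
  So the total over all \<phi> is at most \<open>(card J0 + 1) * card W\<close> times the number of
  larger cliques.\<close>

lemma good_clique:
  fixes J0 :: "'i set" and W :: "'a set" and T :: real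
  assumes W: "finite W" and J0: "finite J0" and j0: "j0 \<notin> J0"
    and S: "multipartite_homs W E id J0 \<noteq> {}"
    and T: "real (card J0 + 1) * real (card W) * card (multipartite_homs W E id (insert j0 J0)) \<le> T * card (multipartite_homs W E id J0)"
  obtains \<phi> where "\<phi> \<in> multipartite_homs W E id J0"
    "card W * card {y \<in> W. \<phi>(j0 := y) \<in> multipartite_homs W E id (insert j0 J0)} +
     (\<Sum>i\<in>J0. card {p \<in> W \<times> W. \<phi>(i := fst p, j0 := snd p) \<in> multipartite_homs W E id (insert j0 J0)}) \<le> T"
proof -
  let ?S = "multipartite_homs W E id J0" and ?H = "multipartite_homs W E id (insert j0 J0)"
  let ?com = "\<lambda>\<phi>. {y \<in> W. \<phi>(j0 := y) \<in> ?H}"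
  let ?pr = "\<lambda>i \<phi>. {p \<in> W \<times> W. \<phi>(i := fst p, j0 := snd p) \<in> ?H}"
  have finS: "finite ?S" and finH: "finite ?H" using W J0 by (auto intro: finite_multipartite_homs)
  have ext: "\<phi> z = undefined" if "\<phi> \<in> ?S" "z \<notin> J0" for \<phi> z
    using that by (auto simp: multipartite_homs_def PiE_def extensional_def)
  have com: "(\<Sum>\<phi>\<in>?S. card (?com \<phi>)) \<le> card ?H"
  proof -
    have "(\<Sum>\<phi>\<in>?S. card (?com \<phi>)) = card (Sigma ?S ?com)" using finS W by (simp add: card_SigmaI)
    also have "\<dots> \<le> card ?H"
    proof (rule card_inj_on_le[of "\<lambda>p. (fst p)(j0 := snd p)"])
      show "inj_on (\<lambda>p. (fst p)(j0 := snd p)) (Sigma ?S ?com)"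
      proof (rule inj_onI)
        fix p q assume p: "p \<in> Sigma ?S ?com" and q: "q \<in> Sigma ?S ?com" and eq: "(fst p)(j0 := snd p) = (fst q)(j0 := snd q)"
        have "fst p z = fst q z" for z
        proof (cases "z = j0")
          case True then show ?thesis using ext[of "fst p"] ext[of "fst q"] p q j0 by auto
        next
          case False then show ?thesis using fun_cong[OF eq, of z] by simp
        qed
        moreover have "snd p = snd q" using fun_cong[OF eq, of j0] by simp
        ultimately show "p = q" by (simp add: prod_eq_iff fun_eq_iff)
      qed
    qed (use finH in auto)
    finally show ?thesis .
  qed
  have pr: "(\<Sum>\<phi>\<in>?S. card (?pr i \<phi>)) \<le> card W * card ?H" if i: "i \<in> J0" for i
  proof -
    have ij: "i \<noteq> j0" using i j0 by auto
    have "(\<Sum>\<phi>\<in>?S. card (?pr i \<phi>)) = card (Sigma ?S (?pr i))" using finS W by (simp add: card_SigmaI)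
    also have "\<dots> \<le> card (W \<times> ?H)"
    proof (rule card_inj_on_le[of "\<lambda>p. (fst p i, (fst p)(i := fst (snd p), j0 := snd (snd p)))"])
      show "inj_on (\<lambda>p. (fst p i, (fst p)(i := fst (snd p), j0 := snd (snd p)))) (Sigma ?S (?pr i))"
      proof (rule inj_onI)
        fix p q assume p: "p \<in> Sigma ?S (?pr i)" and q: "q \<in> Sigma ?S (?pr i)"
          and eq2: "(fst p i, (fst p)(i := fst (snd p), j0 := snd (snd p))) = (fst q i, (fst q)(i := fst (snd q), j0 := snd (snd q)))"
        then have eqi: "fst p i = fst q i" and eq: "(fst p)(i := fst (snd p), j0 := snd (snd p)) = (fst q)(i := fst (snd q), j0 := snd (snd q))"
          by simp_all
        have "fst p z = fst q z" for z
        proof (cases "z = j0")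
          case True then show ?thesis using ext[of "fst p"] ext[of "fst q"] p q j0 by auto
        next
          case False then show ?thesis using fun_cong[OF eq, of z] eqi by (cases "z = i") auto
        qed
        moreover have "snd (snd p) = snd (snd q)" using fun_cong[OF eq, of j0] by simp
        moreover have "fst (snd p) = fst (snd q)" using fun_cong[OF eq, of i] ij by simp
        ultimately show "p = q" by (simp add: prod_eq_iff fun_eq_iff)
      qed
      show "(\<lambda>p. (fst p i, (fst p)(i := fst (snd p), j0 := snd (snd p)))) ` Sigma ?S (?pr i) \<subseteq> W \<times> ?H"
        using i by (auto simp: multipartite_homs_def PiE_iff)
    qed (use finH W in auto)
    finally show ?thesis by (simp add: card_cartesian_product)
  qed
  let ?val = "\<lambda>\<phi>. card W * card (?com \<phi>) + (\<Sum>i\<in>J0. card (?pr i \<phi>))"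
  have "(\<Sum>\<phi>\<in>?S. ?val \<phi>) = card W * (\<Sum>\<phi>\<in>?S. card (?com \<phi>)) + (\<Sum>\<phi>\<in>?S. \<Sum>i\<in>J0. card (?pr i \<phi>))"
    by (simp add: sum.distrib sum_distrib_left)
  also have "(\<Sum>\<phi>\<in>?S. \<Sum>i\<in>J0. card (?pr i \<phi>)) = (\<Sum>i\<in>J0. \<Sum>\<phi>\<in>?S. card (?pr i \<phi>))" by (rule sum.swap)
  also have "card W * (\<Sum>\<phi>\<in>?S. card (?com \<phi>)) + (\<Sum>i\<in>J0. \<Sum>\<phi>\<in>?S. card (?pr i \<phi>)) \<le> card W * card ?H + (\<Sum>i\<in>J0. card W * card ?H)"
    using com by (intro add_mono mult_left_mono sum_mono pr) auto
  also have "\<dots> = (card J0 + 1) * card W * card ?H" by (simp add: algebra_simps)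
  finally have tot: "(\<Sum>\<phi>\<in>?S. ?val \<phi>) \<le> (card J0 + 1) * card W * card ?H" .
  have "\<exists>\<phi>\<in>?S. real (?val \<phi>) \<le> T"
  proof (rule ccontr)
    assume "\<not> ?thesis"
    then have "(\<Sum>\<phi>\<in>?S. T) < (\<Sum>\<phi>\<in>?S. real (?val \<phi>))" using finS S by (intro sum_strict_mono) (auto simp: not_le)
    also have "\<dots> = real (\<Sum>\<phi>\<in>?S. ?val \<phi>)" by simp
    also have "\<dots> \<le> real ((card J0 + 1) * card W * card ?H)" using tot of_nat_le_iff by blast
    also have "\<dots> \<le> T * card ?S" using T by (simp only: of_nat_mult)
    finally show False by simp
  qed
  then obtain \<phi> where "\<phi> \<in> ?S" "real (?val \<phi>) \<le> T" by (elim bexE)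
  then show ?thesis by (rule that)
qed

text \<open>The vertices of \<open>W\<close> are sorted by the one vertex of the clique \<phi> to
  which they are not adjacent. Those adjacent to the whole clique (\<open>C\<close>) extend it and
  are few by \<open>good\<close>; the degree sum of the clique then leaves few vertices
  (\<open>R\<close>) that miss two or more. An edge between two vertices that both miss only
  \<open>\<phi> i\<close> forms, with the rest of the clique, a clique on \<open>r + 1\<close>
  vertices counted by \<open>pr i\<close>.\<close>

lemma clique_partition:
  fixes J0 :: "'i set" and V W :: "'a set" and g th :: real
  assumes V: "finite V" and WV: "W \<subseteq> V" and W: "(1 - g) * card V \<le> card W"
    and J0: "finite J0" "card J0 = r" "r \<ge> 1" and j0: "j0 \<notin> J0" and loop: "\<And>x. {x} \<notin> E"
    and \<phi>: "\<phi> \<in> multipartite_homs W E id J0"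
    and good: "card W * card {y \<in> W. \<phi>(j0 := y) \<in> multipartite_homs W E id (insert j0 J0)} +
     (\<Sum>i\<in>J0. card {p \<in> W \<times> W. \<phi>(i := fst p, j0 := snd p) \<in> multipartite_homs W E id (insert j0 J0)}) \<le> th * real (card W)^2"
    and deg: "\<And>x. x \<in> W \<Longrightarrow> (1 - 1 / r - g) * (card W - 1/2) \<le> card (nbs W E x)"
    and g: "0 \<le> g" and th: "0 \<le> th" and Wne: "W \<noteq> {}"
  shows "\<exists>P. (\<forall>x\<in>V. P x < r) \<and>
    card {p \<in> opairs V E. P (fst p) = P (snd p)} \<le> (2 * (real r + 1) * g + 5 * th) * real (card V)^2 + real r * real (card V)"
proof -
  let ?n = "real (card V)" and ?N = "real (card W)"
  let ?H = "multipartite_homs W E id (insert j0 J0)"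
  define com where "com = {y \<in> W. \<phi>(j0 := y) \<in> ?H}"
  define pr where "pr i = {p \<in> W \<times> W. \<phi>(i := fst p, j0 := snd p) \<in> ?H}" for i
  have finW: "finite W" using WV V finite_subset by blast
  have Npos: "?N > 0" using Wne finW by (simp add: card_gt_0_iff)
  have Nn: "?N \<le> ?n" using WV V by (simp add: card_mono)
  have \<phi>W: "\<phi> i \<in> W" if "i \<in> J0" for i using \<phi> that by (auto simp: multipartite_homs_def)
  have \<phi>E: "{\<phi> i, \<phi> j} \<in> E" if "i \<in> J0" "j \<in> J0" "i \<noteq> j" for i j using \<phi> that by (auto simp: multipartite_homs_def)
  have \<phi>ext: "\<phi> \<in> extensional J0" using \<phi> by (auto simp: multipartite_homs_def PiE_def)
  define A where "A y = {i \<in> J0. {\<phi> i, y} \<in> E}" for y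
  define k where "k y = card (A y)" for y
  have kr: "k y \<le> r" for y unfolding k_def A_def J0(2)[symmetric] using J0(1) by (intro card_mono) auto
  have kall: "A y = J0" if "k y = r" for y
    using that J0 unfolding k_def A_def by (intro card_subset_eq) auto
  define C where "C = {y \<in> W. k y = r}"
  define R where "R = {y \<in> W. k y + 2 \<le> r}"
  have comC: "C \<subseteq> com"
  proof
    fix y assume y: "y \<in> C"
    then have yW: "y \<in> W" and adj: "{\<phi> i, y} \<in> E" if "i \<in> J0" for i
      using kall[of y] that by (auto simp: C_def A_def)
    have yW: "y \<in> W" using y by (simp add: C_def)
    have "\<phi>(j0 := y) \<in> insert j0 J0 \<rightarrow>\<^sub>E W" using \<phi>W \<phi>ext yW by (auto simp: PiE_def extensional_def)
    moreover have "{(\<phi>(j0 := y)) a, (\<phi>(j0 := y)) b} \<in> E" if "a \<in> insert j0 J0" "b \<in> insert j0 J0" "a \<noteq> b" for a b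
      using that adj[of a] adj[of b] \<phi>E[of a b] j0 by (auto simp: insert_commute)
    ultimately have "\<phi>(j0 := y) \<in> ?H" unfolding multipartite_homs_def id_apply by blast
    then show "y \<in> com" using yW unfolding com_def by blast
  qed
  have cardcom: "real (card com) \<le> th * ?N"
  proof -
    have "?N * real (card com) \<le> th * ?N^2"
      using good unfolding com_def[symmetric] pr_def[symmetric]
      by (rule order_trans[rotated]) (simp add: sum_nonneg)
    then show ?thesis using Npos by (simp add: power2_eq_square mult.commute)
  qed
  have cardpr: "real (\<Sum>i\<in>J0. card (pr i)) \<le> th * ?N^2"
    using good unfolding com_def[symmetric] pr_def[symmetric]
    by (rule order_trans[rotated]) simp
  have finCR: "finite C" "finite R" using finW by (auto simp: C_def R_def)
  have cardC: "real (card C) \<le> th * ?N"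
  proof -
    have "card C \<le> card com" using comC finW by (intro card_mono) (auto simp: com_def)
    then show ?thesis using cardcom by linarith
  qed
  have cardR: "real (card R) \<le> th * ?N + r * g * ?N + r / 2"
  proof -
    have WCR: "W \<inter> C = C" "W \<inter> R = R" by (auto simp: C_def R_def)
    have "r * ((1 - 1 / r - g) * (?N - 1/2)) = (\<Sum>i\<in>J0. (1 - 1 / r - g) * (?N - 1/2))" using J0 by simp
    also have "\<dots> \<le> (\<Sum>i\<in>J0. real (card (nbs W E (\<phi> i))))" by (intro sum_mono deg \<phi>W)
    also have "\<dots> = real (\<Sum>i\<in>J0. \<Sum>y\<in>W. if {\<phi> i, y} \<in> E then 1 else 0)"
      using finW by (simp add: nbs_def sum.If_cases Int_def)
    also have "\<dots> = real (\<Sum>y\<in>W. k y)"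
      using J0(1) by (subst sum.swap) (simp add: k_def A_def sum.If_cases Int_def)
    also have "\<dots> = (\<Sum>y\<in>W. real (k y))" by simp
    \<comment> \<open>The baseline is \<open>r - 1\<close> clique vertices seen; a vertex of
      \<open>C\<close> sees one more, a vertex of \<open>R\<close> at least one fewer.\<close>
    also have "\<dots> \<le> (\<Sum>y\<in>W. (real r - 1) + (if y \<in> C then 1 else 0) - (if y \<in> R then 1 else 0))"
    proof (rule sum_mono)
      fix y assume "y \<in> W"
      then show "real (k y) \<le> (real r - 1) + (if y \<in> C then 1 else 0) - (if y \<in> R then 1 else 0)"
        using kr[of y] by (auto simp: C_def R_def)
    qed
    also have "\<dots> = ?N * (real r - 1) + card (W \<inter> C) - card (W \<inter> R)"
      using finW by (simp add: sum.distrib sum_subtractf sum.If_cases Int_def)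
    finally have le: "r * ((1 - 1 / r - g) * (?N - 1/2)) \<le> ?N * (real r - 1) + card C - card R" by (simp only: WCR)
    have "r * ((1 - 1 / r - g) * (?N - 1/2)) = (real r - 1 - r * g) * (?N - 1/2)"
      using J0(3) by (simp add: field_simps)
    also have "\<dots> = (real r - 1) * ?N - r * g * ?N - (real r - 1 - r * g) / 2"
      by (simp add: algebra_simps diff_divide_distrib add_divide_distrib)
    also have "\<dots> \<ge> (real r - 1) * ?N - r * g * ?N - r / 2"
    proof -
      have "0 \<le> real r * g" using g by simp
      then show ?thesis by (simp add: field_simps)
    qed
    finally have "(real r - 1) * ?N - r * g * ?N - r / 2 \<le> ?N * (real r - 1) + card C - card R" using le by linarith
    then show ?thesis using cardC by (simp add: mult.commute)
  qed
  obtain f where f: "bij_betw f J0 {0..<r}" using ex_bij_betw_finite_nat[OF J0(1)] J0(2) by auto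
  define sel where "sel y = (SOME i. i \<in> J0 - A y)" for y
  \<comment> \<open>The exceptional vertices go to class 0; all pairs at them are charged through
    \<open>Z\<close> as if they were inside a class.\<close>
  define P where "P y = (if y \<in> W \<and> k y + 1 = r then f (sel y) else 0)" for y
  have sel: "sel y \<in> J0" "J0 - A y = {sel y}" if "k y + 1 = r" for y
  proof -
    have "card (J0 - A y) = card J0 - card (A y)" using J0(1) by (intro card_Diff_subset) (auto simp: A_def)
    then have "card (J0 - A y) = 1" using that J0 by (simp add: k_def)
    then obtain i where i: "J0 - A y = {i}" by (auto simp: card_1_singleton_iff)
    then have "sel y = i" by (simp add: sel_def)
    then show "sel y \<in> J0" "J0 - A y = {sel y}" using i by auto
  qed
  have Pr: "P y < r" for y
    using sel(1)[of y] f J0(3) by (auto simp: P_def bij_betw_def)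
  define Z where "Z = (V - W) \<union> (C \<union> R)"
  have finZ: "finite Z" using V finCR by (simp add: Z_def)
  have ZV: "Z \<subseteq> V" using WV by (auto simp: Z_def C_def R_def)
  let ?inner = "{p \<in> opairs V E. P (fst p) = P (snd p)}"
  have sub: "?inner \<subseteq> Z \<times> V \<union> (V \<times> Z \<union> (\<Union>i\<in>J0. pr i))"
  proof
    fix p assume p: "p \<in> ?inner"
    obtain y z where yz: "p = (y,z)" by (cases p)
    have yzV: "y \<in> V" "z \<in> V" "{y,z} \<in> E" "P y = P z" using p yz by (auto simp: opairs_def)
    show "p \<in> Z \<times> V \<union> (V \<times> Z \<union> (\<Union>i\<in>J0. pr i))"
    proof (cases "y \<in> Z \<or> z \<in> Z")
      case True
      then show ?thesis using yz yzV by auto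
    next
      case False
      have typc: "x \<in> W \<and> k x + 1 = r" if "x \<in> V" "x \<notin> Z" for x
        using that kr[of x] by (auto simp: Z_def C_def R_def)
      have ky: "y \<in> W" "k y + 1 = r" and kz: "z \<in> W" "k z + 1 = r"
        using typc[of y] typc[of z] yzV False by auto
      have "f (sel y) = f (sel z)" using yzV(4) ky kz by (simp add: P_def)
      then have seq: "sel y = sel z" using f sel(1)[OF ky(2)] sel(1)[OF kz(2)] by (auto simp: bij_betw_def inj_on_def)
      let ?i = "sel y"
      have i: "?i \<in> J0" by (rule sel(1)[OF ky(2)])
      have ij: "?i \<noteq> j0" using i j0 by auto
      have adj: "{\<phi> j, y} \<in> E" "{\<phi> j, z} \<in> E" if j: "j \<in> J0" "j \<noteq> ?i" for j
        using sel(2)[OF ky(2)] sel(2)[OF kz(2)] j unfolding seq[symmetric] by (auto simp: A_def)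
      let ?g = "\<phi>(?i := y, j0 := z)"
      have "?g \<in> insert j0 J0 \<rightarrow>\<^sub>E W" using \<phi>W \<phi>ext ky kz i by (auto simp: PiE_def extensional_def)
      moreover have "{?g a, ?g b} \<in> E" if ab: "a \<in> insert j0 J0" "b \<in> insert j0 J0" "a \<noteq> b" for a b
      proof -
        have sw: "{\<phi> j, x} = {x, \<phi> j}" "{z,y} = {y,z}" for j x by auto
        consider "a = j0" "b = ?i" | "a = j0" "b \<in> J0" "b \<noteq> ?i" | "a = ?i" "b = j0" | "a = ?i" "b \<in> J0" "b \<noteq> ?i"
          | "a \<in> J0" "a \<noteq> ?i" "b = j0" | "a \<in> J0" "a \<noteq> ?i" "b = ?i" | "a \<in> J0" "a \<noteq> ?i" "b \<in> J0" "b \<noteq> ?i"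
          using ab by blast
        then show ?thesis
        proof cases
          case 1 then show ?thesis using yzV(3) sw ij by simp
        next
          case 2
          then have "b \<noteq> j0" using j0 by auto
          then show ?thesis using 2 adj(2)[of b] sw by simp
        next
          case 3 then show ?thesis using yzV(3) ij by simp
        next
          case 4
          then have "b \<noteq> j0" using j0 by auto
          then show ?thesis using 4 ij adj(1)[of b] sw by simp
        next
          case 5
          then have "a \<noteq> j0" using j0 by auto
          then show ?thesis using 5 adj(2)[of a] by simp
        next
          case 6
          then have "a \<noteq> j0" using j0 by auto
          then show ?thesis using 6 ij adj(1)[of a] by simp
        next
          case 7
          then have "a \<noteq> j0" "b \<noteq> j0" using j0 by auto
          then show ?thesis using 7 \<phi>E[of a b] ab by simp
        qed
      qed
      ultimately have "?g \<in> ?H" unfolding multipartite_homs_def id_apply by blast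
      then have "p \<in> pr ?i" unfolding pr_def yz using ky kz by simp
      then show ?thesis using i by blast
    qed
  qed
  have finpr: "finite (pr i)" for i using finW by (simp add: pr_def)
  have finall: "finite (Z \<times> V \<union> (V \<times> Z \<union> (\<Union>i\<in>J0. pr i)))" using finZ V J0 finpr by auto
  have "card ?inner \<le> card (Z \<times> V \<union> (V \<times> Z \<union> (\<Union>i\<in>J0. pr i)))" by (rule card_mono[OF finall sub])
  also have "\<dots> \<le> card (Z \<times> V) + card (V \<times> Z \<union> (\<Union>i\<in>J0. pr i))" by (rule card_Un_le)
  also have "\<dots> \<le> card (Z \<times> V) + (card (V \<times> Z) + card (\<Union>i\<in>J0. pr i))" by (intro add_left_mono card_Un_le)
  also have "\<dots> \<le> card (Z \<times> V) + (card (V \<times> Z) + (\<Sum>i\<in>J0. card (pr i)))"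
    by (intro add_left_mono card_UN_le J0)
  also have "\<dots> = 2 * card Z * card V + (\<Sum>i\<in>J0. card (pr i))" by (simp add: card_cartesian_product)
  finally have "real (card ?inner) \<le> real (2 * card Z * card V + (\<Sum>i\<in>J0. card (pr i)))" by (rule of_nat_mono)
  also have "\<dots> = 2 * real (card Z) * ?n + real (\<Sum>i\<in>J0. card (pr i))" by simp
  also have "\<dots> \<le> 2 * real (card Z) * ?n + th * ?N^2" using cardpr by linarith
  finally have b1: "real (card ?inner) \<le> 2 * real (card Z) * ?n + th * ?N^2" .
  have "real (card Z) \<le> (?n - ?N) + (card C + card R)"
  proof -
    have "card Z \<le> card (V - W) + card (C \<union> R)" unfolding Z_def by (rule card_Un_le)
    also have "\<dots> \<le> card (V - W) + (card C + card R)" by (intro add_left_mono card_Un_le)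
    also have "card (V - W) = card V - card W" by (rule card_Diff_subset[OF finW WV])
    finally show ?thesis using Nn by linarith
  qed
  also have "\<dots> \<le> g * ?n + (2 * th * ?N + r * g * ?N + r / 2)"
  proof -
    have "?n - ?N \<le> g * ?n" using W by (simp add: algebra_simps)
    then show ?thesis using cardC cardR by linarith
  qed
  also have "\<dots> \<le> g * ?n + (2 * th * ?n + r * g * ?n + r / 2)"
    using Nn th g by (intro add_left_mono add_right_mono add_mono mult_left_mono) auto
  also have "\<dots> = ((real r + 1) * g + 2 * th) * ?n + r / 2" by (simp add: algebra_simps)
  finally have cZ: "real (card Z) \<le> ((real r + 1) * g + 2 * th) * ?n + r / 2" .
  have "2 * real (card Z) * ?n \<le> 2 * (((real r + 1) * g + 2 * th) * ?n + r / 2) * ?n"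
    using cZ by (intro mult_right_mono) auto
  moreover have "th * ?N^2 \<le> th * ?n^2" using Nn th by (intro mult_left_mono power_mono) auto
  ultimately have "real (card ?inner) \<le> 2 * (((real r + 1) * g + 2 * th) * ?n + r / 2) * ?n + th * ?n^2" using b1 by linarith
  also have "\<dots> = (2 * (real r + 1) * g + 5 * th) * ?n^2 + real r * ?n" by (simp add: algebra_simps power2_eq_square)
  finally show ?thesis using Pr by blast
qed

text \<open>A subset \<open>W\<close> of large minimum degree is at the outset only known to have
  \<open>g * card V\<close> vertices. The scarcity of cliques on \<open>r + 1\<close> vertices keeps
  its density below \<open>1 - 1/r + g^2\<close>, and this forces it to contain all but a fraction
  \<open>g\<close> of \<open>V\<close>. Its many cliques on \<open>r\<close> vertices have few
  extensions on average, so one of them yields the partition.\<close>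

lemma stability:
  fixes eta :: real
  assumes eta: "0 < eta" "eta \<le> 1" and r: "r \<ge> 2"
  shows "\<exists>e>0. \<exists>n0. \<forall>(V :: 'a set) E (J :: 'i set). finite V \<longrightarrow> card V \<ge> n0 \<longrightarrow> (\<forall>x. {x} \<notin> E) \<longrightarrow> finite J \<longrightarrow> card J = Suc r \<longrightarrow>
    (1 - 1 / r) * real (card V)^2 \<le> card (opairs V E) \<longrightarrow>
    card (multipartite_homs V E id J) \<le> e * real (card V) ^ Suc r \<longrightarrow>
    (\<exists>P. (\<forall>x\<in>V. P x < r) \<and> card {p \<in> opairs V E. P (fst p) = P (snd p)} \<le> eta * real (card V)^2)"
proof -
  \<comment> \<open>The square of \<open>r + 1\<close> serves two ends:
    \<open>2 * (r + 1) * g\<close> is at most \<open>eta / 8\<close>, and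
    \<open>g \<le> 1 / (4 * r^2)\<close> leaves room in the greedy count of cliques on
    \<open>r\<close> vertices.\<close>
  define g where "g = eta / (16 * (real r + 1)^2)"
  have "g \<le> 1 / (16 * (real r + 1)^2)" using eta by (simp add: g_def divide_right_mono)
  also have "\<dots> \<le> 1 / (4 * (real r)^2)"
    using r by (intro divide_left_mono mult_mono power_mono) auto
  finally have gr: "g \<le> 1 / (4 * (real r)^2)" .
  have g0: "0 < g" using eta by (simp add: g_def zero_less_power)
  have "1 / (4 * (real r)^2) \<le> 1 / 16" using r power_mono[of 2 "real r" 2] by (intro divide_left_mono) auto
  then have g1: "g \<le> 1 / 16" using gr by linarith
  have g2: "0 < g^2" "g^2 \<le> 1" using g0 g1 by (auto simp: power_le_one)
  have r1: "r \<ge> 1" using r by simp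
  obtain c3 n3 where c3: "c3 > 0" and tur: "\<And>(V :: 'a set) E (J :: 'i set). finite V \<Longrightarrow> card V \<ge> n3 \<Longrightarrow> finite J \<Longrightarrow> card J = Suc r \<Longrightarrow>
    (1 - 1 / r + g^2) * real (card V)^2 \<le> card (opairs V E) \<Longrightarrow>
    c3 * real (card V) ^ Suc r \<le> card (multipartite_homs V E id J)"
    using turan_supersaturation[OF g2 r1, where ?'a='a and ?'i='i] by blast
  \<comment> \<open>The first bound lets supersaturation be contradicted; the second makes
    \<open>th\<close>, the allowance handed to \<open>good_clique\<close>, at most
    \<open>eta / 16\<close>.\<close>
  define mu where "mu = min (c3 / 2) (eta / (16 * (real r + 1) * (2 * real r) ^ r))"
  have mu: "mu > 0" "mu \<le> c3 / 2" "mu \<le> eta / (16 * (real r + 1) * (2 * real r) ^ r)"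
  proof -
    have "0 < eta / (16 * (real r + 1) * (2 * real r) ^ r)" using eta r by simp
    then show "mu > 0" using c3 by (simp only: mu_def min_less_iff_conj half_gt_zero_iff simp_thms)
  qed (simp_all only: mu_def min.cobounded1 min.cobounded2)
  define th where "th = (real r + 1) * mu * (2 * real r) ^ r"
  have th0: "th > 0" using mu r by (simp add: th_def)
  have th1: "th \<le> eta / 16"
  proof -
    have "th \<le> (real r + 1) * (eta / (16 * (real r + 1) * (2 * real r) ^ r)) * (2 * real r) ^ r"
      unfolding th_def using mu(3) by (intro mult_right_mono mult_left_mono) auto
    also have "\<dots> = eta / 16"
    proof -
      have gen: "B * (eta / (16 * B * A)) * A = eta / 16" if "B > 0" "A > 0" for A B :: real
        using that by simp
      show ?thesis by (rule gen) (use r in simp_all)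
    qed
    finally show ?thesis .
  qed
  define n0 where "n0 = nat \<lceil>real n3 / g\<rceil> + nat \<lceil>2 * real r^2 / g\<rceil> + nat \<lceil>4 * real r / eta\<rceil> + 1"
  show ?thesis
  \<comment> \<open>The factor \<open>g ^ Suc r\<close> turns a count relative to \<open>V\<close>
    into one relative to \<open>W\<close>, as \<open>card W\<close> is at least
    \<open>g * card V\<close>.\<close>
  proof (intro exI[of _ "g ^ Suc r * mu"] conjI exI[of _ n0] allI impI)
    show "0 < g ^ Suc r * mu" using g0 mu by simp
    fix V :: "'a set" and E and J :: "'i set"
    assume V: "finite V" and n: "n0 \<le> card V" and loop: "\<forall>x. {x} \<notin> E" and J: "finite J" "card J = Suc r"
      and ed: "(1 - 1 / r) * real (card V)^2 \<le> card (opairs V E)"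
      and few: "card (multipartite_homs V E id J) \<le> g ^ Suc r * mu * real (card V) ^ Suc r"
    let ?n = "real (card V)"
    have nn: "real n3 / g \<le> ?n" "2 * real r^2 / g \<le> ?n" "4 * real r / eta \<le> ?n" "?n \<ge> 1"
      using n unfolding n0_def by linarith+
    define a where "a = 1 - 1 / real r - g"
    have rinv: "1 / real r \<le> 1 / 2" "0 \<le> 1 / real r" using r by (auto simp: field_simps)
    have a: "0 \<le> a" "a \<le> 1" unfolding a_def using g0 g1 rinv by linarith+
    obtain W where W: "W \<subseteq> V" "\<forall>x\<in>W. a * (card W - 1/2) \<le> card (nbs W E x)"
      "card (opairs V E) - a * real (card V)^2 \<le> card (opairs W E) - a * real (card W)^2"
      using min_degree_subset[OF V, of a E] by (elim exE conjE)
    let ?N = "real (card W)"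
    have finW: "finite W" using W(1) V finite_subset by blast
    have ge: "g * ?n^2 + a * ?N^2 \<le> card (opairs W E)"
      using ed W(3) by (simp add: a_def algebra_simps)
    have "real (card (opairs W E)) \<le> ?N^2" using card_opairs_le[OF finW, of E] by (simp flip: of_nat_power)
    moreover have "0 \<le> a * ?N^2" using a by simp
    moreover have "(g * ?n)^2 \<le> g * ?n^2"
    proof -
      have "g^2 \<le> g" using g0 g1 by (simp add: power2_eq_square)
      then have "g^2 * ?n^2 \<le> g * ?n^2" by (rule mult_right_mono) simp
      then show ?thesis unfolding power_mult_distrib .
    qed
    ultimately have "(g * ?n)^2 \<le> ?N^2" using ge by linarith
    then have N: "g * ?n \<le> ?N" by (rule power2_le_imp_le) simp
    have Nn: "?N \<le> ?n" using W(1) V by (simp add: card_mono)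
    have "real n3 \<le> g * ?n" using nn(1) g0 by (simp add: field_simps)
    then have N3: "n3 \<le> card W" using N by linarith
    have "2 * real r^2 \<le> g * ?n" using nn(2) g0 by (simp add: field_simps)
    then have Nr: "2 * real r^2 \<le> ?N" using N by linarith
    then have Npos: "?N > 0" using r by (smt (verit) of_nat_0_less_iff zero_less_power less_le_trans pos2)
    have "card (multipartite_homs W E id J) \<le> card (multipartite_homs V E id J)"
      by (rule card_mono[OF finite_multipartite_homs[OF V J(1)] multipartite_homs_mono[OF W(1)]])
    then have "real (card (multipartite_homs W E id J)) \<le> g ^ Suc r * mu * ?n ^ Suc r" using few by linarith
    also have "\<dots> = mu * (g * ?n) ^ Suc r" by (simp only: power_mult_distrib mult_ac)
    also have "\<dots> \<le> mu * ?N ^ Suc r" using N g0 mu by (intro mult_left_mono power_mono) auto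
    finally have fewW: "real (card (multipartite_homs W E id J)) \<le> mu * ?N ^ Suc r" .
    \<comment> \<open>The surplus \<open>g^2\<close>, smaller than \<open>g\<close> by a factor
      \<open>g\<close>, is what gives \<open>?n^2 < (1 + g) * ?N^2\<close> below.\<close>
    have "\<not> (1 - 1 / r + g^2) * ?N^2 \<le> card (opairs W E)"
    proof
      assume "(1 - 1 / r + g^2) * ?N^2 \<le> card (opairs W E)"
      from tur[OF finW N3 J this] fewW have "c3 * ?N ^ Suc r \<le> mu * ?N ^ Suc r" by linarith
      then have "c3 \<le> mu" using Npos by (simp add: mult_le_cancel_right)
      then show False using mu c3 by linarith
    qed
    then have "g * ?n^2 + a * ?N^2 < (1 - 1 / r + g^2) * ?N^2" using ge by linarith
    then have "g * ?n^2 < g * ((1 + g) * ?N^2)" by (simp add: a_def algebra_simps power2_eq_square)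
    then have "?n^2 < (1 + g) * ?N^2" using g0 by simp
    then have "(1 - g)^2 * ?n^2 \<le> (1 - g)^2 * ((1 + g) * ?N^2)" by (intro mult_left_mono) auto
    also have "\<dots> = ((1 - g)^2 * (1 + g)) * ?N^2" by simp
    also have "\<dots> \<le> 1 * ?N^2"
    proof (rule mult_right_mono)
      have "(1 - g)^2 * (1 + g) = (1 - g) * (1 - g^2)" by (simp add: power2_eq_square algebra_simps)
      also have "\<dots> \<le> 1 * 1" using g0 g1 g2 by (intro mult_mono) auto
      finally show "(1 - g)^2 * (1 + g) \<le> 1" by simp
    qed simp
    finally have "((1 - g) * ?n)^2 \<le> ?N^2" by (simp add: power_mult_distrib)
    then have Ng: "(1 - g) * ?n \<le> ?N" by (rule power2_le_imp_le) simp
    obtain j0 where j0: "j0 \<in> J" using J by (metis card.empty ex_in_conv nat.distinct(1))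
    define J0 where "J0 = J - {j0}"
    have J0: "finite J0" "card J0 = r" "j0 \<notin> J0" "insert j0 J0 = J" using J j0 by (auto simp: J0_def)
    define e where "e = ?N - a * (?N - 1/2)"
    have Wne: "W \<noteq> {}" using Npos by auto
    then obtain x where x: "x \<in> W" by blast
    have "a * (?N - 1/2) \<le> ?N"
      using W(2)[rule_format, OF x] card_mono[OF finW, of "nbs W E x"] by (auto simp: nbs_def)
    then have e0: "0 \<le> e" by (simp add: e_def)
    \<comment> \<open>After \<open>r - 1\<close> choices about \<open>card W / r\<close> candidates
      remain; half of that pays for the error terms.\<close>
    have lb: "?N / (2 * r) \<le> ?N - real (r - 1) * e"
    proof -
      have "e \<le> (1 / r + g) * ?N + 1 / 2" unfolding e_def using a by (simp add: a_def algebra_simps)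
      then have "real (r - 1) * e \<le> real (r - 1) * ((1 / r + g) * ?N + 1 / 2)" by (intro mult_left_mono) auto
      also have "\<dots> = ?N - ?N / r + (real r - 1) * g * ?N + (real r - 1) / 2"
        using r by (simp add: of_nat_diff field_simps)
      also have "\<dots> \<le> ?N - ?N / r + real r * g * ?N + real r / 2"
        using g0 Npos by (simp add: algebra_simps)
      also have "real r * g * ?N \<le> real r * (1 / (4 * (real r)^2)) * ?N"
        using gr by (intro mult_right_mono mult_left_mono) auto
      also have "real r * (1 / (4 * (real r)^2)) * ?N = ?N / (4 * r)" using r by (simp add: power2_eq_square field_simps)
      also have "real r / 2 \<le> ?N / (4 * r)" using Nr r by (simp add: power2_eq_square field_simps)
      also have "?N - ?N / r + ?N / (4 * r) + ?N / (4 * r) = ?N - ?N / (2 * r)" using r by (simp add: field_simps)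
      finally show ?thesis by simp
    qed
    have cl: "(?N / (2 * r)) ^ r \<le> card (multipartite_homs W E id J0)"
    proof -
      have "(?N / (2 * r)) ^ r \<le> (?N - real (r - 1) * e) ^ card J0"
        unfolding J0(2) using lb Npos r by (intro power_mono) auto
      also have "\<dots> \<le> card (multipartite_homs W E id J0)"
      proof (rule many_cliques[OF finW J0(1)])
        show "?N - e \<le> card (nbs W E x)" if "x \<in> W" for x using W(2)[rule_format, OF that] by (simp add: e_def)
        have "0 \<le> ?N / (2 * r)" by simp
        then show "real (r - 1) * e \<le> ?N" using lb by linarith
      qed (use J0 e0 r in auto)
      finally show ?thesis .
    qed
    have clpos: "0 < (?N / (2 * r)) ^ r" using Npos r by simp
    then have Sne: "multipartite_homs W E id J0 \<noteq> {}" using cl by auto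
    have "real (card J0 + 1) * ?N * card (multipartite_homs W E id (insert j0 J0)) \<le> (real r + 1) * ?N * (mu * ?N ^ Suc r)"
      using mult_left_mono[OF fewW, of "(real r + 1) * ?N"] by (simp add: J0 add.commute)
    also have "\<dots> = th * ?N^2 * (?N / (2 * r)) ^ r"
      using r by (simp add: th_def power2_eq_square power_divide field_simps)
    also have "\<dots> \<le> th * ?N^2 * card (multipartite_homs W E id J0)" using cl th0 by (intro mult_left_mono) auto
    finally have T: "real (card J0 + 1) * ?N * card (multipartite_homs W E id (insert j0 J0)) \<le> th * ?N^2 * card (multipartite_homs W E id J0)" .
    obtain \<phi> where \<phi>: "\<phi> \<in> multipartite_homs W E id J0"
      "card W * card {y \<in> W. \<phi>(j0 := y) \<in> multipartite_homs W E id (insert j0 J0)} +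
       (\<Sum>i\<in>J0. card {p \<in> W \<times> W. \<phi>(i := fst p, j0 := snd p) \<in> multipartite_homs W E id (insert j0 J0)}) \<le> th * ?N^2"
      by (rule good_clique[OF finW J0(1) J0(3) Sne T])
    have "\<exists>P. (\<forall>x\<in>V. P x < r) \<and>
      card {p \<in> opairs V E. P (fst p) = P (snd p)} \<le> (2 * (real r + 1) * g + 5 * th) * ?n^2 + real r * ?n"
      by (rule clique_partition[OF V W(1) Ng J0(1,2) r1 J0(3) _ \<phi>]) (use loop W(2) g0 th0 Wne in \<open>auto simp: a_def\<close>)
    moreover have "(2 * (real r + 1) * g + 5 * th) * ?n^2 + real r * ?n \<le> eta * ?n^2"
    proof -
      have gen: "2 * B * (eta / (16 * B^2)) = eta / (8 * B)" if "B > 0" for B :: real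
        using that by (simp add: power2_eq_square)
      have "2 * (real r + 1) * g = eta / (8 * (real r + 1))" unfolding g_def by (rule gen) simp
      also have "\<dots> \<le> eta / 8" using eta by (intro divide_left_mono) auto
      finally have "2 * (real r + 1) * g + 5 * th \<le> eta / 2" using th1 eta by linarith
      then have "(2 * (real r + 1) * g + 5 * th) * ?n^2 \<le> eta / 2 * ?n^2" by (intro mult_right_mono) auto
      moreover have "real r \<le> eta / 4 * ?n" using nn(3) eta by (simp add: field_simps)
      then have "real r * ?n \<le> eta / 4 * ?n * ?n" by (intro mult_right_mono) auto
      moreover have "eta / 4 * ?n * ?n \<le> eta / 2 * ?n^2" using eta by (simp add: power2_eq_square)
      ultimately have "(2 * (real r + 1) * g + 5 * th) * ?n^2 + real r * ?n \<le> eta * ?n^2" by linarith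
      then show ?thesis .
    qed
    ultimately show "\<exists>P. (\<forall>x\<in>V. P x < r) \<and> card {p \<in> opairs V E. P (fst p) = P (snd p)} \<le> eta * ?n^2"
      by (meson order_trans)
  qed
qed

section \<open>Copies forced by two or three apex vertices\<close>

lemma pairs_four:
  assumes "x \<subseteq> {1..4::nat}" "card x = 2"
  shows "x = {1,2} \<or> x = {1,3} \<or> x = {2,3} \<or> x = {3,4} \<or> x = {2,4} \<or> x = {1,4}"
proof -
  obtain u' v' where uv': "x = {u',v'}" "u' \<noteq> v'" using assms(2) by (auto simp: card_2_iff)
  have "x = {min u' v', max u' v'} \<and> min u' v' < max u' v'" using uv' by (auto simp: min_def max_def)
  then obtain u v where uv: "x = {u,v}" "u < v" by blast
  have "{1..4::nat} = {1,2,3,4}" by auto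
  then have "u = 1 \<or> u = 2 \<or> u = 3 \<or> u = 4" "v = 1 \<or> v = 2 \<or> v = 3 \<or> v = 4" using assms(1) uv by auto
  then have "(u, v) \<in> {(1,2),(1,3),(2,3),(3,4),(2,4),(1,4)}" using uv(2) by (elim disjE) simp_all
  then show ?thesis unfolding uv(1) by (elim insertE) simp_all
qed

text \<open>The edges of \<open>K(t,2)\<close> inside colour classes are three disjoint edges, all in class \<open>i\<close>, and
  that class has no further vertices.\<close>

definition three_edge_colouring :: "nat \<Rightarrow> nat \<Rightarrow> (nat set \<Rightarrow> nat) \<Rightarrow> nat set \<Rightarrow> nat set \<Rightarrow> nat set \<Rightarrow> nat set \<Rightarrow> nat set \<Rightarrow> nat set \<Rightarrow> bool" where
  "three_edge_colouring t i c a b d a' b' d' \<longleftrightarrow>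
    (\<forall>x\<in>kn t. c x < t - 3) \<and> {a,b,d,a',b',d'} \<subseteq> kn t \<and> distinct [a,b,d,a',b',d'] \<and>
    (\<forall>x\<in>kn t. c x = i \<longrightarrow> x \<in> {a,b,d,a',b',d'}) \<and> (\<forall>x\<in>{a,b,d,a',b',d'}. c x = i) \<and>
    (\<forall>x\<in>kn t. \<forall>y\<in>kn t. x \<inter> y = {} \<longrightarrow> c x = c y \<longrightarrow> {x,y} = {a,a'} \<or> {x,y} = {b,b'} \<or> {x,y} = {d,d'}) \<and>
    d \<inter> d' = {}"

lemma three_edge_colouringD:
  assumes "three_edge_colouring t i c a b d a' b' d'"
  shows "x \<in> kn t \<Longrightarrow> c x < t - 3" and "{a,b,d,a',b',d'} \<subseteq> kn t" and "distinct [a,b,d,a',b',d']"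
    and "x \<in> kn t \<Longrightarrow> c x = i \<Longrightarrow> x \<in> {a,b,d,a',b',d'}" and "x \<in> {a,b,d,a',b',d'} \<Longrightarrow> c x = i"
    and "x \<in> kn t \<Longrightarrow> y \<in> kn t \<Longrightarrow> x \<inter> y = {} \<Longrightarrow> c x = c y \<Longrightarrow> {x,y} = {a,a'} \<or> {x,y} = {b,b'} \<or> {x,y} = {d,d'}"
    and "d \<inter> d' = {}"
proof -
  note h = assms[unfolded three_edge_colouring_def]
  show "x \<in> kn t \<Longrightarrow> c x < t - 3" by (rule h[THEN conjunct1, THEN bspec])
  note h = h[THEN conjunct2]
  show "{a,b,d,a',b',d'} \<subseteq> kn t" by (rule h[THEN conjunct1])
  note h = h[THEN conjunct2]
  show "distinct [a,b,d,a',b',d']" by (rule h[THEN conjunct1])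
  note h = h[THEN conjunct2]
  show "x \<in> kn t \<Longrightarrow> c x = i \<Longrightarrow> x \<in> {a,b,d,a',b',d'}" by (rule h[THEN conjunct1, rule_format])
  note h = h[THEN conjunct2]
  show "x \<in> {a,b,d,a',b',d'} \<Longrightarrow> c x = i" by (rule h[THEN conjunct1, THEN bspec])
  note h = h[THEN conjunct2]
  show "x \<in> kn t \<Longrightarrow> y \<in> kn t \<Longrightarrow> x \<inter> y = {} \<Longrightarrow> c x = c y \<Longrightarrow> {x,y} = {a,a'} \<or> {x,y} = {b,b'} \<or> {x,y} = {d,d'}"
    by (rule h[THEN conjunct1, THEN bspec, THEN bspec, THEN mp, THEN mp])
  show "d \<inter> d' = {}" by (rule h[THEN conjunct2])
qed

text \<open>The colouring by \<open>max 4 (Max x)\<close> works: its monochromatic edges are the perfect matchings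
  of \<open>{1,2,3,4}\<close>.\<close>

lemma kneser_structure:
  fixes t i :: nat
  assumes t: "t \<ge> 5" and i: "i < t - 3"
  shows "\<exists>c a b d a' b' d'. three_edge_colouring t i c a b d a' b' d'"
proof -
  define a b d a' b' d' :: "nat set" where "a = {1,2}" and "b = {1,3}" and "d = {2,3}" and
    "a' = {3,4}" and "b' = {2,4}" and "d' = {1,4}"
  note defs = a_def b_def d_def a'_def b'_def d'_def
  \<comment> \<open>Under \<open>c0\<close> the special class has colour 0; exchanging the colours 0
    and \<open>i\<close> puts it where it is wanted.\<close>
  define sw where "sw k = (if k = 0 then i else if k = i then 0 else k)" for k
  define c0 where "c0 x = max 4 (Max x) - 4" for x :: "nat set"
  have swinj: "sw k = sw l \<longleftrightarrow> k = l" for k l by (auto simp: sw_def)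
  have swi: "sw k = i \<longleftrightarrow> k = 0" for k by (auto simp: sw_def)
  have fin: "finite x" "x \<noteq> {}" "x \<subseteq> {1..t}" "card x = 2" if "x \<in> kn t" for x
    using that by (auto simp: pairs_def intro: finite_subset)
  have Mx: "Max x \<in> x" "Max x \<le> t" if "x \<in> kn t" for x
    using Max_in[OF fin(1,2)[OF that]] fin(3)[OF that] by auto
  have c0: "c0 x < t - 3" if "x \<in> kn t" for x using Mx(2)[OF that] t by (auto simp: c0_def)
  have sub4: "x \<subseteq> {1..4}" if "x \<in> kn t" "c0 x = 0" for x
  proof
    fix u assume u: "u \<in> x"
    have "u \<le> Max x" using fin[OF that(1)] u by simp
    moreover have "Max x \<le> 4" using that(2) by (simp add: c0_def)
    ultimately show "u \<in> {1..4}" using fin(3)[OF that(1)] u by auto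
  qed
  have six: "x = a \<or> x = b \<or> x = d \<or> x = a' \<or> x = b' \<or> x = d'" if "x \<in> kn t" "c0 x = 0" for x
    using pairs_four[OF sub4[OF that] fin(4)[OF that(1)]] unfolding defs .
  have c06: "c0 a = 0" "c0 b = 0" "c0 d = 0" "c0 a' = 0" "c0 b' = 0" "c0 d' = 0"
    unfolding c0_def defs by simp_all
  have kn6: "a \<in> kn t" "b \<in> kn t" "d \<in> kn t" "a' \<in> kn t" "b' \<in> kn t" "d' \<in> kn t"
    using t unfolding defs pairs_def by simp_all
  have dist: "distinct [a,b,d,a',b',d']" unfolding defs by (simp add: doubleton_eq_iff)
  have mono: "{x,y} = {a,a'} \<or> {x,y} = {b,b'} \<or> {x,y} = {d,d'}"
    if xy: "x \<in> kn t" "y \<in> kn t" "x \<inter> y = {}" "c0 x = c0 y" for x y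
  proof (cases "c0 x = 0")
    case True
    have "x \<union> y = {1..4}"
    proof (rule card_subset_eq)
      show "x \<union> y \<subseteq> {1..4}" using sub4[OF xy(1)] sub4[OF xy(2)] xy(4) True by simp
      show "card (x \<union> y) = card {1..4::nat}" using fin(1,4)[OF xy(1)] fin(1,4)[OF xy(2)] xy(3) by (simp add: card_Un_disjoint)
    qed simp
    moreover have "{1..4::nat} = {1,2,3,4}" by auto
    ultimately have y: "y = {1,2,3,4} - x" using xy(3) by auto
    have m: "x = a \<Longrightarrow> y = a'" "x = b \<Longrightarrow> y = b'" "x = d \<Longrightarrow> y = d'" "x = a' \<Longrightarrow> y = a" "x = b' \<Longrightarrow> y = b" "x = d' \<Longrightarrow> y = d"
      unfolding y defs by auto
    show ?thesis using six[OF xy(1) True]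
    proof (elim disjE)
      assume "x = a"
      with m(1)[OF this] show ?thesis by (simp)
    next
      assume "x = b"
      with m(2)[OF this] show ?thesis by (simp)
    next
      assume "x = d"
      with m(3)[OF this] show ?thesis by (simp)
    next
      assume "x = a'"
      with m(4)[OF this] show ?thesis by (simp add: insert_commute)
    next
      assume "x = b'"
      with m(5)[OF this] show ?thesis by (simp add: insert_commute)
    next
      assume "x = d'"
      with m(6)[OF this] show ?thesis by (simp add: insert_commute)
    qed
  next
    case False
    then have "Max x = Max y" using xy(4) by (auto simp: c0_def max_def split: if_splits)
    then have "Max x \<in> x \<inter> y" using Mx(1)[OF xy(1)] Mx(1)[OF xy(2)] by simp
    then show ?thesis using xy(3) by simp
  qed
  show ?thesis unfolding three_edge_colouring_def
  proof (rule exI[of _ "\<lambda>x. sw (c0 x)"], rule exI[of _ a], rule exI[of _ b], rule exI[of _ d],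
      rule exI[of _ a'], rule exI[of _ b'], rule exI[of _ d'], intro conjI)
    show "\<forall>x\<in>kn t. sw (c0 x) < t - 3"
    proof
      fix x assume "x \<in> kn t"
      from c0[OF this] show "sw (c0 x) < t - 3" using i by (auto simp: sw_def)
    qed
    show "{a,b,d,a',b',d'} \<subseteq> kn t" using kn6 by blast
    show "distinct [a,b,d,a',b',d']" by (rule dist)
    show "\<forall>x\<in>kn t. sw (c0 x) = i \<longrightarrow> x \<in> {a,b,d,a',b',d'}"
      unfolding swi by (intro ballI impI) (simp add: six)
    show "\<forall>x\<in>{a,b,d,a',b',d'}. sw (c0 x) = i" unfolding swi using c06 by simp
    show "\<forall>x\<in>kn t. \<forall>y\<in>kn t. x \<inter> y = {} \<longrightarrow> sw (c0 x) = sw (c0 y) \<longrightarrow> {x,y} = {a,a'} \<or> {x,y} = {b,b'} \<or> {x,y} = {d,d'}"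
      unfolding swinj by (intro ballI impI) (rule mono)
    show "d \<inter> d' = {}" unfolding defs by simp
  qed
qed

section \<open>Greedy extension of partial embeddings\<close>

definition missing :: "'a set \<Rightarrow> 'a set set \<Rightarrow> ('a \<Rightarrow> nat) \<Rightarrow> 'a \<Rightarrow> 'a set" where
  "missing V E P x = {y \<in> V. P y \<noteq> P x \<and> {x,y} \<notin> E}"

definition inside :: "'a set \<Rightarrow> 'a set set \<Rightarrow> ('a \<Rightarrow> nat) \<Rightarrow> 'a \<Rightarrow> 'a set" where
  "inside V E P x = {y \<in> V. P y = P x \<and> {x,y} \<in> E}"

text \<open>Here \<open>mu\<close> is an absolute number of missing cross neighbours, to be
  instantiated with a fraction of the number of vertices.\<close>

definition typical :: "'a set \<Rightarrow> 'a set set \<Rightarrow> ('a \<Rightarrow> nat) \<Rightarrow> real \<Rightarrow> nat \<Rightarrow> 'a set" where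
  "typical V E P mu j = {x \<in> V. P x = j \<and> real (card (missing V E P x)) \<le> mu}"

text \<open>\<open>D\<close> carries a prescribed partial embedding, and \<open>c\<close> is a
  proper colouring of the rest. Two adjacent free vertices go to different classes, where a typical
  image rules out at most \<open>mu\<close> candidates by non-adjacency and one more by injectivity;
  so the greedy count applies with error \<open>mu + 1\<close>.\<close>

lemma partial_embedding_extensions:
  fixes V :: "'a set" and f :: "nat set \<Rightarrow> 'a" and mu al :: real
  assumes V: "finite V" and D: "D \<subseteq> kn t" and f: "f ` D \<subseteq> V" "inj_on f D"
    and fE: "\<And>x y. x \<in> D \<Longrightarrow> y \<in> D \<Longrightarrow> x \<inter> y = {} \<Longrightarrow> {f x, f y} \<in> E"
    and c: "\<And>x y. x \<in> kn t - D \<Longrightarrow> y \<in> kn t - D \<Longrightarrow> x \<inter> y = {} \<Longrightarrow> c x \<noteq> c y"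
    and al: "\<And>x. x \<in> kn t - D \<Longrightarrow> 
      al \<le> card {w \<in> typical V E P mu (c x). w \<notin> f ` D \<and> (\<forall>y\<in>D. x \<inter> y = {} \<longrightarrow> {f y, w} \<in> E)}"
    and mu: "0 \<le> mu" "card (kn t) * (mu + 1) \<le> al"
  shows "(al - card (kn t) * (mu + 1)) ^ (card (kn t) - card D) \<le>
    card {\<phi> \<in> embeddings (kneser2 t) (V, E). (\<forall>x\<in>D. \<phi> x = f x) \<and> (\<forall>x\<in>kn t - D. P (\<phi> x) = c x)}"
proof -
  let ?I = "kn t - D" and ?v = "card (kn t)"
  define C where "C x = {w \<in> typical V E P mu (c x). w \<notin> f ` D \<and> (\<forall>y\<in>D. x \<inter> y = {} \<longrightarrow> {f y, w} \<in> E)}" for x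
  define R where "R x y w z \<longleftrightarrow> w \<noteq> z \<and> (x \<inter> y = {} \<longrightarrow> {w,z} \<in> E)" for x y :: "nat set" and w z :: 'a
  let ?S = "{\<phi> \<in> PiE ?I C. \<forall>x\<in>?I. \<forall>y\<in>?I. x \<noteq> y \<longrightarrow> R x y (\<phi> x) (\<phi> y)}"
  let ?T = "{\<phi> \<in> embeddings (kneser2 t) (V, E). (\<forall>x\<in>D. \<phi> x = f x) \<and> (\<forall>x\<in>?I. P (\<phi> x) = c x)}"
  have CV: "w \<in> V" "P w = c x" "card (missing V E P w) \<le> mu" "w \<notin> f ` D" "\<And>y. y \<in> D \<Longrightarrow> x \<inter> y = {} \<Longrightarrow> {f y, w} \<in> E"
    if "w \<in> C x" for w x using that by (auto simp: C_def typical_def)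
  have finC: "finite (C x)" for x using V by (rule finite_subset[rotated]) (use CV in blast)
  have fink: "finite (kn t)" by (simp add: finite_pairs)
  have greedy: "(al - ?v * (mu + 1)) ^ card ?I \<le> card ?S"
  proof (rule greedy_count[where R = R])
    show "card ?I \<le> Suc ?v" using fink by (simp add: card_mono le_SucI)
    show "al \<le> card (C x)" if "x \<in> ?I" for x unfolding C_def by (rule al[OF that])
    show "real (card {z \<in> C y. \<not> R x y w z}) \<le> mu + 1" if "x \<in> ?I" "y \<in> ?I" "x \<noteq> y" "w \<in> C x" for x y w
    proof -
      have finm: "finite (missing V E P w)" using V by (simp add: missing_def)
      have "{z \<in> C y. \<not> R x y w z} \<subseteq> insert w (missing V E P w)"
      proof
        fix z assume z: "z \<in> {z \<in> C y. \<not> R x y w z}"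
        show "z \<in> insert w (missing V E P w)"
        proof (cases "z = w")
          case False
          with z have xy: "x \<inter> y = {}" "{w,z} \<notin> E" by (auto simp: R_def)
          have "P z \<noteq> P w" using c[OF that(1,2) xy(1)] CV(2)[of z y] CV(2)[OF that(4)] z by auto
          then show ?thesis using CV(1)[of z y] z xy by (simp add: missing_def)
        qed simp
      qed
      then have "card {z \<in> C y. \<not> R x y w z} \<le> card (insert w (missing V E P w))"
        using finm by (intro card_mono) auto
      also have "\<dots> \<le> Suc (card (missing V E P w))" by (rule card_insert_le_m1) simp_all
      finally show ?thesis using CV(3)[OF that(4)] by linarith
    qed
    show "R y x z w" if "R x y w z" for x y w z using that by (auto simp: R_def insert_commute Int_commute)
  qed (use fink finC mu in auto)
  let ?g = "\<lambda>\<psi> x. if x \<in> D then f x else \<psi> x"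
  have inj: "inj_on ?g ?S"
  proof (rule inj_onI)
    fix p q assume p: "p \<in> ?S" and q: "q \<in> ?S" and eq: "?g p = ?g q"
    show "p = q"
    proof (rule PiE_ext[of _ ?I C])
      fix x assume "x \<in> ?I"
      then show "p x = q x" using fun_cong[OF eq, of x] by simp
    qed (use p q in auto)
  qed
  have sub: "?g ` ?S \<subseteq> ?T"
  proof
    fix g assume "g \<in> ?g ` ?S"
    then obtain \<psi> where g: "g = ?g \<psi>" and \<psi>: "\<psi> \<in> ?S" by blast
    have \<psi>C: "\<psi> x \<in> C x" if "x \<in> ?I" for x using \<psi> that by auto
    have \<psi>R: "\<psi> x \<noteq> \<psi> y" "x \<inter> y = {} \<Longrightarrow> {\<psi> x, \<psi> y} \<in> E" if "x \<in> ?I" "y \<in> ?I" "x \<noteq> y" for x y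
      using \<psi> that by (auto simp: R_def)
    have ext: "\<psi> x = undefined" if "x \<notin> ?I" for x using \<psi> that by (auto simp: PiE_def extensional_def)
    have gD: "g x = f x" if "x \<in> D" for x using that g by simp
    have gI: "g x = \<psi> x" if "x \<in> ?I" for x using that g by simp
    have "g \<in> kn t \<rightarrow>\<^sub>E V"
    proof (rule PiE_I)
      fix x assume "x \<in> kn t"
      then show "g x \<in> V" using f(1) gD[of x] gI[of x] CV(1)[OF \<psi>C[of x]] by (cases "x \<in> D") auto
    next
      fix x assume "x \<notin> kn t"
      then show "g x = undefined" using D ext[of x] g by auto
    qed
    moreover have "inj_on g (kn t)"
    proof (rule inj_onI)
      fix x y assume xy: "x \<in> kn t" "y \<in> kn t" "g x = g y"
      have off: "f u \<noteq> \<psi> w" if "u \<in> D" "w \<in> ?I" for u w using CV(4)[OF \<psi>C[OF that(2)]] that(1) by (metis imageI)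
      consider "x \<in> D" "y \<in> D" | "x \<in> D" "y \<in> ?I" | "x \<in> ?I" "y \<in> D" | "x \<in> ?I" "y \<in> ?I" using xy by blast
      then show "x = y"
      proof cases
        case 1 then show ?thesis using xy(3) f(2) gD by (auto dest: inj_onD)
      next
        case 2 then show ?thesis using xy(3) gD gI off[of x y] by simp
      next
        case 3 then show ?thesis using xy(3) gD gI off[of y x] by simp
      next
        case 4 then show ?thesis using xy(3) gI \<psi>R(1)[of x y] by metis
      qed
    qed
    moreover have "{g x, g y} \<in> E" if xy: "x \<in> kn t" "y \<in> kn t" "x \<inter> y = {}" for x y
    proof -
      have ne: "x \<noteq> y" using xy by (auto simp: pairs_def)
      consider "x \<in> D" "y \<in> D" | "x \<in> D" "y \<in> ?I" | "x \<in> ?I" "y \<in> D" | "x \<in> ?I" "y \<in> ?I" using xy by blast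
      then show ?thesis
      proof cases
        case 1 then show ?thesis using fE xy(3) gD by simp
      next
        case 2 then show ?thesis using CV(5)[OF \<psi>C[of y], of x] xy(3) gD gI by (simp add: Int_commute)
      next
        case 3
        then have "{f y, \<psi> x} \<in> E" using CV(5)[OF \<psi>C[of x], of y] xy(3) by simp
        then show ?thesis using 3 gD gI by (simp add: insert_commute)
      next
        case 4 then show ?thesis using xy(3) gI \<psi>R(2)[of x y] ne by simp
      qed
    qed
    ultimately have "g \<in> embeddings (kneser2 t) (V, E)" by (simp add: kneser_embeddings_iff)
    moreover have "\<forall>x\<in>D. g x = f x" using gD by simp
    moreover have "\<forall>x\<in>?I. P (g x) = c x" using gI CV(2)[OF \<psi>C] by simp
    ultimately show "g \<in> ?T" by blast
  qed
  have "finite ?T" using finite_kneser_embeddings[OF V] by simp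
  then have "card ?S \<le> card ?T" using inj sub by (intro card_inj_on_le[of ?g])
  moreover have "card ?I = ?v - card D" using D fink by (simp add: card_Diff_subset finite_subset)
  ultimately show ?thesis using greedy by simp
qed

lemma distinct6:
  assumes "distinct [a,b,d,a',b',d']"
  shows "a \<noteq> b" "a \<noteq> d" "a \<noteq> a'" "a \<noteq> b'" "a \<noteq> d'" "b \<noteq> a" "b \<noteq> d" "b \<noteq> a'" "b \<noteq> b'" "b \<noteq> d'" "d \<noteq> a" "d \<noteq> b" "d \<noteq> a'" "d \<noteq> b'" "d \<noteq> d'" "a' \<noteq> a" "a' \<noteq> b" "a' \<noteq> d" "a' \<noteq> b'" "a' \<noteq> d'" "b' \<noteq> a" "b' \<noteq> b" "b' \<noteq> d" "b' \<noteq> a'" "b' \<noteq> d'" "d' \<noteq> a" "d' \<noteq> b" "d' \<noteq> d" "d' \<noteq> a'" "d' \<noteq> b'"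
  using assms by auto

lemma matched_partner:
  assumes "distinct [a,b,d,a',b',d']" "{z,y} = {a,a'} \<or> {z,y} = {b,b'} \<or> {z,y} = {d,d'}"
  shows "z = a' \<Longrightarrow> y = a" "z = b' \<Longrightarrow> y = b" "z = d' \<Longrightarrow> y = d"
  using assms by (auto simp: doubleton_eq_iff)

text \<open>A common frame for realising the three monochromatic edges: \<open>D\<close> contains
  one end of each and possibly some of the other ends; it is used with 3, 4 and 6 vertices. Class
  \<open>i\<close> contains no further vertices of \<open>K\<close>, so a free vertex there needs
  adjacency only to the image of its partner (\<open>own\<close>), while a free vertex of another
  class may need all images of \<open>D\<close> (\<open>com\<close>). The loss of 6 keeps new images
  off those of \<open>D\<close>.\<close>

lemma three_edge_gadget:
  fixes V :: "'a set" and f :: "nat set \<Rightarrow> 'a" and mu be :: real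
  assumes ks: "three_edge_colouring t i c a b d a' b' d'" and V: "finite V"
    and D: "D \<subseteq> {a,b,d,a',b',d'}" "{a,b,d} \<subseteq> D" and f: "f ` D \<subseteq> V" "inj_on f D"
    and pair: "a' \<in> D \<Longrightarrow> {f a, f a'} \<in> E" "b' \<in> D \<Longrightarrow> {f b, f b'} \<in> E" "d' \<in> D \<Longrightarrow> {f d, f d'} \<in> E"
    and own: "a' \<notin> D \<Longrightarrow> be \<le> card {w \<in> typical V E P mu i. {f a, w} \<in> E}"
      "b' \<notin> D \<Longrightarrow> be \<le> card {w \<in> typical V E P mu i. {f b, w} \<in> E}"
      "d' \<notin> D \<Longrightarrow> be \<le> card {w \<in> typical V E P mu i. {f d, w} \<in> E}"
    and com: "\<And>j. j < t - 3 \<Longrightarrow> j \<noteq> i \<Longrightarrow> be \<le> card {w \<in> typical V E P mu j. \<forall>y\<in>D. {f y, w} \<in> E}"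
    and mu: "0 \<le> mu" "card (kn t) * (mu + 1) \<le> be - 6"
  shows "(be - 6 - card (kn t) * (mu + 1)) ^ (card (kn t) - card D) \<le>
    card {\<phi> \<in> embeddings (kneser2 t) (V, E). (\<forall>x\<in>D. \<phi> x = f x) \<and> (\<forall>x\<in>kn t - D. P (\<phi> x) = c x)}"
proof -
  define S where "S = {a,b,d,a',b',d'}"
  note ksD = three_edge_colouringD[OF ks, folded S_def]
  have kn6: "S \<subseteq> kn t" by (rule ksD(2))
  have cS: "c x = i" if "x \<in> S" for x by (rule ksD(5)[OF that])
  have Sc: "x \<in> S" if "x \<in> kn t" "c x = i" for x by (rule ksD(4)[OF that])
  have dist: "distinct [a,b,d,a',b',d']" by (rule ksD(3))
  have cr: "c x < t - 3" if "x \<in> kn t" for x by (rule ksD(1)[OF that])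
  have mono: "{x,y} = {a,a'} \<or> {x,y} = {b,b'} \<or> {x,y} = {d,d'}"
    if "x \<in> kn t" "y \<in> kn t" "x \<inter> y = {}" "c x = c y" for x y by (rule ksD(6)[OF that])
  have DS: "D \<subseteq> S" using D by (simp add: S_def)
  have DK: "D \<subseteq> kn t" using DS kn6 by blast
  have abd: "a \<in> D" "b \<in> D" "d \<in> D" using D(2) by simp_all
  have finD: "finite D" using D(1) finite_subset by blast
  have cardD: "card D \<le> 6"
    using card_mono[of "set [a,b,d,a',b',d']" D] D(1) card_length[of "[a,b,d,a',b',d']"] by simp
  have cardf: "card (f ` D) \<le> 6" using card_image_le[OF finD, of f] cardD by linarith
  have minus: "be - 6 \<le> card B" if "be \<le> card A" "A - f ` D \<subseteq> B" "finite B" for A B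
  proof -
    have "card A - card (f ` D) \<le> card (A - f ` D)" using finD by (intro diff_card_le_card_Diff) simp
    also have "\<dots> \<le> card B" using that by (intro card_mono)
    finally show ?thesis using that(1) cardf by linarith
  qed
  have matched: "{x,y} = {a,a'} \<or> {x,y} = {b,b'} \<or> {x,y} = {d,d'}" if "x \<in> S" "y \<in> S" "x \<inter> y = {}" for x y
    using cS[OF that(1)] cS[OF that(2)] that kn6 by (intro mono) auto
  have fint: "finite (typical V E P mu j)" for j using V by (simp add: typical_def)
  show ?thesis
  proof (rule partial_embedding_extensions[OF V DK f])
    fix x y assume xy: "x \<in> D" "y \<in> D" "x \<inter> y = {}"
    then have "{x,y} = {a,a'} \<or> {x,y} = {b,b'} \<or> {x,y} = {d,d'}" using DS by (intro matched) auto
    then show "{f x, f y} \<in> E"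
    proof (elim disjE)
      assume h: "{x,y} = {a,a'}"
      then have "a' \<in> D" using xy by (metis insertCI insertE singletonD)
      moreover have "f ` {x,y} = f ` {a,a'}" using h by simp
      ultimately show ?thesis using pair(1) by simp
    next
      assume h: "{x,y} = {b,b'}"
      then have "b' \<in> D" using xy by (metis insertCI insertE singletonD)
      moreover have "f ` {x,y} = f ` {b,b'}" using h by simp
      ultimately show ?thesis using pair(2) by simp
    next
      assume h: "{x,y} = {d,d'}"
      then have "d' \<in> D" using xy by (metis insertCI insertE singletonD)
      moreover have "f ` {x,y} = f ` {d,d'}" using h by simp
      ultimately show ?thesis using pair(3) by simp
    qed
  next
    fix x y assume xy: "x \<in> kn t - D" "y \<in> kn t - D" "x \<inter> y = {}"
    show "c x \<noteq> c y"
    proof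
      assume "c x = c y"
      then have "{x,y} = {a,a'} \<or> {x,y} = {b,b'} \<or> {x,y} = {d,d'}" using xy by (intro mono) auto
      then have "a \<in> {x,y} \<or> b \<in> {x,y} \<or> d \<in> {x,y}" by blast
      then show False using xy(1,2) abd by blast
    qed
  next
    fix x assume x: "x \<in> kn t - D"
    let ?B = "{w \<in> typical V E P mu (c x). w \<notin> f ` D \<and> (\<forall>y\<in>D. x \<inter> y = {} \<longrightarrow> {f y, w} \<in> E)}"
    have finB: "finite ?B" using fint by simp
    show "be - 6 \<le> card ?B"
    proof (cases "c x = i")
      case True
      have xS: "x \<in> S" using Sc[of x] x True by blast
      have main: "be - 6 \<le> card ?B" if h: "be \<le> card {w \<in> typical V E P mu i. {f z, w} \<in> E}"
        and z: "\<And>y. y \<in> D \<Longrightarrow> x \<inter> y = {} \<Longrightarrow> y = z" for z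
      proof (rule minus[OF h _ finB])
        show "{w \<in> typical V E P mu i. {f z, w} \<in> E} - f ` D \<subseteq> ?B"
        proof
          fix w assume w: "w \<in> {w \<in> typical V E P mu i. {f z, w} \<in> E} - f ` D"
          have "\<forall>y\<in>D. x \<inter> y = {} \<longrightarrow> {f y, w} \<in> E"
          proof (intro ballI impI)
            fix y assume "y \<in> D" "x \<inter> y = {}"
            then have "y = z" by (rule z)
            then show "{f y, w} \<in> E" using w by simp
          qed
          then show "w \<in> ?B" using w True by simp
        qed
      qed
      have "x \<noteq> a" "x \<noteq> b" "x \<noteq> d" using x abd by auto
      then have "x = a' \<or> x = b' \<or> x = d'" using xS unfolding S_def by simp
      then show ?thesis
      proof (elim disjE)
        assume xa: "x = a'"
        show ?thesis
        proof (rule main[of a])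
          show "y = a" if y: "y \<in> D" "x \<inter> y = {}" for y
          proof -
            have "y \<in> S" using y(1) DS by (rule rev_subsetD)
            from matched_partner(1)[OF dist matched[OF xS this y(2)] xa] show ?thesis .
          qed
          show "be \<le> card {w \<in> typical V E P mu i. {f a, w} \<in> E}" by (rule own(1)) (use x xa in simp)
        qed
      next
        assume xa: "x = b'"
        show ?thesis
        proof (rule main[of b])
          show "y = b" if y: "y \<in> D" "x \<inter> y = {}" for y
          proof -
            have "y \<in> S" using y(1) DS by (rule rev_subsetD)
            from matched_partner(2)[OF dist matched[OF xS this y(2)] xa] show ?thesis .
          qed
          show "be \<le> card {w \<in> typical V E P mu i. {f b, w} \<in> E}" by (rule own(2)) (use x xa in simp)
        qed
      next
        assume xa: "x = d'"
        show ?thesis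
        proof (rule main[of d])
          show "y = d" if y: "y \<in> D" "x \<inter> y = {}" for y
          proof -
            have "y \<in> S" using y(1) DS by (rule rev_subsetD)
            from matched_partner(3)[OF dist matched[OF xS this y(2)] xa] show ?thesis .
          qed
          show "be \<le> card {w \<in> typical V E P mu i. {f d, w} \<in> E}" by (rule own(3)) (use x xa in simp)
        qed
      qed
    next
      case False
      show ?thesis
      proof (rule minus[OF com[OF cr False] _ finB])
        show "x \<in> kn t" using x by simp
        show "{w \<in> typical V E P mu (c x). \<forall>y\<in>D. {f y, w} \<in> E} - f ` D \<subseteq> ?B" by (intro subsetI) simp
      qed
    qed
  qed (use mu in auto)
qed

text \<open>The three host vertices take one end of each monochromatic edge, and the partners are
  free in class \<open>i\<close>; only three images are fixed.\<close>

lemma three_apex_copies: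
  fixes V :: "'a set" and mu be :: real
  assumes t: "t \<ge> 5" and i: "i < t - 3" and V: "finite V" and abd: "a0 \<in> V" "b0 \<in> V" "d0 \<in> V" "distinct [a0,b0,d0]"
    and own: "\<And>x. x \<in> {a0,b0,d0} \<Longrightarrow> be \<le> card {w \<in> typical V E P mu i. {x, w} \<in> E}"
    and com: "\<And>j. j < t - 3 \<Longrightarrow> j \<noteq> i \<Longrightarrow> be \<le> card {w \<in> typical V E P mu j. \<forall>x\<in>{a0,b0,d0}. {x,w} \<in> E}"
    and mu: "0 \<le> mu" "card (kn t) * (mu + 1) \<le> be - 6"
  shows "(be - 6 - card (kn t) * (mu + 1)) ^ (card (kn t) - 3) \<le> card (embeddings (kneser2 t) (V, E))"
proof -
  obtain c a b d a' b' d' where ks: "three_edge_colouring t i c a b d a' b' d'"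
    using kneser_structure[OF t i] by blast
  have dist: "distinct [a,b,d,a',b',d']" by (rule three_edge_colouringD(3)[OF ks])
  define f where "f = (\<lambda>x. if x = a then a0 else if x = b then b0 else d0)"
  have fv: "f a = a0" "f b = b0" "f d = d0" using distinct6[OF dist] by (simp_all add: f_def)
  have no: "a' \<notin> {a,b,d}" "b' \<notin> {a,b,d}" "d' \<notin> {a,b,d}" using distinct6[OF dist] by simp_all
  have fD: "f ` {a,b,d} = {a0,b0,d0}" using fv by simp
  have "card (f ` {a,b,d}) = card {a,b,d}" unfolding fD using abd(4) distinct6[OF dist] by simp
  then have inj: "inj_on f {a,b,d}" by (intro eq_card_imp_inj_on) auto
  have "(be - 6 - card (kn t) * (mu + 1)) ^ (card (kn t) - card {a,b,d}) \<le>
    card {\<phi> \<in> embeddings (kneser2 t) (V, E). (\<forall>x\<in>{a,b,d}. \<phi> x = f x) \<and> (\<forall>x\<in>kn t - {a,b,d}. P (\<phi> x) = c x)}"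
  proof (rule three_edge_gadget[OF ks V])
    show "{a,b,d} \<subseteq> {a,b,d,a',b',d'}" by blast
    show "f ` {a,b,d} \<subseteq> V" unfolding fD using abd by simp
    show "be \<le> card {w \<in> typical V E P mu j. \<forall>y\<in>{a,b,d}. {f y,w} \<in> E}" if "j < t - 3" "j \<noteq> i" for j
      using com[OF that] by (simp add: fv)
    show "be \<le> card {w \<in> typical V E P mu i. {f a, w} \<in> E}" "be \<le> card {w \<in> typical V E P mu i. {f b, w} \<in> E}"
      "be \<le> card {w \<in> typical V E P mu i. {f d, w} \<in> E}" unfolding fv using own by simp_all
  qed (use inj no mu in auto)
  also have "\<dots> \<le> real (card (embeddings (kneser2 t) (V, E)))"
    using finite_kneser_embeddings[OF V] by (intro of_nat_mono card_mono) auto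
  also have "card {a,b,d} = 3" using distinct6[OF dist] by simp
  finally show ?thesis .
qed

text \<open>The third monochromatic edge is placed on the given edge, so four images are fixed. The
  extra conditions record that this edge is the only pair inside a class used away from
  \<open>a0\<close> and \<open>b0\<close>; they make the copies found for different inner edges
  distinct.\<close>

lemma two_apex_copies:
  fixes V :: "'a set" and mu be :: real
  assumes t: "t \<ge> 5" and i: "i < t - 3" and V: "finite V" and ax: "a0 \<in> V" "b0 \<in> V" "x0 \<in> V" "y0 \<in> V" "distinct [a0,b0,x0,y0]"
    and xy: "{x0,y0} \<in> E" "P x0 = i" "P y0 = i"
    and own: "\<And>x. x \<in> {a0,b0} \<Longrightarrow> be \<le> card {w \<in> typical V E P mu i. {x, w} \<in> E}"
    and com: "\<And>j. j < t - 3 \<Longrightarrow> j \<noteq> i \<Longrightarrow> be \<le> card {w \<in> typical V E P mu j. \<forall>x\<in>{a0,b0,x0,y0}. {x,w} \<in> E}"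
    and mu: "0 \<le> mu" "card (kn t) * (mu + 1) \<le> be - 6"
  shows "(be - 6 - card (kn t) * (mu + 1)) ^ (card (kn t) - 4) \<le> card {\<phi> \<in> embeddings (kneser2 t) (V, E).
    (\<exists>p\<in>kn t. \<exists>q\<in>kn t. p \<inter> q = {} \<and> {\<phi> p, \<phi> q} = {x0,y0}) \<and>
    (\<forall>p\<in>kn t. \<forall>q\<in>kn t. p \<inter> q = {} \<longrightarrow> P (\<phi> p) = P (\<phi> q) \<longrightarrow> {\<phi> p, \<phi> q} = {x0,y0} \<or> \<phi> p \<in> {a0,b0} \<or> \<phi> q \<in> {a0,b0})}"
    (is "_ \<le> real (card ?T)")
proof -
  obtain c a b d a' b' d' where ks: "three_edge_colouring t i c a b d a' b' d'"
    using kneser_structure[OF t i] by blast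
  define D where "D = {a,b,d,d'}"
  note ksD = three_edge_colouringD[OF ks]
  have dist: "distinct [a,b,d,a',b',d']" by (rule ksD(3))
  have dd: "d \<inter> d' = {}" by (rule ksD(7))
  have kn6: "d \<in> kn t" "d' \<in> kn t" using ksD(2) by simp_all
  have ci: "c d = i" "c d' = i" by (rule ksD(5); simp)+
  have mono: "{x,y} = {a,a'} \<or> {x,y} = {b,b'} \<or> {x,y} = {d,d'}"
    if "x \<in> kn t" "y \<in> kn t" "x \<inter> y = {}" "c x = c y" for x y by (rule ksD(6)[OF that])
  define f where "f = (\<lambda>x. if x = a then a0 else if x = b then b0 else if x = d then x0 else y0)"
  have fv: "f a = a0" "f b = b0" "f d = x0" "f d' = y0" using distinct6[OF dist] by (simp_all add: f_def)
  have no: "a' \<notin> D" "b' \<notin> D" using distinct6[OF dist] by (simp_all add: D_def)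
  have fD: "f ` D = {a0,b0,x0,y0}" using fv by (simp add: D_def)
  have cD: "card D = 4" using distinct6[OF dist] by (simp add: D_def)
  have "card (f ` D) = card D" unfolding fD cD using ax(5) by simp
  then have inj: "inj_on f D" by (intro eq_card_imp_inj_on) (auto simp: D_def)
  let ?S = "{\<phi> \<in> embeddings (kneser2 t) (V, E). (\<forall>x\<in>D. \<phi> x = f x) \<and> (\<forall>x\<in>kn t - D. P (\<phi> x) = c x)}"
  have "(be - 6 - card (kn t) * (mu + 1)) ^ (card (kn t) - card D) \<le> card ?S"
  proof (rule three_edge_gadget[OF ks V])
    show "D \<subseteq> {a,b,d,a',b',d'}" "{a,b,d} \<subseteq> D" unfolding D_def by blast+
    show "f ` D \<subseteq> V" unfolding fD using ax by simp
    show "be \<le> card {w \<in> typical V E P mu j. \<forall>y\<in>D. {f y,w} \<in> E}" if "j < t - 3" "j \<noteq> i" for j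
      using com[OF that] by (simp add: fv D_def)
    show "be \<le> card {w \<in> typical V E P mu i. {f a, w} \<in> E}" "be \<le> card {w \<in> typical V E P mu i. {f b, w} \<in> E}"
      unfolding fv using own by simp_all
    show "{f d, f d'} \<in> E" unfolding fv by (rule xy(1))
    show "be \<le> card {w \<in> typical V E P mu i. {f d, w} \<in> E}" if "d' \<notin> D" using that by (simp add: D_def)
  qed (use inj no mu in auto)
  also have "card ?S \<le> card ?T"
  proof (rule card_mono)
    show "finite ?T" using finite_kneser_embeddings[OF V] by simp
    show "?S \<subseteq> ?T"
    proof
      fix \<phi> assume \<phi>: "\<phi> \<in> ?S"
      then have emb: "\<phi> \<in> embeddings (kneser2 t) (V, E)" and \<phi>D: "\<And>x. x \<in> D \<Longrightarrow> \<phi> x = f x"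
        and \<phi>c: "\<And>x. x \<in> kn t - D \<Longrightarrow> P (\<phi> x) = c x" by blast+
      have \<phi>v: "\<phi> a = a0" "\<phi> b = b0" "\<phi> d = x0" "\<phi> d' = y0" using \<phi>D fv by (simp_all add: D_def)
      \<comment> \<open>\<open>d\<close> and \<open>d'\<close> have colour \<open>i\<close>, which
        is also the class of \<open>x0\<close> and \<open>y0\<close>; so colours and classes agree
        everywhere except possibly at the two apex vertices.\<close>
      have Pc: "P (\<phi> p) = c p" if "p \<in> kn t" "p \<noteq> a" "p \<noteq> b" for p
        using \<phi>c[of p] that \<phi>v xy ci by (cases "p = d"; cases "p = d'") (auto simp: D_def)
      have "\<exists>p\<in>kn t. \<exists>q\<in>kn t. p \<inter> q = {} \<and> {\<phi> p, \<phi> q} = {x0,y0}"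
        using kn6 dd \<phi>v by (intro bexI[of _ d] bexI[of _ d']) auto
      moreover have "{\<phi> p, \<phi> q} = {x0,y0} \<or> \<phi> p \<in> {a0,b0} \<or> \<phi> q \<in> {a0,b0}"
        if pq: "p \<in> kn t" "q \<in> kn t" "p \<inter> q = {}" "P (\<phi> p) = P (\<phi> q)" for p q
      proof (cases "p = a \<or> p = b \<or> q = a \<or> q = b")
        case True
        then show ?thesis using \<phi>v by auto
      next
        case False
        then have "c p = c q" using Pc[of p] Pc[of q] pq by simp
        then have "{p,q} = {a,a'} \<or> {p,q} = {b,b'} \<or> {p,q} = {d,d'}" using pq by (intro mono)
        then have "{p,q} = {d,d'}" using False by blast
        then have "\<phi> ` {p,q} = \<phi> ` {d,d'}" by simp
        then show ?thesis using \<phi>v by simp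
      qed
      ultimately show "\<phi> \<in> ?T" using emb by blast
    qed
  qed
  finally show ?thesis unfolding cD by simp
qed

text \<open>All six ends are prescribed. The greedy count on three indices chooses disjoint members
  of \<open>B\<close>: an earlier edge excludes at most \<open>2 * s\<close> others through its two
  ends, which leaves \<open>card B - 4 * s\<close>. Different triples prescribe different maps on
  \<open>D\<close>, so the families of extensions are disjoint.\<close>

lemma three_edges_copies:
  fixes V :: "'a set" and mu u ka s :: real
  assumes t: "t \<ge> 5" and i: "i < t - 3" and V: "finite V"
    and B: "B \<subseteq> V \<times> V" "\<And>x y. (x,y) \<in> B \<Longrightarrow> x \<noteq> y \<and> {x,y} \<in> E"
    and ka: "\<And>x y z j. (x,y) \<in> B \<Longrightarrow> z \<in> {x,y} \<Longrightarrow> j < t - 3 \<Longrightarrow> j \<noteq> i \<Longrightarrow> card {w \<in> typical V E P mu j. {z,w} \<notin> E} \<le> ka"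
    and u: "\<And>j. j < t - 3 \<Longrightarrow> u \<le> card (typical V E P mu j)"
    and s: "\<And>z. card {p \<in> B. z = fst p \<or> z = snd p} \<le> s"
    and s4: "4 * s \<le> card B"
    and mu: "0 \<le> mu" "card (kn t) * (mu + 1) \<le> u - 6 * ka - 6"
  shows "(card B - 4 * s) ^ 3 * (u - 6 * ka - 6 - card (kn t) * (mu + 1)) ^ (card (kn t) - 6) \<le> card (embeddings (kneser2 t) (V, E))"
proof -
  obtain c a b d a' b' d' where ks: "three_edge_colouring t i c a b d a' b' d'"
    using kneser_structure[OF t i] by blast
  define D where "D = {a,b,d,a',b',d'}"
  have dist: "distinct [a,b,d,a',b',d']" by (rule three_edge_colouringD(3)[OF ks])
  have cD: "card D = 6" using distinct6[OF dist] by (simp add: D_def)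
  have finB: "finite B" using B(1) V finite_subset by blast
  define R where "R p q \<longleftrightarrow> {fst p, snd p} \<inter> {fst q, snd q} = {}" for p q :: "'a \<times> 'a"
  let ?TT = "{\<tau> \<in> {0,1,2::nat} \<rightarrow>\<^sub>E B. \<forall>x\<in>{0,1,2}. \<forall>y\<in>{0,1,2}. x \<noteq> y \<longrightarrow> R (\<tau> x) (\<tau> y)}"
  have s0: "0 \<le> s" using s[of undefined] by (rule order_trans[rotated]) simp
  have "(real (card B) - real 2 * (2 * s)) ^ card {0,1,2::nat} \<le> card ?TT"
  proof (rule greedy_count[where R = "\<lambda>_ _. R"])
    show "real (card {q \<in> B. \<not> R p q}) \<le> 2 * s" for p
    proof -
      have "{q \<in> B. \<not> R p q} \<subseteq> {q \<in> B. fst p = fst q \<or> fst p = snd q} \<union> {q \<in> B. snd p = fst q \<or> snd p = snd q}"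
        unfolding R_def by auto
      then have "card {q \<in> B. \<not> R p q} \<le> card ({q \<in> B. fst p = fst q \<or> fst p = snd q} \<union> {q \<in> B. snd p = fst q \<or> snd p = snd q})"
        using finB by (intro card_mono) auto
      also have "\<dots> \<le> card {q \<in> B. fst p = fst q \<or> fst p = snd q} + card {q \<in> B. snd p = fst q \<or> snd p = snd q}"
        by (rule card_Un_le)
      finally show ?thesis using s[of "fst p"] s[of "snd p"] by linarith
    qed
    show "R q p" if "R p q" for p q using that by (auto simp: R_def)
  qed (use finB s0 s4 in auto)
  moreover have "card {0,1,2::nat} = 3" "real 2 * (2 * s) = 4 * s" by simp_all
  ultimately have TT: "(real (card B) - 4 * s) ^ 3 \<le> card ?TT" by (simp only:)
  define f where "f \<tau> = (\<lambda>x. if x = a then fst (\<tau> 0) else if x = a' then snd (\<tau> 0) else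
     if x = b then fst (\<tau> 1) else if x = b' then snd (\<tau> 1) else if x = d then fst (\<tau> 2) else snd (\<tau> 2))"
    for \<tau> :: "nat \<Rightarrow> 'a \<times> 'a"
  have fv: "f \<tau> a = fst (\<tau> 0)" "f \<tau> a' = snd (\<tau> 0)" "f \<tau> b = fst (\<tau> 1)" "f \<tau> b' = snd (\<tau> 1)" "f \<tau> d = fst (\<tau> 2)" "f \<tau> d' = snd (\<tau> 2)"
    for \<tau> using distinct6[OF dist] by (simp_all add: f_def)
  let ?A = "\<lambda>\<tau>. {\<phi> \<in> embeddings (kneser2 t) (V, E). (\<forall>x\<in>D. \<phi> x = f \<tau> x)}"
  let ?X = "(u - 6 * ka - 6 - card (kn t) * (mu + 1)) ^ (card (kn t) - 6)"
  have finA: "finite (?A \<tau>)" for \<tau> using finite_kneser_embeddings[OF V] by simp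
  have X: "?X \<le> card (?A \<tau>)" if \<tau>: "\<tau> \<in> ?TT" for \<tau>
  proof -
    have \<tau>B: "\<tau> 0 \<in> B" "\<tau> 1 \<in> B" "\<tau> 2 \<in> B" using \<tau> by auto
    have \<tau>R: "R (\<tau> 0) (\<tau> 1)" "R (\<tau> 0) (\<tau> 2)" "R (\<tau> 1) (\<tau> 2)" "R (\<tau> 1) (\<tau> 0)" "R (\<tau> 2) (\<tau> 0)" "R (\<tau> 2) (\<tau> 1)"
      using \<tau> by auto
    have \<tau>E: "fst (\<tau> k) \<noteq> snd (\<tau> k)" "{fst (\<tau> k), snd (\<tau> k)} \<in> E" if "\<tau> k \<in> B" for k
      using B(2)[of "fst (\<tau> k)" "snd (\<tau> k)"] that by auto
    have fD: "f \<tau> ` D = {fst (\<tau> 0), snd (\<tau> 0), fst (\<tau> 1), snd (\<tau> 1), fst (\<tau> 2), snd (\<tau> 2)}"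
      unfolding D_def by (simp add: fv insert_commute)
    have "distinct [fst (\<tau> 0), snd (\<tau> 0), fst (\<tau> 1), snd (\<tau> 1), fst (\<tau> 2), snd (\<tau> 2)]"
      using \<tau>R \<tau>E(1)[OF \<tau>B(1)] \<tau>E(1)[OF \<tau>B(2)] \<tau>E(1)[OF \<tau>B(3)] unfolding R_def by auto
    then have "card (f \<tau> ` D) = card D" unfolding fD cD using distinct_card by fastforce
    then have inj: "inj_on (f \<tau>) D" by (intro eq_card_imp_inj_on) (auto simp: D_def)
    let ?S = "{\<phi> \<in> embeddings (kneser2 t) (V, E). (\<forall>x\<in>D. \<phi> x = f \<tau> x) \<and> (\<forall>x\<in>kn t - D. P (\<phi> x) = c x)}"
    have "((u - 6 * ka) - 6 - card (kn t) * (mu + 1)) ^ (card (kn t) - card D) \<le> card ?S"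
    proof (rule three_edge_gadget[OF ks V])
      show "D \<subseteq> {a,b,d,a',b',d'}" "{a,b,d} \<subseteq> D" unfolding D_def by blast+
      have "{fst (\<tau> k), snd (\<tau> k)} \<subseteq> V" if "\<tau> k \<in> B" for k using B(1) that by (cases "\<tau> k") auto
      then show "f \<tau> ` D \<subseteq> V" unfolding fD using \<tau>B by simp
      show "{f \<tau> a, f \<tau> a'} \<in> E" "{f \<tau> b, f \<tau> b'} \<in> E" "{f \<tau> d, f \<tau> d'} \<in> E" unfolding fv using \<tau>E(2) \<tau>B by simp_all
      show "u - 6 * ka \<le> card {w \<in> typical V E P mu j. \<forall>y\<in>D. {f \<tau> y, w} \<in> E}" if j: "j < t - 3" "j \<noteq> i" for j
      proof -
        let ?T = "typical V E P mu j"
        have finT: "finite ?T" using V by (simp add: typical_def)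
        have bad: "real (card {w \<in> ?T. {f \<tau> y, w} \<notin> E}) \<le> ka" if y: "y \<in> D" for y
        proof -
          have "\<exists>k. \<tau> k \<in> B \<and> f \<tau> y \<in> {fst (\<tau> k), snd (\<tau> k)}"
          proof -
            have "f \<tau> y \<in> f \<tau> ` D" using y by blast
            then show ?thesis unfolding fD using \<tau>B by blast
          qed
          then obtain k where k: "\<tau> k \<in> B" "f \<tau> y \<in> {fst (\<tau> k), snd (\<tau> k)}" by blast
          then show ?thesis by (intro ka[OF _ _ j, of "fst (\<tau> k)" "snd (\<tau> k)"]) auto
        qed
        have "?T - {w \<in> ?T. \<forall>y\<in>D. {f \<tau> y, w} \<in> E} \<subseteq> (\<Union>y\<in>D. {w \<in> ?T. {f \<tau> y, w} \<notin> E})" by blast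
        then have "card (?T - {w \<in> ?T. \<forall>y\<in>D. {f \<tau> y, w} \<in> E}) \<le> card (\<Union>y\<in>D. {w \<in> ?T. {f \<tau> y, w} \<notin> E})"
          using finT by (intro card_mono) (auto simp: D_def)
        also have "\<dots> \<le> (\<Sum>y\<in>D. card {w \<in> ?T. {f \<tau> y, w} \<notin> E})" by (rule card_UN_le) (simp add: D_def)
        finally have "real (card (?T - {w \<in> ?T. \<forall>y\<in>D. {f \<tau> y, w} \<in> E})) \<le> (\<Sum>y\<in>D. real (card {w \<in> ?T. {f \<tau> y, w} \<notin> E}))"
          by (simp flip: of_nat_sum)
        also have "\<dots> \<le> (\<Sum>y\<in>D. ka)" by (rule sum_mono) (rule bad)
        also have "\<dots> = 6 * ka" by (simp add: cD)
        finally have "real (card (?T - {w \<in> ?T. \<forall>y\<in>D. {f \<tau> y, w} \<in> E})) \<le> 6 * ka" .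
        moreover have "card (?T - {w \<in> ?T. \<forall>y\<in>D. {f \<tau> y, w} \<in> E}) = card ?T - card {w \<in> ?T. \<forall>y\<in>D. {f \<tau> y, w} \<in> E}"
          using finT by (intro card_Diff_subset) auto
        ultimately show ?thesis using u[OF j(1)] by linarith
      qed
    qed (use inj mu in \<open>auto simp: D_def\<close>)
    also have "card ?S \<le> card (?A \<tau>)" by (rule card_mono[OF finA]) blast
    finally show ?thesis unfolding cD by simp
  qed
  have finTT: "finite ?TT" using finB by (intro finite_subset[of ?TT "{0,1,2::nat} \<rightarrow>\<^sub>E B"] finite_PiE) auto
  have disj: "?A \<tau> \<inter> ?A \<sigma> = {}" if "\<tau> \<in> ?TT" "\<sigma> \<in> ?TT" "\<tau> \<noteq> \<sigma>" for \<tau> \<sigma>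
  proof (rule ccontr)
    assume "?A \<tau> \<inter> ?A \<sigma> \<noteq> {}"
    then obtain \<phi> where "\<And>x. x \<in> D \<Longrightarrow> f \<tau> x = f \<sigma> x" by force
    then have "f \<tau> a = f \<sigma> a" "f \<tau> a' = f \<sigma> a'" "f \<tau> b = f \<sigma> b" "f \<tau> b' = f \<sigma> b'" "f \<tau> d = f \<sigma> d" "f \<tau> d' = f \<sigma> d'"
      by (simp_all add: D_def)
    then have "\<tau> 0 = \<sigma> 0" "\<tau> 1 = \<sigma> 1" "\<tau> 2 = \<sigma> 2" unfolding fv by (simp_all add: prod_eq_iff)
    then have "\<tau> = \<sigma>" using that by (intro PiE_ext[of \<tau> "{0,1,2}" "\<lambda>_. B" \<sigma>]) auto
    then show False using that(3) by simp
  qed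
  have X0: "0 \<le> ?X" using mu(2) by simp
  have "(real (card B) - 4 * s) ^ 3 * ?X \<le> card ?TT * ?X" using TT X0 by (intro mult_right_mono)
  also have "\<dots> = (\<Sum>\<tau>\<in>?TT. ?X)" by simp
  also have "\<dots> \<le> (\<Sum>\<tau>\<in>?TT. real (card (?A \<tau>)))" by (intro sum_mono X)
  also have "\<dots> = real (card (\<Union>\<tau>\<in>?TT. ?A \<tau>))"
    using finTT finA disj by (subst card_UN_disjoint) auto
  also have "\<dots> \<le> real (card (embeddings (kneser2 t) (V, E)))"
    using finite_kneser_embeddings[OF V] by (intro of_nat_mono card_mono) auto
  finally show ?thesis .
qed

section \<open>Almost balanced partitions\<close>

lemma inside_pairs_remove:
  assumes V: "finite V" and x: "x \<in> V" and loop: "{x} \<notin> E"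
  shows "card {p \<in> opairs V E. P (fst p) = P (snd p)} =
    card {p \<in> opairs (V - {x}) E. P (fst p) = P (snd p)} + 2 * card (inside V E P x)"
proof -
  let ?A = "{p \<in> opairs (V - {x}) E. P (fst p) = P (snd p)}"
  let ?B = "Pair x ` inside V E P x" and ?C = "(\<lambda>y. (y,x)) ` inside V E P x"
  have fin: "finite (inside V E P x)" using V by (simp add: inside_def)
  have eq: "{p \<in> opairs V E. P (fst p) = P (snd p)} = ?A \<union> (?B \<union> ?C)"
  proof (rule set_eqI)
    fix p :: "'a \<times> 'a"
    obtain u w where p: "p = (u,w)" by (cases p)
    show "p \<in> {p \<in> opairs V E. P (fst p) = P (snd p)} \<longleftrightarrow> p \<in> ?A \<union> (?B \<union> ?C)"
      unfolding p opairs_def inside_def using x loop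
      by (cases "u = x"; cases "w = x") (auto simp: insert_commute)
  qed
  have xx: "x \<notin> inside V E P x" using loop by (simp add: inside_def)
  have d1: "?A \<inter> (?B \<union> ?C) = {}" by (auto simp: opairs_def)
  have d2: "?B \<inter> ?C = {}" using xx by auto
  have "card (?A \<union> (?B \<union> ?C)) = card ?A + (card ?B + card ?C)"
    using d1 d2 fin V by (subst card_Un_disjoint, simp, simp, simp, subst card_Un_disjoint) simp_all
  moreover have "card ?B = card (inside V E P x)" by (intro card_image) (auto simp: inj_on_def)
  moreover have "card ?C = card (inside V E P x)" by (intro card_image) (auto simp: inj_on_def)
  ultimately show ?thesis unfolding eq by simp
qed

text \<open>\<open>P\<close> minimises the pairs inside classes. Moving \<open>x\<close> to class
  \<open>j\<close> changes their number by twice the difference of the degrees of \<open>x\<close>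
  into the two classes, so minimality is the degree inequality.\<close>

lemma max_cut:
  fixes V :: "'a set"
  assumes V: "finite V" and loop: "\<And>x. {x} \<notin> E" and P0: "\<And>x. x \<in> V \<Longrightarrow> P0 x < r"
  obtains P where "\<And>x. x \<in> V \<Longrightarrow> P x < r"
    "card {p \<in> opairs V E. P (fst p) = P (snd p)} \<le> card {p \<in> opairs V E. P0 (fst p) = P0 (snd p)}"
    "\<And>x j. x \<in> V \<Longrightarrow> j < r \<Longrightarrow> card (inside V E P x) \<le> card {y \<in> V. P y = j \<and> {x,y} \<in> E}"
proof -
  let ?c = "\<lambda>P :: 'a \<Rightarrow> nat. card {p \<in> opairs V E. P (fst p) = P (snd p)}"
  define P where "P = arg_min ?c (\<lambda>P. \<forall>x\<in>V. P x < r)"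
  have Pr: "\<forall>x\<in>V. P x < r" unfolding P_def by (rule arg_min_natI[of "\<lambda>P. \<forall>x\<in>V. P x < r" P0]) (simp add: P0)
  have min: "?c P \<le> ?c Q" if "\<forall>x\<in>V. Q x < r" for Q
    unfolding P_def by (rule arg_min_nat_le[of "\<lambda>P. \<forall>x\<in>V. P x < r" Q ?c]) (rule that)
  have loc: "card (inside V E P x) \<le> card {y \<in> V. P y = j \<and> {x,y} \<in> E}" if x: "x \<in> V" and j: "j < r" for x j
  proof -
    let ?Q = "P(x := j)"
    have "?c P \<le> ?c ?Q" using Pr j by (intro min) auto
    moreover have "{p \<in> opairs (V - {x}) E. ?Q (fst p) = ?Q (snd p)} = {p \<in> opairs (V - {x}) E. P (fst p) = P (snd p)}"
      by (auto simp: opairs_def)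
    moreover have "inside V E ?Q x = {y \<in> V. P y = j \<and> {x,y} \<in> E}"
    proof (rule set_eqI)
      fix y show "y \<in> inside V E ?Q x \<longleftrightarrow> y \<in> {y \<in> V. P y = j \<and> {x,y} \<in> E}"
        using loop by (cases "y = x") (simp_all add: inside_def)
    qed
    ultimately show ?thesis
      using inside_pairs_remove[OF V x loop, of P] inside_pairs_remove[OF V x loop, of ?Q] by simp
  qed
  show ?thesis
  proof (rule that[of P])
    show "P x < r" if "x \<in> V" for x using Pr that by blast
    show "?c P \<le> ?c P0" using P0 by (intro min) simp
  qed (rule loc)
qed

text \<open>The quadratic defect of a partition: how far the class sizes are from equal, plus the number
  of missing cross pairs, is paid for by the pairs inside classes.\<close>

lemma cut_defect:
  fixes V :: "'a set" and r :: nat and P :: "'a \<Rightarrow> nat"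
  assumes V: "finite V" and P: "\<And>x. x \<in> V \<Longrightarrow> P x < r" and r: "r \<ge> 1"
  defines "n \<equiv> real (card V)"
  shows "(\<Sum>j<r. (real (card {x \<in> V. P x = j}) - n / r)^2) + (\<Sum>x\<in>V. real (card (missing V E P x))) =
    (1 - 1 / r) * n^2 - card (opairs V E) + card {p \<in> opairs V E. P (fst p) = P (snd p)}"
proof -
  let ?s = "\<lambda>j. real (card {x \<in> V. P x = j})"
  have sizes: "(\<Sum>j<r. ?s j) = n"
  proof -
    have "card V = card (\<Union>j<r. {x \<in> V. P x = j})" by (rule arg_cong[of _ _ card]) (use P in auto)
    also have "\<dots> = (\<Sum>j<r. card {x \<in> V. P x = j})" using V by (subst card_UN_disjoint) auto
    finally show ?thesis unfolding n_def by simp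
  qed
  have sq: "(\<Sum>j<r. (?s j)^2) = card {p \<in> V \<times> V. P (fst p) = P (snd p)}"
  proof -
    have "card {p \<in> V \<times> V. P (fst p) = P (snd p)} = card (\<Union>j<r. {x \<in> V. P x = j} \<times> {x \<in> V. P x = j})"
      by (rule arg_cong[of _ _ card]) (use P in auto)
    also have "\<dots> = (\<Sum>j<r. card ({x \<in> V. P x = j} \<times> {x \<in> V. P x = j}))"
      using V by (subst card_UN_disjoint) auto
    finally show ?thesis by (simp add: card_cartesian_product power2_eq_square)
  qed
  have miss: "(\<Sum>x\<in>V. card (missing V E P x)) = card {p \<in> V \<times> V. P (fst p) \<noteq> P (snd p) \<and> {fst p, snd p} \<notin> E}"
  proof -
    have "(\<Sum>x\<in>V. card (missing V E P x)) = card (Sigma V (missing V E P))"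
      using V by (subst card_SigmaI) (auto simp: missing_def)
    also have "Sigma V (missing V E P) = {p \<in> V \<times> V. P (fst p) \<noteq> P (snd p) \<and> {fst p, snd p} \<notin> E}"
      by (auto simp: missing_def)
    finally show ?thesis .
  qed
  have "(card V)^2 = card (V \<times> V)" by (simp add: card_cartesian_product power2_eq_square)
  also have "V \<times> V = {p \<in> V \<times> V. P (fst p) = P (snd p)} \<union> ({p \<in> V \<times> V. P (fst p) \<noteq> P (snd p) \<and> {fst p, snd p} \<notin> E} \<union>
     {p \<in> opairs V E. P (fst p) \<noteq> P (snd p)})"
    by (auto simp: opairs_def)
  also have "card \<dots> = card {p \<in> V \<times> V. P (fst p) = P (snd p)} + (card {p \<in> V \<times> V. P (fst p) \<noteq> P (snd p) \<and> {fst p, snd p} \<notin> E} +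
     card {p \<in> opairs V E. P (fst p) \<noteq> P (snd p)})"
    using V by (subst card_Un_disjoint, simp, simp, force simp: opairs_def, subst card_Un_disjoint) (auto simp: opairs_def)
  finally have total: "(card V)^2 = card {p \<in> V \<times> V. P (fst p) = P (snd p)} + ((\<Sum>x\<in>V. card (missing V E P x)) +
     card {p \<in> opairs V E. P (fst p) \<noteq> P (snd p)})" unfolding miss .
  have "card (opairs V E) = card ({p \<in> opairs V E. P (fst p) = P (snd p)} \<union> {p \<in> opairs V E. P (fst p) \<noteq> P (snd p)})"
    by (rule arg_cong[of _ _ card]) auto
  also have "\<dots> = card {p \<in> opairs V E. P (fst p) = P (snd p)} + card {p \<in> opairs V E. P (fst p) \<noteq> P (snd p)}"
    using V by (subst card_Un_disjoint) auto
  finally have op: "card (opairs V E) = card {p \<in> opairs V E. P (fst p) = P (snd p)} + card {p \<in> opairs V E. P (fst p) \<noteq> P (snd p)}" .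
  have tot: "n^2 = (\<Sum>j<r. (?s j)^2) + (\<Sum>x\<in>V. real (card (missing V E P x))) +
     (real (card (opairs V E)) - card {p \<in> opairs V E. P (fst p) = P (snd p)})"
  proof -
    have "n^2 = real ((card V)^2)" by (simp add: n_def)
    then show ?thesis unfolding total sq using op by simp
  qed
  have "(\<Sum>j<r. (?s j - n / r)^2) = (\<Sum>j<r. (?s j)^2 - 2 * (n / r) * ?s j + (n / r)^2)"
    by (intro sum.cong refl) (simp add: power2_eq_square algebra_simps)
  also have "\<dots> = (\<Sum>j<r. (?s j)^2) - 2 * (n / r) * (\<Sum>j<r. ?s j) + r * (n / r)^2"
    by (simp add: sum.distrib sum_subtractf sum_distrib_left)
  also have "\<dots> = (\<Sum>j<r. (?s j)^2) - n^2 / r" unfolding sizes using r by (simp add: power2_eq_square field_simps)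
  finally have q: "(\<Sum>j<r. (?s j - n / r)^2) = (\<Sum>j<r. (?s j)^2) - n^2 / r" .
  have "(1 - 1 / real r) * n^2 = n^2 - n^2 / r" by (simp add: left_diff_distrib)
  then show ?thesis using tot q by linarith
qed

text \<open>The defect is at most \<open>z^2 * card V ^ 2\<close>. One square in it controls a class
  size; Markov's inequality for the missing pairs, with \<open>z^2 \<le> mu * z\<close>, controls
  the atypical vertices; the third claim combines the two.\<close>

lemma near_balanced_partition:
  fixes V :: "'a set" and z mu :: real and r :: nat and P :: "'a \<Rightarrow> nat"
  assumes V: "finite V" and P: "\<And>x. x \<in> V \<Longrightarrow> P x < r" and r: "r \<ge> 1"
    and ed: "(1 - 1 / r) * real (card V)^2 \<le> card (opairs V E)"
    and ins: "card {p \<in> opairs V E. P (fst p) = P (snd p)} \<le> z^2 * real (card V)^2"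
    and z: "0 < z" and mu: "0 < mu" "z^2 \<le> mu * z" and n: "card V > 0" and j: "j < r"
  shows "\<bar>real (card {x \<in> V. P x = j}) - card V / r\<bar> \<le> z * card V"
    and "card {x \<in> V. \<not> real (card (missing V E P x)) \<le> mu * card V} \<le> z * card V"
    and "card V / r - 2 * z * card V \<le> card (typical V E P (mu * card V) j)"
proof -
  let ?n = "real (card V)"
  let ?s = "\<lambda>j. real (card {x \<in> V. P x = j})"
  have defect: "(\<Sum>j<r. (?s j - ?n / r)^2) + (\<Sum>x\<in>V. real (card (missing V E P x))) \<le> z^2 * ?n^2"
    using cut_defect[OF V P r, where E = E] ed ins by simp
  have sq0: "0 \<le> (\<Sum>j<r. (?s j - ?n / r)^2)" by (simp add: sum_nonneg)
  have ms0: "0 \<le> (\<Sum>x\<in>V. real (card (missing V E P x)))" by (simp add: sum_nonneg)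
  have "(?s j - ?n / r)^2 \<le> (\<Sum>j<r. (?s j - ?n / r)^2)" using j by (intro member_le_sum) auto
  then have "(?s j - ?n / r)^2 \<le> (z * ?n)^2" using defect ms0 by (simp add: power_mult_distrib)
  then show size: "\<bar>?s j - ?n / r\<bar> \<le> z * ?n" using z by (metis abs_le_square_iff abs_of_nonneg mult_nonneg_nonneg less_imp_le of_nat_0_le_iff)
  let ?A = "{x \<in> V. \<not> real (card (missing V E P x)) \<le> mu * card V}"
  have "card ?A * (mu * ?n) = (\<Sum>x\<in>?A. mu * ?n)" by simp
  also have "\<dots> \<le> (\<Sum>x\<in>?A. real (card (missing V E P x)))" by (intro sum_mono) auto
  also have "\<dots> \<le> (\<Sum>x\<in>V. real (card (missing V E P x)))" using V by (intro sum_mono2) auto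
  also have "\<dots> \<le> z^2 * ?n^2" using defect sq0 by linarith
  also have "\<dots> \<le> (mu * z) * ?n^2" using mu by (intro mult_right_mono) auto
  finally have "card ?A * (mu * ?n) \<le> (z * ?n) * (mu * ?n)" by (simp add: power2_eq_square mult_ac)
  then show aty: "card ?A \<le> z * ?n" using mu n by (simp add: mult_le_cancel_right)
  have "{x \<in> V. P x = j} - ?A \<subseteq> typical V E P (mu * ?n) j" by (auto simp: typical_def)
  then have "card ({x \<in> V. P x = j} - ?A) \<le> card (typical V E P (mu * ?n) j)"
    using V by (intro card_mono) (auto simp: typical_def)
  moreover have "card {x \<in> V. P x = j} - card ?A \<le> card ({x \<in> V. P x = j} - ?A)" using V by (intro diff_card_le_card_Diff) simp
  ultimately show "?n / r - 2 * z * ?n \<le> card (typical V E P (mu * ?n) j)" using size aty by linarith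
qed

section \<open>Graphs close to the extremal one\<close>

lemma card_filter_sum: "finite A \<Longrightarrow> card {a \<in> A. Q a} = (\<Sum>a\<in>A. if Q a then 1 else 0)"
  by (simp add: sum.If_cases Int_def)

text \<open>The constants are chosen in the order \<open>ep\<close> (degree threshold for high
  vertices), \<open>l0\<close> (a bound on their number), \<open>al\<close> (size of common
  neighbourhoods of three of them), and \<open>z\<close> and \<open>mu\<close> (atypical vertices).
  \<open>few1\<close> and \<open>few2\<close> exclude the counts of order \<open>n^(v-3)\<close>
  that come from three apex vertices and from three disjoint inner edges. \<open>edges_many\<close>
  is twice the extremal number up to a constant: \<open>(n-2)^2 / r + r / 4\<close> bounds the sum
  of the squares of balanced class sizes.\<close>

locale near_turan =
  fixes t r l0 :: nat and V :: "'a set" and E :: "'a set set" and P :: "'a \<Rightarrow> nat" and n ep al z mu :: real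
  assumes t5: "t \<ge> 5" and r_def: "r = t - 3" and finV: "finite V" and n_def: "n = card V"
    and simple: "\<And>e. e \<in> E \<Longrightarrow> e \<subseteq> V \<and> card e = 2"
    and Pr: "\<And>x. x \<in> V \<Longrightarrow> P x < r"
    and cut: "\<And>x j. x \<in> V \<Longrightarrow> j < r \<Longrightarrow> card (inside V E P x) \<le> card {y \<in> V. P y = j \<and> {x,y} \<in> E}"
    and atypical: "card {x \<in> V. \<not> real (card (missing V E P x)) \<le> mu * n} \<le> z * n"
    and typical_size: "\<And>j. j < r \<Longrightarrow> n / r - 2 * z * n \<le> card (typical V E P (mu * n) j)"
    and edges_many: "n^2 - 2 - (n - 2)^2 / real r - real r / 4 \<le> card (opairs V E)"
    and pos: "0 < ep" "0 < al" "0 < z" "0 < mu"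
    and ep: "ep \<le> 1 / (1024 * real r^2)" and al: "al \<le> ep / 2" and z: "z \<le> ep / 4"
    and l0: "3 * (2 / ep) ^ r \<le> l0" "real l0 ^ 3 * al \<le> ep / 4" "real l0 * (2 * z + real l0 ^ 3 * al) \<le> 1 / (8 * real r)"
    and n1: "card (kn t) * (mu * n + 1) + 6 \<le> al * n / 2" and n2: "64 * real r * real l0^2 \<le> n" and n3: "32 * real r * (6 + real r) \<le> n"
    and few1: "card (embeddings (kneser2 t) (V, E)) < (al * n / 2) ^ (card (kn t) - 3)"
    and few2: "card (embeddings (kneser2 t) (V, E)) < (n / (64 * real r^2)) ^ 3 * (n / (4 * real r)) ^ (card (kn t) - 6)"
begin

abbreviation "typ_set j \<equiv> typical V E P (mu * n) j"
abbreviation "ncommon T j \<equiv> {w \<in> typ_set j. \<forall>x\<in>T. {x,w} \<in> E}"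

lemma r2: "r \<ge> 2" using t5 r_def by simp

lemma n_pos: "n > 0"
proof -
  have "0 < 32 * real r * (6 + real r)" using r2 by simp
  then show ?thesis using n3 by (simp add: algebra_simps)
qed

lemma loop: "{x} \<notin> E" using simple[of "{x}"] by auto

lemma finite_typ: "finite (typ_set j)" using finV by (simp add: typical_def)

lemma typ_V: "typ_set j \<subseteq> V" by (auto simp: typical_def)

section \<open>Boundedly many high vertices\<close>

definition high :: "'a set" where "high = {x \<in> V. ep * n \<le> card (inside V E P x)}"

text \<open>Maximality of the cut gives a high vertex its \<open>ep * n\<close> neighbours in every
  class, not just in its own; at most \<open>z * n\<close> of them are atypical.\<close>

lemma high_nbs:
  assumes x: "x \<in> high" and j: "j < r"
  shows "(ep - z) * n \<le> card {w \<in> typ_set j. {x,w} \<in> E}"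
proof -
  let ?A = "{x \<in> V. \<not> real (card (missing V E P x)) \<le> mu * n}"
  have "{y \<in> V. P y = j \<and> {x,y} \<in> E} - ?A \<subseteq> {w \<in> typ_set j. {x,w} \<in> E}" by (auto simp: typical_def)
  then have "card ({y \<in> V. P y = j \<and> {x,y} \<in> E} - ?A) \<le> card {w \<in> typ_set j. {x,w} \<in> E}"
    using finite_typ by (intro card_mono) auto
  moreover have "card {y \<in> V. P y = j \<and> {x,y} \<in> E} - card ?A \<le> card ({y \<in> V. P y = j \<and> {x,y} \<in> E} - ?A)"
    using finV by (intro diff_card_le_card_Diff) simp
  moreover have "ep * n \<le> card {y \<in> V. P y = j \<and> {x,y} \<in> E}"
    using x cut[of x j] j by (auto simp: high_def)
  moreover have "real (card ?A) \<le> z * n" by (rule atypical)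
  ultimately have "ep * n - z * n \<le> card {w \<in> typ_set j. {x,w} \<in> E}" by linarith
  then show ?thesis by (simp add: algebra_simps)
qed

text \<open>Otherwise the three vertices serve as apex vertices for class \<open>i\<close> and
  create more copies than \<open>few1\<close> allows.\<close>

lemma three_high:
  assumes T: "T \<subseteq> high" "card T = 3" and i: "i < r"
  shows "\<exists>j<r. j \<noteq> i \<and> card (ncommon T j) < al * n"
proof (rule ccontr)
  assume neg: "\<not> ?thesis"
  obtain a b d where abd: "T = {a,b,d}" "distinct [a,b,d]" using T(2) by (auto simp: card_3_iff)
  let ?v = "card (kn t)"
  have "(al * n - 6 - ?v * (mu * n + 1)) ^ (?v - 3) \<le> card (embeddings (kneser2 t) (V, E))"
  proof (rule three_apex_copies[OF t5 _ finV])
    show "i < t - 3" using i r_def by simp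
    show "a \<in> V" "b \<in> V" "d \<in> V" using T(1) abd(1) by (auto simp: high_def)
    show "distinct [a,b,d]" by (rule abd(2))
    show "al * n \<le> card {w \<in> typ_set i. {x,w} \<in> E}" if "x \<in> {a,b,d}" for x
    proof -
      have "x \<in> high" using that T(1) abd(1) by blast
      from high_nbs[OF this i] have "(ep - z) * n \<le> card {w \<in> typ_set i. {x,w} \<in> E}" .
      moreover have "al * n \<le> (ep - z) * n" using al z pos n_pos by (intro mult_right_mono) auto
      ultimately show ?thesis by linarith
    qed
    show "al * n \<le> card {w \<in> typ_set j. \<forall>x\<in>{a,b,d}. {x,w} \<in> E}" if "j < t - 3" "j \<noteq> i" for j
    proof -
      have "\<not> card (ncommon T j) < al * n" using neg that r_def by blast
      then show ?thesis unfolding abd(1) by (simp only: not_less)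
    qed
    show "0 \<le> mu * n" using pos n_pos by simp
    have "0 < al * n" using pos n_pos by simp
    then show "?v * (mu * n + 1) \<le> al * n - 6" using n1 by linarith
  qed
  moreover have "(al * n / 2) ^ (?v - 3) \<le> (al * n - 6 - ?v * (mu * n + 1)) ^ (?v - 3)"
    using n1 pos n_pos by (intro power_mono) auto
  ultimately show False using few1 by linarith
qed

text \<open>Small common neighbourhoods of triples are cut out, so that a single common neighbour
  left in class \<open>j\<close> certifies a large common neighbourhood there. For \<open>L\<close>
  of bounded size little is lost.\<close>

definition reduced :: "'a set \<Rightarrow> nat \<Rightarrow> 'a set" where
  "reduced L j = typ_set j - \<Union>{ncommon T j | T. T \<subseteq> L \<and> card T = 3 \<and> card (ncommon T j) < al * n}"

lemma finite_reduced: "finite (reduced L j)" using finite_typ by (simp add: reduced_def)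

lemma reduced_typ: "reduced L j \<subseteq> typ_set j" by (auto simp: reduced_def)

lemma removed_card:
  assumes L: "finite L"
  shows "card (typ_set j - reduced L j) \<le> real (card L) ^ 3 * (al * n)"
proof -
  let ?TT = "{T. T \<subseteq> L \<and> card T = 3 \<and> card (ncommon T j) < al * n}"
  have finTT: "finite ?TT" using L by simp
  have "typ_set j - reduced L j \<subseteq> (\<Union>T\<in>?TT. ncommon T j)" by (auto simp: reduced_def)
  then have "card (typ_set j - reduced L j) \<le> card (\<Union>T\<in>?TT. ncommon T j)"
    using finTT finite_typ by (intro card_mono) auto
  also have "\<dots> \<le> (\<Sum>T\<in>?TT. card (ncommon T j))" by (rule card_UN_le[OF finTT])
  finally have "real (card (typ_set j - reduced L j)) \<le> (\<Sum>T\<in>?TT. real (card (ncommon T j)))" by (simp flip: of_nat_sum)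
  also have "\<dots> \<le> (\<Sum>T\<in>?TT. al * n)" by (intro sum_mono) auto
  also have "\<dots> = card ?TT * (al * n)" by simp
  also have "\<dots> \<le> real (card L) ^ 3 * (al * n)"
  proof (rule mult_right_mono)
    have "card ?TT \<le> card {T. T \<subseteq> L \<and> card T = 3}" using L by (intro card_mono) auto
    also have "\<dots> = card L choose 3" using L by (simp add: n_subsets)
    also have "\<dots> \<le> card L ^ 3"
      by (cases "3 \<le> card L") (simp_all add: binomial_le_pow binomial_eq_0)
    finally show "real (card ?TT) \<le> real (card L) ^ 3" by (simp flip: of_nat_power)
  qed (use pos n_pos in simp)
  finally show ?thesis .
qed

text \<open>The vertices \<open>f j\<close> would certify that the triple has large common
  neighbourhoods in all classes but \<open>i\<close>, against \<open>three_high\<close>.\<close>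

lemma reduced_common:
  assumes L: "L \<subseteq> high" and T: "T \<subseteq> L" "card T = 3" and i: "i < r"
    and f: "\<And>j. j < r \<Longrightarrow> j \<noteq> i \<Longrightarrow> f j \<in> reduced L j" and adj: "\<And>j x. j < r \<Longrightarrow> j \<noteq> i \<Longrightarrow> x \<in> T \<Longrightarrow> {x, f j} \<in> E"
  shows False
proof -
  obtain j where j: "j < r" "j \<noteq> i" "card (ncommon T j) < al * n" using three_high[of T i] L T i by blast
  have "f j \<in> reduced L j" by (rule f[OF j(1,2)])
  then have "f j \<in> typ_set j" and nin: "f j \<notin> ncommon T j" using T j(3) unfolding reduced_def by blast+
  then show False using adj[OF j(1,2)] by blast
qed

lemma high_reduced_nbs:
  assumes L: "finite L" "card L \<le> l0" and x: "x \<in> high" and j: "j < r"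
  shows "ep / 2 * n \<le> card {w \<in> reduced L j. {x,w} \<in> E}"
proof -
  have "{w \<in> typ_set j. {x,w} \<in> E} \<subseteq> {w \<in> reduced L j. {x,w} \<in> E} \<union> (typ_set j - reduced L j)" by blast
  then have "card {w \<in> typ_set j. {x,w} \<in> E} \<le> card ({w \<in> reduced L j. {x,w} \<in> E} \<union> (typ_set j - reduced L j))"
    using finite_typ finite_reduced by (intro card_mono) auto
  also have "\<dots> \<le> card {w \<in> reduced L j. {x,w} \<in> E} + card (typ_set j - reduced L j)" by (rule card_Un_le)
  finally have "(ep - z) * n \<le> card {w \<in> reduced L j. {x,w} \<in> E} + real (card L) ^ 3 * (al * n)"
    using high_nbs[OF x j] removed_card[OF L(1), of j] by linarith
  moreover have "real (card L) ^ 3 * (al * n) \<le> ep / 4 * n"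
  proof -
    have "real (card L) ^ 3 * (al * n) \<le> real l0 ^ 3 * (al * n)"
      using L(2) pos n_pos by (intro mult_right_mono power_mono) auto
    also have "\<dots> = (real l0 ^ 3 * al) * n" by simp
    also have "\<dots> \<le> ep / 4 * n" using l0(2) n_pos by (intro mult_right_mono) auto
    finally show ?thesis .
  qed
  moreover have "z * n \<le> ep / 4 * n" using z n_pos by (intro mult_right_mono) auto
  ultimately show ?thesis by (simp add: algebra_simps)
qed

text \<open>Starting from \<open>l0\<close> high vertices, each class offers, by double counting, a
  vertex of its reduced part that is adjacent to a fraction \<open>ep / 2\<close> of the high
  vertices still alive. After \<open>r\<close> classes at least three survive and have common
  neighbours everywhere, against \<open>reduced_common\<close>.\<close>

lemma card_high: "card high < l0"
proof (rule ccontr)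
  assume "\<not> card high < l0"
  then obtain L where L: "L \<subseteq> high" "card L = l0" "finite L"
    using finV by (metis not_less obtain_subset_with_card_n)
  have ep1: "0 < ep / 2" using pos by simp
  have "k \<le> r \<Longrightarrow> \<exists>f M. M \<subseteq> L \<and> (ep / 2) ^ k * l0 \<le> card M \<and> (\<forall>j<k. f j \<in> reduced L j \<and> (\<forall>x\<in>M. {x, f j} \<in> E))" for k
  proof (induction k)
    case 0
    show ?case using L by (intro exI[of _ "\<lambda>_. undefined"] exI[of _ L]) auto
  next
    case (Suc k)
    then obtain f M where M: "M \<subseteq> L" "(ep / 2) ^ k * l0 \<le> card M" "\<forall>j<k. f j \<in> reduced L j \<and> (\<forall>x\<in>M. {x, f j} \<in> E)"
      by auto
    have k: "k < r" using Suc by simp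
    have finM: "finite M" using M(1) L(3) finite_subset by blast
    let ?R = "reduced L k"
    have "\<exists>w\<in>?R. ep / 2 * card M \<le> card {x \<in> M. {x,w} \<in> E}"
    proof (rule ccontr)
      assume neg: "\<not> ?thesis"
      have l0pos: "0 < real l0" using l0(1) pos by (smt (verit) zero_less_power divide_pos_pos)
      then have "0 < (ep / 2) ^ k * l0" using ep1 by simp
      then have Mne: "M \<noteq> {}" using M(2) by auto
      then obtain x0 where x0: "x0 \<in> M" by blast
      have "0 < ep / 2 * n" using ep1 n_pos by simp
      then have "{w \<in> ?R. {x0,w} \<in> E} \<noteq> {}"
        using high_reduced_nbs[OF L(3) _ _ k, of x0] L x0 M(1) by (metis card.empty not_less of_nat_0 order_refl subsetD)
      then have Rne: "?R \<noteq> {}" by blast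
      have "ep / 2 * n * card M = (\<Sum>x\<in>M. ep / 2 * n)" by simp
      also have "\<dots> \<le> (\<Sum>x\<in>M. real (card {w \<in> ?R. {x,w} \<in> E}))"
        using L M(1) k by (intro sum_mono high_reduced_nbs) auto
      also have "\<dots> = real (\<Sum>x\<in>M. \<Sum>w\<in>?R. if {x,w} \<in> E then 1 else 0)"
        using finite_reduced by (simp add: sum.If_cases Int_def)
      also have "\<dots> = real (\<Sum>w\<in>?R. card {x \<in> M. {x,w} \<in> E})"
        using finM by (subst sum.swap) (simp add: sum.If_cases Int_def)
      also have "\<dots> = (\<Sum>w\<in>?R. real (card {x \<in> M. {x,w} \<in> E}))" by simp
      also have "\<dots> < (\<Sum>w\<in>?R. ep / 2 * card M)"
        using finite_reduced Rne neg by (intro sum_strict_mono) (auto simp: not_le)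
      also have "\<dots> = card ?R * (ep / 2 * card M)" by simp
      also have "\<dots> \<le> n * (ep / 2 * card M)"
      proof (rule mult_right_mono)
        have "card ?R \<le> card V" using reduced_typ typ_V finV by (intro card_mono) blast+
        then show "real (card ?R) \<le> n" by (simp add: n_def)
      qed (use pos in simp)
      finally show False by simp
    qed
    then obtain w where w: "w \<in> ?R" "ep / 2 * card M \<le> card {x \<in> M. {x,w} \<in> E}" by blast
    let ?M = "{x \<in> M. {x,w} \<in> E}" and ?f = "f(k := w)"
    have "(ep / 2) ^ Suc k * l0 = ep / 2 * ((ep / 2) ^ k * l0)" by simp
    also have "\<dots> \<le> ep / 2 * card M" using M(2) ep1 by (intro mult_left_mono) auto
    finally have "(ep / 2) ^ Suc k * l0 \<le> card ?M" using w(2) by linarith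
    moreover have "?f j \<in> reduced L j \<and> (\<forall>x\<in>?M. {x, ?f j} \<in> E)" if "j < Suc k" for j
      using that w(1) M(3) by (cases "j = k") auto
    moreover have "?M \<subseteq> L" using M(1) by blast
    ultimately show ?case by blast
  qed
  from this[OF order_refl] obtain f M where M: "M \<subseteq> L" "(ep / 2) ^ r * l0 \<le> card M"
    "\<forall>j<r. f j \<in> reduced L j \<and> (\<forall>x\<in>M. {x, f j} \<in> E)" by blast
  have "3 = (ep / 2) ^ r * (3 * (2 / ep) ^ r)" using pos by (simp add: power_divide)
  also have "\<dots> \<le> (ep / 2) ^ r * l0" using l0(1) pos by (intro mult_left_mono) auto
  finally have "3 \<le> card M" using M(2) by linarith
  then obtain T where T: "T \<subseteq> M" "card T = 3" by (metis obtain_subset_with_card_n)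
  show False
  proof (rule reduced_common[OF L(1), of T 0 f])
    show "T \<subseteq> L" using T M by blast
    show "card T = 3" by (rule T)
    show "0 < r" using r2 by simp
    show "f j \<in> reduced L j" if "j < r" "j \<noteq> 0" for j using M(3) that by blast
    show "{x, f j} \<in> E" if "j < r" "j \<noteq> 0" "x \<in> T" for j x using M(3) T(1) that by blast
  qed
qed

section \<open>Edges inside classes away from the high vertices\<close>

definition good_inside :: "nat \<Rightarrow> ('a \<times> 'a) set" where
  "good_inside i = {p \<in> opairs V E. fst p \<notin> high \<and> snd p \<notin> high \<and> P (fst p) = i \<and> P (snd p) = i \<and>
    card (missing V E P (fst p)) \<le> n / (32 * real r) \<and> card (missing V E P (snd p)) \<le> n / (32 * real r)}"

text \<open>The ends of these edges are adjacent to almost all of the other classes, and a vertex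
  lies in at most \<open>2 * ep * n\<close> of the ordered pairs because high vertices are excluded.
  Linearly many pairs would contain enough disjoint triples for \<open>three_edges_copies\<close> to
  violate \<open>few2\<close>.\<close>

lemma good_inside_few: assumes i: "i < r" shows "card (good_inside i) < n / (32 * real r^2)"
proof (rule ccontr)
  assume neg: "\<not> ?thesis"
  let ?B = "good_inside i" and ?v = "card (kn t)"
  have finB: "finite ?B" using finV by (simp add: good_inside_def)
  have rr: "real r \<ge> 2" using r2 by simp
  define u where "u = n / r - 2 * z * n"
  define ka where "ka = n / (32 * real r)"
  have ep8: "8 * ep * n \<le> n / (64 * real r^2)"
  proof -
    have "8 * ep * n \<le> 8 * (1 / (1024 * real r^2)) * n" using ep n_pos by (intro mult_right_mono mult_left_mono) auto
    also have "\<dots> \<le> n / (64 * real r^2)" using rr n_pos by (simp add: field_simps)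
    finally show ?thesis .
  qed
  have small: "ep \<le> 1 / (64 * real r)"
  proof -
    have "1 / (1024 * real r^2) \<le> 1 / (64 * real r)"
      using rr by (intro divide_left_mono) (auto simp: power2_eq_square)
    then show ?thesis using ep by linarith
  qed
  have uu: "n / (4 * real r) \<le> u - 6 * ka - 6 - ?v * (mu * n + 1)"
  proof -
    have "2 * z * n \<le> 2 * (ep / 4) * n" using z n_pos by (intro mult_right_mono mult_left_mono) auto
    also have "\<dots> = ep * n / 2" by simp
    finally have a: "2 * z * n \<le> ep * n / 2" .
    have b: "6 + ?v * (mu * n + 1) \<le> ep * n / 4"
    proof -
      have "al * n / 2 \<le> (ep / 2) * n / 2" using al n_pos by (intro divide_right_mono mult_right_mono) auto
      then show ?thesis using n1 by simp
    qed
    have "ep * n \<le> 1 / (64 * real r) * n" using small n_pos by (intro mult_right_mono) auto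
    then have c: "ep * n \<le> n / r / 64" by simp
    have d: "6 * ka = n / r * (6 / 32)" "n / (4 * real r) = n / r / 4" by (simp_all add: ka_def)
    have "0 < n / r" using n_pos rr by simp
    have lin: "A / 4 \<le> A - Z - K - 6 - X"
      if "0 < A" "Z \<le> B / 2" "6 + X \<le> B / 4" "B \<le> A / 64" "K = A * (6 / 32)" for A B Z K X :: real
      using that by linarith
    show ?thesis unfolding u_def d(2) by (rule lin[OF \<open>0 < n / r\<close> a b c d(1)])
  qed
  have "(card ?B - 4 * (2 * ep * n)) ^ 3 * (u - 6 * ka - 6 - ?v * (mu * n + 1)) ^ (?v - 6) \<le> card (embeddings (kneser2 t) (V, E))"
  proof (rule three_edges_copies[OF t5 _ finV])
    show "i < t - 3" using i r_def by simp
    show "?B \<subseteq> V \<times> V" by (auto simp: good_inside_def opairs_def)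
    show "x \<noteq> y \<and> {x,y} \<in> E" if "(x,y) \<in> ?B" for x y
      using that loop[of x] by (auto simp: good_inside_def opairs_def)
    show "card {w \<in> typ_set j. {x,w} \<notin> E} \<le> ka" if "(x0,y0) \<in> ?B" "x \<in> {x0,y0}" "j < t - 3" "j \<noteq> i" for x0 y0 x j
    proof -
      have x: "P x = i" "card (missing V E P x) \<le> ka" using that by (auto simp: good_inside_def ka_def)
      have "{w \<in> typ_set j. {x,w} \<notin> E} \<subseteq> missing V E P x" using x that(4) by (auto simp: typical_def missing_def)
      then have "card {w \<in> typ_set j. {x,w} \<notin> E} \<le> card (missing V E P x)"
        using finV by (intro card_mono) (auto simp: missing_def)
      then show ?thesis using x(2) by linarith
    qed
    show "u \<le> card (typ_set j)" if "j < t - 3" for j using typical_size[of j] that r_def by (simp add: u_def)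
    show "card {p \<in> ?B. x = fst p \<or> x = snd p} \<le> 2 * ep * n" for x
    proof (cases "x \<in> V - high")
      case True
      have "{p \<in> ?B. x = fst p \<or> x = snd p} \<subseteq> Pair x ` inside V E P x \<union> (\<lambda>y. (y,x)) ` inside V E P x"
      proof
        fix p assume "p \<in> {p \<in> ?B. x = fst p \<or> x = snd p}"
        then show "p \<in> Pair x ` inside V E P x \<union> (\<lambda>y. (y,x)) ` inside V E P x"
          by (cases p) (auto simp: good_inside_def opairs_def inside_def insert_commute)
      qed
      then have "card {p \<in> ?B. x = fst p \<or> x = snd p} \<le> card (Pair x ` inside V E P x \<union> (\<lambda>y. (y,x)) ` inside V E P x)"
        using finV by (intro card_mono) (auto simp: inside_def)
      also have "\<dots> \<le> card (Pair x ` inside V E P x) + card ((\<lambda>y. (y,x)) ` inside V E P x)" by (rule card_Un_le)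
      also have "\<dots> \<le> card (inside V E P x) + card (inside V E P x)"
        using finV by (intro add_mono card_image_le) (auto simp: inside_def)
      finally show ?thesis using True by (auto simp: high_def)
    next
      case False
      then have emp: "{p \<in> ?B. x = fst p \<or> x = snd p} = {}" by (auto simp: good_inside_def opairs_def)
      show ?thesis unfolding emp using pos n_pos by simp
    qed
    have "n / (32 * real r^2) \<le> card ?B" using neg by simp
    moreover have "n / (32 * real r^2) = 2 * (n / (64 * real r^2))" "0 < n / (64 * real r^2)" using n_pos rr by simp_all
    ultimately show "4 * (2 * ep * n) \<le> card ?B" using ep8 by linarith
    show "0 \<le> mu * n" using pos n_pos by simp
    have "0 < n / (4 * real r)" using n_pos rr by simp
    then show "?v * (mu * n + 1) \<le> u - 6 * ka - 6" using uu by linarith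
  qed
  moreover have "(n / (64 * real r^2)) ^ 3 * (n / (4 * real r)) ^ (?v - 6) \<le>
     (card ?B - 4 * (2 * ep * n)) ^ 3 * (u - 6 * ka - 6 - ?v * (mu * n + 1)) ^ (?v - 6)"
  proof (intro mult_mono power_mono uu)
    have "n / (32 * real r^2) \<le> card ?B" using neg by simp
    moreover have "n / (32 * real r^2) = 2 * (n / (64 * real r^2))" by simp
    ultimately show le: "n / (64 * real r^2) \<le> card ?B - 4 * (2 * ep * n)" using ep8 by linarith
    have "0 \<le> n / (64 * real r^2)" using n_pos by simp
    then show "0 \<le> (card ?B - 4 * (2 * ep * n)) ^ 3" using le by simp
  qed (use n_pos in auto)
  ultimately show False using few2 by linarith
qed


lemma typ_classes: "typ_set j \<inter> typ_set k = {}" if "j \<noteq> k"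
  using that by (auto simp: typical_def)

lemma high_subset: "high \<subseteq> V" by (auto simp: high_def)

lemma finite_high: "finite high" using high_subset finV finite_subset by blast

abbreviation "rest \<equiv> V - high"
abbreviation "total_missing \<equiv> \<Sum>a\<in>high. card {w \<in> rest. {a,w} \<notin> E}"

text \<open>An inner edge that is not good has an end in \<open>X\<close>: more than
  \<open>n / (32 r)\<close> missing cross neighbours but, not being high, fewer than
  \<open>ep * n\<close> neighbours in its own class. So the missing pairs at \<open>X\<close> pay
  for both orientations of these edges, and only the good pairs are left.\<close>

lemma inside_excess:
  "card {p \<in> opairs rest E. P (fst p) = P (snd p)} \<le> (\<Sum>x\<in>rest. real (card (missing rest E P x))) + n / (32 * real r)"
proof -
  let ?I = "{p \<in> opairs rest E. P (fst p) = P (snd p)}"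
  define X where "X = {x \<in> rest. \<not> card (missing V E P x) \<le> n / (32 * real r)}"
  have rr: "real r \<ge> 2" using r2 by simp
  have finI: "finite (inside V E P x)" for x using finV by (simp add: inside_def)
  have finX: "finite X" using finV by (simp add: X_def)
  have fingood: "finite (\<Union>i<r. good_inside i)" using finV by (auto simp: good_inside_def)
  have sub: "?I \<subseteq> (\<Union>i<r. good_inside i) \<union> ((\<Union>x\<in>X. Pair x ` inside V E P x) \<union> (\<Union>x\<in>X. (\<lambda>y. (y,x)) ` inside V E P x))"
  proof
    fix p assume p: "p \<in> ?I"
    obtain x y where xy: "p = (x,y)" by (cases p)
    have h: "x \<in> rest" "y \<in> rest" "{x,y} \<in> E" "P x = P y" using p xy by (auto simp: opairs_def)
    consider "x \<in> X" | "y \<in> X" | "x \<notin> X" "y \<notin> X" by blast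
    then show "p \<in> (\<Union>i<r. good_inside i) \<union> ((\<Union>x\<in>X. Pair x ` inside V E P x) \<union> (\<Union>x\<in>X. (\<lambda>y. (y,x)) ` inside V E P x))"
    proof cases
      case 1
      moreover have "p \<in> Pair x ` inside V E P x" using xy h by (auto simp: inside_def)
      ultimately show ?thesis by blast
    next
      case 2
      moreover have "p \<in> (\<lambda>z. (z,y)) ` inside V E P y" using xy h by (auto simp: inside_def insert_commute)
      ultimately show ?thesis by blast
    next
      case 3
      then have "p \<in> good_inside (P x)" using xy h by (auto simp: good_inside_def X_def opairs_def)
      moreover have "P x < r" using h(1) Pr by blast
      ultimately show ?thesis by blast
    qed
  qed
  have "card ?I \<le> card ((\<Union>i<r. good_inside i) \<union> ((\<Union>x\<in>X. Pair x ` inside V E P x) \<union> (\<Union>x\<in>X. (\<lambda>y. (y,x)) ` inside V E P x)))"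
    using fingood finX finI by (intro card_mono sub) auto
  also have "\<dots> \<le> card (\<Union>i<r. good_inside i) + card ((\<Union>x\<in>X. Pair x ` inside V E P x) \<union> (\<Union>x\<in>X. (\<lambda>y. (y,x)) ` inside V E P x))"
    by (rule card_Un_le)
  also have "\<dots> \<le> card (\<Union>i<r. good_inside i) + (card (\<Union>x\<in>X. Pair x ` inside V E P x) + card (\<Union>x\<in>X. (\<lambda>y. (y,x)) ` inside V E P x))"
    by (intro add_left_mono card_Un_le)
  also have "\<dots> \<le> (\<Sum>i<r. card (good_inside i)) + ((\<Sum>x\<in>X. card (inside V E P x)) + (\<Sum>x\<in>X. card (inside V E P x)))"
  proof (intro add_mono)
    show "card (\<Union>i<r. good_inside i) \<le> (\<Sum>i<r. card (good_inside i))" by (rule card_UN_le) simp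
    have "card (\<Union>x\<in>X. Pair x ` inside V E P x) \<le> (\<Sum>x\<in>X. card (Pair x ` inside V E P x))" by (rule card_UN_le[OF finX])
    also have "\<dots> \<le> (\<Sum>x\<in>X. card (inside V E P x))" by (intro sum_mono card_image_le finI)
    finally show "card (\<Union>x\<in>X. Pair x ` inside V E P x) \<le> (\<Sum>x\<in>X. card (inside V E P x))" .
    have "card (\<Union>x\<in>X. (\<lambda>y. (y,x)) ` inside V E P x) \<le> (\<Sum>x\<in>X. card ((\<lambda>y. (y,x)) ` inside V E P x))" by (rule card_UN_le[OF finX])
    also have "\<dots> \<le> (\<Sum>x\<in>X. card (inside V E P x))" by (intro sum_mono card_image_le finI)
    finally show "card (\<Union>x\<in>X. (\<lambda>y. (y,x)) ` inside V E P x) \<le> (\<Sum>x\<in>X. card (inside V E P x))" .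
  qed
  finally have "card ?I \<le> (\<Sum>i<r. card (good_inside i)) + ((\<Sum>x\<in>X. card (inside V E P x)) + (\<Sum>x\<in>X. card (inside V E P x)))" .
  then have "real (card ?I) \<le> real ((\<Sum>i<r. card (good_inside i)) + ((\<Sum>x\<in>X. card (inside V E P x)) + (\<Sum>x\<in>X. card (inside V E P x))))"
    by (rule of_nat_mono)
  then have 1: "real (card ?I) \<le> (\<Sum>i<r. real (card (good_inside i))) + 2 * (\<Sum>x\<in>X. real (card (inside V E P x)))" by simp
  have 2: "(\<Sum>i<r. real (card (good_inside i))) \<le> n / (32 * real r)"
  proof -
    have "(\<Sum>i<r. real (card (good_inside i))) \<le> (\<Sum>i<r. n / (32 * real r^2))"
      using good_inside_few by (intro sum_mono) (auto intro: less_imp_le)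
    also have "\<dots> = n / (32 * real r)" using rr by (simp add: power2_eq_square)
    finally show ?thesis .
  qed
  have 3: "2 * (\<Sum>x\<in>X. real (card (inside V E P x))) \<le> (\<Sum>x\<in>rest. real (card (missing rest E P x)))"
  proof -
    have "2 * (\<Sum>x\<in>X. real (card (inside V E P x))) = (\<Sum>x\<in>X. 2 * real (card (inside V E P x)))" by (simp add: sum_distrib_left)
    also have "\<dots> \<le> (\<Sum>x\<in>X. real (card (missing rest E P x)))"
    proof (rule sum_mono)
      fix x assume x: "x \<in> X"
      have "real (card (inside V E P x)) \<le> ep * n" using x by (auto simp: X_def high_def)
      moreover have "n / (32 * real r) \<le> card (missing V E P x)" using x by (auto simp: X_def)
      moreover have "card (missing V E P x) \<le> card (missing rest E P x) + card high"
      proof -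
        have "missing V E P x \<subseteq> missing rest E P x \<union> high" by (auto simp: missing_def)
        then have "card (missing V E P x) \<le> card (missing rest E P x \<union> high)"
          using finV finite_high by (intro card_mono) (auto simp: missing_def)
        also have "\<dots> \<le> card (missing rest E P x) + card high" by (rule card_Un_le)
        finally show ?thesis .
      qed
      moreover have "2 * (ep * n) + card high \<le> n / (32 * real r)"
      proof -
        have "ep * n \<le> 1 / (1024 * real r^2) * n" using ep n_pos by (intro mult_right_mono) auto
        also have "\<dots> \<le> n / (128 * real r)" using rr n_pos by (simp add: field_simps power2_eq_square)
        finally have "ep * n \<le> n / (128 * real r)" .
        moreover have "card high \<le> n / (64 * real r)"
        proof -
          have "real (card high) \<le> real l0 ^ 2"
          proof -
            have "card high \<le> l0 * l0" using card_high le_square[of l0] by linarith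
            then show ?thesis by (simp add: power2_eq_square flip: of_nat_mult)
          qed
          also have "\<dots> \<le> n / (64 * real r)" using n2 rr by (simp add: field_simps)
          finally show ?thesis .
        qed
        ultimately show ?thesis by (simp add: field_simps)
      qed
      ultimately show "2 * real (card (inside V E P x)) \<le> real (card (missing rest E P x))" by linarith
    qed
    also have "\<dots> \<le> (\<Sum>x\<in>rest. real (card (missing rest E P x)))"
      using finV by (intro sum_mono2) (auto simp: X_def)
    finally show ?thesis .
  qed
  show ?thesis using 1 2 3 by linarith
qed

lemma opairs_split:
  "card (opairs V E) + 2 * total_missing \<le> card (opairs rest E) + 2 * (card high * card rest) + (card high)^2"
proof -
  let ?A = "\<Union>a\<in>high. Pair a ` {w \<in> rest. {a,w} \<in> E}" and ?B = "\<Union>a\<in>high. (\<lambda>w. (w,a)) ` {w \<in> rest. {a,w} \<in> E}"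
  have sub: "opairs V E \<subseteq> opairs rest E \<union> (?A \<union> (?B \<union> high \<times> high))"
  proof
    fix p assume p: "p \<in> opairs V E"
    obtain x y where xy: "p = (x,y)" by (cases p)
    have h: "x \<in> V" "y \<in> V" "{x,y} \<in> E" using p xy by (auto simp: opairs_def)
    show "p \<in> opairs rest E \<union> (?A \<union> (?B \<union> high \<times> high))"
    proof (cases "x \<in> high")
      case x: True
      show ?thesis
      proof (cases "y \<in> high")
        case True
        then show ?thesis using x xy by blast
      next
        case False
        then have "p \<in> Pair x ` {w \<in> rest. {x,w} \<in> E}" using h xy by simp
        then show ?thesis using x by blast
      qed
    next
      case x: False
      show ?thesis
      proof (cases "y \<in> high")
        case True
        have "p \<in> (\<lambda>w. (w,y)) ` {w \<in> rest. {y,w} \<in> E}" using x h xy by (simp add: insert_commute)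
        then show ?thesis using True by blast
      next
        case False
        then have "p \<in> opairs rest E" using x h xy by (simp add: opairs_def)
        then show ?thesis by blast
      qed
    qed
  qed
  have e: "(\<Sum>a\<in>high. card {w \<in> rest. {a,w} \<in> E}) + total_missing = card high * card rest"
  proof -
    have "card {w \<in> rest. {a,w} \<in> E} + card {w \<in> rest. {a,w} \<notin> E} = card rest" for a
    proof -
      have "card ({w \<in> rest. {a,w} \<in> E} \<union> {w \<in> rest. {a,w} \<notin> E}) = card {w \<in> rest. {a,w} \<in> E} + card {w \<in> rest. {a,w} \<notin> E}"
        using finV by (intro card_Un_disjoint) auto
      moreover have "{w \<in> rest. {a,w} \<in> E} \<union> {w \<in> rest. {a,w} \<notin> E} = rest" by blast
      ultimately show ?thesis by simp
    qed
    then show ?thesis by (simp add: sum.distrib[symmetric])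
  qed
  have A: "card ?A \<le> (\<Sum>a\<in>high. card {w \<in> rest. {a,w} \<in> E})"
  proof -
    have "card ?A \<le> (\<Sum>a\<in>high. card (Pair a ` {w \<in> rest. {a,w} \<in> E}))" by (rule card_UN_le[OF finite_high])
    also have "\<dots> \<le> (\<Sum>a\<in>high. card {w \<in> rest. {a,w} \<in> E})" using finV by (intro sum_mono card_image_le) auto
    finally show ?thesis .
  qed
  have B: "card ?B \<le> (\<Sum>a\<in>high. card {w \<in> rest. {a,w} \<in> E})"
  proof -
    have "card ?B \<le> (\<Sum>a\<in>high. card ((\<lambda>w. (w,a)) ` {w \<in> rest. {a,w} \<in> E}))" by (rule card_UN_le[OF finite_high])
    also have "\<dots> \<le> (\<Sum>a\<in>high. card {w \<in> rest. {a,w} \<in> E})" using finV by (intro sum_mono card_image_le) auto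
    finally show ?thesis .
  qed
  have fin: "finite (opairs rest E)" "finite ?A" "finite ?B" "finite (high \<times> high)"
    using finV finite_high by (auto intro: finite_opairs)
  have "card (opairs V E) \<le> card (opairs rest E \<union> (?A \<union> (?B \<union> high \<times> high)))" using fin by (intro card_mono sub) simp
  also have "\<dots> \<le> card (opairs rest E) + card (?A \<union> (?B \<union> high \<times> high))" by (rule card_Un_le)
  also have "card (?A \<union> (?B \<union> high \<times> high)) \<le> card ?A + card (?B \<union> high \<times> high)" by (rule card_Un_le)
  also have "card (?B \<union> high \<times> high) \<le> card ?B + card (high \<times> high)" by (rule card_Un_le)
  finally have "card (opairs V E) \<le> card (opairs rest E) + (card ?A + (card ?B + (card high)^2))"
    by (simp add: card_cartesian_product power2_eq_square)
  then show ?thesis using A B e by linarith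
qed

text \<open>Outside the high vertices, inner edges are compensated by missing cross pairs up to
  \<open>n / (32 r)\<close>, so that part is hardly denser than a balanced \<open>r\<close>-partite
  graph. Against \<open>edges_many\<close>, which counts two vertices joined to everything, each
  high vertex beyond two buys only about \<open>n / r\<close> missing pairs. The bound is over the
  reals and turns negative for fewer than two high vertices.\<close>

lemma total_missing_le: "total_missing \<le> (real (card high) - 2) * (n / r) + n / (32 * real r)"
proof -
  let ?l = "real (card high)" and ?D = "real total_missing"
  have rr: "real r \<ge> 2" using r2 by simp
  have cr: "real (card rest) = n - ?l"
    using finV finite_high high_subset by (simp add: card_Diff_subset n_def of_nat_diff card_mono)
  have "(\<Sum>j<r. (real (card {x \<in> rest. P x = j}) - real (card rest) / r)^2) + (\<Sum>x\<in>rest. real (card (missing rest E P x))) =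
    (1 - 1 / r) * real (card rest)^2 - card (opairs rest E) + card {p \<in> opairs rest E. P (fst p) = P (snd p)}"
    by (rule cut_defect) (use finV Pr r2 in auto)
  moreover have "0 \<le> (\<Sum>j<r. (real (card {x \<in> rest. P x = j}) - real (card rest) / r)^2)" by (simp add: sum_nonneg)
  ultimately have ow: "card (opairs rest E) \<le> (1 - 1 / r) * (n - ?l)^2 + n / (32 * real r)"
    using inside_excess unfolding cr by linarith
  have "real (card (opairs V E) + 2 * total_missing) \<le> real (card (opairs rest E) + 2 * (card high * card rest) + (card high)^2)"
    using opairs_split by (rule of_nat_mono)
  then have "real (card (opairs V E)) + 2 * ?D \<le> real (card (opairs rest E)) + 2 * (?l * (n - ?l)) + ?l^2"
    by (simp add: cr)
  then have "n^2 - 2 - (n - 2)^2 / r - r / 4 + 2 * ?D \<le> (1 - 1 / r) * (n - ?l)^2 + n / (32 * real r) + 2 * (?l * (n - ?l)) + ?l^2"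
    using ow edges_many by linarith
  also have "\<dots> = n^2 - (n - ?l)^2 / r + n / (32 * real r)"
  proof -
    have "(1 - 1 / r) * (n - ?l)^2 = (n - ?l)^2 - (n - ?l)^2 / r" by (simp add: left_diff_distrib)
    moreover have "(n - ?l)^2 + 2 * (?l * (n - ?l)) + ?l^2 = n^2" by (simp add: power2_eq_square algebra_simps)
    ultimately show ?thesis by linarith
  qed
  finally have "2 * ?D \<le> ((n - 2)^2 - (n - ?l)^2) / r + n / (32 * real r) + 2 + r / 4"
    by (simp add: diff_divide_distrib)
  also have "((n - 2)^2 - (n - ?l)^2) / r \<le> (2 * (?l - 2) * n + 4) / r"
    using rr by (intro divide_right_mono) (auto simp: power2_eq_square algebra_simps)
  also have "(2 * (?l - 2) * n + 4) / r = 2 * ((?l - 2) * (n / r)) + 4 / r" by (simp add: add_divide_distrib)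
  also have "4 / real r \<le> 2" using rr by (simp add: field_simps)
  finally have "2 * ?D \<le> 2 * ((?l - 2) * (n / r)) + 2 + n / (32 * real r) + 2 + r / 4" by simp
  moreover have "4 + r / 4 \<le> n / (32 * real r)"
  proof -
    have "6 + real r \<le> n / (32 * real r)" using n3 rr by (simp add: field_simps)
    then show ?thesis by simp
  qed
  ultimately show ?thesis by linarith
qed

section \<open>Exactly two high vertices\<close>

text \<open>\<open>N a\<close> holds the classes in which \<open>a\<close> misses the transversal
  \<open>f\<close>. With at most \<open>card high - 2\<close> misses in total, either three high
  vertices miss nothing, or two miss nothing and a third misses a single class \<open>i\<close>.
  Both contradict \<open>reduced_common\<close>, the second with \<open>i\<close> as the exempted
  class.\<close>

lemma transversal_nonneighbours:
  assumes l3: "3 \<le> card high" and f: "\<And>j. j < r \<Longrightarrow> f j \<in> reduced high j"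
  shows "card high - 1 \<le> (\<Sum>j<r. card {a \<in> high. {a, f j} \<notin> E})"
proof (rule ccontr)
  assume neg: "\<not> ?thesis"
  define N where "N a = {j \<in> {..<r}. {a, f j} \<notin> E}" for a
  have finN: "finite (N a)" for a by (simp add: N_def)
  have "(\<Sum>j<r. card {a \<in> high. {a, f j} \<notin> E}) = (\<Sum>j<r. \<Sum>a\<in>high. if {a, f j} \<notin> E then 1 else 0)"
    by (intro sum.cong refl card_filter_sum finite_high)
  also have "\<dots> = (\<Sum>a\<in>high. \<Sum>j<r. if {a, f j} \<notin> E then 1 else 0)" by (rule sum.swap)
  also have "\<dots> = (\<Sum>a\<in>high. card (N a))" unfolding N_def by (intro sum.cong refl card_filter_sum[symmetric]) simp
  finally have tot: "(\<Sum>a\<in>high. card (N a)) + 2 \<le> card high" using neg l3 by linarith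
  have use: False if T: "T \<subseteq> high" "card T = 3" and i: "i < r" and adj: "\<And>a. a \<in> T \<Longrightarrow> N a \<subseteq> {i}" for T i
  proof (rule reduced_common[OF order_refl T i])
    show "f j \<in> reduced high j" if "j < r" for j using f[OF that] .
    show "{x, f j} \<in> E" if "j < r" "j \<noteq> i" "x \<in> T" for j x using adj[OF that(3)] that by (auto simp: N_def)
  qed
  define Z where "Z = {a \<in> high. N a = {}}"
  have Zh: "Z \<subseteq> high" "finite Z" using finite_high by (auto simp: Z_def)
  have r0: "0 < r" using r2 by simp
  show False
  proof (cases "3 \<le> card Z")
    case True
    then obtain T where T: "T \<subseteq> Z" "card T = 3" by (metis obtain_subset_with_card_n)
    show False by (rule use[of T 0]) (use T Zh r0 in \<open>auto simp: Z_def\<close>)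
  next
    case False
    have N1: "1 \<le> card (N a)" if "a \<in> high - Z" for a
    proof -
      have "N a \<noteq> {}" using that by (auto simp: Z_def)
      then show ?thesis using finN[of a] by (simp add: Suc_le_eq card_gt_0_iff)
    qed
    have split: "(\<Sum>a\<in>high. card (N a)) = (\<Sum>a\<in>high - Z. card (N a))"
      using finite_high by (intro sum.mono_neutral_right) (auto simp: Z_def)
    have cardd: "card (high - Z) = card high - card Z" using Zh by (simp add: card_Diff_subset)
    have "card (high - Z) \<le> (\<Sum>a\<in>high - Z. card (N a))" using sum_mono[of "high - Z" "\<lambda>_. 1" "\<lambda>a. card (N a)"] N1 by simp
    then have Z2: "card Z = 2" using tot split cardd False l3 by linarith
    have "\<exists>c\<in>high - Z. card (N c) = 1"
    proof (rule ccontr)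
      assume no: "\<not> ?thesis"
      have "2 \<le> card (N a)" if "a \<in> high - Z" for a
      proof -
        have "card (N a) \<noteq> 1" using no that by blast
        then show ?thesis using N1[OF that] by linarith
      qed
      then have "2 * card (high - Z) \<le> (\<Sum>a\<in>high - Z. card (N a))"
        using sum_mono[of "high - Z" "\<lambda>_. 2" "\<lambda>a. card (N a)"] by simp
      then show False using tot split cardd Z2 l3 by linarith
    qed
    then obtain c where c: "c \<in> high - Z" "card (N c) = 1" by blast
    then obtain i where i: "N c = {i}" by (auto simp: card_1_singleton_iff)
    have ir: "i < r" using i by (auto simp: N_def)
    have cT: "card (insert c Z) = 3" using c Z2 Zh by simp
    show False by (rule use[of "insert c Z" i]) (use c Zh cT i ir in \<open>auto simp: Z_def\<close>)
  qed
qed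

text \<open>For three or more high vertices, take in each class a vertex with the fewest high
  non-neighbours. All vertices of the reduced class have at least as many, so
  \<open>transversal_nonneighbours\<close> yields about \<open>(card high - 1) * n / r\<close>
  missing pairs, while \<open>total_missing_le\<close> allows only about
  \<open>(card high - 2) * n / r\<close>.\<close>

lemma two_high: "card high = 2" "total_missing \<le> n / (32 * real r)"
proof -
  let ?l = "real (card high)" and ?D = "real total_missing"
  have rr: "real r \<ge> 2" using r2 by simp
  have nr: "n / r > 0" using n_pos rr by simp
  have "\<not> card high \<le> 1"
  proof
    assume "card high \<le> 1"
    then have "(?l - 2) * (n / r) \<le> (-1) * (n / r)" using nr by (intro mult_right_mono) auto
    moreover have "n / (32 * real r) = n / r / 32" by simp
    ultimately have "?D < 0" using total_missing_le nr by linarith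
    moreover have "0 \<le> ?D" by (rule of_nat_0_le_iff)
    ultimately show False by linarith
  qed
  moreover have "\<not> 3 \<le> card high"
  proof
    assume l3: "3 \<le> card high"
    \<comment> \<open>A lower bound for the reduced classes without the high vertices. As
      \<open>l0 * (n / r - m)\<close> stays below \<open>n / (4 r)\<close>, the gap of
      \<open>n / r\<close> between the two estimates survives the errors.\<close>
    define m where "m = n / r - 2 * z * n - real l0 ^ 3 * (al * n) - real l0"
    have ll: "?l \<le> real l0" using card_high by simp
    have l1: "1 \<le> real l0" using l3 card_high by simp
    have lm: "real l0 * (n / r - m) \<le> n / (4 * real r)"
    proof -
      have "real l0 * (n / r - m) = (real l0 * (2 * z + real l0 ^ 3 * al)) * n + real l0^2"
        by (simp add: m_def algebra_simps power2_eq_square)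
      also have "\<dots> \<le> 1 / (8 * real r) * n + n / (64 * real r)"
      proof (rule add_mono)
        show "(real l0 * (2 * z + real l0 ^ 3 * al)) * n \<le> 1 / (8 * real r) * n"
          using l0(3) n_pos by (intro mult_right_mono) auto
        show "real l0^2 \<le> n / (64 * real r)" using n2 rr by (simp add: field_simps)
      qed
      also have "\<dots> \<le> n / (4 * real r)" using rr n_pos by (simp add: field_simps)
      finally show ?thesis .
    qed
    have nm0: "0 \<le> n / r - m" using pos n_pos l1 by (simp add: m_def)
    have "n / r - m \<le> real l0 * (n / r - m)" using nm0 l1 by (simp add: mult_left_mono[of 1 "real l0", simplified] mult_le_cancel_right1)
    then have m0: "0 < m" using lm nr by (simp add: field_simps) 
    have size: "m \<le> card (reduced high j - high)" if j: "j < r" for j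
    proof -
      have "typ_set j \<subseteq> (reduced high j - high) \<union> ((typ_set j - reduced high j) \<union> high)" by blast
      then have "card (typ_set j) \<le> card ((reduced high j - high) \<union> ((typ_set j - reduced high j) \<union> high))"
        using finite_typ finite_reduced finite_high by (intro card_mono) auto
      also have "\<dots> \<le> card (reduced high j - high) + card ((typ_set j - reduced high j) \<union> high)" by (rule card_Un_le)
      also have "card ((typ_set j - reduced high j) \<union> high) \<le> card (typ_set j - reduced high j) + card high" by (rule card_Un_le)
      finally have "real (card (typ_set j)) \<le> card (reduced high j - high) + (real (card (typ_set j - reduced high j)) + ?l)" by simp
      moreover have "real (card (typ_set j - reduced high j)) \<le> real l0 ^ 3 * (al * n)"
      proof -
        have "real (card (typ_set j - reduced high j)) \<le> ?l ^ 3 * (al * n)" by (rule removed_card[OF finite_high])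
        also have "\<dots> \<le> real l0 ^ 3 * (al * n)" using ll pos n_pos by (intro mult_right_mono power_mono) auto
        finally show ?thesis .
      qed
      ultimately show ?thesis using typical_size[OF j] ll by (simp add: m_def)
    qed
    define nn where "nn w = card {a \<in> high. {a,w} \<notin> E}" for w
    define f where "f j = arg_min nn (\<lambda>w. w \<in> reduced high j - high)" for j
    have ne: "\<exists>w. w \<in> reduced high j - high" if "j < r" for j
      using size[OF that] m0 by (metis all_not_in_conv card.empty not_less of_nat_0)
    have fin: "f j \<in> reduced high j - high" if j: "j < r" for j
    proof -
      obtain w where "w \<in> reduced high j - high" using ne[OF j] by blast
      then show ?thesis unfolding f_def by (rule arg_min_natI[of "\<lambda>w. w \<in> reduced high j - high"])
    qed
    have fmin: "nn (f j) \<le> nn w" if "w \<in> reduced high j - high" for j w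
      unfolding f_def by (rule arg_min_nat_le[of "\<lambda>w. w \<in> reduced high j - high"]) (rule that)
    have "card high - 1 \<le> (\<Sum>j<r. nn (f j))"
      unfolding nn_def using fin by (intro transversal_nonneighbours[OF l3]) blast
    then have tr: "?l - 1 \<le> (\<Sum>j<r. real (nn (f j)))" using l3 by (simp flip: of_nat_sum)
    have "m * (?l - 1) \<le> m * (\<Sum>j<r. real (nn (f j)))" using tr m0 by (intro mult_left_mono) auto
    also have "\<dots> = (\<Sum>j<r. m * real (nn (f j)))" by (simp add: sum_distrib_left)
    also have "\<dots> \<le> (\<Sum>j<r. real (\<Sum>w\<in>reduced high j - high. nn w))"
    proof (rule sum_mono)
      fix j assume "j \<in> {..<r}"
      then have "m * real (nn (f j)) \<le> card (reduced high j - high) * real (nn (f j))"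
        using size[of j] by (intro mult_right_mono) auto
      also have "\<dots> = (\<Sum>w\<in>reduced high j - high. real (nn (f j)))" by simp
      also have "\<dots> \<le> (\<Sum>w\<in>reduced high j - high. real (nn w))" using fmin by (intro sum_mono) simp
      finally show "m * real (nn (f j)) \<le> real (\<Sum>w\<in>reduced high j - high. nn w)" by simp
    qed
    also have "\<dots> = real (\<Sum>j<r. \<Sum>w\<in>reduced high j - high. nn w)" by simp
    also have "(\<Sum>j<r. \<Sum>w\<in>reduced high j - high. nn w) = (\<Sum>w\<in>(\<Union>j<r. reduced high j - high). nn w)"
    proof (rule sum.UNION_disjoint[symmetric])
      show "\<forall>i\<in>{..<r}. \<forall>j\<in>{..<r}. i \<noteq> j \<longrightarrow> (reduced high i - high) \<inter> (reduced high j - high) = {}"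
        using reduced_typ typ_classes by blast
    qed (use finite_reduced in auto)
    also have "\<dots> \<le> (\<Sum>w\<in>rest. nn w)"
      using finV reduced_typ typ_V by (intro sum_mono2) blast+
    also have "(\<Sum>w\<in>rest. nn w) = total_missing"
    proof -
      have "(\<Sum>w\<in>rest. nn w) = (\<Sum>w\<in>rest. \<Sum>a\<in>high. if {a,w} \<notin> E then 1 else 0)"
        unfolding nn_def by (intro sum.cong refl card_filter_sum finite_high)
      also have "\<dots> = (\<Sum>a\<in>high. \<Sum>w\<in>rest. if {a,w} \<notin> E then 1 else 0)" by (rule sum.swap)
      also have "\<dots> = total_missing" using finV by (intro sum.cong refl card_filter_sum[symmetric]) simp
      finally show ?thesis .
    qed
    finally have "m * (?l - 1) \<le> ?D" by simp
    also have "\<dots> \<le> (?l - 2) * (n / r) + n / (32 * real r)" by (rule total_missing_le)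
    finally have "m * (?l - 1) \<le> (?l - 2) * (n / r) + n / (32 * real r)" .
    then have "n / r \<le> (?l - 1) * (n / r - m) + n / (32 * real r)" by (simp add: algebra_simps)
    also have "(?l - 1) * (n / r - m) \<le> real l0 * (n / r - m)" using ll nm0 by (intro mult_right_mono) auto
    also have "\<dots> \<le> n / (4 * real r)" by (rule lm)
    finally have "n / r \<le> n / (4 * real r) + n / (32 * real r)" by simp
    moreover have "n / (4 * real r) = n / r / 4" "n / (32 * real r) = n / r / 32" by simp_all
    ultimately show False using nr by linarith
  qed
  ultimately show c2: "card high = 2" by linarith
  show "total_missing \<le> n / (32 * real r)" using total_missing_le unfolding c2 by simp
qed

end

section \<open>Copies in apex graphs\<close>

text \<open>The factor \<open>card I ^ k\<close> chooses the arguments that land on a tuple of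
  \<open>R\<close>; lists keep track of which argument goes where.\<close>

lemma card_maps_union:
  assumes I: "finite I" and V: "finite V" and R: "finite R"
  shows "card {\<phi> \<in> I \<rightarrow>\<^sub>E V. \<exists>js. distinct js \<and> set js \<subseteq> I \<and> length js = k \<and> map \<phi> js \<in> R} \<le>
    card I ^ k * (card R * card V ^ (card I - k))"
proof -
  let ?J = "{js. set js \<subseteq> I \<and> length js = k}"
  let ?A = "\<lambda>js. {\<phi> \<in> I \<rightarrow>\<^sub>E V. distinct js \<and> map \<phi> js \<in> R}"
  have finJ: "finite ?J" using I by (rule finite_lists_length_eq)
  have finP: "finite (I \<rightarrow>\<^sub>E V)" using I V by (intro finite_PiE) auto
  have "card {\<phi> \<in> I \<rightarrow>\<^sub>E V. \<exists>js. distinct js \<and> set js \<subseteq> I \<and> length js = k \<and> map \<phi> js \<in> R} \<le> card (\<Union>js\<in>?J. ?A js)"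
    using finJ finP by (intro card_mono) auto
  also have "\<dots> \<le> (\<Sum>js\<in>?J. card (?A js))" by (rule card_UN_le[OF finJ])
  also have "\<dots> \<le> (\<Sum>js\<in>?J. card R * card V ^ (card I - k))"
  proof (rule sum_mono)
    fix js assume js: "js \<in> ?J"
    show "card (?A js) \<le> card R * card V ^ (card I - k)"
    proof (cases "distinct js")
      case True
      then have "card (?A js) \<le> card R * card V ^ (card I - length js)"
        using card_maps_fixed[OF I V True _ R] js by simp
      then show ?thesis using js by simp
    qed simp
  qed
  also have "\<dots> = card I ^ k * (card R * card V ^ (card I - k))" using card_lists_length_eq[OF I, of k] by simp
  finally show ?thesis .
qed

lemma card_opairs_simple:
  assumes E: "\<And>e. e \<in> E \<Longrightarrow> e \<subseteq> V \<and> card e = 2" and V: "finite V"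
  shows "card (opairs V E) = 2 * card E"
proof -
  have finE: "finite E" using E V by (intro finite_subset[of E "Pow V"]) auto
  let ?A = "\<lambda>e. {p. {fst p, snd p} = e}"
  have A2: "card (?A e) = 2 \<and> finite (?A e)" if e: "e \<in> E" for e
  proof -
    obtain x y where xy: "e = {x,y}" "x \<noteq> y" using E[OF e] by (auto simp: card_2_iff)
    have "?A e = {(x,y),(y,x)}" unfolding xy(1) by (auto simp: doubleton_eq_iff)
    then show ?thesis using xy(2) by simp
  qed
  have "x \<in> V \<and> y \<in> V" if "{x,y} \<in> E" for x y using E[OF that] by simp
  then have "opairs V E = (\<Union>e\<in>E. ?A e)" by (auto simp: opairs_def)
  moreover have "card (\<Union>e\<in>E. ?A e) = (\<Sum>e\<in>E. card (?A e))" using finE A2 by (intro card_UN_disjoint) auto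
  ultimately show ?thesis using A2 by simp
qed

definition cross :: "'a set \<Rightarrow> ('a \<Rightarrow> nat) \<Rightarrow> 'a set set" where
  "cross V Q = {e. \<exists>x\<in>V. \<exists>y\<in>V. Q x \<noteq> Q y \<and> e = {x,y}}"

lemma in_cross: "{x,y} \<in> cross V Q \<longleftrightarrow> x \<in> V \<and> y \<in> V \<and> Q x \<noteq> Q y"
  by (auto simp: cross_def doubleton_eq_iff)

lemma cross_simple:
  assumes "e \<in> cross V Q"
  shows "e \<subseteq> V \<and> card e = 2"
proof -
  obtain x y where xy: "x \<in> V" "y \<in> V" "Q x \<noteq> Q y" "e = {x,y}" using assms unfolding cross_def by blast
  then have "x \<noteq> y" by auto
  then show ?thesis using xy by simp
qed

lemma finite_cross: "finite V \<Longrightarrow> finite (cross V Q)"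
  by (rule finite_subset[of _ "Pow V"]) (auto simp: cross_def)

lemma card_cross:
  assumes V: "finite V" and Q: "\<And>x. x \<in> V \<Longrightarrow> Q x < K"
  shows "2 * card (cross V Q) + (\<Sum>k<K. (card {x \<in> V. Q x = k})^2) = (card V)^2"
proof -
  have "2 * card (cross V Q) = card (opairs V (cross V Q))" using card_opairs_simple[OF cross_simple V] by simp
  also have "opairs V (cross V Q) = {p \<in> V \<times> V. Q (fst p) \<noteq> Q (snd p)}" by (auto simp: opairs_def in_cross)
  finally have 1: "2 * card (cross V Q) = card {p \<in> V \<times> V. Q (fst p) \<noteq> Q (snd p)}" .
  have "card {p \<in> V \<times> V. Q (fst p) = Q (snd p)} = card (\<Union>k<K. {x \<in> V. Q x = k} \<times> {x \<in> V. Q x = k})"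
    by (rule arg_cong[of _ _ card]) (use Q in auto)
  also have "\<dots> = (\<Sum>k<K. card ({x \<in> V. Q x = k} \<times> {x \<in> V. Q x = k}))"
    using V by (subst card_UN_disjoint) auto
  finally have 2: "card {p \<in> V \<times> V. Q (fst p) = Q (snd p)} = (\<Sum>k<K. (card {x \<in> V. Q x = k})^2)"
    by (simp add: card_cartesian_product power2_eq_square)
  have "card (V \<times> V) = card ({p \<in> V \<times> V. Q (fst p) \<noteq> Q (snd p)} \<union> {p \<in> V \<times> V. Q (fst p) = Q (snd p)})"
    by (rule arg_cong[of _ _ card]) blast
  also have "\<dots> = card {p \<in> V \<times> V. Q (fst p) \<noteq> Q (snd p)} + card {p \<in> V \<times> V. Q (fst p) = Q (snd p)}"
    using V by (intro card_Un_disjoint) auto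
  finally show ?thesis using 1 2 by (simp add: card_cartesian_product power2_eq_square)
qed

text \<open>The graph \<open>cross V Q \<union> B\<close>: two apex vertices (the classes \<open>r\<close> and \<open>r + 1\<close>) joined to
  everything, a complete \<open>r\<close>-partite graph on the rest, and extra edges \<open>B\<close> inside classes.\<close>

locale apex_graph =
  fixes t r :: nat and V :: "'a set" and Q :: "'a \<Rightarrow> nat" and B :: "'a set set" and a1 a2 :: 'a
  assumes t5: "t \<ge> 5" and r_def: "r = t - 3" and finV: "finite V"
    and Q: "\<And>x. x \<in> V \<Longrightarrow> Q x < r \<or> x = a1 \<or> x = a2"
    and apex: "a1 \<in> V" "a2 \<in> V" "Q a1 = r" "Q a2 = Suc r"
    and inner: "\<And>e. e \<in> B \<Longrightarrow> \<exists>x y. e = {x,y} \<and> x \<in> V \<and> y \<in> V \<and> x \<noteq> y \<and> Q x = Q y"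
begin

abbreviation "H \<equiv> cross V Q \<union> B"
abbreviation "copies \<equiv> embeddings (kneser2 t) (V, H)"
abbreviation "v \<equiv> card (kn t)"

lemma inner_edge:
  assumes "{x,y} \<in> B"
  shows "x \<in> V" "y \<in> V" "x \<noteq> y" "Q x = Q y" "Q x < r"
proof -
  obtain x' y' where "{x,y} = {x',y'}" "x' \<in> V" "y' \<in> V" "x' \<noteq> y'" "Q x' = Q y'" using inner[OF assms] by blast
  then show h: "x \<in> V" "y \<in> V" "x \<noteq> y" "Q x = Q y" by (auto simp: doubleton_eq_iff)
  show "Q x < r" using Q[OF h(1)] Q[OF h(2)] h apex by auto
qed

lemma finite_B: "finite B"
proof (rule finite_subset[of _ "Pow V"])
  show "B \<subseteq> Pow V" using inner by blast
qed (use finV in simp)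

lemma cross_B: "cross V Q \<inter> B = {}"
proof -
  have False if e: "e \<in> cross V Q" "e \<in> B" for e
  proof -
    obtain x y where "e = {x,y}" "Q x \<noteq> Q y" using e(1) unfolding cross_def by blast
    then show False using inner_edge(4)[of x y] e(2) by simp
  qed
  then show ?thesis by blast
qed

text \<open>Giving apex vertices the colour 0 makes the colouring total with \<open>t - 3\<close>
  colours. The spurious monochromatic edges that this creates touch an apex vertex and are allowed
  for in \<open>mono_edge\<close>.\<close>

definition colour :: "(nat set \<Rightarrow> 'a) \<Rightarrow> nat set \<Rightarrow> nat" where
  "colour \<phi> x = (if Q (\<phi> x) < r then Q (\<phi> x) else 0)"

lemma colour_less: "colour \<phi> x < t - 3"
proof -
  have "0 < r" using t5 r_def by simp
  then have "colour \<phi> x < r" by (simp add: colour_def)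
  then show ?thesis unfolding r_def[symmetric] .
qed

lemma copyD:
  assumes "\<phi> \<in> copies"
  shows "\<phi> \<in> kn t \<rightarrow>\<^sub>E V" "x \<in> kn t \<Longrightarrow> \<phi> x \<in> V" "inj_on \<phi> (kn t)"
    and "x \<in> kn t \<Longrightarrow> y \<in> kn t \<Longrightarrow> x \<inter> y = {} \<Longrightarrow> {\<phi> x, \<phi> y} \<in> H"
  using assms by (auto simp: kneser_embeddings_iff)

lemma mono_edge:
  assumes \<phi>: "\<phi> \<in> copies" and xy: "x \<in> kn t" "y \<in> kn t" "x \<inter> y = {}" "colour \<phi> x = colour \<phi> y"
  shows "{\<phi> x, \<phi> y} \<in> B \<or> \<phi> x \<in> {a1,a2} \<or> \<phi> y \<in> {a1,a2}"
proof (cases "Q (\<phi> x) < r \<and> Q (\<phi> y) < r")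
  case True
  then have "Q (\<phi> x) = Q (\<phi> y)" using xy(4) by (simp add: colour_def)
  then have "{\<phi> x, \<phi> y} \<notin> cross V Q" by (simp add: in_cross)
  then show ?thesis using copyD(4)[OF \<phi> xy(1-3)] by blast
next
  case False
  then show ?thesis using Q[OF copyD(2)[OF \<phi> xy(1)]] Q[OF copyD(2)[OF \<phi> xy(2)]] by blast
qed

lemma preimage_card:
  assumes \<phi>: "\<phi> \<in> copies" and "finite A"
  shows "card {x \<in> kn t. \<phi> x \<in> A} \<le> card A"
  by (rule card_inj_on_le[of \<phi>]) (use assms copyD(3)[OF \<phi>] in \<open>auto simp: inj_on_def\<close>)

text \<open>At most two vertices of the Kneser graph go to apex vertices, and deleting two never
  makes the rest properly colourable with \<open>r\<close> colours.\<close>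

lemma uses_inner_edge:
  assumes \<phi>: "\<phi> \<in> copies"
  obtains x y where "x \<in> kn t" "y \<in> kn t" "x \<inter> y = {}" "{\<phi> x, \<phi> y} \<in> B"
proof -
  let ?D = "{x \<in> kn t. \<phi> x \<in> {a1,a2}}"
  have "card ?D \<le> card {a1,a2}" by (rule preimage_card[OF \<phi>]) simp
  also have "\<dots> < 3" using card_length[of "[a1,a2]"] by simp
  finally have d: "card ?D < 3" .
  have "\<exists>x\<in>kn t - ?D. \<exists>y\<in>kn t - ?D. x \<inter> y = {} \<and> colour \<phi> x = colour \<phi> y"
    using t5 d colour_less by (intro kneser_cover) auto
  then obtain x y where xy: "x \<in> kn t - ?D" "y \<in> kn t - ?D" "x \<inter> y = {}" "colour \<phi> x = colour \<phi> y"
    by (elim bexE conjE)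
  then have "{\<phi> x, \<phi> y} \<in> B" using mono_edge[OF \<phi>, of x y] by simp
  then show ?thesis using that[of x y] xy by simp
qed

lemma no_copies: "B = {} \<Longrightarrow> copies = {}"
  using uses_inner_edge by (metis all_not_in_conv)

definition orderedB :: "('a \<times> 'a) set" where "orderedB = {p. {fst p, snd p} \<in> B}"

lemma orderedB: "finite orderedB" "card orderedB = 2 * card B" "orderedB \<subseteq> V \<times> V"
proof -
  have "orderedB = opairs V B" using inner_edge by (auto simp: orderedB_def opairs_def)
  moreover have "card (opairs V B) = 2 * card B"
  proof (rule card_opairs_simple[OF _ finV])
    show "e \<subseteq> V \<and> card e = 2" if "e \<in> B" for e using inner[OF that] by auto
  qed
  ultimately show "finite orderedB" "card orderedB = 2 * card B" "orderedB \<subseteq> V \<times> V"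
    using finV by (auto simp: opairs_def)
qed

text \<open>Two disjoint monochromatic edges avoid the pair sent to \<open>{u,w}\<close>. If one of
  them goes to an edge of \<open>B\<close>, six images are pinned: \<open>u\<close>,
  \<open>w\<close>, that edge (\<open>2 * card B\<close> ways) and the other one (at most
  \<open>6 * card V\<close> ways). If both merely touch apex vertices, these are \<open>a1\<close>
  and \<open>a2\<close>, and an edge of \<open>B\<close> is used as well; it differs from the cross
  edge and so pins a fifth image.\<close>

lemma copies_through_cross_edge:
  assumes uw: "{u,w} \<in> cross V Q" and q: "card B \<le> card V"
  shows "card {\<phi> \<in> copies. \<exists>p\<in>kn t. \<exists>p'\<in>kn t. p \<inter> p' = {} \<and> {\<phi> p, \<phi> p'} = {u,w}} \<le>
    v ^ 6 * (12 * card B * card V * card V ^ (v - 6)) + v ^ 5 * (4 * card B * card V ^ (v - 5))"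
proof -
  let ?n = "card V" and ?q = "card B"
  \<comment> \<open>The possible images of the second monochromatic edge; their number is linear in
    \<open>card V\<close> as \<open>card B \<le> card V\<close>.\<close>
  define C where "C = orderedB \<union> ({a1,a2} \<times> V \<union> V \<times> {a1,a2})"
  define R6 where "R6 = (\<lambda>(p,q). [u,w,fst p,snd p,fst q,snd q]) ` (orderedB \<times> C)"
  define R5 where "R5 = (\<lambda>(p,y). [u,w,fst p,snd p,y]) ` ({(a1,a2),(a2,a1)} \<times> fst ` orderedB)"
  have finC: "finite C" using orderedB(1) finV by (simp add: C_def)
  have n1: "1 \<le> ?n" using apex(1) finV by (simp add: Suc_le_eq card_gt_0_iff) auto
  have cardap: "card {a1,a2} \<le> 2" using card_length[of "[a1,a2]"] by simp
  have cardC: "card C \<le> 6 * ?n"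
  proof -
    have "card C \<le> card orderedB + card ({a1,a2} \<times> V \<union> V \<times> {a1,a2})" unfolding C_def by (rule card_Un_le)
    also have "\<dots> \<le> card orderedB + (card ({a1,a2} \<times> V) + card (V \<times> {a1,a2}))" by (intro add_left_mono card_Un_le)
    also have "\<dots> = 2 * ?q + (card {a1,a2} * ?n + ?n * card {a1,a2})" by (simp only: orderedB(2) card_cartesian_product)
    also have "\<dots> \<le> 2 * ?n + (2 * ?n + ?n * 2)" using q cardap by (intro add_mono mult_le_mono) auto
    finally show ?thesis by simp
  qed
  have R6: "finite R6" "card R6 \<le> 12 * ?q * ?n"
  proof -
    show "finite R6" unfolding R6_def using orderedB(1) finC by simp
    have "card R6 \<le> card (orderedB \<times> C)" unfolding R6_def using orderedB(1) finC by (intro card_image_le) simp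
    also have "\<dots> = 2 * ?q * card C" by (simp add: card_cartesian_product orderedB(2))
    also have "\<dots> \<le> 2 * ?q * (6 * ?n)" by (intro mult_le_mono2 cardC)
    finally show "card R6 \<le> 12 * ?q * ?n" by simp
  qed
  have R5: "finite R5" "card R5 \<le> 4 * ?q"
  proof -
    show "finite R5" unfolding R5_def using orderedB(1) by simp
    have "card R5 \<le> card ({(a1,a2),(a2,a1)} \<times> fst ` orderedB)" unfolding R5_def using orderedB(1) by (intro card_image_le) simp
    also have "\<dots> = card {(a1,a2),(a2,a1)} * card (fst ` orderedB)" by (rule card_cartesian_product)
    also have "\<dots> \<le> 2 * (2 * ?q)"
    proof (rule mult_le_mono)
      show "card {(a1,a2),(a2,a1)} \<le> 2" using card_length[of "[(a1,a2),(a2,a1)]"] by simp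
      show "card (fst ` orderedB) \<le> 2 * ?q" using card_image_le[OF orderedB(1), of fst] orderedB(2) by simp
    qed
    finally show "card R5 \<le> 4 * ?q" by simp
  qed
  let ?S = "\<lambda>k R. {\<phi> \<in> kn t \<rightarrow>\<^sub>E V. \<exists>js. distinct js \<and> set js \<subseteq> kn t \<and> length js = k \<and> map \<phi> js \<in> R}"
  have sub: "{\<phi> \<in> copies. \<exists>p\<in>kn t. \<exists>p'\<in>kn t. p \<inter> p' = {} \<and> {\<phi> p, \<phi> p'} = {u,w}} \<subseteq> ?S 6 R6 \<union> ?S 5 R5"
  proof
    fix \<phi> assume "\<phi> \<in> {\<phi> \<in> copies. \<exists>p\<in>kn t. \<exists>p'\<in>kn t. p \<inter> p' = {} \<and> {\<phi> p, \<phi> p'} = {u,w}}"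
    then have \<phi>: "\<phi> \<in> copies" and "\<exists>p\<in>kn t. \<exists>p'\<in>kn t. p \<inter> p' = {} \<and> {\<phi> p, \<phi> p'} = {u,w}" by simp_all
    then obtain p0 p0' where p0: "p0 \<in> kn t" "p0' \<in> kn t" "p0 \<inter> p0' = {}" "{\<phi> p0, \<phi> p0'} = {u,w}" by blast
    then have "(\<phi> p0 = u \<and> \<phi> p0' = w) \<or> (\<phi> p0 = w \<and> \<phi> p0' = u)" by (simp add: doubleton_eq_iff)
    then obtain p p' where p: "p \<in> kn t" "p' \<in> kn t" "p \<inter> p' = {}" "\<phi> p = u" "\<phi> p' = w"
      using p0 by (metis Int_commute)
    have pp': "p \<noteq> p'" using p by (auto simp: pairs_def)
    have "\<exists>x1 y1 x2 y2. {x1,y1,x2,y2} \<subseteq> kn t - {p,p'} \<and> distinct [x1,y1,x2,y2] \<and>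
      x1 \<inter> y1 = {} \<and> x2 \<inter> y2 = {} \<and> colour \<phi> x1 = colour \<phi> y1 \<and> colour \<phi> x2 = colour \<phi> y2"
      by (rule kneser_two_disjoint_mono_edges[OF _ p(1-3)]) (use t5 colour_less in auto)
    then obtain x1 y1 x2 y2 where xs: "{x1,y1,x2,y2} \<subseteq> kn t - {p,p'}" "distinct [x1,y1,x2,y2]"
      and e1: "x1 \<inter> y1 = {}" "colour \<phi> x1 = colour \<phi> y1" and e2: "x2 \<inter> y2 = {}" "colour \<phi> x2 = colour \<phi> y2"
      by (elim exE conjE)
    have k: "x1 \<in> kn t" "y1 \<in> kn t" "x2 \<in> kn t" "y2 \<in> kn t" using xs(1) by blast+
    have off: "p \<notin> {x1,y1,x2,y2}" "p' \<notin> {x1,y1,x2,y2}" using xs(1) by blast+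
    have xsr: "distinct [x2,y2,x1,y1]" using xs(2) by auto
    have d6: "distinct [p,p',x1,y1,x2,y2]" "distinct [p,p',x2,y2,x1,y1]" using xs(2) xsr off pp' by simp_all
    have P: "\<phi> \<in> kn t \<rightarrow>\<^sub>E V" by (rule copyD(1)[OF \<phi>])
    have inC: "(\<phi> x, \<phi> y) \<in> C" if "x \<in> kn t" "y \<in> kn t" "x \<inter> y = {}" "colour \<phi> x = colour \<phi> y" for x y
    proof -
      have "\<phi> x \<in> V" "\<phi> y \<in> V" using copyD(2)[OF \<phi>] that by blast+
      then show ?thesis using mono_edge[OF \<phi> that] by (auto simp: C_def orderedB_def)
    qed
    have six: "\<phi> \<in> ?S 6 R6" if js: "distinct [p,p',x,y,x',y']" "{x,y,x',y'} \<subseteq> kn t" "(\<phi> x, \<phi> y) \<in> orderedB" "(\<phi> x', \<phi> y') \<in> C" for x y x' y'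
    proof -
      show ?thesis
      proof (intro CollectI conjI exI[of _ "[p,p',x,y,x',y']"])
        show "map \<phi> [p,p',x,y,x',y'] \<in> R6" unfolding R6_def
          by (rule image_eqI[of _ _ "((\<phi> x, \<phi> y), (\<phi> x', \<phi> y'))"]) (use js(3,4) p in simp_all)
        show "set [p,p',x,y,x',y'] \<subseteq> kn t" using js(2) p by simp
      qed (use P js(1) in simp_all)
    qed
    consider "{\<phi> x1, \<phi> y1} \<in> B" | "{\<phi> x2, \<phi> y2} \<in> B"
      | "\<phi> x1 \<in> {a1,a2} \<or> \<phi> y1 \<in> {a1,a2}" "\<phi> x2 \<in> {a1,a2} \<or> \<phi> y2 \<in> {a1,a2}"
      using mono_edge[OF \<phi> k(1,2) e1] mono_edge[OF \<phi> k(3,4) e2] by blast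
    then show "\<phi> \<in> ?S 6 R6 \<union> ?S 5 R5"
    proof cases
      case 1
      have "\<phi> \<in> ?S 6 R6" by (rule six[OF d6(1)]) (use 1 k inC[OF k(3,4) e2] in \<open>auto simp: orderedB_def\<close>)
      then show ?thesis by blast
    next
      case 2
      have "\<phi> \<in> ?S 6 R6" by (rule six[OF d6(2)]) (use 2 k inC[OF k(1,2) e1] in \<open>auto simp: orderedB_def\<close>)
      then show ?thesis by blast
    next
      case 3
      obtain z1 where z1: "z1 \<in> {x1,y1}" "\<phi> z1 \<in> {a1,a2}" using 3(1) by blast
      obtain z2 where z2: "z2 \<in> {x2,y2}" "\<phi> z2 \<in> {a1,a2}" using 3(2) by blast
      have zk: "z1 \<in> kn t" "z2 \<in> kn t" using z1(1) z2(1) k by blast+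
      have zd: "distinct [p,p',z1,z2]" using z1(1) z2(1)
        by (elim insertE emptyE) (use xs(2) off pp' in simp_all)
      then have "\<phi> z1 \<noteq> \<phi> z2" using copyD(3)[OF \<phi>] zk by (auto dest: inj_onD)
      then have za: "(\<phi> z1, \<phi> z2) \<in> {(a1,a2),(a2,a1)}" using z1(2) z2(2) by auto
      obtain x3 y3 where b: "x3 \<in> kn t" "y3 \<in> kn t" "x3 \<inter> y3 = {}" "{\<phi> x3, \<phi> y3} \<in> B"
        by (rule uses_inner_edge[OF \<phi>])
      \<comment> \<open>\<open>B\<close> contains no cross edge, so the inner edge has an end off
        \<open>p\<close> and \<open>p'\<close>; only that end is recorded in
        \<open>R5\<close>.\<close>
      have "\<not> (x3 \<in> {p,p'} \<and> y3 \<in> {p,p'})"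
      proof
        assume h: "x3 \<in> {p,p'} \<and> y3 \<in> {p,p'}"
        have "x3 \<noteq> y3" using b(1,3) by (auto simp: pairs_def)
        then have "{\<phi> x3, \<phi> y3} = {u,w}" using h p(4,5) by auto
        then show False using uw b(4) cross_B by auto
      qed
      then obtain y x where y: "y \<in> {x3,y3}" "x \<in> {x3,y3}" "y \<notin> {p,p'}" "{y,x} = {x3,y3}" by blast
      have yk: "y \<in> kn t" using y(1) b by blast
      have yB: "{\<phi> y, \<phi> x} \<in> B"
      proof -
        have "\<phi> ` {y,x} = \<phi> ` {x3,y3}" using y(4) by simp
        then show ?thesis using b(4) by simp
      qed
      have "Q (\<phi> y) < r" by (rule inner_edge(5)[OF yB])
      then have "\<phi> y \<notin> {a1,a2}" using apex by auto
      then have "y \<noteq> z1" "y \<noteq> z2" using z1(2) z2(2) by blast+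
      then have d5: "distinct [p,p',z1,z2,y]" using zd y(3) \<open>y \<noteq> z1\<close> \<open>y \<noteq> z2\<close> by auto
      have "(\<phi> y, \<phi> x) \<in> orderedB" using yB by (simp add: orderedB_def)
      then have "\<phi> y \<in> fst ` orderedB" by (rule rev_image_eqI) simp
      have "\<phi> \<in> ?S 5 R5"
      proof (intro CollectI conjI exI[of _ "[p,p',z1,z2,y]"])
        show "map \<phi> [p,p',z1,z2,y] \<in> R5" unfolding R5_def
          by (rule image_eqI[of _ _ "((\<phi> z1, \<phi> z2), \<phi> y)"]) (use za p \<open>\<phi> y \<in> fst ` orderedB\<close> in simp_all)
        show "set [p,p',z1,z2,y] \<subseteq> kn t" using p zk yk by simp
      qed (use P d5 in simp_all)
      then show ?thesis by blast
    qed
  qed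
  have finS: "finite (?S k R)" for k and R :: "'a list set"
    by (rule finite_subset[of _ "kn t \<rightarrow>\<^sub>E V"]) (auto intro!: finite_PiE finite_pairs finV)
  have "card {\<phi> \<in> copies. \<exists>p\<in>kn t. \<exists>p'\<in>kn t. p \<inter> p' = {} \<and> {\<phi> p, \<phi> p'} = {u,w}} \<le> card (?S 6 R6 \<union> ?S 5 R5)"
    using finS by (intro card_mono sub) simp
  also have "\<dots> \<le> card (?S 6 R6) + card (?S 5 R5)" by (rule card_Un_le)
  also have "\<dots> \<le> v ^ 6 * (card R6 * card V ^ (v - 6)) + v ^ 5 * (card R5 * card V ^ (v - 5))"
    by (intro add_mono card_maps_union finV R6 R5) (auto simp: finite_pairs)
  also have "\<dots> \<le> v ^ 6 * (12 * ?q * ?n * card V ^ (v - 6)) + v ^ 5 * (4 * ?q * card V ^ (v - 5))"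
    using R6 R5 by (intro add_mono mult_le_mono2 mult_le_mono1)
  finally show ?thesis .
qed

text \<open>A copy that avoided one of \<open>a1\<close>, \<open>a2\<close>, \<open>x0\<close> would
  have at most two vertices on these three; deleting them leaves a monochromatic edge, which would
  need an inner edge off \<open>x0\<close>. So \<open>a1\<close>, \<open>a2\<close>,
  \<open>x0\<close> and a leaf of the star are pinned, and only the leaf varies.\<close>

lemma star_copies:
  assumes B: "B = (\<lambda>y. {x0,y}) ` Y" and x0: "Q x0 < r" and Y: "finite Y"
  shows "card copies \<le> v ^ 4 * (card Y * card V ^ (v - 4))"
proof -
  define R where "R = (\<lambda>y. [a1,a2,x0,y]) ` Y"
  have R: "finite R" "card R \<le> card Y" using Y by (auto simp: R_def card_image_le)
  let ?S = "{\<phi> \<in> kn t \<rightarrow>\<^sub>E V. \<exists>js. distinct js \<and> set js \<subseteq> kn t \<and> length js = 4 \<and> map \<phi> js \<in> R}"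
  have sub: "copies \<subseteq> ?S"
  proof
    fix \<phi> assume \<phi>: "\<phi> \<in> copies"
    let ?D = "\<lambda>A. {x \<in> kn t. \<phi> x \<in> A}"
    have hit: "\<exists>x\<in>kn t. \<phi> x = z" if z: "z \<in> {a1,a2,x0}" for z
    proof (rule ccontr)
      assume no: "\<not> ?thesis"
      then have eq: "?D {a1,a2,x0} = ?D ({a1,a2,x0} - {z})" by auto
      have "card (?D ({a1,a2,x0} - {z})) \<le> card ({a1,a2,x0} - {z})" by (rule preimage_card[OF \<phi>]) simp
      also have "\<dots> < card {a1,a2,x0}" using z by (intro psubset_card_mono) auto
      also have "\<dots> \<le> 3" using card_length[of "[a1,a2,x0]"] by simp
      finally have d: "card (?D {a1,a2,x0}) < 3" using eq by simp
      have "\<exists>x\<in>kn t - ?D {a1,a2,x0}. \<exists>y\<in>kn t - ?D {a1,a2,x0}. x \<inter> y = {} \<and> colour \<phi> x = colour \<phi> y"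
        using t5 d colour_less by (intro kneser_cover) auto
      then obtain x y where xy: "x \<in> kn t - ?D {a1,a2,x0}" "y \<in> kn t - ?D {a1,a2,x0}" "x \<inter> y = {}" "colour \<phi> x = colour \<phi> y"
        by (elim bexE conjE)
      then have "{\<phi> x, \<phi> y} \<in> B" using mono_edge[OF \<phi>, of x y] by simp
      then have "\<phi> x = x0 \<or> \<phi> y = x0" unfolding B by (auto simp: doubleton_eq_iff)
      then show False using xy by auto
    qed
    obtain p1 where p1: "p1 \<in> kn t" "\<phi> p1 = a1" using hit[of a1] by auto
    obtain p2 where p2: "p2 \<in> kn t" "\<phi> p2 = a2" using hit[of a2] by auto
    obtain x y where xy: "x \<in> kn t" "y \<in> kn t" "x \<inter> y = {}" "{\<phi> x, \<phi> y} \<in> B"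
      by (rule uses_inner_edge[OF \<phi>])
    obtain w where w: "w \<in> Y" "{\<phi> x, \<phi> y} = {x0,w}" using xy(4) unfolding B by (elim imageE) blast
    have "\<exists>p3 p4. p3 \<in> kn t \<and> p4 \<in> kn t \<and> \<phi> p3 = x0 \<and> \<phi> p4 = w"
    proof -
      have "(\<phi> x = x0 \<and> \<phi> y = w) \<or> (\<phi> x = w \<and> \<phi> y = x0)" using w(2) by (simp add: doubleton_eq_iff)
      then show ?thesis
      proof
        assume "\<phi> x = x0 \<and> \<phi> y = w"
        with xy(1,2) show ?thesis by (intro exI[of _ x] exI[of _ y]) simp
      next
        assume "\<phi> x = w \<and> \<phi> y = x0"
        with xy(1,2) show ?thesis by blast
      qed
    qed
    then obtain p3 p4 where p34: "p3 \<in> kn t" "p4 \<in> kn t" "\<phi> p3 = x0" "\<phi> p4 = w" by (elim exE conjE)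
    have p: "p3 \<in> kn t" "p4 \<in> kn t" "\<phi> p3 = x0" "\<phi> p4 = w" "w \<in> Y" "{\<phi> p3, \<phi> p4} \<in> B"
      using p34 w xy(4) by simp_all
    have xw: "{x0, w} \<in> B" using p(6) unfolding p34(3,4) .
    have "Q w < r" "x0 \<noteq> w" using inner_edge[OF xw] by simp_all
    then have ne: "a1 \<noteq> a2" "a1 \<noteq> x0" "a1 \<noteq> w" "a2 \<noteq> x0" "a2 \<noteq> w" "x0 \<noteq> w" using apex(3,4) x0 by auto
    have m: "map \<phi> [p1,p2,p3,p4] = [a1,a2,x0,w]" using p1(2) p2(2) p34(3,4) by simp
    have "distinct (map \<phi> [p1,p2,p3,p4])" unfolding m using ne by simp
    then have d: "distinct [p1,p2,p3,p4]" unfolding distinct_map by (rule conjunct1)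
    show "\<phi> \<in> ?S"
    proof (intro CollectI conjI exI[of _ "[p1,p2,p3,p4]"])
      show "map \<phi> [p1,p2,p3,p4] \<in> R" unfolding m R_def using w(1) by (rule imageI)
      show "set [p1,p2,p3,p4] \<subseteq> kn t" using p1(1) p2(1) p34(1,2) by simp
      show "\<phi> \<in> kn t \<rightarrow>\<^sub>E V" by (rule copyD(1)[OF \<phi>])
    qed (rule d, simp)
  qed
  have "finite ?S" by (rule finite_subset[of _ "kn t \<rightarrow>\<^sub>E V"]) (auto intro!: finite_PiE finite_pairs finV)
  then have "card copies \<le> card ?S" using sub by (rule card_mono)
  also have "\<dots> \<le> v ^ 4 * (card R * card V ^ (v - 4))"
    by (intro card_maps_union finV R) (simp add: finite_pairs)
  also have "\<dots> \<le> v ^ 4 * (card Y * card V ^ (v - 4))" using R by (intro mult_le_mono2 mult_le_mono1)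
  finally show ?thesis .
qed

end

section \<open>Moving a vertex to another class\<close>

text \<open>The transposition of \<open>s\<close> and \<open>w\<close> preserves the host graph, and
  composing with it exchanges the two kinds of copies.\<close>

lemma embeddings_swap:
  fixes V :: "'a set"
  assumes V: "finite V" and s: "s \<in> V" and w: "w \<in> V"
    and inv: "\<And>x y. {x,y} \<in> E \<Longrightarrow> {if x = s then w else if x = w then s else x, if y = s then w else if y = w then s else y} \<in> E"
  shows "card {\<phi> \<in> embeddings (kneser2 t) (V,E). s \<in> \<phi> ` kn t \<and> w \<notin> \<phi> ` kn t} \<le>
    card {\<phi> \<in> embeddings (kneser2 t) (V,E). w \<in> \<phi> ` kn t \<and> s \<notin> \<phi> ` kn t}"
proof -
  let ?A = "{\<phi> \<in> embeddings (kneser2 t) (V,E). s \<in> \<phi> ` kn t \<and> w \<notin> \<phi> ` kn t}"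
  let ?B = "{\<phi> \<in> embeddings (kneser2 t) (V,E). w \<in> \<phi> ` kn t \<and> s \<notin> \<phi> ` kn t}"
  define tau where "tau x = (if x = s then w else if x = w then s else x)" for x
  have tt: "tau (tau x) = x" for x by (simp add: tau_def)
  have tinj: "tau x = tau y \<longleftrightarrow> x = y" for x y by (metis tt)
  have tV: "tau x \<in> V \<longleftrightarrow> x \<in> V" for x using s w by (auto simp: tau_def)
  have ts: "tau s = w" "tau w = s" by (simp_all add: tau_def)
  let ?f = "\<lambda>\<phi>. restrict (tau \<circ> \<phi>) (kn t)"
  show ?thesis
  proof (rule card_inj_on_le[of ?f])
    show "finite ?B" using finite_kneser_embeddings[OF V] by simp
    show "inj_on ?f ?A"
    proof (rule inj_onI)
      fix f g assume f: "f \<in> ?A" and g: "g \<in> ?A" and eq: "?f f = ?f g"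
      show "f = g"
      proof (rule PiE_ext[of _ "kn t" "\<lambda>_. V"])
        show "f \<in> kn t \<rightarrow>\<^sub>E V" "g \<in> kn t \<rightarrow>\<^sub>E V" using f g by (simp_all add: kneser_embeddings_iff)
        fix x assume "x \<in> kn t"
        then show "f x = g x" using fun_cong[OF eq, of x] tinj by simp
      qed
    qed
    show "?f ` ?A \<subseteq> ?B"
    proof
      fix g assume "g \<in> ?f ` ?A"
      then obtain \<phi> where g: "g = ?f \<phi>" and \<phi>: "\<phi> \<in> ?A" by blast
      have emb: "\<phi> \<in> kn t \<rightarrow>\<^sub>E V" "inj_on \<phi> (kn t)"
        and edge: "\<And>a b. a \<in> kn t \<Longrightarrow> b \<in> kn t \<Longrightarrow> a \<inter> b = {} \<Longrightarrow> {\<phi> a, \<phi> b} \<in> E"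
        using \<phi> by (simp_all add: kneser_embeddings_iff)
      have gx: "g x = tau (\<phi> x)" if "x \<in> kn t" for x using that g by simp
      have im: "g ` kn t = tau ` \<phi> ` kn t" using gx by (auto simp: image_image)
      have "g \<in> kn t \<rightarrow>\<^sub>E V" using emb(1) tV unfolding g by (auto simp: PiE_iff)
      moreover have "inj_on g (kn t)" using emb(2) gx tinj by (simp add: inj_on_def)
      moreover have "{g a, g b} \<in> E" if "a \<in> kn t" "b \<in> kn t" "a \<inter> b = {}" for a b
        using inv[OF edge[OF that]] gx that by (simp add: tau_def)
      ultimately have "g \<in> embeddings (kneser2 t) (V,E)" by (simp add: kneser_embeddings_iff)
      moreover have "w \<in> g ` kn t" unfolding im using \<phi> ts by (metis (no_types, lifting) imageI mem_Collect_eq)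
      moreover have "s \<notin> g ` kn t"
      proof
        assume "s \<in> g ` kn t"
        then obtain u where "u \<in> \<phi> ` kn t" "s = tau u" unfolding im by blast
        then have "u = w" using tt ts by metis
        then show False using \<phi> \<open>u \<in> \<phi> ` kn t\<close> by simp
      qed
      ultimately show "g \<in> ?B" by simp
    qed
  qed
qed

text \<open>Symmetrization: a vertex \<open>s\<close> moved into the class \<open>j\<close> becomes a twin of the untouched
  vertices there, so it lies in no more copies than these do on average.\<close>

lemma move_vertex_copies:
  fixes V :: "'a set" and Q :: "'a \<Rightarrow> nat"
  assumes V: "finite V" and s: "s \<in> V" "s \<notin> \<Union>B"
    and T: "T \<subseteq> {w \<in> V. Q w = j \<and> w \<notin> \<Union>B}" and sj: "Q s \<noteq> j" and big: "card (kn t) < card T"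
  shows "real (card (embeddings (kneser2 t) (V, cross V (Q(s := j)) \<union> B))) \<le>
    card (embeddings (kneser2 t) (V, cross V Q \<union> B)) * (1 + card (kn t) / (card T - card (kn t)))"
proof -
  let ?Q = "Q(s := j)" and ?v = "card (kn t)"
  let ?E = "cross V (Q(s := j)) \<union> B"
  let ?M = "embeddings (kneser2 t) (V, ?E)" and ?N = "embeddings (kneser2 t) (V, cross V Q \<union> B)"
  define S1 where "S1 = {\<phi> \<in> ?M. s \<in> \<phi> ` kn t}"
  define S0 where "S0 = {\<phi> \<in> ?M. s \<notin> \<phi> ` kn t}"
  have fin: "finite ?M" "finite ?N" "finite S1" "finite S0" using finite_kneser_embeddings[OF V] by (simp_all add: S1_def S0_def)
  have finT: "finite T" using T V finite_subset by fastforce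
  have finim: "finite (\<phi> ` kn t)" "card (\<phi> ` kn t) \<le> ?v" for \<phi> :: "nat set \<Rightarrow> 'a"
    by (simp_all add: finite_pairs card_image_le)
  have M: "card ?M = card S0 + card S1"
  proof -
    have "?M = S0 \<union> S1" by (auto simp: S0_def S1_def)
    moreover have "S0 \<inter> S1 = {}" by (auto simp: S0_def S1_def)
    ultimately show ?thesis using fin by (simp add: card_Un_disjoint)
  qed
  have S0N: "S0 \<subseteq> ?N"
  proof
    fix \<phi> assume "\<phi> \<in> S0"
    then have \<phi>: "\<phi> \<in> ?M" and ns: "\<And>x. x \<in> kn t \<Longrightarrow> \<phi> x \<noteq> s" by (auto simp: S0_def)
    have "{\<phi> a, \<phi> b} \<in> cross V Q \<union> B" if "a \<in> kn t" "b \<in> kn t" "a \<inter> b = {}" for a b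
    proof -
      have "{\<phi> a, \<phi> b} \<in> ?E" using \<phi> that by (simp add: kneser_embeddings_iff)
      then show ?thesis using ns[OF that(1)] ns[OF that(2)] by (simp add: in_cross)
    qed
    then show "\<phi> \<in> ?N" using \<phi> by (simp add: kneser_embeddings_iff)
  qed
  have swap: "card {\<phi> \<in> S1. w \<notin> \<phi> ` kn t} \<le> card {\<phi> \<in> S0. w \<in> \<phi> ` kn t}" if w: "w \<in> T" for w
  proof -
    have wp: "w \<in> V" "Q w = j" "w \<notin> \<Union>B" using T w by auto
    have ws: "w \<noteq> s" using wp(2) sj by auto
    have "card {\<phi> \<in> ?M. s \<in> \<phi> ` kn t \<and> w \<notin> \<phi> ` kn t} \<le> card {\<phi> \<in> ?M. w \<in> \<phi> ` kn t \<and> s \<notin> \<phi> ` kn t}"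
    proof (rule embeddings_swap[OF V s(1) wp(1)])
      fix x y assume xy: "{x,y} \<in> ?E"
      let ?t = "\<lambda>x. if x = s then w else if x = w then s else x"
      show "{?t x, ?t y} \<in> ?E"
      proof (cases "{x,y} \<in> B")
        case True
        then have "x \<noteq> s" "x \<noteq> w" "y \<noteq> s" "y \<noteq> w" using s(2) wp(3) by auto
        then show ?thesis using True by simp
      next
        case False
        then have h: "x \<in> V" "y \<in> V" "?Q x \<noteq> ?Q y" using xy by (simp_all add: in_cross)
        have "?Q (?t u) = ?Q u" for u using wp(2) ws by simp
        moreover have "?t u \<in> V" if "u \<in> V" for u using that s(1) wp(1) by simp
        ultimately have "{?t x, ?t y} \<in> cross V ?Q" unfolding in_cross using h by simp
        then show ?thesis by blast
      qed
    qed
    moreover have "{\<phi> \<in> S1. w \<notin> \<phi> ` kn t} = {\<phi> \<in> ?M. s \<in> \<phi> ` kn t \<and> w \<notin> \<phi> ` kn t}" by (auto simp: S1_def)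
    moreover have "{\<phi> \<in> S0. w \<in> \<phi> ` kn t} = {\<phi> \<in> ?M. w \<in> \<phi> ` kn t \<and> s \<notin> \<phi> ` kn t}" by (auto simp: S0_def)
    ultimately show ?thesis by simp
  qed
  \<comment> \<open>Pairs of a copy and a vertex of \<open>T\<close> are counted in two ways: a copy
    through \<open>s\<close> avoids at least \<open>card T - ?v\<close> vertices of
    \<open>T\<close>, while a copy off \<open>s\<close>, which is already present in the old graph,
    meets at most \<open>?v\<close> of them.\<close>
  have "real (card S1) * (real (card T) - ?v) = (\<Sum>\<phi>\<in>S1. real (card T) - ?v)" by simp
  also have "\<dots> \<le> (\<Sum>\<phi>\<in>S1. real (card {w \<in> T. w \<notin> \<phi> ` kn t}))"
  proof (rule sum_mono)
    fix \<phi>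
    have "card T - card (\<phi> ` kn t) \<le> card (T - \<phi> ` kn t)" by (rule diff_card_le_card_Diff[OF finim(1)])
    moreover have "T - \<phi> ` kn t = {w \<in> T. w \<notin> \<phi> ` kn t}" by blast
    ultimately show "real (card T) - ?v \<le> real (card {w \<in> T. w \<notin> \<phi> ` kn t})" using finim(2)[of \<phi>] by simp
  qed
  also have "\<dots> = real (\<Sum>\<phi>\<in>S1. \<Sum>w\<in>T. if w \<notin> \<phi> ` kn t then 1 else 0)"
    using card_filter_sum[OF finT] by simp
  also have "\<dots> = real (\<Sum>w\<in>T. \<Sum>\<phi>\<in>S1. if w \<notin> \<phi> ` kn t then 1 else 0)" by (subst sum.swap) (rule refl)
  also have "\<dots> = real (\<Sum>w\<in>T. card {\<phi> \<in> S1. w \<notin> \<phi> ` kn t})" using card_filter_sum[OF fin(3)] by simp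
  also have "\<dots> \<le> real (\<Sum>w\<in>T. card {\<phi> \<in> S0. w \<in> \<phi> ` kn t})" by (intro of_nat_mono sum_mono swap)
  also have "\<dots> = real (\<Sum>w\<in>T. \<Sum>\<phi>\<in>S0. if w \<in> \<phi> ` kn t then 1 else 0)" using card_filter_sum[OF fin(4)] by simp
  also have "\<dots> = real (\<Sum>\<phi>\<in>S0. \<Sum>w\<in>T. if w \<in> \<phi> ` kn t then 1 else 0)" by (subst sum.swap) (rule refl)
  also have "\<dots> = real (\<Sum>\<phi>\<in>S0. card {w \<in> T. w \<in> \<phi> ` kn t})" using card_filter_sum[OF finT] by simp
  also have "\<dots> \<le> real (\<Sum>\<phi>\<in>S0. ?v)"
  proof (intro of_nat_mono sum_mono)
    fix \<phi>
    have "card {w \<in> T. w \<in> \<phi> ` kn t} \<le> card (\<phi> ` kn t)" by (intro card_mono finim) blast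
    then show "card {w \<in> T. w \<in> \<phi> ` kn t} \<le> ?v" using finim(2)[of \<phi>] by linarith
  qed
  also have "\<dots> = real (card S0) * ?v" by simp
  also have "\<dots> \<le> real (card ?N) * ?v" using card_mono[OF fin(2) S0N] by (simp add: mult_right_mono)
  finally have "real (card S1) \<le> real (card ?N) * (?v / (card T - ?v))"
    using big by (simp add: field_simps of_nat_diff)
  moreover have "real (card S0) \<le> real (card ?N)" using card_mono[OF fin(2) S0N] by simp
  ultimately show ?thesis unfolding M by (simp add: algebra_simps)
qed

text \<open>Only the squares of two class sizes change. In particular a move to a class smaller by
  at least two gains a cross edge.\<close>

lemma card_cross_move:
  fixes V :: "'a set" and Q :: "'a \<Rightarrow> nat"
  assumes V: "finite V" and Q: "\<And>x. x \<in> V \<Longrightarrow> Q x < K" and s: "s \<in> V" "Q s = i" and j: "j < K" "i \<noteq> j"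
  shows "card (cross V (Q(s := j))) + card {x \<in> V. Q x = j} + 1 = card (cross V Q) + card {x \<in> V. Q x = i}"
proof -
  let ?Q = "Q(s := j)"
  let ?n = "\<lambda>k. card {x \<in> V. Q x = k}" and ?m = "\<lambda>k. card {x \<in> V. ?Q x = k}"
  have iK: "i < K" using Q[OF s(1)] s(2) by simp
  have a: "2 * card (cross V Q) + (\<Sum>k<K. (?n k)^2) = (card V)^2" by (rule card_cross[OF V Q])
  have b: "2 * card (cross V ?Q) + (\<Sum>k<K. (?m k)^2) = (card V)^2" by (rule card_cross[OF V]) (use Q j in auto)
  have mi: "?m i + 1 = ?n i"
  proof -
    have "{x \<in> V. Q x = i} = insert s {x \<in> V. ?Q x = i}" using s j by auto
    moreover have "s \<notin> {x \<in> V. ?Q x = i}" using j by simp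
    ultimately show ?thesis using V by simp
  qed
  have mj: "?m j = ?n j + 1"
  proof -
    have "{x \<in> V. ?Q x = j} = insert s {x \<in> V. Q x = j}" using s j by auto
    moreover have "s \<notin> {x \<in> V. Q x = j}" using s j by simp
    ultimately show ?thesis using V by simp
  qed
  have mk: "?m k = ?n k" if "k \<noteq> i" "k \<noteq> j" for k
    using that s(2) by (intro arg_cong[of _ _ card]) auto
  have split: "(\<Sum>k<K. f k) = f i + f j + (\<Sum>k\<in>{..<K} - {i,j}. f k)" for f :: "nat \<Rightarrow> nat"
  proof -
    have "(\<Sum>k<K. f k) = (\<Sum>k\<in>{i,j}. f k) + (\<Sum>k\<in>{..<K} - {i,j}. f k)"
      using iK j by (subst sum.union_disjoint[symmetric]) (auto intro: sum.cong)
    then show ?thesis using j by simp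
  qed
  have rest: "(\<Sum>k\<in>{..<K} - {i,j}. (?m k)^2) = (\<Sum>k\<in>{..<K} - {i,j}. (?n k)^2)"
    using mk by (intro sum.cong) auto
  have "2 * card (cross V Q) + ((?n i)^2 + (?n j)^2) = 2 * card (cross V ?Q) + ((?m i)^2 + (?m j)^2)"
    using a b split[of "\<lambda>k. (?n k)^2"] split[of "\<lambda>k. (?m k)^2"] rest by linarith
  moreover have "(?n i)^2 = (?m i)^2 + 2 * ?m i + 1" unfolding mi[symmetric] by (simp add: power2_eq_square)
  moreover have "(?m j)^2 = (?n j)^2 + 2 * ?n j + 1" unfolding mj by (simp add: power2_eq_square)
  ultimately show ?thesis using mi by linarith
qed

section \<open>Edges of apex graphs\<close>

text \<open>Class sizes \<open>m\<close> equal to \<open>k\<close> or \<open>k + 1\<close> satisfy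
  \<open>m^2 = (2 k + 1) m - k (k + 1)\<close>. Summing this over the classes evaluates half of
  \<open>n^2\<close> minus the squares of the class sizes, where the two singleton apex classes
  account for the 2.\<close>

definition extremal_size :: "nat \<Rightarrow> nat \<Rightarrow> nat" where
  "extremal_size r n = (let k = (n - 2) div r in (n^2 + r * (k * (k + 1)) - ((2 * k + 1) * (n - 2) + 2)) div 2)"

context apex_graph
begin

abbreviation "class_size j \<equiv> card {x \<in> V. Q x = j}"

definition balanced :: bool where "balanced \<longleftrightarrow> (\<forall>i<r. \<forall>j<r. class_size i \<le> class_size j + 1)"

lemma r_pos: "0 < r" using t5 r_def by simp

lemma class_sizes: "(\<Sum>j<r. class_size j) + 2 = card V"
  and apex_sizes: "class_size r = 1" "class_size (Suc r) = 1"
proof -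
  have a: "{x \<in> V. Q x = r} = {a1}" "{x \<in> V. Q x = Suc r} = {a2}" using Q apex by fastforce+
  then show ones: "class_size r = 1" "class_size (Suc r) = 1" by simp_all
  have "V = (\<Union>j<Suc (Suc r). {x \<in> V. Q x = j})" using Q apex by (fastforce simp: less_Suc_eq)
  then have "card V = card (\<Union>j<Suc (Suc r). {x \<in> V. Q x = j})" by simp
  also have "\<dots> = (\<Sum>j<Suc (Suc r). class_size j)" using finV by (subst card_UN_disjoint) auto
  also have "\<dots> = (\<Sum>j<r. class_size j) + 2" using ones by simp
  finally show "(\<Sum>j<r. class_size j) + 2 = card V" by simp
qed

lemma cross_squares: "2 * card (cross V Q) + (\<Sum>j<r. (class_size j)^2) + 2 = (card V)^2"
proof -
  have "2 * card (cross V Q) + (\<Sum>j<Suc (Suc r). (class_size j)^2) = (card V)^2"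
    by (rule card_cross[OF finV]) (use Q apex in \<open>fastforce simp: less_Suc_eq\<close>)
  then show ?thesis using apex_sizes by simp
qed

text \<open>The tangent inequality \<open>(2 k + 1) m \<le> m\<^sup>2 + k (k + 1)\<close> at the balanced sizes \<open>k\<close>, \<open>k + 1\<close>.\<close>

lemma cross_size_bound:
  fixes k :: nat
  defines "k \<equiv> (card V - 2) div r"
  shows "2 * card (cross V Q) + ((2 * k + 1) * (card V - 2) + 2) \<le> (card V)^2 + r * (k * (k + 1))"
    and "balanced \<Longrightarrow> 2 * card (cross V Q) + ((2 * k + 1) * (card V - 2) + 2) = (card V)^2 + r * (k * (k + 1))"
proof -
  have S: "(\<Sum>j<r. class_size j) = card V - 2" using class_sizes by simp
  have tang: "(2 * k + 1) * m \<le> m^2 + k * (k + 1)" for m :: nat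
  proof (cases "m \<le> k")
    case True
    then obtain d where "k = m + d" using le_Suc_ex by blast
    then show ?thesis by (simp add: power2_eq_square algebra_simps)
  next
    case False
    then obtain d where "m = k + Suc d" using less_imp_Suc_add[of k m] by auto
    then show ?thesis by (simp add: power2_eq_square algebra_simps)
  qed
  have "(2 * k + 1) * (card V - 2) = (\<Sum>j<r. (2 * k + 1) * class_size j)" by (simp only: S[symmetric] sum_distrib_left)
  also have "\<dots> \<le> (\<Sum>j<r. (class_size j)^2 + k * (k + 1))" by (intro sum_mono tang)
  also have "\<dots> = (\<Sum>j<r. (class_size j)^2) + r * (k * (k + 1))" by (simp only: sum.distrib sum_constant card_lessThan of_nat_id)
  finally show "2 * card (cross V Q) + ((2 * k + 1) * (card V - 2) + 2) \<le> (card V)^2 + r * (k * (k + 1))"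
    using cross_squares by linarith
  assume bal: balanced
  define m where "m = Min (class_size ` {..<r})"
  have fin: "finite (class_size ` {..<r})" "class_size ` {..<r} \<noteq> {}" using r_pos by auto
  obtain j0 where j0: "j0 < r" "class_size j0 = m" using Min_in[OF fin] by (auto simp: m_def)
  have rng: "m \<le> class_size j" "class_size j \<le> m + 1" if "j < r" for j
  proof -
    show "m \<le> class_size j" unfolding m_def using that by (intro Min_le) auto
    show "class_size j \<le> m + 1" using bal that j0 by (auto simp: balanced_def)
  qed
  have "r * m \<le> card V - 2" using sum_mono[of "{..<r}" "\<lambda>_. m" class_size] rng S by simp
  moreover have "card V - 2 < r * (m + 1)"
  proof -
    have "(\<Sum>j<r. class_size j) < (\<Sum>j<r. m + 1)"
      by (rule sum_strict_mono_ex1) (use rng j0 in \<open>auto intro!: bexI[of _ j0]\<close>)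
    then show ?thesis using S by simp
  qed
  ultimately have km: "k = m" unfolding k_def using r_pos
    by (intro div_nat_eqI) (simp_all add: algebra_simps)
  have eqt: "(2 * k + 1) * class_size j = (class_size j)^2 + k * (k + 1)" if "j < r" for j
  proof -
    have "class_size j = k \<or> class_size j = k + 1" using rng[OF that] km by linarith
    then show ?thesis by (elim disjE) (simp_all add: power2_eq_square algebra_simps)
  qed
  have "(2 * k + 1) * (card V - 2) = (\<Sum>j<r. (2 * k + 1) * class_size j)" by (simp only: S[symmetric] sum_distrib_left)
  also have "\<dots> = (\<Sum>j<r. (class_size j)^2 + k * (k + 1))" by (rule sum.cong[OF refl], rule eqt) simp
  also have "\<dots> = (\<Sum>j<r. (class_size j)^2) + r * (k * (k + 1))" by (simp only: sum.distrib sum_constant card_lessThan of_nat_id)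
  finally show "2 * card (cross V Q) + ((2 * k + 1) * (card V - 2) + 2) = (card V)^2 + r * (k * (k + 1))"
    using cross_squares by linarith
qed

lemma cross_le_extremal: "card (cross V Q) \<le> extremal_size r (card V)"
proof -
  have gen: "2 * c + x \<le> y \<Longrightarrow> c \<le> (y - x) div 2" for c x y :: nat by linarith
  show ?thesis unfolding extremal_size_def Let_def by (rule gen[OF cross_size_bound(1)])
qed

lemma cross_balanced: "balanced \<Longrightarrow> card (cross V Q) = extremal_size r (card V)"
proof -
  assume b: balanced
  have gen: "2 * c + x = y \<Longrightarrow> c = (y - x) div 2" for c x y :: nat by linarith
  show ?thesis unfolding extremal_size_def Let_def by (rule gen[OF cross_size_bound(2)[OF b]])
qed

lemma card_touched: "card (\<Union>B) \<le> 2 * card B"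
proof -
  have "card (\<Union>B) \<le> (\<Sum>e\<in>B. card e)" by (rule card_Union_le_sum_card)
  also have "\<dots> \<le> (\<Sum>e\<in>B. 2)"
  proof (rule sum_mono)
    fix e assume "e \<in> B"
    then obtain x y where "e = {x,y}" using inner by blast
    then show "card e \<le> 2" using card_length[of "[x,y]"] by simp
  qed
  finally show ?thesis by simp
qed

lemma move:
  assumes s: "s \<in> V" "Q s < r" "s \<notin> \<Union>B" and j: "j < r"
  shows "apex_graph t r V (Q(s := j)) B a1 a2"
proof
  show "t \<ge> 5" "r = t - 3" "finite V" by (fact t5 r_def finV)+
  show "(Q(s := j)) x < r \<or> x = a1 \<or> x = a2" if "x \<in> V" for x using Q[OF that] j by simp
  show "a1 \<in> V" "a2 \<in> V" by (fact apex)+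
  show "(Q(s := j)) a1 = r" "(Q(s := j)) a2 = Suc r" using apex s(2) by auto
  show "\<exists>x y. e = {x,y} \<and> x \<in> V \<and> y \<in> V \<and> x \<noteq> y \<and> (Q(s := j)) x = (Q(s := j)) y" if e: "e \<in> B" for e
  proof -
    obtain x y where xy: "e = {x,y}" "x \<in> V" "y \<in> V" "x \<noteq> y" "Q x = Q y" using inner[OF e] by blast
    then have "x \<noteq> s" "y \<noteq> s" using s(3) e by auto
    then show ?thesis using xy by (intro exI[of _ x] exI[of _ y]) simp
  qed
qed

lemma unbalanced_class:
  assumes "\<not> balanced"
  obtains i j where "i < r" "j < r" "class_size j + 1 < class_size i"
  using assms by (auto simp: balanced_def not_le)

end

text \<open>A potential argument: the copies plus \<open>X\<close> times the deficit of cross edges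
  never exceed \<open>Z\<close>. A move to a class smaller by at least two lowers the deficit by at
  least one and, by symmetrization, creates at most \<open>X\<close> copies. Vertices touched by
  \<open>B\<close> stay put; the bound \<open>m\<close> guarantees others, and it survives since the
  class that loses a vertex stays at least as large as the other one was.\<close>

lemma rebalance:
  fixes m X Z :: real
  assumes "apex_graph t r V Q B a1 a2" and "\<And>j. j < r \<Longrightarrow> m \<le> card {x \<in> V. Q x = j}"
    and m: "card (kn t) + 2 * card B < m" and X: "Z * (card (kn t) / (m - 2 * card B - card (kn t))) \<le> X" "0 \<le> X"
    and "card (embeddings (kneser2 t) (V, cross V Q \<union> B)) + (real (extremal_size r (card V)) - card (cross V Q)) * X \<le> Z"
  shows "\<exists>Q'. apex_graph t r V Q' B a1 a2 \<and> apex_graph.balanced r V Q' \<and> card (embeddings (kneser2 t) (V, cross V Q' \<union> B)) \<le> Z"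
  using assms(1,2,6)
proof (induction "extremal_size r (card V) - card (cross V Q)" arbitrary: Q rule: less_induct)
  case less
  interpret A: apex_graph t r V Q B a1 a2 by (rule less.prems(1))
  have Qle: "card (cross V Q) \<le> extremal_size r (card V)" by (rule A.cross_le_extremal)
  have "0 \<le> (real (extremal_size r (card V)) - card (cross V Q)) * X" using Qle X(2) by simp
  then have NZ: "real (card A.copies) \<le> Z" using less.prems(3) by simp
  show ?case
  proof (cases A.balanced)
    case True
    then show ?thesis using less.prems(1) NZ by blast
  next
    case False
    then obtain i j where ij: "i < r" "j < r" "A.class_size j + 1 < A.class_size i" by (rule A.unbalanced_class)
    have finU: "finite (\<Union>B)" using A.inner A.finite_B by (intro finite_Union) auto
    have free: "card {x \<in> V. Q x = k} - 2 * real (card B) \<le> card {x \<in> V. Q x = k \<and> x \<notin> \<Union>B}" for k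
    proof -
      have "card {x \<in> V. Q x = k} - card (\<Union>B) \<le> card ({x \<in> V. Q x = k} - \<Union>B)" by (rule diff_card_le_card_Diff[OF finU])
      moreover have "{x \<in> V. Q x = k} - \<Union>B = {x \<in> V. Q x = k \<and> x \<notin> \<Union>B}" by blast
      ultimately show ?thesis using A.card_touched by simp
    qed
    have "0 < card {x \<in> V. Q x = i \<and> x \<notin> \<Union>B}" using free[of i] less.prems(2)[OF ij(1)] m by linarith
    then obtain s where s: "s \<in> V" "Q s = i" "s \<notin> \<Union>B" by (auto simp: card_gt_0_iff)
    let ?Q = "Q(s := j)" and ?T = "{w \<in> V. Q w = j \<and> w \<notin> \<Union>B}"
    have neq: "i \<noteq> j" using ij by auto
    have ag: "apex_graph t r V ?Q B a1 a2" using s ij by (intro A.move) auto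
    interpret A': apex_graph t r V ?Q B a1 a2 by (rule ag)
    have mv: "card (cross V ?Q) + A.class_size j + 1 = card (cross V Q) + A.class_size i"
      by (rule card_cross_move[OF A.finV, where K = "Suc (Suc r)"]) (use A.Q A.apex s ij neq in \<open>fastforce simp: less_Suc_eq\<close>)+
    then have up: "card (cross V Q) + 1 \<le> card (cross V ?Q)" using ij by linarith
    have Q'le: "card (cross V ?Q) \<le> extremal_size r (card V)" by (rule A'.cross_le_extremal)
    have Tsize: "m - 2 * card B \<le> card ?T" using free[of j] less.prems(2)[OF ij(2)] by linarith
    have den: "0 < m - 2 * card B - card (kn t)" using m by linarith
    have "real (card A'.copies) \<le> card A.copies * (1 + card (kn t) / (card ?T - card (kn t)))"
    proof (rule move_vertex_copies[OF A.finV s(1,3)])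
      show "card (kn t) < card ?T" using Tsize den by linarith
    qed (use s neq in auto)
    also have "\<dots> = card A.copies + card A.copies * (card (kn t) / (card ?T - card (kn t)))" by (simp add: algebra_simps)
    also have "\<dots> \<le> card A.copies + Z * (card (kn t) / (m - 2 * card B - card (kn t)))"
      using NZ Tsize den by (intro add_left_mono mult_mono divide_left_mono mult_pos_pos) auto
    also have "\<dots> \<le> card A.copies + X" using X by simp
    finally have step: "real (card A'.copies) \<le> card A.copies + X" .
    show ?thesis
    proof (rule less.hyps[OF _ ag])
      show "extremal_size r (card V) - card (cross V ?Q) < extremal_size r (card V) - card (cross V Q)"
        using up Q'le by linarith
      show "m \<le> A'.class_size k" if k: "k < r" for k
      proof -
        consider "k = i" | "k = j" | "k \<noteq> i" "k \<noteq> j" by blast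
        then show ?thesis
        proof cases
          case 1
          have "{x \<in> V. Q x = i} = insert s {x \<in> V. ?Q x = i}" using s neq by auto
          then have "A.class_size i \<le> A'.class_size i + 1" by (metis (no_types, lifting) Suc_eq_plus1 card_insert_le_m1 diff_Suc_1 zero_less_Suc order_refl)
          then have "A.class_size j \<le> A'.class_size i" using ij(3) by linarith
          then show ?thesis unfolding 1 using less.prems(2)[OF ij(2)] by linarith
        next
          case 2
          have "A.class_size j \<le> A'.class_size j" using A.finV s by (intro card_mono) auto
          then show ?thesis unfolding 2 using less.prems(2)[OF ij(2)] by linarith
        next
          case 3
          have "A'.class_size k = A.class_size k" using 3 s by (intro arg_cong[of _ _ card]) auto
          then show ?thesis using less.prems(2)[OF k] by linarith
        qed
      qed
      have "(real (extremal_size r (card V)) - card (cross V ?Q)) * X \<le> (real (extremal_size r (card V)) - card (cross V Q) - 1) * X"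
        using up X(2) by (intro mult_right_mono) auto
      also have "\<dots> = (real (extremal_size r (card V)) - card (cross V Q)) * X - X" by (simp add: algebra_simps)
      finally show "card A'.copies + (real (extremal_size r (card V)) - card (cross V ?Q)) * X \<le> Z"
        using step less.prems(3) by linarith
    qed
  qed
qed

text \<open>Completing the square in the tangent formula: the slack is
  \<open>r * ((n-2) / r - k - 1/2)^2\<close>. The \<open>+ 1\<close> absorbs the rounding of
  \<open>div 2\<close>.\<close>

lemma extremal_size_bound:
  assumes r: "r > 0" and n: "n \<ge> 2" "r \<le> n"
  shows "real n^2 - 2 - (real n - 2)^2 / r - real r / 4 \<le> 2 * real (extremal_size r n) + 1"
proof -
  define k where "k = (n - 2) div r"
  define Y where "Y = n^2 + r * (k * (k + 1))"
  define X where "X = (2 * k + 1) * (n - 2) + 2"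
  have nn: "real (n - 2) = real n - 2" using n by simp
  let ?N = "real n - 2"
  have "real X - real Y = (2 * real k + 1) * ?N + 2 - real n^2 - r * (real k * (real k + 1))"
  proof -
    have "real X = (2 * real k + 1) * ?N + 2"
      unfolding X_def by (simp only: of_nat_add of_nat_mult nn of_nat_numeral of_nat_1)
    moreover have "real Y = real n^2 + r * (real k * (real k + 1))" by (simp add: Y_def algebra_simps)
    ultimately show ?thesis by linarith
  qed
  also have "\<dots> \<le> ?N^2 / r + real r / 4 + 2 - real n^2"
  proof -
    have "(2 * real k + 1) * ?N - r * (real k * (real k + 1)) = ?N^2 / r + real r / 4 - r * (?N / r - real k - 1/2)^2"
      using r by (simp add: power2_eq_square field_simps)
    moreover have "0 \<le> r * (?N / r - real k - 1/2)^2" by simp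
    ultimately show ?thesis by linarith
  qed
  finally have diff: "real n^2 - 2 - ?N^2 / r - real r / 4 \<le> real Y - real X" by linarith
  have "real Y - real X \<le> 2 * real (extremal_size r n) + 1"
  proof -
    have "extremal_size r n = (Y - X) div 2" by (simp add: extremal_size_def Let_def k_def X_def Y_def)
    then have "Y - X \<le> 2 * extremal_size r n + 1" by linarith
    then show ?thesis by linarith
  qed
  then show ?thesis using diff by linarith
qed

section \<open>Comparison with an apex graph\<close>

lemma card_filter_split: "finite A \<Longrightarrow> card A = card {a \<in> A. S a} + card {a \<in> A. \<not> S a}"
proof -
  assume A: "finite A"
  have "card ({a \<in> A. S a} \<union> {a \<in> A. \<not> S a}) = card {a \<in> A. S a} + card {a \<in> A. \<not> S a}"
    using A by (intro card_Un_disjoint) auto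
  moreover have "{a \<in> A. S a} \<union> {a \<in> A. \<not> S a} = A" by blast
  ultimately show ?thesis by simp
qed

context near_turan
begin

abbreviation "kv \<equiv> card (kn t)"
abbreviation "count F \<equiv> card (embeddings (kneser2 t) (V, F))"
definition kappa :: real where "kappa = n / (32 * real r)"

text \<open>All parts of the final comparison are measured against \<open>unit\<close>, a lower bound for the number
  of copies created by a single edge inside a class.\<close>

definition unit :: real where "unit = (n / (4 * real r)) ^ (kv - 4)"

lemma unit_pos: "0 < unit" using n_pos r2 by (simp add: unit_def)

lemma kv6: "6 \<le> kv"
  using card_kn_ge[OF t5] by simp

lemma few_nonneighbours:
  assumes a: "a \<in> high" shows "card {w \<in> typ_set j. {a,w} \<notin> E} \<le> kappa + 2"
proof -
  have "{w \<in> typ_set j. {a,w} \<notin> E} \<subseteq> {w \<in> rest. {a,w} \<notin> E} \<union> high" using typ_V by blast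
  then have "card {w \<in> typ_set j. {a,w} \<notin> E} \<le> card ({w \<in> rest. {a,w} \<notin> E} \<union> high)"
    using finV finite_high by (intro card_mono) auto
  also have "\<dots> \<le> card {w \<in> rest. {a,w} \<notin> E} + card high" by (rule card_Un_le)
  also have "card {w \<in> rest. {a,w} \<notin> E} \<le> total_missing"
    using a finite_high by (intro member_le_sum) auto
  finally show ?thesis using two_high unfolding kappa_def by linarith
qed

lemma large_n: "kappa \<ge> 6 + real r"
  using n3 r2 by (simp add: kappa_def field_simps)

lemma small_ep: "ep * n \<le> kappa / 32"
proof -
  have rr: "real r \<ge> 2" using r2 by simp
  have "ep * n \<le> 1 / (1024 * real r^2) * n" using ep n_pos by (intro mult_right_mono) auto
  also have "\<dots> \<le> 1 / (1024 * real r) * n"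
    using rr n_pos by (intro mult_right_mono divide_left_mono) (auto simp: power2_eq_square)
  finally show ?thesis by (simp add: kappa_def)
qed

lemma small_z: "2 * z * n \<le> kappa / 32"
proof -
  have "2 * z * n \<le> 2 * (ep / 4) * n" using z n_pos by (intro mult_right_mono mult_left_mono) auto
  also have "\<dots> \<le> ep * n" using pos n_pos by simp
  finally show ?thesis using small_ep by linarith
qed

lemma small_greedy: "6 + kv * (mu * n + 1) \<le> kappa / 32"
proof -
  have "al * n / 2 \<le> (ep / 2) * n / 2" using al n_pos by (intro divide_right_mono mult_right_mono) auto
  moreover have "0 < ep * n" using pos n_pos by simp
  ultimately show ?thesis using n1 small_ep by linarith
qed

lemma n_kappa: "n / r = 32 * kappa" "n / (4 * real r) = 8 * kappa" "n / (2 * real r) = 16 * kappa" by (simp_all add: kappa_def)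

text \<open>Of the at least \<open>31 * kappa\<close> typical vertices of a class, the four
  prescribed vertices exclude at most \<open>4 * kappa + 4\<close>, so
  \<open>two_apex_copies\<close> applies with \<open>n / (2 r) = 16 * kappa\<close>; after the
  greedy losses this still exceeds the base \<open>8 * kappa\<close> of \<open>unit\<close>.\<close>

lemma inside_edge_copies:
  assumes hi: "high = {a1,a2}" "a1 \<noteq> a2" and x: "x \<in> rest" "y \<in> rest" "{x,y} \<in> E" "P x = P y"
    and m: "card (missing V E P x) \<le> kappa" "card (missing V E P y) \<le> kappa"
  shows "unit \<le> card {\<phi> \<in> embeddings (kneser2 t) (V, E).
    (\<exists>p\<in>kn t. \<exists>q\<in>kn t. p \<inter> q = {} \<and> {\<phi> p, \<phi> q} = {x,y}) \<and>
    (\<forall>p\<in>kn t. \<forall>q\<in>kn t. p \<inter> q = {} \<longrightarrow> P (\<phi> p) = P (\<phi> q) \<longrightarrow> {\<phi> p, \<phi> q} = {x,y} \<or> \<phi> p \<in> {a1,a2} \<or> \<phi> q \<in> {a1,a2})}"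
    (is "_ \<le> real (card ?T)")
proof -
  let ?be = "n / (2 * real r)"
  have xy: "x \<noteq> y" using x(3) loop by auto
  have i: "P x < r" using x(1) Pr by blast
  have a: "a1 \<in> high" "a2 \<in> high" using hi by simp_all
  have typ_big: "31 * kappa \<le> card (typ_set j)" if "j < r" for j
  proof -
    have "32 * kappa - 2 * z * n \<le> card (typ_set j)" using typical_size[OF that] by (simp only: n_kappa(1))
    moreover have "0 < kappa" using n_pos r2 by (simp add: kappa_def)
    ultimately show ?thesis using small_z by linarith
  qed
  have k6: "6 \<le> kappa" using large_n by linarith
  have "(?be - 6 - kv * (mu * n + 1)) ^ (kv - 4) \<le> real (card ?T)"
  proof (rule two_apex_copies[OF t5 _ finV, where i = "P x"])
    show "P x < t - 3" using i r_def by simp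
    show "a1 \<in> V" "a2 \<in> V" using a high_subset by blast+
    show "x \<in> V" "y \<in> V" using x by blast+
    have "x \<notin> high" "y \<notin> high" using x by blast+
    then show "distinct [a1,a2,x,y]" using hi xy by auto
    show "{x,y} \<in> E" "P x = P x" "P y = P x" using x by simp_all
    show "?be \<le> card {w \<in> typ_set (P x). {b,w} \<in> E}" if b: "b \<in> {a1,a2}" for b
    proof -
      have "card (typ_set (P x)) = card {w \<in> typ_set (P x). {b,w} \<in> E} + card {w \<in> typ_set (P x). {b,w} \<notin> E}"
        by (rule card_filter_split[OF finite_typ])
      moreover have "b \<in> high" using b hi by simp
      ultimately show ?thesis using typ_big[OF i] few_nonneighbours[of b "P x"] k6 unfolding n_kappa(3) by linarith
    qed
    show "?be \<le> card {w \<in> typ_set j. \<forall>b\<in>{a1,a2,x,y}. {b,w} \<in> E}" if j: "j < t - 3" "j \<noteq> P x" for j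
    proof -
      let ?G = "{w \<in> typ_set j. \<forall>b\<in>{a1,a2,x,y}. {b,w} \<in> E}"
      let ?N = "\<lambda>b. {w \<in> typ_set j. {b,w} \<notin> E}"
      have fin: "finite (?N b)" for b using finite_typ by simp
      have mm: "card (?N b) \<le> card (missing V E P b)" if "P b = P x" for b
        using that j finV by (intro card_mono) (auto simp: typical_def missing_def)
      have "typ_set j \<subseteq> ?G \<union> (?N a1 \<union> (?N a2 \<union> (?N x \<union> ?N y)))" by blast
      then have "card (typ_set j) \<le> card (?G \<union> (?N a1 \<union> (?N a2 \<union> (?N x \<union> ?N y))))"
        using finite_typ by (intro card_mono) auto
      also have "\<dots> \<le> card ?G + card (?N a1 \<union> (?N a2 \<union> (?N x \<union> ?N y)))" by (rule card_Un_le)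
      also have "card (?N a1 \<union> (?N a2 \<union> (?N x \<union> ?N y))) \<le> card (?N a1) + card (?N a2 \<union> (?N x \<union> ?N y))" by (rule card_Un_le)
      also have "card (?N a2 \<union> (?N x \<union> ?N y)) \<le> card (?N a2) + card (?N x \<union> ?N y)" by (rule card_Un_le)
      also have "card (?N x \<union> ?N y) \<le> card (?N x) + card (?N y)" by (rule card_Un_le)
      finally have "real (card (typ_set j)) \<le> card ?G + (card (?N a1) + (card (?N a2) + (real (card (?N x)) + card (?N y))))" by simp
      moreover have "card (?N a1) \<le> kappa + 2" "card (?N a2) \<le> kappa + 2" using few_nonneighbours a by blast+
      moreover have "card (?N x) \<le> kappa" using mm[of x] m(1) by simp
      moreover have "card (?N y) \<le> kappa" using mm[of y] m(2) x(4) by simp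
      moreover have "31 * kappa \<le> card (typ_set j)" using typ_big[of j] j r_def by simp
      ultimately have "16 * kappa \<le> card ?G" using k6 by linarith
      then show ?thesis by (simp only: n_kappa(3))
    qed
    show "0 \<le> mu * n" using pos n_pos by simp
    show "kv * (mu * n + 1) \<le> ?be - 6" unfolding n_kappa(3) using small_greedy k6 by linarith
  qed
  moreover have "unit \<le> (?be - 6 - kv * (mu * n + 1)) ^ (kv - 4)"
    unfolding unit_def
  proof (rule power_mono)
    show "n / (4 * real r) \<le> ?be - 6 - kv * (mu * n + 1)" unfolding n_kappa using small_greedy k6 by linarith
  qed (use n_pos in simp)
  ultimately show ?thesis by linarith
qed

end

text \<open>Let \<open>B0\<close> be the edges inside classes, \<open>M\<close> the missing cross
  edges and \<open>def\<close> the loss of cross edges by unbalanced classes; then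
  \<open>card B0 = q + def + card M\<close>. Every edge of \<open>B0\<close> turns out to own at
  least \<open>unit\<close> copies that use no other edge of \<open>B0\<close>. Keeping only
  \<open>q\<close> of these edges saves \<open>unit\<close> for each of the other
  \<open>def + card M\<close>; restoring \<open>M\<close> costs at most \<open>unit\<close> per
  edge, and \<open>def * unit\<close> remains to pay for the balancing moves.\<close>

lemma (in near_turan) optimal_structure:
  fixes q :: nat
  assumes eE: "card E = extremal_size r (card V) + q" and q: "1 \<le> q" and q1: "4096 * real r * real kv^6 * (4 * real r) ^ (kv - 4) * q \<le> n"
    and few: "count E \<le> real kv ^ 4 * (q * n ^ (kv - 4))" and n4: "8 * real r * real kv \<le> n"
  shows "0 < count E \<and> (\<exists>Q a1 a2 B. apex_graph t r V Q B a1 a2 \<and> apex_graph.balanced r V Q \<and> card B = q \<and>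
    count (cross V Q \<union> B) \<le> count E)"
proof -
  have rr: "real r \<ge> 2" using r2 by simp
  have kv1: "real kv \<ge> 6" using kv6 by simp
  have k6: "6 \<le> kappa" using large_n by linarith
  have "E \<subseteq> Pow V" using simple by blast
  then have finE: "finite E" using finV by (simp add: finite_subset)
  define W where "W = (4 * real r) ^ (kv - 4)"
  have W1: "1 \<le> W" unfolding W_def using rr by (intro one_le_power) simp
  have Wu: "W * unit = n ^ (kv - 4)" 
  proof -
    have "W * unit = ((4 * real r) * (n / (4 * real r))) ^ (kv - 4)" unfolding W_def unit_def by (rule power_mult_distrib[symmetric])
    moreover have "(4 * real r) * (n / (4 * real r)) = n" using rr by simp
    ultimately show ?thesis by simp
  qed
  obtain a1 a2 where hi: "high = {a1,a2}" "a1 \<noteq> a2" using two_high(1) by (auto simp: card_2_iff)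
  have aV: "a1 \<in> V" "a2 \<in> V" using hi high_subset by auto
  \<comment> \<open>As singleton classes the two high vertices count as joined to everything;
    whatever they miss becomes part of \<open>M\<close>.\<close>
  define Q where "Q = P(a1 := r, a2 := Suc r)"
  have offa: "x \<noteq> a1 \<and> x \<noteq> a2" if "x \<in> rest" for x using that hi(1) by blast
  have Qr: "Q x = P x" if "x \<in> rest" for x using offa[OF that] by (simp add: Q_def)
  have Qa: "Q a1 = r" "Q a2 = Suc r" using hi(2) by (simp_all add: Q_def)
  have Qlt: "Q x < r \<or> x = a1 \<or> x = a2" if "x \<in> V" for x 
  proof (cases "x \<in> high")
    case True then show ?thesis using hi(1) by blast
  next
    case False then show ?thesis using Qr[of x] Pr[OF that] that by simp
  qed
  define B0 where "B0 = E - cross V Q"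
  define M where "M = cross V Q - E"
  have B0rep: "\<exists>x y. e = {x,y} \<and> x \<in> rest \<and> y \<in> rest \<and> x \<noteq> y \<and> P x = P y \<and> Q x = Q y \<and> {x,y} \<in> E" if e: "e \<in> B0" for e
  proof -
    have eE': "e \<in> E" "e \<notin> cross V Q" using e by (auto simp: B0_def)
    obtain x y where xy: "e = {x,y}" "x \<noteq> y" using simple[OF eE'(1)] by (auto simp: card_2_iff)
    have xyV: "x \<in> V" "y \<in> V" using simple[OF eE'(1)] xy by auto
    have Qeq: "Q x = Q y" using eE'(2) xy xyV by (simp add: in_cross)
    have "x \<noteq> a1" "x \<noteq> a2" "y \<noteq> a1" "y \<noteq> a2" using Qlt[OF xyV(1)] Qlt[OF xyV(2)] xy(2) Qa Qeq by auto
    then have rst: "x \<in> rest" "y \<in> rest" using xyV hi(1) by blast+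
    show ?thesis
      by (rule exI[of _ x], rule exI[of _ y]) (use xy Qeq Qr[OF rst(1)] Qr[OF rst(2)] rst eE'(1) in simp)
  qed
  have sub_apex: "apex_graph t r V Q B a1 a2" if B: "B \<subseteq> B0" for B
  proof
    show "\<exists>x y. e = {x,y} \<and> x \<in> V \<and> y \<in> V \<and> x \<noteq> y \<and> Q x = Q y" if "e \<in> B" for e
      using B0rep[of e] that B by blast
  qed (use t5 r_def finV Qlt aV Qa in auto)
  interpret A0: apex_graph t r V Q B0 a1 a2 by (rule sub_apex) simp
  have cross_le: "card (cross V Q) \<le> extremal_size r (card V)" by (rule A0.cross_le_extremal)
  define def where "def = extremal_size r (card V) - card (cross V Q)"
  have cardB0: "card B0 = q + def + card M"
  proof -
    have finc: "finite (cross V Q)" by (rule finite_cross[OF finV])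
    have "card E = card (E \<inter> cross V Q) + card B0" unfolding B0_def using finE by (rule card_Int_Diff)
    moreover have "card (cross V Q) = card (cross V Q \<inter> E) + card M" unfolding M_def using finc by (rule card_Int_Diff)
    ultimately show ?thesis using eE cross_le by (simp add: def_def Int_commute)
  qed
  have finM: "finite M" unfolding M_def using finite_cross[OF finV] by simp
  have finB0: "finite B0" using finE by (simp add: B0_def)
  let ?emb = "\<lambda>F. embeddings (kneser2 t) (V, F)"
  \<comment> \<open>The copies owned by \<open>e\<close>: no other edge of \<open>B0\<close> occurs
    in them, so these sets are disjoint and their sizes add up.\<close>
  define S where "S e = {\<phi> \<in> ?emb E. (\<exists>p\<in>kn t. \<exists>p'\<in>kn t. p \<inter> p' = {} \<and> {\<phi> p, \<phi> p'} = e) \<and>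
      (\<forall>p\<in>kn t. \<forall>p'\<in>kn t. p \<inter> p' = {} \<longrightarrow> {\<phi> p, \<phi> p'} \<in> B0 \<longrightarrow> {\<phi> p, \<phi> p'} = e)}" for e
  have finS: "finite (S e)" for e using finite_kneser_embeddings[OF finV] by (simp add: S_def)
  have finemb: "finite (?emb F)" for F by (rule finite_kneser_embeddings[OF finV])
  have Sdisj: "S e \<inter> S e' = {}" if "e \<in> B0" "e' \<in> B0" "e \<noteq> e'" for e e'
    using that unfolding S_def by blast
  have SU: "card (\<Union>e\<in>F. S e) = (\<Sum>e\<in>F. card (S e))" if F: "F \<subseteq> B0" for F
  proof (rule card_UN_disjoint)
    show "finite F" using F finB0 finite_subset by blast
    show "\<forall>i\<in>F. \<forall>j\<in>F. i \<noteq> j \<longrightarrow> S i \<inter> S j = {}" using F by (intro ballI impI Sdisj) blast+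
  qed (simp add: finS)
  define ok where "ok = {e \<in> B0. unit \<le> card (S e)}"
  have okI: "e \<in> ok" if e: "e = {x,y}" "e \<in> B0" "x \<in> rest" "y \<in> rest" "{x,y} \<in> E" "P x = P y"
    "card (missing V E P x) \<le> kappa" "card (missing V E P y) \<le> kappa" for e x y
  proof -
    have "unit \<le> card {\<phi> \<in> ?emb E. (\<exists>p\<in>kn t. \<exists>q\<in>kn t. p \<inter> q = {} \<and> {\<phi> p, \<phi> q} = {x,y}) \<and>
      (\<forall>p\<in>kn t. \<forall>q\<in>kn t. p \<inter> q = {} \<longrightarrow> P (\<phi> p) = P (\<phi> q) \<longrightarrow> {\<phi> p, \<phi> q} = {x,y} \<or> \<phi> p \<in> {a1,a2} \<or> \<phi> q \<in> {a1,a2})}"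
      (is "_ \<le> real (card ?T)") by (rule inside_edge_copies[OF hi e(3-8)])
    also have "?T \<subseteq> S e"
    proof
      fix \<phi> assume "\<phi> \<in> ?T"
      then have \<phi>: "\<phi> \<in> ?emb E" "\<exists>p\<in>kn t. \<exists>q\<in>kn t. p \<inter> q = {} \<and> {\<phi> p, \<phi> q} = {x,y}"
        and mono: "\<forall>p\<in>kn t. \<forall>q\<in>kn t. p \<inter> q = {} \<longrightarrow> P (\<phi> p) = P (\<phi> q) \<longrightarrow> {\<phi> p, \<phi> q} = {x,y} \<or> \<phi> p \<in> {a1,a2} \<or> \<phi> q \<in> {a1,a2}"
        by simp_all
      have "{\<phi> p, \<phi> p'} = e" if pp: "p \<in> kn t" "p' \<in> kn t" "p \<inter> p' = {}" "{\<phi> p, \<phi> p'} \<in> B0" for p p'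
      proof -
        obtain x' y' where "{\<phi> p, \<phi> p'} = {x',y'}" "x' \<in> rest" "y' \<in> rest" "P x' = P y'" using B0rep[OF pp(4)] by blast
        then have "\<phi> p \<in> rest" "\<phi> p' \<in> rest" "P (\<phi> p) = P (\<phi> p')" by (auto simp: doubleton_eq_iff)
        then have "{\<phi> p, \<phi> p'} = {x,y}" using mono pp(1-3) hi by blast
        then show ?thesis using e(1) by simp
      qed
      then show "\<phi> \<in> S e" unfolding S_def e(1) using \<phi> e(1) by blast
    qed
    then have "card ?T \<le> card (S e)" by (rule card_mono[OF finS])
    finally show ?thesis using e(2) by (simp add: ok_def)
  qed
  have okfin: "finite ok" "ok \<subseteq> B0" using finB0 by (auto simp: ok_def)
  have okcount: "real (card ok) * unit \<le> count E"
  proof -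
    have "real (card ok) * unit = (\<Sum>e\<in>ok. unit)" by simp
    also have "\<dots> \<le> (\<Sum>e\<in>ok. real (card (S e)))" by (intro sum_mono) (simp add: ok_def)
    also have "\<dots> = real (card (\<Union>e\<in>ok. S e))" using SU[OF okfin(2)] by simp
    also have "\<dots> \<le> count E" by (intro of_nat_mono card_mono finemb) (auto simp: S_def)
    finally show ?thesis .
  qed
  have q2: "4096 * real r * real kv^6 * W * q \<le> n" using q1 by (simp add: W_def)
  have cE: "count E \<le> real kv^4 * q * W * unit" 
  proof -
    have "real kv^4 * q * W * unit = real kv^4 * (q * (W * unit))" by (simp only: mult.assoc)
    then show ?thesis using few by (simp only: Wu)
  qed
  have okle: "real (card ok) \<le> real kv^4 * q * W"
    using okcount cE unit_pos by (meson mult_le_cancel_right_pos order_trans)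
  \<comment> \<open>The 4096 in the bound on \<open>q\<close> is 32 times 128, with the 32 from
    \<open>kappa = n / (32 r)\<close>.\<close>
  have okn: "real (card ok) \<le> kappa / 128"
  proof -
    have "real kv^4 * q * W \<le> real kv^6 * q * W" using kv1 W1 by (intro mult_right_mono power_increasing) auto
    then have "4096 * real r * (real kv^4 * q * W) \<le> 4096 * real r * (real kv^6 * q * W)" using rr by (intro mult_left_mono) auto
    then have "4096 * real r * (real kv^4 * q * W) \<le> n" using q2 by (simp add: mult_ac)
    then have "real kv^4 * q * W \<le> kappa / 128" using rr by (simp add: kappa_def field_simps)
    then show ?thesis using okle by linarith
  qed
  define X where "X = {x \<in> rest. \<not> card (missing V E P x) \<le> kappa}"
  have finX: "finite X" using finV by (simp add: X_def)
  have XB: "card (B0 - ok) \<le> card X * (ep * n)"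
  proof -
    have "B0 - ok \<subseteq> (\<Union>x\<in>X. (\<lambda>y. {x,y}) ` inside V E P x)"
    proof
      fix e assume e: "e \<in> B0 - ok"
      then obtain x y where xy: "e = {x,y}" "x \<in> rest" "y \<in> rest" "P x = P y" "{x,y} \<in> E" using B0rep[of e] by blast
      then have "\<not> card (missing V E P x) \<le> kappa \<or> \<not> card (missing V E P y) \<le> kappa" using okI[OF xy(1) _ xy(2,3,5,4)] e by blast
      then show "e \<in> (\<Union>x\<in>X. (\<lambda>y. {x,y}) ` inside V E P x)"
      proof
        assume "\<not> card (missing V E P x) \<le> kappa"
        then have "x \<in> X" "y \<in> inside V E P x" using xy by (auto simp: X_def inside_def)
        then show ?thesis using xy(1) by blast
      next
        assume "\<not> card (missing V E P y) \<le> kappa"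
        then have "y \<in> X" "x \<in> inside V E P y" using xy by (auto simp: X_def inside_def insert_commute)
        moreover have "e = {y,x}" using xy(1) by auto
        ultimately show ?thesis by blast
      qed
    qed
    then have "card (B0 - ok) \<le> card (\<Union>x\<in>X. (\<lambda>y. {x,y}) ` inside V E P x)"
      using finX finV by (intro card_mono) (auto simp: inside_def)
    also have "\<dots> \<le> (\<Sum>x\<in>X. card ((\<lambda>y. {x,y}) ` inside V E P x))" by (rule card_UN_le[OF finX])
    also have "\<dots> \<le> (\<Sum>x\<in>X. card (inside V E P x))" using finV by (intro sum_mono card_image_le) (auto simp: inside_def)
    finally have "real (card (B0 - ok)) \<le> (\<Sum>x\<in>X. real (card (inside V E P x)))" by (simp flip: of_nat_sum)
    also have "\<dots> \<le> (\<Sum>x\<in>X. ep * n)" by (intro sum_mono) (auto simp: X_def high_def)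
    finally show ?thesis by simp
  qed
  have XM: "card X * (kappa - 2) \<le> 2 * real (card M)"
  proof -
    have "card X * (kappa - 2) = (\<Sum>x\<in>X. kappa - 2)" by simp
    also have "\<dots> \<le> (\<Sum>x\<in>X. real (card (missing rest E P x)))"
    proof (rule sum_mono)
      fix x assume x: "x \<in> X"
      have "missing V E P x \<subseteq> missing rest E P x \<union> high" by (auto simp: missing_def)
      then have "card (missing V E P x) \<le> card (missing rest E P x \<union> high)"
        using finV finite_high by (intro card_mono) (auto simp: missing_def)
      also have "\<dots> \<le> card (missing rest E P x) + card high" by (rule card_Un_le)
      finally show "kappa - 2 \<le> real (card (missing rest E P x))" using x two_high(1) by (auto simp: X_def)
    qed
    also have "\<dots> = real (card (Sigma X (missing rest E P)))" using finX finV by (subst card_SigmaI) (auto simp: missing_def)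
    also have "\<dots> \<le> real (card (opairs V M))"
    proof (intro of_nat_mono card_mono finite_opairs finV subsetI)
      fix p assume "p \<in> Sigma X (missing rest E P)"
      then obtain x y where p: "p = (x,y)" "x \<in> rest" "y \<in> rest" "P y \<noteq> P x" "{x,y} \<notin> E"
        by (auto simp: X_def missing_def)
      then have "Q x \<noteq> Q y" using Qr by simp
      then show "p \<in> opairs V M" using p by (simp add: opairs_def M_def in_cross)
    qed
    also have "card (opairs V M) = 2 * card M"
      by (rule card_opairs_simple[OF _ finV]) (use cross_simple in \<open>auto simp: M_def\<close>)
    finally show ?thesis by simp
  qed
  \<comment> \<open>A vertex of \<open>X\<close> accounts on average for at least
    \<open>(kappa - 2) / 2\<close> edges of \<open>M\<close>, but for at most \<open>ep * n\<close>
    edges of \<open>B0 - ok\<close>. As \<open>card M \<le> card B0\<close>, a nonempty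
    \<open>X\<close> would make \<open>ok\<close> larger than \<open>okn\<close> allows.\<close>
  have XE: "X = {}"
  proof (rule ccontr)
    assume "X \<noteq> {}"
    then have X1: "1 \<le> real (card X)" using finX by (simp add: Suc_le_eq card_gt_0_iff)
    have "card B0 = card ok + card (B0 - ok)" using okfin finB0 by (metis card_Diff_subset card_mono le_add_diff_inverse)
    then have "real (card M) \<le> card ok + card X * (ep * n)" using cardB0 XB by linarith
    then have "2 * real (card M) \<le> 2 * (card ok + card X * (ep * n))" by simp
    with XM have "card X * (kappa - 2) \<le> 2 * (card ok + card X * (ep * n))" by (rule order_trans)
    then have "card X * (kappa - 2 - 2 * (ep * n)) \<le> 2 * card ok" by (simp add: algebra_simps)
    moreover have "1 * (kappa / 2) \<le> card X * (kappa - 2 - 2 * (ep * n))"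
      using X1 small_ep k6 by (intro mult_mono) auto
    ultimately show False using okn k6 by linarith
  qed
  have allok: "ok = B0"
  proof
    show "B0 \<subseteq> ok"
    proof
      fix e assume e: "e \<in> B0"
      then obtain x y where xy: "e = {x,y}" "x \<in> rest" "y \<in> rest" "P x = P y" "{x,y} \<in> E" using B0rep[of e] by blast
      show "e \<in> ok" by (rule okI[OF xy(1) e xy(2,3,5,4)]) (use XE xy in \<open>auto simp: X_def\<close>)
    qed
  qed (rule okfin)
  obtain B where B: "B \<subseteq> B0" "card B = q" using cardB0 by (metis (no_types, lifting) add.assoc le_add1 obtain_subset_with_card_n)
  interpret A: apex_graph t r V Q B a1 a2 by (rule sub_apex[OF B(1)])
  let ?H = "cross V Q \<union> B"
  \<comment> \<open>The copies free of \<open>B0 - B\<close> and the copies owned by the edges of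
    \<open>B0 - B\<close> are disjoint parts of all copies in \<open>E\<close>.\<close>
  have lower: "real (count (E \<inter> ?H)) + card (B0 - B) * unit \<le> count E"
  proof -
    have "card (B0 - B) * unit = (\<Sum>e\<in>B0 - B. unit)" by simp
    also have "\<dots> \<le> (\<Sum>e\<in>B0 - B. real (card (S e)))" using allok by (intro sum_mono) (auto simp: ok_def)
    also have "\<dots> = real (card (\<Union>e\<in>B0 - B. S e))" using SU[of "B0 - B"] by simp
    finally have u: "card (B0 - B) * unit \<le> real (card (\<Union>e\<in>B0 - B. S e))" .
    have disj: "?emb (E \<inter> ?H) \<inter> (\<Union>e\<in>B0 - B. S e) = {}"
    proof -
      have False if e: "e \<in> B0 - B" "\<phi> \<in> S e" "\<phi> \<in> ?emb (E \<inter> ?H)" for \<phi> e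
      proof -
        obtain p p' where "p \<in> kn t" "p' \<in> kn t" "p \<inter> p' = {}" "{\<phi> p, \<phi> p'} = e" using e(2) unfolding S_def by blast
        then have "e \<in> ?H" using e(3) by (auto simp: kneser_embeddings_iff)
        then show False using e(1) by (auto simp: B0_def)
      qed
      then show ?thesis by blast
    qed
    have "S e \<subseteq> ?emb E" for e by (auto simp: S_def)
    moreover have "?emb (E \<inter> ?H) \<subseteq> ?emb E" unfolding kneser_embeddings_iff subset_iff by blast
    ultimately have "?emb (E \<inter> ?H) \<union> (\<Union>e\<in>B0 - B. S e) \<subseteq> ?emb E" by (intro Un_least UN_least)
    then have "card (?emb (E \<inter> ?H) \<union> (\<Union>e\<in>B0 - B. S e)) \<le> count E" by (rule card_mono[OF finemb])
    moreover have "card (?emb (E \<inter> ?H) \<union> (\<Union>e\<in>B0 - B. S e)) = count (E \<inter> ?H) + card (\<Union>e\<in>B0 - B. S e)"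
      by (intro card_Un_disjoint finemb disj finite_UN_I) (simp_all add: finB0 finS)
    ultimately show ?thesis using u by linarith
  qed
  let ?Y = "\<lambda>m. {\<phi> \<in> ?emb ?H. \<exists>p\<in>kn t. \<exists>p'\<in>kn t. p \<inter> p' = {} \<and> {\<phi> p, \<phi> p'} = m}"
  have qn: "real q \<le> n"
  proof -
    have "1 \<le> 4096 * real r" "1 \<le> real kv^6" using rr kv1 by (simp_all add: one_le_power)
    then have c: "1 * 1 \<le> (4096 * real r) * real kv^6" by (rule mult_mono) simp_all
    then have "(1 * 1) * 1 \<le> (4096 * real r) * real kv^6 * W"
      by (rule mult_mono[OF _ W1]) (use c in linarith)+
    then have "(1 * 1) * 1 * real q \<le> (4096 * real r) * real kv^6 * W * q" by (rule mult_right_mono) simp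
    then show ?thesis using q2 by simp
  qed
  \<comment> \<open>The decisive use of the linear bound on \<open>q\<close>: a restored cross edge
    creates at most \<open>16 * kv^6 * q * n^(kv-5)\<close> copies, and \<open>unit\<close> has
    order \<open>n^(kv-4)\<close>.\<close>
  have Y: "real (card (?Y m)) \<le> unit" if m: "m \<in> M" for m
  proof -
    have mc: "m \<in> cross V Q" using m by (simp add: M_def)
    then obtain u w where uw: "m = {u,w}" unfolding cross_def by blast
    have "card (?Y {u,w}) \<le> kv ^ 6 * (12 * card B * card V * card V ^ (kv - 6)) + kv ^ 5 * (4 * card B * card V ^ (kv - 5))"
    proof (rule A.copies_through_cross_edge)
      show "{u,w} \<in> cross V Q" using mc uw by simp
      show "card B \<le> card V" using qn B(2) n_def by simp
    qed
    also have "\<dots> = kv ^ 6 * (12 * q * card V ^ (kv - 5)) + kv ^ 5 * (4 * q * card V ^ (kv - 5))"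
    proof -
      have "kv - 5 = Suc (kv - 6)" using kv6 by simp
      then show ?thesis by (simp add: B(2))
    qed
    also have "\<dots> \<le> kv ^ 6 * (12 * q * card V ^ (kv - 5)) + kv ^ 6 * (4 * q * card V ^ (kv - 5))"
      using kv6 by (intro add_left_mono mult_le_mono1 power_increasing) auto
    also have "\<dots> = 16 * kv ^ 6 * q * card V ^ (kv - 5)" by (simp add: algebra_simps)
    finally have "real (card (?Y m)) \<le> real (16 * kv ^ 6 * q * card V ^ (kv - 5))" unfolding uw by (rule of_nat_mono)
    also have "\<dots> = (16 * real kv ^ 6 * q) * n ^ (kv - 5)" by (simp add: n_def)
    finally have "W * real (card (?Y m)) \<le> W * ((16 * real kv ^ 6 * q) * n ^ (kv - 5))" using W1 by (intro mult_left_mono) auto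
    also have "\<dots> = (16 * real kv^6 * W * q) * n ^ (kv - 5)" by (simp add: mult_ac)
    also have "\<dots> \<le> n * n ^ (kv - 5)"
    proof (rule mult_right_mono)
      have "16 * (real kv^6 * W * q) \<le> (4096 * real r) * (real kv^6 * W * q)" using rr W1 by (intro mult_right_mono) auto
      then show "16 * real kv^6 * W * q \<le> n" using q2 by (simp add: mult_ac)
    qed (use n_pos in simp)
    also have "\<dots> = n ^ (kv - 4)"
    proof -
      have "kv - 4 = Suc (kv - 5)" using kv6 by simp
      then show ?thesis by simp
    qed
    also have "\<dots> = W * unit" by (rule Wu[symmetric])
    finally show ?thesis using W1 by simp
  qed
  have upper: "real (count ?H) \<le> count (E \<inter> ?H) + card M * unit"
  proof -
    have "?emb ?H \<subseteq> ?emb (E \<inter> ?H) \<union> (\<Union>m\<in>M. ?Y m)"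
    proof
      fix \<phi> assume \<phi>: "\<phi> \<in> ?emb ?H"
      show "\<phi> \<in> ?emb (E \<inter> ?H) \<union> (\<Union>m\<in>M. ?Y m)"
      proof (cases "\<phi> \<in> ?emb (E \<inter> ?H)")
        case False
        then obtain p p' where p: "p \<in> kn t" "p' \<in> kn t" "p \<inter> p' = {}" "{\<phi> p, \<phi> p'} \<notin> E" "{\<phi> p, \<phi> p'} \<in> ?H"
          using \<phi> unfolding kneser_embeddings_iff by blast
        then have "{\<phi> p, \<phi> p'} \<in> M" using B(1) by (auto simp: M_def B0_def)
        then show ?thesis using \<phi> p by blast
      qed simp
    qed
    then have "count ?H \<le> card (?emb (E \<inter> ?H) \<union> (\<Union>m\<in>M. ?Y m))" using finM finemb by (intro card_mono) auto
    also have "\<dots> \<le> count (E \<inter> ?H) + card (\<Union>m\<in>M. ?Y m)" by (rule card_Un_le)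
    also have "\<dots> \<le> count (E \<inter> ?H) + (\<Sum>m\<in>M. card (?Y m))" by (intro add_left_mono card_UN_le finM)
    finally have "real (count ?H) \<le> count (E \<inter> ?H) + (\<Sum>m\<in>M. real (card (?Y m)))" by (simp flip: of_nat_sum)
    also have "(\<Sum>m\<in>M. real (card (?Y m))) \<le> (\<Sum>m\<in>M. unit)" by (intro sum_mono Y)
    finally show ?thesis by simp
  qed
  have main: "real (count ?H) + (real (extremal_size r (card V)) - card (cross V Q)) * unit \<le> count E"
  proof -
    have "card (B0 - B) = card B0 - card B" using B finB0 by (intro card_Diff_subset) (auto intro: finite_subset)
    then have "card (B0 - B) = def + card M" using cardB0 B(2) by simp
    then have "card (B0 - B) * unit = real def * unit + card M * unit" by (simp add: algebra_simps)
    moreover have d: "real (extremal_size r (card V)) - card (cross V Q) = real def" using cross_le by (simp add: def_def of_nat_diff)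
    ultimately show ?thesis unfolding d using lower upper by linarith
  qed
  have size: "n / (2 * real r) \<le> card {x \<in> V. Q x = j}" if j: "j < r" for j
  proof -
    have "typ_set j - high \<subseteq> {x \<in> V. Q x = j}" using Qr typ_V by (auto simp: typical_def)
    then have "card (typ_set j - high) \<le> card {x \<in> V. Q x = j}" using finV by (intro card_mono) auto
    moreover have "card (typ_set j) - card high \<le> card (typ_set j - high)" by (rule diff_card_le_card_Diff[OF finite_high])
    moreover have "32 * kappa - 2 * z * n \<le> card (typ_set j)" using typical_size[OF j] by (simp only: n_kappa(1))
    ultimately show ?thesis unfolding n_kappa(3) using two_high(1) small_z k6 by linarith
  qed
  have q16: "2 * real q \<le> n / (8 * real r)"
  proof -
    have "1 \<le> real kv^6" using kv1 by (simp add: one_le_power)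
    then have "1 * 1 \<le> real kv^6 * W" using W1 by (rule mult_mono) simp_all
    then have "(4096 * real r * q) * (1 * 1) \<le> (4096 * real r * q) * (real kv^6 * W)" using rr by (intro mult_left_mono) auto
    then have "4096 * real r * q \<le> n" using q2 by (simp add: mult_ac)
    moreover have "16 * real r * q \<le> 4096 * real r * q" by (intro mult_right_mono) auto
    ultimately have "16 * real r * q \<le> n" by linarith
    then show ?thesis using rr by (simp add: field_simps)
  qed
  have v8: "real kv \<le> n / (8 * real r)" using n4 rr by (simp add: field_simps)
  have den: "n / (4 * real r) \<le> n / (2 * real r) - 2 * card B - kv"
  proof -
    have "n / (4 * real r) = 2 * (n / (8 * real r))" "n / (2 * real r) = 4 * (n / (8 * real r))" by simp_all
    then show ?thesis using q16 v8 B(2) by linarith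
  qed
  have npos4: "0 < n / (4 * real r)" using n_pos rr by simp
  \<comment> \<open>With \<open>count E\<close> as the ceiling, one move creates at most a fraction
    of order \<open>1 / n\<close> of it. As \<open>count E\<close> is of order at most
    \<open>q * n^(kv-4)\<close>, this is below \<open>unit\<close> for \<open>q\<close> small
    against \<open>n\<close>.\<close>
  have "\<exists>Q'. apex_graph t r V Q' B a1 a2 \<and> apex_graph.balanced r V Q' \<and> card (?emb (cross V Q' \<union> B)) \<le> real (count E)"
  proof (rule rebalance[OF A.apex_graph_axioms size, where X = unit])
    show "kv + 2 * card B < n / (2 * real r)" using den npos4 by simp
    have "count E * (kv / (n / (2 * real r) - 2 * card B - kv)) \<le> count E * (kv / (n / (4 * real r)))"
      using den npos4 by (intro mult_left_mono divide_left_mono mult_pos_pos) auto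
    also have "\<dots> \<le> (real kv^4 * q * W * unit) * (kv / (n / (4 * real r)))"
    proof (rule mult_right_mono[OF cE])
      show "0 \<le> kv / (n / (4 * real r))" using npos4 by (intro divide_nonneg_pos) simp_all
    qed
    also have "\<dots> = (4 * real r * real kv^5 * W * q / n) * unit" 
    proof -
      have "real kv^5 = real kv^4 * kv" by (simp add: eval_nat_numeral)
      then show ?thesis by (simp add: mult_ac)
    qed
    also have "\<dots> \<le> 1 * unit"
    proof (rule mult_right_mono)
      have "4 * real r * real kv^5 * W * q \<le> 4096 * real r * real kv^6 * W * q"
      proof -
        have "real kv^5 \<le> real kv^6" using kv1 by (intro power_increasing) auto
        then have "4 * real r * real kv^5 \<le> 4096 * real r * real kv^6" using rr by (intro mult_mono) auto
        then have "4 * real r * real kv^5 * W \<le> 4096 * real r * real kv^6 * W" by (rule mult_right_mono) (use W1 in simp)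
        then show ?thesis by (rule mult_right_mono) simp
      qed
      then have "4 * real r * real kv^5 * W * q \<le> n" using q2 by linarith
      then show "4 * real r * real kv^5 * W * q / n \<le> 1" using n_pos by simp
    qed (use unit_pos in simp)
    finally show "count E * (kv / (n / (2 * real r) - 2 * card B - kv)) \<le> unit" by simp
    show "0 \<le> unit" using unit_pos by simp
    show "real (count ?H) + (real (extremal_size r (card V)) - card (cross V Q)) * unit \<le> count E" by (rule main)
  qed
  then obtain Q' where Q': "apex_graph t r V Q' B a1 a2" "apex_graph.balanced r V Q'" "real (count (cross V Q' \<union> B)) \<le> real (count E)"
    by blast
  have "0 < count E"
  proof -
    have "B0 \<noteq> {}" using cardB0 q by auto
    then have "0 < card ok" using allok okfin finB0 by (simp add: card_gt_0_iff)
    then have "0 < real (card ok) * unit" using unit_pos by simp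
    then have "0 < real (count E)" using okcount by linarith
    then show ?thesis by simp
  qed
  moreover have "count (cross V Q' \<union> B) \<le> count E" using Q'(3) by simp
  ultimately show ?thesis using Q'(1,2) B(2) by blast
qed

section \<open>Choice of the constants\<close>

text \<open>Few copies leave few cliques on \<open>r + 1\<close> vertices, stability gives a
  partition, passing to a maximum cut keeps the number of inner pairs small, and the defect identity
  supplies the size conditions. One number serves as both \<open>z\<close> and
  \<open>mu\<close>.\<close>

lemma near_turan_exists:
  fixes t :: nat
  assumes t5: "t \<ge> 5"
  defines "r \<equiv> t - 3"
  shows "\<exists>k0 > 0. \<exists>n0. \<forall>(V :: 'a set) E. finite V \<longrightarrow> n0 \<le> card V \<longrightarrow> (\<forall>e\<in>E. e \<subseteq> V \<and> card e = 2) \<longrightarrow>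
    extremal_size r (card V) < card E \<longrightarrow> card (embeddings (kneser2 t) (V, E)) < k0 * real (card V) ^ (card (kn t) - 3) \<longrightarrow>
    (\<exists>P l0 ep al z mu. near_turan t r l0 V E P (real (card V)) ep al z mu)"
proof -
  let ?v = "card (kn t)"
  have r2: "r \<ge> 2" using t5 by (simp add: r_def)
  have rr: "real r \<ge> 2" using r2 by simp
  have v6: "6 \<le> ?v" using card_kn_ge[OF t5] by simp
  \<comment> \<open>\<open>l0\<close> depends on \<open>ep\<close>, \<open>al\<close> on both,
    \<open>z\<close> on \<open>al\<close>. The fourth power in \<open>al\<close> covers the at most
    \<open>l0^3\<close> triples and the further factor \<open>l0\<close> in the third condition on
    \<open>l0\<close>; the division by \<open>?v\<close> in \<open>z\<close> keeps the greedy loss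
    \<open>?v * z * n\<close> at \<open>al * n / 8\<close>.\<close>
  define ep where "ep = 1 / (1024 * real r^2)"
  define l0 where "l0 = nat \<lceil>3 * (2 / ep) ^ r\<rceil> + 1"
  define al where "al = ep / (64 * real r * real l0 ^ 4)"
  define z where "z = al / (8 * real ?v)"
  define eta where "eta = z^2"
  have ep0: "0 < ep" "ep \<le> 1" using rr by (auto simp: ep_def power2_eq_square intro!: mult_ge1_I)
  have l01: "1 \<le> real l0" by (simp add: l0_def)
  have L4: "1 \<le> 64 * real r * real l0 ^ 4"
  proof -
    have "1 \<le> real l0 ^ 4" using l01 by (rule one_le_power)
    then have "1 * 1 \<le> (64 * real r) * real l0 ^ 4" using rr by (intro mult_mono) auto
    then show ?thesis by simp
  qed
  have al0: "0 < al" using ep0 L4 unfolding al_def by (intro divide_pos_pos) linarith+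
  have alL: "al * (64 * real r * real l0 ^ 4) = ep"
  proof -
    have gen: "e / A * A = e" if "A \<noteq> 0" for e A :: real using that by simp
    show ?thesis unfolding al_def using L4 by (intro gen) linarith
  qed
  have al3: "real l0 ^ 3 * al * (64 * real r) \<le> ep"
  proof -
    have "real l0 ^ 3 \<le> real l0 ^ 4" using l01 by (intro power_increasing) auto
    then have "real l0 ^ 3 * (al * (64 * real r)) \<le> real l0 ^ 4 * (al * (64 * real r))" using al0 rr by (intro mult_right_mono) auto
    then show ?thesis using alL by (simp add: mult_ac)
  qed
  have al1: "al * 128 \<le> ep"
  proof -
    have "1 \<le> real l0 ^ 4" using l01 by (rule one_le_power)
    then have "2 * 1 \<le> real r * real l0 ^ 4" using rr by (intro mult_mono) auto
    then have "al * (64 * 2) \<le> al * (64 * (real r * real l0 ^ 4))" using al0 by (intro mult_left_mono) auto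
    then show ?thesis using alL by (simp add: mult_ac)
  qed
  have z0: "0 < z" using al0 v6 by (simp add: z_def)
  have zal: "z \<le> al / 8"
  proof -
    have "al / (8 * real ?v) \<le> al / 8" using al0 v6 by (intro divide_left_mono) auto
    then show ?thesis by (simp add: z_def)
  qed
  have eta0: "0 < eta" "eta \<le> 1"
  proof -
    show "0 < eta" using z0 by (simp add: eta_def)
    have "z \<le> 1" using al1 ep0 al0 zal by linarith
    then have "z^2 \<le> 1" using z0 by (simp add: power_le_one)
    then show "eta \<le> 1" by (simp add: eta_def)
  qed
  obtain es ns where es: "es > 0" and stab: "\<And>(V :: 'a set) E (J :: nat set set). finite V \<Longrightarrow> card V \<ge> ns \<Longrightarrow> (\<forall>x. {x} \<notin> E) \<Longrightarrow> finite J \<Longrightarrow> card J = Suc r \<Longrightarrow>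
    (1 - 1 / r) * real (card V)^2 \<le> card (opairs V E) \<Longrightarrow>
    card (multipartite_homs V E id J) \<le> es * real (card V) ^ Suc r \<Longrightarrow>
    (\<exists>P. (\<forall>x\<in>V. P x < r) \<and> card {p \<in> opairs V E. P (fst p) = P (snd p)} \<le> eta * real (card V)^2)"
    using stability[OF eta0 r2, where ?'a = 'a and ?'i = "nat set"] by blast
  have t3: "t \<ge> 3" using t5 by simp
  obtain k1 n1 where k1: "k1 > 0" and cliq: "\<And>(V :: 'a set) E. finite V \<Longrightarrow> card V \<ge> n1 \<Longrightarrow>
    es * real (card V) ^ (t - 2) \<le> card (multipartite_homs V E id ((\<lambda>k. {1,k}) ` {3..t})) \<Longrightarrow>
    k1 * real (card V) ^ ?v \<le> card (embeddings (kneser2 t) (V, E))"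
    using many_cliques_many_kneser[OF t3 es, where ?'a = 'a] by blast
  \<comment> \<open>One bound for each source of too many copies: cliques, three apex vertices,
    three disjoint inner edges.\<close>
  define k0 where "k0 = Min {k1, (al / 2) ^ (?v - 3), (1 / (64 * real r^2)) ^ 3 * (1 / (4 * real r)) ^ (?v - 6)}"
  have k0: "0 < k0" "k0 \<le> k1" "k0 \<le> (al / 2) ^ (?v - 3)" "k0 \<le> (1 / (64 * real r^2)) ^ 3 * (1 / (4 * real r)) ^ (?v - 6)"
    using k1 al0 rr by (auto simp: k0_def)
  define n0 where "n0 = ns + n1 + nat \<lceil>(real ?v + 6) * 4 / al\<rceil> + nat \<lceil>64 * real r * real l0^2\<rceil> + nat \<lceil>32 * real r * (6 + real r)\<rceil> + 2"
  show ?thesis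
  proof (intro exI[of _ k0] conjI exI[of _ n0] allI impI)
    show "0 < k0" by (rule k0)
    fix V :: "'a set" and E
    assume V: "finite V" and n: "n0 \<le> card V" and simple: "\<forall>e\<in>E. e \<subseteq> V \<and> card e = 2"
      and big: "extremal_size r (card V) < card E" and few: "card (embeddings (kneser2 t) (V, E)) < k0 * real (card V) ^ (?v - 3)"
    let ?n = "real (card V)"
    have nn: "ns \<le> card V" "n1 \<le> card V" "(real ?v + 6) * 4 / al \<le> ?n" "64 * real r * real l0^2 \<le> ?n"
      "32 * real r * (6 + real r) \<le> ?n" "2 \<le> card V"
      using n unfolding n0_def by linarith+
    have n1': "1 \<le> ?n" using nn(6) by simp
    have rn: "real r \<le> ?n"
    proof -
      have "real r * 1 \<le> 32 * real r * (6 + real r)" using rr by (intro mult_mono) auto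
      then show ?thesis using nn(5) by simp
    qed
    have loop: "{x} \<notin> E" for x using simple by fastforce
    have simple': "e \<subseteq> V \<and> card e = 2" if "e \<in> E" for e using simple that by blast
    have op: "card (opairs V E) = 2 * card E" by (rule card_opairs_simple[OF simple' V])
    have ed: "?n^2 - 2 - (?n - 2)^2 / real r - real r / 4 \<le> card (opairs V E)"
    proof -
      have "?n^2 - 2 - (?n - 2)^2 / real r - real r / 4 \<le> 2 * real (extremal_size r (card V)) + 1"
        using r2 nn(6) rn by (intro extremal_size_bound) auto
      then show ?thesis using big op by simp
    qed
    have ed2: "(1 - 1 / r) * ?n^2 \<le> card (opairs V E)"
    proof -
      have "(?n - 2)^2 / real r = ?n^2 / r - (4 * ?n - 4) / r" by (simp add: power2_eq_square diff_divide_distrib[symmetric] algebra_simps)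
      moreover have "2 + real r / 4 \<le> (4 * ?n - 4) / r"
      proof -
        have "(2 + real r / 4) * r \<le> 32 * real r * (6 + real r) - 4"
        proof -
          have "4 \<le> real r * real r" using mult_mono[of 2 "real r" 2 "real r"] rr by simp
          then show ?thesis using rr by (simp add: algebra_simps)
        qed
        then have "(2 + real r / 4) * r \<le> 4 * ?n - 4" using nn(5) n1' by linarith
        then show ?thesis using rr by (simp add: pos_le_divide_eq)
      qed
      moreover have "(1 - 1 / r) * ?n^2 = ?n^2 - ?n^2 / r" by (simp add: left_diff_distrib)
      ultimately show ?thesis using ed by linarith
    qed
    define J where "J = (\<lambda>k. {1,k}) ` {3..t}"
    have injJ: "inj_on (\<lambda>k::nat. {1,k}) {3..t}" by (auto simp: inj_on_def doubleton_eq_iff)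
    have J: "finite J" "card J = Suc r" unfolding J_def using card_image[OF injJ] t5 by (simp_all add: r_def)
    have vpow: "?n ^ (?v - 3) \<le> ?n ^ ?v" using n1' by (intro power_increasing) auto
    have hom: "card (multipartite_homs V E id J) \<le> es * ?n ^ Suc r"
    proof (rule ccontr)
      assume "\<not> ?thesis"
      moreover have "t - 2 = Suc r" using t5 by (simp add: r_def)
      ultimately have "k1 * ?n ^ ?v \<le> card (embeddings (kneser2 t) (V, E))"
        using cliq[OF V nn(2), of E] by (simp add: J_def)
      moreover have "k0 * ?n ^ (?v - 3) \<le> k1 * ?n ^ ?v" using k0(1,2) vpow by (intro mult_mono) auto
      ultimately show False using few by linarith
    qed
    obtain P0 where P0: "\<forall>x\<in>V. P0 x < r" "card {p \<in> opairs V E. P0 (fst p) = P0 (snd p)} \<le> eta * ?n^2"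
      using stab[OF V nn(1) _ J ed2 hom] loop by blast
    obtain P where P: "\<And>x. x \<in> V \<Longrightarrow> P x < r"
      and ins: "card {p \<in> opairs V E. P (fst p) = P (snd p)} \<le> card {p \<in> opairs V E. P0 (fst p) = P0 (snd p)}"
      and cut: "\<And>x j. x \<in> V \<Longrightarrow> j < r \<Longrightarrow> card (inside V E P x) \<le> card {y \<in> V. P y = j \<and> {x,y} \<in> E}"
      using max_cut[OF V, of E P0 r] loop P0(1) by blast
    have "near_turan t r l0 V E P ?n ep al z z"
    proof
      have z2: "card {p \<in> opairs V E. P (fst p) = P (snd p)} \<le> z^2 * ?n^2"
        using ins P0(2) unfolding eta_def by linarith
      have zz: "z^2 \<le> z * z" by (simp add: power2_eq_square)
      show "5 \<le> t" "r = t - 3" "finite V" "?n = ?n" using t5 V by (simp_all add: r_def)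
      show "e \<subseteq> V \<and> card e = 2" if "e \<in> E" for e by (rule simple'[OF that])
      show "P x < r" if "x \<in> V" for x by (rule P[OF that])
      show "card (inside V E P x) \<le> card {y \<in> V. P y = j \<and> {x,y} \<in> E}" if "x \<in> V" "j < r" for x j by (rule cut[OF that])
      have r1: "1 \<le> r" using r2 by simp
      have np: "card V > 0" "0 < r" using nn(6) r2 by simp_all
      note nb = near_balanced_partition[OF V P r1 ed2 z2 z0 z0 zz np(1)]
      show "card {x \<in> V. \<not> real (card (missing V E P x)) \<le> z * ?n} \<le> z * ?n" by (rule nb(2)[OF _ np(2)])
      show "?n / r - 2 * z * ?n \<le> card (typical V E P (z * ?n) j)" if j: "j < r" for j by (rule nb(3)[OF _ j])
      show "?n^2 - 2 - (?n - 2)^2 / real r - real r / 4 \<le> card (opairs V E)" by (rule ed)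
      show "0 < ep" "0 < al" "0 < z" by (fact ep0 al0 z0)+
      show "ep \<le> 1 / (1024 * real r^2)" by (simp add: ep_def)
      show "al \<le> ep / 2" using al1 al0 by simp
      show "z \<le> ep / 4" using al1 al0 zal by linarith
      show "3 * (2 / ep) ^ r \<le> l0" unfolding l0_def by linarith
      have a3: "real l0 ^ 3 * al \<le> ep / 128"
      proof -
        have "real l0 ^ 3 * al * 128 \<le> real l0 ^ 3 * al * (64 * real r)" using al0 rr by (intro mult_left_mono) auto
        then show ?thesis using al3 by linarith
      qed
      then show "real l0 ^ 3 * al \<le> ep / 4" using ep0 by linarith
      show "real l0 * (2 * z + real l0 ^ 3 * al) \<le> 1 / (8 * real r)"
      proof -
        have "real l0 * (2 * z) \<le> real l0 ^ 4 * al"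
        proof -
          have "real l0 ^ 1 \<le> real l0 ^ 4" using l01 by (intro power_increasing) auto
          then show ?thesis using al0 zal z0 by (intro mult_mono) auto
        qed
        then have "real l0 * (2 * z + real l0 ^ 3 * al) \<le> 2 * (real l0 ^ 4 * al)"
          by (simp add: algebra_simps eval_nat_numeral)
        also have "\<dots> = ep / (32 * real r)"
        proof -
          have gen: "2 * (L * a) = e / (32 * R)" if "a * (64 * R * L) = e" "R \<noteq> 0" for L a e R :: real
            using that(2) unfolding that(1)[symmetric] by simp
          show ?thesis using rr by (intro gen[OF alL]) simp
        qed
        also have "\<dots> \<le> 1 / (8 * real r)"
        proof -
          have "ep / (32 * real r) \<le> 1 / (32 * real r)" using ep0 rr by (intro divide_right_mono) auto
          also have "\<dots> \<le> 1 / (8 * real r)" using rr by (intro divide_left_mono) auto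
          finally show ?thesis .
        qed
        finally show ?thesis .
      qed
      show "?v * (z * ?n + 1) + 6 \<le> al * ?n / 2"
      proof -
        have "?v * (z * ?n) = al * ?n / 8" using v6 by (simp add: z_def)
        moreover have "real ?v + 6 \<le> al * ?n / 4" using nn(3) al0 by (simp add: field_simps)
        moreover have "0 \<le> al * ?n" using al0 by simp
        moreover have gen: "v * (w + 1) + 6 \<le> A / 2" if "v * w = A / 8" "v + 6 \<le> A / 4" "0 \<le> A" for v w A :: real
          using that by (simp add: distrib_left)
        ultimately show ?thesis by (intro gen)
      qed
      show "64 * real r * real l0^2 \<le> ?n" "32 * real r * (6 + real r) \<le> ?n" by (fact nn)+
      show "card (embeddings (kneser2 t) (V, E)) < (al * ?n / 2) ^ (?v - 3)"
      proof -
        have "k0 * ?n ^ (?v - 3) \<le> (al / 2) ^ (?v - 3) * ?n ^ (?v - 3)" using k0(3) by (intro mult_right_mono) auto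
        also have "\<dots> = (al * ?n / 2) ^ (?v - 3)" by (simp add: power_mult_distrib[symmetric])
        finally show ?thesis using few by linarith
      qed
      show "card (embeddings (kneser2 t) (V, E)) < (?n / (64 * real r^2)) ^ 3 * (?n / (4 * real r)) ^ (?v - 6)"
      proof -
        have "k0 * ?n ^ (?v - 3) \<le> ((1 / (64 * real r^2)) ^ 3 * (1 / (4 * real r)) ^ (?v - 6)) * ?n ^ (?v - 3)"
          using k0(4) by (intro mult_right_mono) auto
        also have "\<dots> = ((1 / (64 * real r^2)) ^ 3 * (1 / (4 * real r)) ^ (?v - 6)) * (?n ^ 3 * ?n ^ (?v - 6))"
          using v6 by (simp add: power_add[symmetric])
        also have "((1 / (64 * real r^2)) ^ 3 * (1 / (4 * real r)) ^ (?v - 6)) * (?n ^ 3 * ?n ^ (?v - 6)) =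
          (1 / (64 * real r^2) * ?n) ^ 3 * (1 / (4 * real r) * ?n) ^ (?v - 6)" by (simp only: power_mult_distrib mult_ac)
        finally show ?thesis using few by simp
      qed
    qed
    then show "\<exists>P l0 ep al z mu. near_turan t r l0 V E P ?n ep al z mu" by blast
  qed
qed

text \<open>All vertices but two start in class 0. Each move towards balance gains a cross edge, and
  \<open>extremal_size\<close> bounds their number, so the moves end.\<close>

lemma balanced_exists:
  assumes t: "t \<ge> 5" and V: "finite V" "2 \<le> card V"
  shows "\<exists>Q a1 a2. apex_graph t (t - 3) V Q {} a1 a2 \<and> apex_graph.balanced (t - 3) V Q"
proof -
  define r where "r = t - 3"
  have "\<not> card V \<le> Suc 0" using V(2) by simp
  then obtain a1 a2 where a: "a1 \<in> V" "a2 \<in> V" "a1 \<noteq> a2" using card_le_Suc0_iff_eq[OF V(1)] by blast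
  have bal: "\<exists>Q'. apex_graph t r V Q' {} a1 a2 \<and> apex_graph.balanced r V Q'" if "apex_graph t r V Q {} a1 a2" for Q
    using that
  proof (induction "extremal_size r (card V) - card (cross V Q)" arbitrary: Q rule: less_induct)
    case less
    interpret A: apex_graph t r V Q "{}" a1 a2 by (rule less.prems)
    show ?case
    proof (cases A.balanced)
      case True
      then show ?thesis using less.prems by blast
    next
      case False
      then obtain i j where ij: "i < r" "j < r" "A.class_size j + 1 < A.class_size i" by (rule A.unbalanced_class)
      have "0 < A.class_size i" using ij by linarith
      then obtain s where s: "s \<in> V" "Q s = i" by (auto simp: card_gt_0_iff)
      have ag: "apex_graph t r V (Q(s := j)) {} a1 a2" using s ij by (intro A.move) auto
      interpret A': apex_graph t r V "Q(s := j)" "{}" a1 a2 by (rule ag)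
      have neq: "i \<noteq> j" using ij by auto
      have "card (cross V (Q(s := j))) + A.class_size j + 1 = card (cross V Q) + A.class_size i"
        by (rule card_cross_move[OF A.finV, where K = "Suc (Suc r)"]) (use A.Q A.apex s ij neq in \<open>fastforce simp: less_Suc_eq\<close>)+
      then have "extremal_size r (card V) - card (cross V (Q(s := j))) < extremal_size r (card V) - card (cross V Q)"
        using ij A'.cross_le_extremal by linarith
      then show ?thesis by (rule less.hyps[OF _ ag])
    qed
  qed
  have "apex_graph t r V (\<lambda>x. if x = a1 then r else if x = a2 then Suc r else 0) {} a1 a2"
    by unfold_locales (use t V a in \<open>auto simp: r_def\<close>)
  from bal[OF this] show ?thesis unfolding r_def by blast
qed

text \<open>If class 0 had at most \<open>q\<close> vertices, balance would bound every class by
  \<open>q + 1\<close> and leave too few vertices in total; so a star with \<open>q\<close> edges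
  fits into it.\<close>

lemma balanced_star:
  assumes A: "apex_graph t r V Q {} a1 a2" and bal: "apex_graph.balanced r V Q" and q: "r * (q + 1) + 2 < card V"
  shows "\<exists>B. apex_graph t r V Q B a1 a2 \<and> card B = q \<and>
    card (embeddings (kneser2 t) (V, cross V Q \<union> B)) \<le> card (kn t) ^ 4 * (q * card V ^ (card (kn t) - 4))"
proof -
  interpret A: apex_graph t r V Q "{}" a1 a2 by (rule A)
  have "q + 1 \<le> A.class_size 0"
  proof (rule ccontr)
    assume "\<not> ?thesis"
    then have "A.class_size j \<le> q + 1" if "j < r" for j
      using bal that A.r_pos by (fastforce simp: A.balanced_def)
    then have "(\<Sum>j<r. A.class_size j) \<le> (\<Sum>j<r. q + 1)" by (intro sum_mono) simp
    then show False using A.class_sizes q by simp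
  qed
  then obtain S where S: "S \<subseteq> {x \<in> V. Q x = 0}" "card S = q + 1" by (rule obtain_subset_with_card_n)
  then obtain x0 Y where Y: "S = insert x0 Y" "x0 \<notin> Y" "card Y = q" using card_Suc_eq[of S q] by auto
  define B where "B = (\<lambda>y. {x0,y}) ` Y"
  have inj: "inj_on (\<lambda>y. {x0,y}) Y" using Y(2) by (auto simp: inj_on_def doubleton_eq_iff)
  have ag: "apex_graph t r V Q B a1 a2"
  proof
    show "\<exists>x y. e = {x,y} \<and> x \<in> V \<and> y \<in> V \<and> x \<noteq> y \<and> Q x = Q y" if e: "e \<in> B" for e
    proof -
      obtain y where y: "e = {x0,y}" "y \<in> Y" using e unfolding B_def by blast
      then have "x0 \<in> V" "y \<in> V" "x0 \<noteq> y" "Q x0 = Q y" using S(1) Y by auto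
      with y(1) show ?thesis by blast
    qed
  qed (use A.t5 A.r_def A.finV A.Q A.apex in blast)+
  have x0: "Q x0 < r" using S(1) Y(1) A.r_pos by auto
  have finY: "finite Y" using S(1) Y(1) A.finV by (auto intro: finite_subset)
  have "card B = q" using card_image[OF inj] Y(3) by (simp add: B_def)
  moreover have "card (embeddings (kneser2 t) (V, cross V Q \<union> B)) \<le> card (kn t) ^ 4 * (q * card V ^ (card (kn t) - 4))"
    using apex_graph.star_copies[OF ag B_def x0 finY] Y(3) by simp
  ultimately show ?thesis using ag by blast
qed

text \<open>If \<open>E\<close> has more copies than the bound for a star, a balanced apex graph
  with a star is the graph sought; otherwise \<open>near_turan\<close> is available. In
  \<open>d\<close>, \<open>c1\<close> puts the star bound below \<open>k0 * n^(v-3)\<close>,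
  \<open>1 / c2\<close> is the smallness of \<open>q\<close> required by
  \<open>optimal_structure\<close>, and \<open>1 / (4 r)\<close> makes the star fit.\<close>

lemma supersaturated_structure:
  fixes t :: nat
  assumes t5: "t \<ge> 5"
  defines "r \<equiv> t - 3"
  shows "\<exists>d > 0. \<exists>N. \<forall>(V :: 'a set) E q. finite V \<longrightarrow> N \<le> card V \<longrightarrow> (\<forall>e\<in>E. e \<subseteq> V \<and> card e = 2) \<longrightarrow>
    1 \<le> q \<longrightarrow> real q \<le> d * real (card V) \<longrightarrow> card E = extremal_size r (card V) + q \<longrightarrow>
    0 < card (embeddings (kneser2 t) (V, E)) \<and>
    (\<exists>Q a1 a2 B. apex_graph t r V Q B a1 a2 \<and> apex_graph.balanced r V Q \<and> card B = q \<and>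
      card (embeddings (kneser2 t) (V, cross V Q \<union> B)) \<le> card (embeddings (kneser2 t) (V, E)))"
proof -
  obtain k0 n0 where k0: "k0 > 0" and nt: "\<And>(V :: 'a set) E. finite V \<Longrightarrow> n0 \<le> card V \<Longrightarrow> (\<forall>e\<in>E. e \<subseteq> V \<and> card e = 2) \<Longrightarrow>
    extremal_size r (card V) < card E \<Longrightarrow> card (embeddings (kneser2 t) (V, E)) < k0 * real (card V) ^ (card (kn t) - 3) \<Longrightarrow>
    (\<exists>P l0 ep al z mu. near_turan t r l0 V E P (real (card V)) ep al z mu)"
    using near_turan_exists[OF t5, where ?'a = 'a] unfolding r_def by blast
  define v where "v = card (kn t)"
  have v4: "4 \<le> v" using card_kn_ge[OF t5] by (simp add: v_def)
  have r2: "2 \<le> real r" using t5 by (simp add: r_def)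
  define c1 where "c1 = k0 / (2 * real v ^ 4)"
  define c2 where "c2 = 4096 * real r * real v ^ 6 * (4 * real r) ^ (v - 4)"
  have v0: "0 < real v" using v4 by simp
  have c1: "0 < c1" "real v ^ 4 * c1 = k0 / 2" using k0 v0 by (auto simp: c1_def)
  have c2: "0 < c2" using r2 v0 by (simp add: c2_def)
  define d where "d = Min {c1, 1 / c2, 1 / (4 * real r)}"
  have d: "0 < d" "d \<le> c1" "d \<le> 1 / c2" "d \<le> 1 / (4 * real r)" using c1 c2 r2 by (auto simp: d_def)
  define N where "N = n0 + 8 * r * v + 8 * r + 16"
  show ?thesis
  proof (intro exI[of _ d] conjI[OF d(1)] exI[of _ N] allI impI)
    fix V :: "'a set" and E and q :: nat
    assume V: "finite V" and N: "N \<le> card V" and simple: "\<forall>e\<in>E. e \<subseteq> V \<and> card e = 2"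
      and q: "1 \<le> q" "real q \<le> d * real (card V)" and E: "card E = extremal_size r (card V) + q"
    let ?n = "real (card V)" and ?c = "\<lambda>F. card (embeddings (kneser2 t) (V, F))"
    have nn: "n0 \<le> card V" "8 * r * v \<le> card V" "8 * r + 16 \<le> card V" using N unfolding N_def by linarith+
    have n0: "0 < ?n" using nn(3) by linarith
    have dn: "real q \<le> c * ?n" if "d \<le> c" for c
      using q(2) mult_right_mono[OF that, of ?n] n0 by linarith
    show "0 < ?c E \<and> (\<exists>Q a1 a2 B. apex_graph t r V Q B a1 a2 \<and> apex_graph.balanced r V Q \<and> card B = q \<and> ?c (cross V Q \<union> B) \<le> ?c E)"
    proof (cases "real (?c E) \<le> real v ^ 4 * (real q * ?n ^ (v - 4))")
      case True
      have "real v ^ 4 * (real q * ?n ^ (v - 4)) \<le> real v ^ 4 * (c1 * ?n * ?n ^ (v - 4))"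
        using dn[OF d(2)] by (intro mult_left_mono mult_right_mono) auto
      also have "\<dots> = k0 / 2 * ?n ^ Suc (v - 4)" unfolding c1(2)[symmetric] by (simp only: power_Suc mult_ac)
      also have "\<dots> < k0 * ?n ^ Suc (v - 4)" using k0 n0 by simp
      also have "Suc (v - 4) = v - 3" using v4 by simp
      finally have "real (?c E) < k0 * ?n ^ (card (kn t) - 3)" using True unfolding v_def by linarith
      moreover have "extremal_size r (card V) < card E" using E q(1) by simp
      ultimately obtain P l0 ep al z mu where *: "near_turan t r l0 V E P ?n ep al z mu" using nt[OF V nn(1) simple] by blast
      show ?thesis
      proof (rule near_turan.optimal_structure[OF * E q(1)])
        show "4096 * real r * real (card (kn t))^6 * (4 * real r) ^ (card (kn t) - 4) * q \<le> ?n"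
        proof -
          have gen: "c * x \<le> y" if "x \<le> 1 / c * y" "0 < c" for c x y :: real using that by (simp add: field_simps)
          show ?thesis using gen[OF dn[OF d(3)] c2] unfolding c2_def v_def .
        qed
        show "?c E \<le> real (card (kn t)) ^ 4 * (q * ?n ^ (card (kn t) - 4))" using True unfolding v_def .
        show "8 * real r * real (card (kn t)) \<le> ?n" using nn(2) unfolding v_def by (metis of_nat_le_iff of_nat_mult of_nat_numeral)
      qed
    next
      case False
      obtain Q a1 a2 where Q: "apex_graph t r V Q {} a1 a2" "apex_graph.balanced r V Q"
        using balanced_exists[OF t5 V] nn(3) unfolding r_def by auto
      have "real q * (4 * real r) \<le> ?n"
      proof -
        have gen: "x * c \<le> y" if "x \<le> 1 / c * y" "0 < c" for c x y :: real using that by (simp add: field_simps)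
        show ?thesis by (rule gen[OF dn[OF d(4)]]) (use r2 in simp)
      qed
      then have "real (4 * (r * q)) \<le> ?n" by (simp add: mult_ac)
      then have "4 * (r * q) \<le> card V" by (simp only: of_nat_le_iff)
      then have "r * (q + 1) + 2 < card V" using nn(3) unfolding distrib_left by linarith
      from balanced_star[OF Q this] obtain B where B: "apex_graph t r V Q B a1 a2" "card B = q"
        "?c (cross V Q \<union> B) \<le> card (kn t) ^ 4 * (q * card V ^ (card (kn t) - 4))" by blast
      have "real (?c (cross V Q \<union> B)) \<le> real (v ^ 4 * (q * card V ^ (v - 4)))" using B(3) unfolding v_def by (simp only: of_nat_le_iff)
      also have "\<dots> = real v ^ 4 * (real q * ?n ^ (v - 4))" by simp
      finally have "?c (cross V Q \<union> B) < ?c E" using False by linarith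
      then show ?thesis using B(1,2) Q(2) by (metis less_imp_le gr_zeroI not_less_zero)
    qed
  qed
qed

lemma embeddings_mono: "E \<subseteq> E' \<Longrightarrow> embeddings F (V, E) \<subseteq> embeddings F (V, E')"
  by (auto simp: embeddings_def)

theorem theorem1p5:
  fixes t :: nat
  assumes "t \<ge> 5"
  shows "\<exists>\<delta>::real. \<delta> > 0 \<and>
    (\<exists>n0::nat. \<forall>n\<ge>n0. \<forall>q::nat. 1 \<le> q \<and> real q \<le> \<delta> * real n \<longrightarrow>
       h_min (kneser2 t) n q = t_min (kneser2 t) n q)"
proof -
  define r where "r = t - 3"
  let ?K = "kneser2 t"
  obtain d N where d: "d > 0" and main: "\<And>(V :: nat set) E q. finite V \<Longrightarrow> N \<le> card V \<Longrightarrow> (\<forall>e\<in>E. e \<subseteq> V \<and> card e = 2) \<Longrightarrow>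
    1 \<le> q \<Longrightarrow> real q \<le> d * real (card V) \<Longrightarrow> card E = extremal_size r (card V) + q \<Longrightarrow>
    0 < card (embeddings ?K (V, E)) \<and>
    (\<exists>Q a1 a2 B. apex_graph t r V Q B a1 a2 \<and> apex_graph.balanced r V Q \<and> card B = q \<and>
      card (embeddings ?K (V, cross V Q \<union> B)) \<le> card (embeddings ?K (V, E)))"
    using supersaturated_structure[OF assms, where ?'a = nat] unfolding r_def by blast
  define d' where "d' = min d (1 / (4 * real r))"
  have r0: "0 < r" using assms by (simp add: r_def)
  have d': "0 < d'" "d' \<le> d" "d' \<le> 1 / (4 * real r)" using d r0 by (auto simp: d'_def)
  \<comment> \<open>The term \<open>1 / d\<close> makes one surplus edge admissible, as the
    evaluation of \<open>ex_number\<close> requires.\<close>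
  define n0 where "n0 = N + nat \<lceil>1 / d\<rceil> + 8 * r + 16"
  show ?thesis
  proof (intro exI[of _ d'] conjI[OF d'(1)] exI[of _ n0] allI impI, elim conjE)
    fix n q :: nat
    assume n: "n0 \<le> n" and q: "1 \<le> q" "real q \<le> d' * real n"
    have nn: "N \<le> n" "1 / d \<le> n" "8 * r + 16 \<le> n" using n unfolding n0_def by linarith+
    have d1: "real 1 \<le> d * real n" using nn(2) d by (simp add: pos_divide_le_eq mult.commute)
    have qd: "real q \<le> d * real n" using q(2) mult_right_mono[OF d'(2), of "real n"] by linarith
    have free: "F_free ?K (V, cross V Q)" if "apex_graph t r V Q {} a1 a2" for V :: "nat set" and Q a1 a2
      using apex_graph.no_copies[OF that] by (simp add: F_free_def)
    have simple_cross: "nvertex_graph n (V, cross V Q)" if "finite V" "card V = n" for V :: "nat set" and Q :: "nat \<Rightarrow> nat"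
      using that cross_simple by (auto simp: nvertex_graph_def simple_graph_def)
    obtain Q a1 a2 where Q: "apex_graph t r {..<n} Q {} a1 a2" "apex_graph.balanced r {..<n} Q"
      using balanced_exists[OF assms, of "{..<n}"] nn(3) unfolding r_def by auto
    \<comment> \<open>The balanced apex graph attains the value. A graph with more edges contains
      one with a single surplus edge, and \<open>main\<close> with \<open>q = 1\<close> finds a copy
      in it.\<close>
    have ex: "ex_number n ?K = extremal_size r n"
      unfolding ex_number_def
    proof (rule Greatest_equality)
      show "\<exists>G. nvertex_graph n G \<and> F_free ?K G \<and> card (edges G) = extremal_size r n"
        using simple_cross[of "{..<n}" Q] free[OF Q(1)] apex_graph.cross_balanced[OF Q]
        by (intro exI[of _ "({..<n}, cross {..<n} Q)"]) simp
      fix y assume "\<exists>G. nvertex_graph n G \<and> F_free ?K G \<and> card (edges G) = y"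
      then obtain V E where G: "nvertex_graph n (V, E)" "F_free ?K (V, E)" "card E = y" by auto
      show "y \<le> extremal_size r n"
      proof (rule ccontr)
        assume "\<not> ?thesis"
        then have "extremal_size r n + 1 \<le> card E" using G(3) by simp
        then obtain E' where E': "E' \<subseteq> E" "card E' = extremal_size r n + 1" by (rule obtain_subset_with_card_n)
        have V: "finite V" "card V = n" and simple: "\<forall>e\<in>E'. e \<subseteq> V \<and> card e = 2"
          using G(1) E'(1) by (auto simp: nvertex_graph_def simple_graph_def)
        have "0 < card (embeddings ?K (V, E'))"
          using main[OF V(1) _ simple, of 1] V(2) nn(1) d1 E'(2) by simp
        moreover have "embeddings ?K (V, E') = {}"
          using G(2) embeddings_mono[OF E'(1), of ?K V] by (auto simp: F_free_def)
        ultimately show False by simp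
      qed
    qed
    let ?h = "\<lambda>c. \<exists>G. nvertex_graph n G \<and> card (edges G) = ex_number n ?K + q \<and> num_copies ?K G = c"
    let ?t = "\<lambda>c. \<exists>G A. extremal_graph ?K n G \<and> A \<inter> edges G = {} \<and> card A = q \<and>
      simple_graph (verts G, edges G \<union> A) \<and> num_copies ?K (verts G, edges G \<union> A) = c"
    have th: "?h c" if "?t c" for c
    proof -
      obtain G A where G: "extremal_graph ?K n G" "A \<inter> edges G = {}" "card A = q"
        "simple_graph (verts G, edges G \<union> A)" "num_copies ?K (verts G, edges G \<union> A) = c" using \<open>?t c\<close> by blast
      have "finite (edges G \<union> A)"
        by (rule finite_subset[of _ "Pow (verts G)"]) (use G(4) in \<open>auto simp: simple_graph_def\<close>)
      then have "card (edges G \<union> A) = card (edges G) + card A" using G(2) by (intro card_Un_disjoint) auto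
      moreover have "card (edges G) = ex_number n ?K" "card (verts G) = n"
        using G(1) by (simp_all add: extremal_graph_def nvertex_graph_def)
      ultimately show ?thesis using G by (intro exI[of _ "(verts G, edges G \<union> A)"]) (simp add: nvertex_graph_def)
    qed
    \<comment> \<open>Balance makes \<open>cross V Q\<close> extremal, and \<open>B\<close> is
      disjoint from it; so every graph supplied by \<open>main\<close> is a candidate for
      \<open>t_min\<close>.\<close>
    have apex_t: "?t (num_copies ?K (V, cross V Q \<union> B))"
      if A: "apex_graph t r V Q B a1 a2" "apex_graph.balanced r V Q" "card B = q" and V: "card V = n" for V :: "nat set" and Q B a1 a2
    proof -
      interpret A: apex_graph t r V Q B a1 a2 by (rule A(1))
      have "apex_graph t r V Q {} a1 a2" using A(1) by (auto simp: apex_graph_def)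
      then have "extremal_graph ?K n (V, cross V Q)"
        using free simple_cross[OF A.finV V] A.cross_balanced[OF A(2)] V by (simp add: extremal_graph_def ex)
      moreover have "simple_graph (V, cross V Q \<union> B)"
        using A.finV A.inner cross_simple[of _ V Q] by (fastforce simp: simple_graph_def)
      ultimately show ?thesis using A.cross_B A(3)
        by (intro exI[of _ "(V, cross V Q)"] exI[of _ B]) (simp add: Int_commute)
    qed
    have t0: "\<exists>c. ?t c"
    proof -
      have gen: "x * c \<le> y" if "x \<le> 1 / c * y" "0 < c" for c x y :: real using that by (simp add: field_simps)
      have "real q \<le> 1 / (4 * real r) * real n" using q(2) mult_right_mono[OF d'(3), of "real n"] by linarith
      then have "real q * (4 * real r) \<le> real n" by (rule gen) (use r0 in simp)
      then have "real (4 * (r * q)) \<le> real n" by (simp add: mult_ac)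
      then have "4 * (r * q) \<le> n" by (simp only: of_nat_le_iff)
      then have "r * (q + 1) + 2 < card {..<n}" using nn(3) unfolding distrib_left card_lessThan by linarith
      from balanced_star[OF Q this] obtain B where "apex_graph t r {..<n} Q B a1 a2" "card B = q" by blast
      from apex_t[OF this(1) Q(2) this(2) card_lessThan] show ?thesis by (rule exI)
    qed
    have h0: "\<exists>c. ?h c" using t0 th by blast
    \<comment> \<open>Both sets of candidates are nonempty by \<open>t0\<close> and
      \<open>h0\<close>, so each \<open>LEAST\<close> is a true minimum.\<close>
    have "h_min ?K n q \<le> t_min ?K n q"
      unfolding h_min_def t_min_def by (rule Least_le, rule th, rule LeastI_ex[OF t0])
    moreover have "t_min ?K n q \<le> h_min ?K n q"
    proof -
      have "?h (h_min ?K n q)" unfolding h_min_def by (rule LeastI_ex[OF h0])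
      then obtain V E where G: "nvertex_graph n (V, E)" "card E = extremal_size r n + q" "num_copies ?K (V, E) = h_min ?K n q"
        unfolding ex by auto
      have V: "finite V" "card V = n" and simple: "\<forall>e\<in>E. e \<subseteq> V \<and> card e = 2"
        using G(1) by (auto simp: nvertex_graph_def simple_graph_def)
      obtain Q a1 a2 B where B: "apex_graph t r V Q B a1 a2" "apex_graph.balanced r V Q" "card B = q"
        "card (embeddings ?K (V, cross V Q \<union> B)) \<le> card (embeddings ?K (V, E))"
        using main[OF V(1) _ simple q(1)] V(2) nn(1) qd G(2) by auto
      have "t_min ?K n q \<le> num_copies ?K (V, cross V Q \<union> B)"
        unfolding t_min_def by (rule Least_le, rule apex_t[OF B(1-3) V(2)])
      also have "\<dots> \<le> num_copies ?K (V, E)" unfolding num_copies_def by (rule div_le_mono[OF B(4)])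
      finally show ?thesis using G(3) by simp
    qed
    ultimately show "h_min ?K n q = t_min ?K n q" by (rule antisym)
  qed
qed

end
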